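(* Let $N\ge1$, let $\Omega\subset\mathbb{R}^N$ be a bounded domain and let $f,g:\mathbb{R}\to\mathbb{R}$ be $C^1$ functions such that: (1) $f(s)=o(s)$ and $g(s)=o(s)$ as $s\to0$; (2) there exist $p,q>1$ with $(p+1)(N-2)<2N$ and $(q+1)(N-2)<2N$, and $C>0$, such that $|f'(s)|\le C(1+|s|^{p-1})$ and $|g'(s)|\le C(1+|s|^{q-1})$ for all $s\in\mathbb{R}$; (3) there exists $\delta>0$ such that $0<(1+\delta)f(s)s\le f'(s)s^2$ and $0<(1+\delta)g(s)s\le g'(s)s^2$ for all $s\ne0$. Let $$\mathcal I(u,v)=\int_\Omega\langle\nabla u,\nabla v\rangle\,dx-\int_\Omega F(u)\,dx-\int_\Omega G(v)\,dx,\qquad (u,v)\in H^1_0(\Omega)\times H^1_0(\Omega),$$ where $F(s)=\int_0^sf(\xi)\,d\xi$, $G(s)=\int_0^sg(\xi)\,d\xi$, and let $$c(\Omega)=\inf\{\mathcal I(u,v):\ u,v\in H^1_0(\Omega),\ (u,v)\ne(0,0),\ \mathcal I'(u,v)=0\}.$$ Then $$c(\Omega)=\inf_{\substack{u,v\in H^1_0(\Omega)\\ v\ne-u}}\ \sup_{\substack{t\ge0\\ \phi\in H^1_0(\Omega)}}\mathcal I\big(t(u,v)+(\phi,-\phi)\big).$$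
   Context: $\langle\cdot,\cdot\rangle$ is the canonical inner product of $\mathbb{R}^N$. Under the hypotheses, $\mathcal I$ is of class $C^2$, and its critical points are the weak solutions of $-\Delta u=g(v)$, $-\Delta v=f(u)$ in $\Omega$, $u=v=0$ on $\partial\Omega$. *)

theory Defs
  imports "HOL-Analysis.Analysis" "HOL-Library.Landau_Symbols"
begin

text \<open>
  Elements of the Lebesgue and Sobolev spaces over \<open>\<Omega>\<close> are represented by functions on the whole of
  \<open>\<real>\<^sup>N\<close> whose values outside \<open>\<Omega>\<close> are irrelevant; two representatives denote the same element iff they
  agree almost everywhere on \<open>\<Omega>\<close>.
\<close>

definition partial_deriv :: "'n::finite \<Rightarrow> (real^'n \<Rightarrow> real) \<Rightarrow> real^'n \<Rightarrow> real" where
  "partial_deriv i \<phi> x = frechet_derivative \<phi> (at x) (axis i 1)"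

primrec Ck :: "nat \<Rightarrow> (real^'n::finite \<Rightarrow> real) \<Rightarrow> bool" where
  "Ck 0 \<phi> \<longleftrightarrow> continuous_on UNIV \<phi>"
| "Ck (Suc k) \<phi> \<longleftrightarrow> \<phi> differentiable_on UNIV \<and> (\<forall>i. Ck k (partial_deriv i \<phi>))"

definition test_functions :: "(real^'n::finite) set \<Rightarrow> (real^'n \<Rightarrow> real) set" where
  "test_functions \<Omega> =
     {\<phi>. (\<forall>k. Ck k \<phi>) \<and> compact (closure {x. \<phi> x \<noteq> 0}) \<and> closure {x. \<phi> x \<noteq> 0} \<subseteq> \<Omega>}"

definition L2 :: "(real^'n::finite) set \<Rightarrow> (real^'n \<Rightarrow> 'b::euclidean_space) set" where
  "L2 \<Omega> = {u. u \<in> borel_measurable (lebesgue_on \<Omega>) \<and>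
               integrable (lebesgue_on \<Omega>) (\<lambda>x. (norm (u x))\<^sup>2)}"

definition is_weak_gradient ::
    "(real^'n::finite) set \<Rightarrow> (real^'n \<Rightarrow> real) \<Rightarrow> (real^'n \<Rightarrow> real^'n) \<Rightarrow> bool" where
  "is_weak_gradient \<Omega> u D \<longleftrightarrow>
     (\<forall>\<phi>\<in>test_functions \<Omega>. \<forall>i.
        (\<integral>x. u x * partial_deriv i \<phi> x \<partial>lebesgue_on \<Omega>) = - (\<integral>x. D x $ i * \<phi> x \<partial>lebesgue_on \<Omega>))"

definition H1 :: "(real^'n::finite) set \<Rightarrow> (real^'n \<Rightarrow> real) set" where
  "H1 \<Omega> = {u \<in> L2 \<Omega>. \<exists>D\<in>L2 \<Omega>. is_weak_gradient \<Omega> u D}"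

text \<open>For open \<open>\<Omega>\<close> the weak gradient is determined up to a null set; the choice is immaterial.\<close>

definition weak_gradient ::
    "(real^'n::finite) set \<Rightarrow> (real^'n \<Rightarrow> real) \<Rightarrow> real^'n \<Rightarrow> real^'n" where
  "weak_gradient \<Omega> u = (SOME D. D \<in> L2 \<Omega> \<and> is_weak_gradient \<Omega> u D)"

definition H1_norm :: "(real^'n::finite) set \<Rightarrow> (real^'n \<Rightarrow> real) \<Rightarrow> real" where
  "H1_norm \<Omega> u = sqrt ((\<integral>x. (u x)\<^sup>2 \<partial>lebesgue_on \<Omega>) +
                       (\<integral>x. (norm (weak_gradient \<Omega> u x))\<^sup>2 \<partial>lebesgue_on \<Omega>))"

definition H10 :: "(real^'n::finite) set \<Rightarrow> (real^'n \<Rightarrow> real) set" where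
  "H10 \<Omega> = {u \<in> H1 \<Omega>. \<exists>\<phi> :: nat \<Rightarrow> real^'n \<Rightarrow> real.
               (\<forall>k. \<phi> k \<in> test_functions \<Omega>) \<and>
               (\<lambda>k. H1_norm \<Omega> (\<lambda>x. \<phi> k x - u x)) \<longlonglongrightarrow> 0}"

definition H1_pair_norm :: "(real^'n::finite) set \<Rightarrow> (real^'n \<Rightarrow> real) \<Rightarrow> (real^'n \<Rightarrow> real) \<Rightarrow> real" where
  "H1_pair_norm \<Omega> u v = sqrt ((H1_norm \<Omega> u)\<^sup>2 + (H1_norm \<Omega> v)\<^sup>2)"

text \<open>
  Frechet differentiability on \<open>H\<^sup>1\<^sub>0(\<Omega>) \<times> H\<^sup>1\<^sub>0(\<Omega>)\<close>. The class-based \<open>has_derivative\<close> does not apply, as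
  this space depends on \<open>\<Omega>\<close> and so is not a type. The bound on \<open>L\<close> together with linearity
  makes \<open>L\<close> respect almost everywhere equality.
\<close>

definition bounded_linear_H10 ::
    "(real^'n::finite) set \<Rightarrow> ((real^'n \<Rightarrow> real) \<Rightarrow> (real^'n \<Rightarrow> real) \<Rightarrow> real) \<Rightarrow> bool" where
  "bounded_linear_H10 \<Omega> L \<longleftrightarrow>
     (\<forall>u\<in>H10 \<Omega>. \<forall>v\<in>H10 \<Omega>. \<forall>\<phi>\<in>H10 \<Omega>. \<forall>\<psi>\<in>H10 \<Omega>.
        L (\<lambda>x. u x + \<phi> x) (\<lambda>x. v x + \<psi> x) = L u v + L \<phi> \<psi>) \<and>
     (\<forall>a. \<forall>u\<in>H10 \<Omega>. \<forall>v\<in>H10 \<Omega>. L (\<lambda>x. a * u x) (\<lambda>x. a * v x) = a * L u v) \<and>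
     (\<exists>K. \<forall>u\<in>H10 \<Omega>. \<forall>v\<in>H10 \<Omega>. \<bar>L u v\<bar> \<le> K * H1_pair_norm \<Omega> u v)"

definition has_derivative_H10 ::
    "(real^'n::finite) set \<Rightarrow> ((real^'n \<Rightarrow> real) \<Rightarrow> (real^'n \<Rightarrow> real) \<Rightarrow> real) \<Rightarrow>
     ((real^'n \<Rightarrow> real) \<Rightarrow> (real^'n \<Rightarrow> real) \<Rightarrow> real) \<Rightarrow> (real^'n \<Rightarrow> real) \<Rightarrow> (real^'n \<Rightarrow> real) \<Rightarrow> bool" where
  "has_derivative_H10 \<Omega> J L u v \<longleftrightarrow>
     bounded_linear_H10 \<Omega> L \<and>
     (\<forall>e>0. \<exists>d>0. \<forall>\<phi>\<in>H10 \<Omega>. \<forall>\<psi>\<in>H10 \<Omega>.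
        H1_pair_norm \<Omega> \<phi> \<psi> < d \<longrightarrow>
        \<bar>J (\<lambda>x. u x + \<phi> x) (\<lambda>x. v x + \<psi> x) - J u v - L \<phi> \<psi>\<bar> \<le> e * H1_pair_norm \<Omega> \<phi> \<psi>)"

definition critical_point ::
    "(real^'n::finite) set \<Rightarrow> ((real^'n \<Rightarrow> real) \<Rightarrow> (real^'n \<Rightarrow> real) \<Rightarrow> real) \<Rightarrow>
     (real^'n \<Rightarrow> real) \<Rightarrow> (real^'n \<Rightarrow> real) \<Rightarrow> bool" where
  "critical_point \<Omega> J u v \<longleftrightarrow> has_derivative_H10 \<Omega> J (\<lambda>_ _. 0) u v"

definition primitive :: "(real \<Rightarrow> real) \<Rightarrow> real \<Rightarrow> real" where
  "primitive f s = (LBINT \<xi>=ereal 0..ereal s. f \<xi>)"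

definition energy ::
    "(real^'n::finite) set \<Rightarrow> (real \<Rightarrow> real) \<Rightarrow> (real \<Rightarrow> real) \<Rightarrow>
     (real^'n \<Rightarrow> real) \<Rightarrow> (real^'n \<Rightarrow> real) \<Rightarrow> real" where
  "energy \<Omega> f g u v =
     (\<integral>x. weak_gradient \<Omega> u x \<bullet> weak_gradient \<Omega> v x \<partial>lebesgue_on \<Omega>)
     - (\<integral>x. primitive f (u x) \<partial>lebesgue_on \<Omega>)
     - (\<integral>x. primitive g (v x) \<partial>lebesgue_on \<Omega>)"

text \<open>
  Infima and suprema are taken in the extended reals, where they always exist.
\<close>

definition ground_level :: "(real^'n::finite) set \<Rightarrow> (real \<Rightarrow> real) \<Rightarrow> (real \<Rightarrow> real) \<Rightarrow> ereal" where
  "ground_level \<Omega> f g =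
     (INF (u, v) \<in> {(u, v). u \<in> H10 \<Omega> \<and> v \<in> H10 \<Omega> \<and>
                           \<not> (AE x in lebesgue_on \<Omega>. u x = 0 \<and> v x = 0) \<and>
                           critical_point \<Omega> (energy \<Omega> f g) u v}.
        ereal (energy \<Omega> f g u v))"

end

theory Submission
  imports Defs "HOL-Complex_Analysis.Great_Picard"
begin

text \<open>
  Write \<open>u = a + b\<close>, \<open>v = a - b\<close>. Then the functional is
  \<open>J a b = \<parallel>\<nabla>a\<parallel>\<^sup>2 - \<parallel>\<nabla>b\<parallel>\<^sup>2 - \<integral>F (a + b) - \<integral>G (a - b)\<close> and the right-hand side is the infimum over
  \<open>a \<noteq> 0\<close> of the supremum of \<open>J (t a) b\<close> over \<open>t \<ge> 0\<close> and \<open>b\<close>. A critical point maximises \<open>I\<close> over its own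
  fibre, since \<open>f s / \<bar>s\<bar>\<close> is increasing; this gives one inequality. For the other one, only norms of gradients
  and compactly continuous terms occur in \<open>J\<close>, so minimising normalised \<open>a\<close>'s converge weakly to a minimiser,
  and the supremum over its fibre is attained because \<open>F\<close> and \<open>G\<close> are superquadratic. Perturbing the minimiser
  to \<open>a + \<epsilon> \<psi>\<close> and comparing values at almost maximal points of the perturbed fibre, which converge to the
  maximiser of the original one, shows that the maximiser is a critical point.

  The subcritical Sobolev embedding is obtained by bootstrapping: \<open>\<phi>\<close> differs from its average over cubes of
  side \<open>h\<close> by \<open>O(h)\<close> in \<open>L\<^sup>2\<close>, and an \<open>L\<^sup>s\<close> bound makes the average small for a suitable \<open>h\<close>, so that \<open>\<phi>\<close> is in
  weak \<open>L\<^sup>r\<close> with \<open>r = 2 + 2 s / N\<close>. The fixed point of \<open>s \<mapsto> 2 + 2 s / N\<close> is the critical exponent. The same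
  averages give Rellich's theorem.
\<close>

section \<open>Test functions and the fundamental lemma of the calculus of variations\<close>

text \<open>On the pairs \<open>(\<phi>, -\<phi>)\<close> the quadratic part of the energy is
  negative, and these directions form an infinite dimensional space, so critical points are not
  found by plain minimisation; the inner supremum absorbs them. The supremum, as a function of
  \<open>a\<close>, is not known to be differentiable, and no derivative of it is ever taken.
  Instead the almost maximal point of the perturbed fibre is inserted into the unperturbed one; with
  tolerance \<open>\<epsilon>^2\<close> the loss disappears after division by
  \<open>\<epsilon>\<close>. The strict monotonicity of \<open>f s / \<bar>s\<bar>\<close> is used
  here a second time: it makes almost maximal points converge to the maximiser. Only three
  consequences of weak convergence are used: a bounded sequence has a convergent subsequence, the
  gradient norm cannot jump up in the limit, and the lower order terms converge. They are collected
  in the locale \<open>compact_embedding\<close>, so that the variational argument mentions neither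
  a domain nor a gradient. Since functions are representatives, its form \<open>D\<close> is only
  semidefinite, and many identities hold only almost everywhere.\<close>

lemma partial_deriv_eq:
  assumes "(f has_derivative f') (at x)"
  shows "partial_deriv i f x = f' (axis i 1)"
  unfolding partial_deriv_def using frechet_derivative_at[OF assms] by simp

lemma differentiable_on_UNIV_D:
  "f differentiable_on UNIV \<Longrightarrow> (f has_derivative frechet_derivative f (at x)) (at x)"
  by (simp add: differentiable_on_def frechet_derivative_works[symmetric])

lemma Ck_Suc_imp: "Ck (Suc k) f \<Longrightarrow> Ck k f"
proof (induction k arbitrary: f)
  case 0 then show ?case by (simp add: differentiable_imp_continuous_on)
next
  case (Suc k) then show ?case by (metis Ck.simps(2))
qed

lemma Ck_add: "Ck k f \<Longrightarrow> Ck k g \<Longrightarrow> Ck k (\<lambda>x. f x + g x)"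
proof (induction k arbitrary: f g)
  case 0 then show ?case by (simp add: continuous_on_add)
next
  case (Suc k)
  have f: "f differentiable_on UNIV" and g: "g differentiable_on UNIV" using Suc.prems by auto
  have "partial_deriv i (\<lambda>x. f x + g x) = (\<lambda>x. partial_deriv i f x + partial_deriv i g x)" for i
    by (rule ext, subst partial_deriv_eq[OF has_derivative_add[OF differentiable_on_UNIV_D[OF f] differentiable_on_UNIV_D[OF g]]])
      (simp add: partial_deriv_def)
  moreover have "Ck k (\<lambda>x. partial_deriv i f x + partial_deriv i g x)" for i
    using Suc.prems by (intro Suc.IH) auto
  ultimately show ?case using f g by (simp add: differentiable_on_def)
qed

lemma Ck_mult: "Ck k f \<Longrightarrow> Ck k g \<Longrightarrow> Ck k (\<lambda>x. f x * g x)"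
proof (induction k arbitrary: f g)
  case 0 then show ?case by (simp add: continuous_on_mult)
next
  case (Suc k)
  have f: "f differentiable_on UNIV" and g: "g differentiable_on UNIV" using Suc.prems by auto
  have "partial_deriv i (\<lambda>x. f x * g x) = (\<lambda>x. f x * partial_deriv i g x + partial_deriv i f x * g x)" for i
    by (rule ext, subst partial_deriv_eq[OF has_derivative_mult[OF differentiable_on_UNIV_D[OF f] differentiable_on_UNIV_D[OF g]]])
      (simp add: partial_deriv_def)
  moreover have "Ck k (\<lambda>x. f x * partial_deriv i g x + partial_deriv i f x * g x)" for i
    using Suc.prems Ck_Suc_imp[OF Suc.prems(1)] Ck_Suc_imp[OF Suc.prems(2)] by (intro Ck_add Suc.IH) auto
  ultimately show ?case using f g by (simp add: differentiable_on_def)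
qed

lemma Ck_const: "Ck k (\<lambda>x. c)"
proof (induction k arbitrary: c)
  case (Suc k)
  have "partial_deriv i (\<lambda>x::real^'a. c) = (\<lambda>x. 0)" for i
    by (rule ext, subst partial_deriv_eq[OF has_derivative_const]) simp
  then show ?case using Suc by (simp add: differentiable_on_def)
qed simp

lemma Ck_prod: "(\<And>i. i \<in> I \<Longrightarrow> Ck k (f i)) \<Longrightarrow> Ck k (\<lambda>x. \<Prod>i\<in>I. f i x)"
  by (induction I rule: infinite_finite_induct) (auto intro!: Ck_const Ck_mult)

text \<open>Indexing by a polynomial makes this family closed under differentiation.\<close>

definition flat :: "real poly \<Rightarrow> real \<Rightarrow> real" where
  "flat p x = (if x > 0 then poly p (inverse x) * exp (- inverse x) else 0)"

lemma poly_exp_tendsto_0: "((\<lambda>y. poly p y * exp (- y)) \<longlongrightarrow> (0::real)) at_top"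
proof -
  have "((\<lambda>y. \<Sum>i\<le>degree p. coeff p i * (y ^ i / exp y)) \<longlongrightarrow> (\<Sum>i\<le>degree p. coeff p i * 0)) at_top"
    by (intro tendsto_intros tendsto_power_div_exp_0)
  then show ?thesis
    by (simp add: poly_altdef sum_distrib_right sum_divide_distrib exp_minus field_simps)
qed

text \<open>With \<open>y = 1 / x\<close> the product rule turns \<open>p y * exp (- y)\<close> into
  \<open>(p' - p) y * exp (- y)\<close>, and the inner derivative is \<open>- y^2\<close>. This is
  where the factor \<open>[:0,0,1:]\<close> and the order of the difference come from.\<close>

lemma flat_deriv: "(flat p has_real_derivative flat ([:0,0,1:] * (p - pderiv p)) x) (at x)"
proof -
  consider "x > 0" | "x < 0" | "x = 0" by linarith
  then show ?thesis
  proof cases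
    case 1
    have "((\<lambda>x. poly p (inverse x) * exp (- inverse x)) has_real_derivative
        flat ([:0,0,1:] * (p - pderiv p)) x) (at x)"
      using 1 by (auto intro!: derivative_eq_intros DERIV_chain2[OF poly_DERIV] simp: flat_def field_simps power2_eq_square)
    then show ?thesis
      by (rule has_field_derivative_transform_within_open[of _ _ _ "{0<..}"]) (use 1 in \<open>auto simp: flat_def\<close>)
  next
    case 2
    have "((\<lambda>x. 0) has_real_derivative flat ([:0,0,1:] * (p - pderiv p)) x) (at x)"
      using 2 by (auto simp: flat_def)
    then show ?thesis
      by (rule has_field_derivative_transform_within_open[of _ _ _ "{..<0}"]) (use 2 in \<open>auto simp: flat_def\<close>)
  next
    case 3
    \<comment> \<open>Dividing by \<open>h\<close> multiplies the polynomial by its variable, hence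
      \<open>pCons 0 p\<close>.\<close>
    have "((\<lambda>h. poly (pCons 0 p) (inverse h) * exp (- inverse h)) \<longlongrightarrow> 0) (at_right 0)"
      by (rule filterlim_compose[OF poly_exp_tendsto_0 filterlim_inverse_at_top_right])
    then have R: "((\<lambda>h. flat p h / h) \<longlongrightarrow> 0) (at_right 0)"
      by (rule Lim_transform_eventually)
        (auto simp: eventually_at_filter flat_def field_simps intro!: always_eventually)
    have L: "((\<lambda>h. flat p h / h) \<longlongrightarrow> 0) (at_left 0)"
      by (rule Lim_transform_eventually[OF tendsto_const])
        (auto simp: eventually_at_filter flat_def intro!: always_eventually)
    have "((\<lambda>h. flat p h / h) \<longlongrightarrow> 0) (at 0)"
      using L R by (simp add: filterlim_split_at)
    then show ?thesis using 3 by (simp add: has_field_derivative_iff flat_def)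
  qed
qed

lemma Ck_flat: "Ck k (\<lambda>x. flat p (a * x $ i + c))"
proof (induction k arbitrary: p)
  case 0
  have "continuous_on UNIV (flat p)"
    by (meson DERIV_continuous_on flat_deriv has_field_derivative_at_within)
  then show ?case
    by (auto intro!: continuous_on_compose2[of UNIV "flat p"] continuous_intros)
next
  case (Suc k)
  let ?q = "[:0,0,1:] * (p - pderiv p)"
  have "((\<lambda>x. a * x $ i + c) has_derivative (\<lambda>h. a * h $ i)) (at x)" for x :: "real^'a"
    by (auto intro!: derivative_eq_intros bounded_linear_imp_has_derivative bounded_linear_vec_nth)
  from DERIV_compose_FDERIV[OF flat_deriv this]
  have D: "((\<lambda>x. flat p (a * x $ i + c)) has_derivative (\<lambda>h. a * h $ i * flat ?q (a * x $ i + c))) (at x)" for x :: "real^'a"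
    .
  have "partial_deriv j (\<lambda>x::real^'a. flat p (a * x $ i + c)) =
     (\<lambda>x. (if j = i then a else 0) * flat ?q (a * x $ i + c))" for j
    by (rule ext, subst partial_deriv_eq[OF D]) (auto simp: axis_def)
  moreover have "Ck k (\<lambda>x. (if j = i then a else 0) * flat ?q (a * x $ i + c))" for j
    by (intro Ck_mult Ck_const Suc.IH)
  ultimately show ?case using D by (auto simp: differentiable_on_def differentiable_def)
qed

text \<open>A smooth substitute for the indicator of \<open>box c d\<close>: each factor vanishes
  beyond one face of the box, and the factor \<open>Suc k\<close> steepens it, so that the product
  tends to 1 inside while its support never leaves the box.\<close>

definition bump :: "real^'n \<Rightarrow> real^'n \<Rightarrow> nat \<Rightarrow> real^'n::finite \<Rightarrow> real" where
  "bump c d k x = (\<Prod>i\<in>UNIV. flat 1 (real (Suc k) * x $ i + - (real (Suc k) * c $ i)) *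
                             flat 1 (- real (Suc k) * x $ i + real (Suc k) * d $ i))"

lemma flat_1_bounds: "0 \<le> flat 1 x" "flat 1 x \<le> 1" by (auto simp: flat_def)

lemma bump_bounds: "0 \<le> bump c d k x" "bump c d k x \<le> 1"
  unfolding bump_def
  by (auto intro!: prod_nonneg prod_le_1 mult_nonneg_nonneg mult_le_one flat_1_bounds)

lemma bump_support: "bump c d k x \<noteq> 0 \<Longrightarrow> x \<in> box c d"
proof -
  assume "bump c d k x \<noteq> 0"
  then have "\<forall>i. real (Suc k) * x $ i + - (real (Suc k) * c $ i) > 0 \<and> - real (Suc k) * x $ i + real (Suc k) * d $ i > 0"
    by (auto simp: bump_def flat_def split: if_splits)
  then have "\<forall>i. real (Suc k) * (x $ i - c $ i) > 0 \<and> real (Suc k) * (d $ i - x $ i) > 0"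
    by (simp add: algebra_simps)
  then have "\<forall>i. x $ i - c $ i > 0 \<and> d $ i - x $ i > 0"
    by (simp add: zero_less_mult_iff)
  then show ?thesis by (auto simp: mem_box_cart)
qed

lemma bump_test:
  assumes "cbox c d \<subseteq> \<Omega>" shows "bump c d k \<in> test_functions \<Omega>"
proof -
  have "Ck m (bump c d k)" for m
    unfolding bump_def by (intro Ck_prod Ck_mult Ck_flat)
  moreover have "closure {x. bump c d k x \<noteq> 0} \<subseteq> cbox c d"
    using bump_support[of c d k] subsetD[OF box_subset_cbox[of c d]] by (intro closure_minimal) auto
  moreover from this have "bounded {x. bump c d k x \<noteq> 0}"
    by (meson bounded_cbox bounded_subset closure_subset subset_trans)
  ultimately show ?thesis
    using assms unfolding test_functions_def by auto
qed

lemma flat_1_tendsto: "a > 0 \<Longrightarrow> (\<lambda>k. flat 1 (real (Suc k) * a)) \<longlonglongrightarrow> 1"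
proof -
  assume a: "a > 0"
  have "(\<lambda>k. exp (- (inverse a * inverse (real (Suc k))))) \<longlonglongrightarrow> exp (- (inverse a * 0))"
    by (intro tendsto_intros LIMSEQ_inverse_real_of_nat)
  moreover have "flat 1 (real (Suc k) * a) = exp (- (inverse a * inverse (real (Suc k))))" for k
    using a by (simp add: flat_def zero_less_mult_iff mult.commute del: of_nat_Suc)
  ultimately show ?thesis by simp
qed

lemma bump_tendsto: "(\<lambda>k. bump c d k x) \<longlonglongrightarrow> indicator (box c d) x"
proof (cases "x \<in> box c d")
  case True
  have "(\<lambda>k. bump c d k x) \<longlonglongrightarrow> (\<Prod>i\<in>(UNIV::'a set). 1 * 1)"
    unfolding bump_def
  proof (rule tendsto_prod, rule tendsto_mult)
    fix i :: 'a
    show "(\<lambda>k. flat 1 (real (Suc k) * x $ i + - (real (Suc k) * c $ i))) \<longlonglongrightarrow> 1"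
      using flat_1_tendsto[of "x $ i - c $ i"] True by (simp add: mem_box_cart right_diff_distrib)
    show "(\<lambda>k. flat 1 (- real (Suc k) * x $ i + real (Suc k) * d $ i)) \<longlonglongrightarrow> 1"
      using flat_1_tendsto[of "d $ i - x $ i"] True by (simp add: mem_box_cart algebra_simps)
  qed
  then show ?thesis using True by simp
next
  case False
  then have "bump c d k x = 0" for k using bump_support by blast
  then show ?thesis using False by simp
qed

lemma integral_lebesgue_on_supp:
  fixes h :: "'a::euclidean_space \<Rightarrow> real"
  assumes "S \<in> sets lebesgue" "h \<in> borel_measurable borel" "\<And>x. x \<notin> S \<Longrightarrow> h x = 0"
  shows "integral\<^sup>L (lebesgue_on S) h = integral\<^sup>L lborel h"
proof -
  have "(\<lambda>x. indicator S x *\<^sub>R h x) = h" using assms(3) by (force simp: indicator_def)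
  then show ?thesis using assms(1,2) by (simp add: integral_restrict_space integral_completion)
qed

text \<open>Open boxes are stable under intersection and generate the Borel sets, so a Dynkin class
  argument carries vanishing integrals from boxes to all Borel subsets of
  \<open>box a b\<close>.\<close>

lemma AE_zero_if_box_integrals_zero:
  fixes e :: "real^'n::finite \<Rightarrow> real"
  assumes e: "integrable lborel e"
    and z: "\<And>c d. box c d \<subseteq> box a b \<Longrightarrow> (\<integral>x. e x * indicator (box c d) x \<partial>lborel) = 0"
  shows "AE x in lborel. x \<in> box a b \<longrightarrow> e x = 0"
proof -
  have [measurable]: "e \<in> borel_measurable borel" using e by simp
  have int: "integrable lborel (\<lambda>x. e x * indicator S x)" if "S \<in> sets borel" for S
    using integrable_mult_indicator[OF _ e, of S] that by (simp add: mult.commute)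
  have A: "(\<integral>x. e x * indicator (A \<inter> box a b) x \<partial>lborel) = 0" if "A \<in> sets borel" for A
  proof -
    have "Int_stable (range (\<lambda>(a, b). box a b :: (real^'n) set))"
      by (auto simp: Int_stable_def Int_interval box_Int_box)
    moreover have "range (\<lambda>(a, b). box a b :: (real^'n) set) \<subseteq> Pow UNIV" by simp
    moreover have "A \<in> sigma_sets UNIV (range (\<lambda>(a, b). box a b))"
      using that unfolding borel_eq_box by simp
    ultimately show ?thesis
    proof (induction rule: sigma_sets_induct_disjoint)
      case (basic A)
      then obtain c d where A: "A = box c d" by auto
      obtain c' d' where "box c d \<inter> box a b = box c' d'" by (simp add: box_Int_box)
      then show ?case unfolding A using z by (metis Int_lower2)
    next
      case empty then show ?case by simp
    next
      case (compl A)
      then have [measurable]: "A \<in> sets borel" by (simp add: borel_eq_box)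
      have "(\<lambda>x. e x * indicator ((UNIV - A) \<inter> box a b) x) =
          (\<lambda>x. e x * indicator (box a b) x - e x * indicator (A \<inter> box a b) x)"
        by (auto simp: indicator_def)
      then show ?case using compl z[of a b]
        by (simp add: Bochner_Integration.integral_diff[OF int int])
    next
      case (union F)
      then have [measurable]: "F i \<in> sets borel" for i by (simp add: borel_eq_box subset_eq)
      have "(\<lambda>n. \<integral>x. e x * indicator ((\<Union>i<n. F i) \<inter> box a b) x \<partial>lborel) \<longlonglongrightarrow>
          (\<integral>x. e x * indicator ((\<Union>i. F i) \<inter> box a b) x \<partial>lborel)"
      proof (rule integral_dominated_convergence[where w="\<lambda>x. norm (e x)"])
        show "AE x in lborel. (\<lambda>n. e x * indicator ((\<Union>i<n. F i) \<inter> box a b) x) \<longlonglongrightarrow>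
                 e x * indicator ((\<Union>i. F i) \<inter> box a b) x"
        proof (rule AE_I2, rule tendsto_mult[OF tendsto_const])
          fix x
          show "(\<lambda>n. indicator ((\<Union>i<n. F i) \<inter> box a b) x :: real) \<longlonglongrightarrow> indicator ((\<Union>i. F i) \<inter> box a b) x"
            using LIMSEQ_indicator_UN[of F x] 
            by (auto intro: tendsto_mult simp: indicator_inter_arith)
        qed
      qed (use e in \<open>auto simp: indicator_def\<close>)
      moreover have "(\<integral>x. e x * indicator ((\<Union>i<n. F i) \<inter> box a b) x \<partial>lborel) = 0" for n
      proof -
        have S: "e x * indicator ((\<Union>i<n. F i) \<inter> box a b) x =
          (\<Sum>i<n. e x * indicator (F i \<inter> box a b) x)" for x
          using union.hyps(1)
          by (simp add: indicator_inter_arith sum_distrib_left[symmetric] sum_distrib_right[symmetric] 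
              indicator_UN_disjoint disjoint_family_on_mono[OF subset_UNIV])
        have "(\<integral>x. (\<Sum>i<n. e x * indicator (F i \<inter> box a b) x) \<partial>lborel) = 0"
          by (subst Bochner_Integration.integral_sum) (auto simp: union.IH intro: int)
        then show ?thesis by (simp only: S)
      qed
      ultimately show ?case by (simp add: LIMSEQ_const_iff)
    qed
  qed
  \<comment> \<open>Testing with the set where \<open>e\<close> is positive and, for
    \<open>s = -1\<close>, with the set where it is negative.\<close>
  have *: "AE x in lborel. s * e x * indicator ({x. s * e x > 0} \<inter> box a b) x = 0" for s
  proof -
    have I: "integrable lborel (\<lambda>x. s * e x * indicator ({x. s * e x > 0} \<inter> box a b) x)"
      using int[of "{x. s * e x > 0} \<inter> box a b"] by (simp add: mult.assoc)
    have "(\<integral>x. s * e x * indicator ({x. s * e x > 0} \<inter> box a b) x \<partial>lborel) = 0"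
      using A[of "{x. s * e x > 0}"] by (simp add: mult.assoc)
    then show ?thesis
      by (subst (asm) integral_nonneg_eq_0_iff_AE[OF I]) (auto simp: indicator_def)
  qed
  from *[of 1] *[of "-1"] show ?thesis
    by eventually_elim (auto simp: indicator_def split: if_splits)
qed

text \<open>Bump functions converge boundedly to indicators of boxes, so orthogonality to test
  functions forces the integrals over boxes inside the domain to vanish. Countably many closed boxes
  exhaust the domain, and their faces are null sets.\<close>

lemma AE_zero_if_orthogonal_tests:
  fixes D :: "real^'n::finite \<Rightarrow> real"
  assumes \<Omega>: "open \<Omega>" and D: "integrable (lebesgue_on \<Omega>) D"
    and z: "\<And>\<phi>. \<phi> \<in> test_functions \<Omega> \<Longrightarrow> (\<integral>x. D x * \<phi> x \<partial>lebesgue_on \<Omega>) = 0"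
  shows "AE x in lebesgue_on \<Omega>. D x = 0"
proof -
  have [measurable]: "\<Omega> \<in> sets lebesgue" using \<Omega> by simp
  let ?e = "\<lambda>x. indicator \<Omega> x * D x"
  have e: "integrable lebesgue ?e"
    using D by (simp add: integrable_restrict_space)
  \<comment> \<open>The box argument lives on \<open>lborel\<close>, while \<open>D\<close> is only
    Lebesgue measurable; a Borel version bridges the gap.\<close>
  obtain e' where [measurable]: "e' \<in> borel_measurable borel" and ae: "AE x in lborel. ?e x = e' x"
    using completion_ex_borel_measurable_real[OF borel_measurable_integrable[OF e]] by auto
  have ae': "AE x in lebesgue. ?e x = e' x" using ae by (rule AE_completion)
  have "integrable lebesgue e'"
    by (rule integrable_cong_AE_imp[OF e]) (use ae' in \<open>auto intro: measurable_completion\<close>)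
  then have e': "integrable lborel e'" by (simp add: integrable_completion)
  have B: "(\<integral>x. e' x * indicator (box c d) x \<partial>lborel) = 0" if cd: "cbox c d \<subseteq> \<Omega>" for c d
  proof -
    have m: "bump c d k \<in> borel_measurable borel" for k
    proof -
      have "Ck 0 (bump c d k)" using bump_test[OF cd] by (auto simp: test_functions_def)
      then show ?thesis by (simp add: borel_measurable_continuous_onI)
    qed
    note [measurable] = m
    have [measurable]: "bump c d k \<in> borel_measurable lebesgue" for k
      using m by (auto intro: measurable_completion)
    have "(\<lambda>k. \<integral>x. e' x * bump c d k x \<partial>lborel) \<longlonglongrightarrow> (\<integral>x. e' x * indicator (box c d) x \<partial>lborel)"
      by (rule integral_dominated_convergence[where w="\<lambda>x. norm (e' x)"])
        (use e' bump_bounds[of c d] in \<open>auto intro!: tendsto_intros bump_tendsto mult_left_le simp: abs_mult\<close>)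
    moreover have "(\<integral>x. e' x * bump c d k x \<partial>lborel) = 0" for k
    proof -
      have "(\<integral>x. e' x * bump c d k x \<partial>lborel) = (\<integral>x. e' x * bump c d k x \<partial>lebesgue)"
        by (subst integral_completion) auto
      also have "\<dots> = (\<integral>x. ?e x * bump c d k x \<partial>lebesgue)"
      proof (intro integral_cong_AE borel_measurable_times[OF borel_measurable_integrable[OF e]])
        show "AE x in lebesgue. e' x * bump c d k x = ?e x * bump c d k x"
          using ae' by eventually_elim simp
      qed (auto intro: measurable_completion)
      also have "\<dots> = (\<integral>x. D x * bump c d k x \<partial>lebesgue_on \<Omega>)"
        by (simp add: integral_restrict_space mult.assoc)
      finally show ?thesis using z[OF bump_test[OF cd]] by simp
    qed
    ultimately show ?thesis by (simp add: LIMSEQ_const_iff)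
  qed
  obtain \<D> where \<D>: "countable \<D>" "\<And>X. X \<in> \<D> \<Longrightarrow> \<exists>a b. X = cbox a b" "\<Union>\<D> = \<Omega>"
    using open_countable_Union_open_cbox[OF \<Omega>] by metis
  have "AE x in lborel. x \<in> X \<longrightarrow> e' x = 0" if XD: "X \<in> \<D>" for X
  proof -
    obtain a b where X: "X = cbox a b" using \<D>(2)[OF XD] by blast
    have sub: "cbox a b \<subseteq> \<Omega>" using \<D>(3) XD X by blast
    have "AE x in lborel. x \<in> box a b \<longrightarrow> e' x = 0"
    proof (rule AE_zero_if_box_integrals_zero[OF e'])
      fix c d assume "box c d \<subseteq> box a b"
      then have "closure (box c d) \<subseteq> cbox a b"
        using box_subset_cbox[of a b] by (intro closure_minimal) auto
      \<comment> \<open>An empty open box may belong to a degenerate but nonempty closed box that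
        sticks out of the domain, so the empty case is split off.\<close>
      then have "box c d = {} \<or> cbox c d \<subseteq> \<Omega>" using sub by (metis closure_box subset_trans)
      then show "(\<integral>x. e' x * indicator (box c d) x \<partial>lborel) = 0" using B by auto
    qed
    moreover have "cbox a b - box a b \<in> null_sets lborel"
      using negligible_frontier_interval[of a b]
      by (subst (asm) negligible_iff_null_sets, subst (asm) null_sets_completion_iff) auto
    then have "AE x in lborel. x \<notin> cbox a b - box a b" by (rule AE_not_in)
    ultimately show ?thesis unfolding X by eventually_elim auto
  qed
  then have "AE x in lborel. \<forall>X\<in>\<D>. x \<in> X \<longrightarrow> e' x = 0" by (subst AE_ball_countable[OF \<D>(1)]) blast
  then have "AE x in lborel. x \<in> \<Omega> \<longrightarrow> e' x = 0"
    by eventually_elim (use \<D>(3) in blast)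
  then have "AE x in lebesgue. x \<in> \<Omega> \<longrightarrow> e' x = 0" by (rule AE_completion)
  then have "AE x in lebesgue. x \<in> \<Omega> \<longrightarrow> D x = 0" using ae' by eventually_elim auto
  then show ?thesis by (simp add: AE_restrict_space_iff)
qed

section \<open>Calculus of test functions and integration by parts\<close>

lemma integral_lborel_translation:
  fixes f :: "'a::euclidean_space \<Rightarrow> real"
  shows "f \<in> borel_measurable borel \<Longrightarrow> (\<integral>x. f (x + c) \<partial>lborel) = (\<integral>x. f x \<partial>lborel)"
  by (subst (2) lborel_distr_plus[of c, symmetric]) (simp add: integral_distr add.commute)

lemma nn_integral_lborel_translation:
  fixes f :: "'a::euclidean_space \<Rightarrow> ennreal"
  shows "f \<in> borel_measurable borel \<Longrightarrow> (\<integral>\<^sup>+x. f (x + c) \<partial>lborel) = (\<integral>\<^sup>+x. f x \<partial>lborel)"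
  by (subst (2) lborel_distr_plus[of c, symmetric]) (simp add: nn_integral_distr add.commute)

definition gradient :: "(real^'n::finite \<Rightarrow> real) \<Rightarrow> real^'n \<Rightarrow> real^'n" where
  "gradient \<phi> x = (\<chi> i. partial_deriv i \<phi> x)"

lemma test_Ck: "\<phi> \<in> test_functions \<Omega> \<Longrightarrow> Ck k \<phi>"
  by (simp add: test_functions_def)

lemma test_differentiable: "\<phi> \<in> test_functions \<Omega> \<Longrightarrow> \<phi> differentiable_on UNIV"
  using test_Ck[of \<phi> \<Omega> "Suc 0"] by simp

lemma test_continuous: "\<phi> \<in> test_functions \<Omega> \<Longrightarrow> continuous_on UNIV \<phi>"
  using test_Ck[of \<phi> \<Omega> 0] by simp

lemma test_zero_outside: "\<phi> \<in> test_functions \<Omega> \<Longrightarrow> x \<notin> \<Omega> \<Longrightarrow> \<phi> x = 0"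
  unfolding test_functions_def using closure_subset[of "{x. \<phi> x \<noteq> 0}"] by auto

lemma test_borel: "\<phi> \<in> test_functions \<Omega> \<Longrightarrow> \<phi> \<in> borel_measurable borel"
  by (simp add: borel_measurable_continuous_onI test_continuous)

lemma gradient_inner:
  assumes "\<phi> differentiable_on UNIV"
  shows "frechet_derivative \<phi> (at x) z = gradient \<phi> x \<bullet> z"
proof -
  let ?f = "frechet_derivative \<phi> (at x)"
  have l: "linear ?f" using differentiable_on_UNIV_D[OF assms] has_derivative_linear by blast
  have "?f z = ?f (\<Sum>i\<in>UNIV. z $ i *\<^sub>R axis i 1)"
    by (simp add: basis_expansion flip: scalar_mult_eq_scaleR)
  also have "\<dots> = (\<Sum>i\<in>UNIV. z $ i * ?f (axis i 1))"
    by (simp add: linear_sum[OF l] linear_cmul[OF l])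
  finally show ?thesis by (simp add: gradient_def inner_vec_def partial_deriv_def mult.commute)
qed

lemma line_derivative:
  assumes "\<phi> differentiable_on UNIV"
  shows "((\<lambda>s. \<phi> (x + s *\<^sub>R z)) has_real_derivative gradient \<phi> (x + s *\<^sub>R z) \<bullet> z) (at s)"
proof -
  have "((\<lambda>s. \<phi> (x + s *\<^sub>R z)) has_derivative (\<lambda>h. frechet_derivative \<phi> (at (x + s *\<^sub>R z)) (h *\<^sub>R z))) (at s)"
    by (rule has_derivative_compose[OF _ differentiable_on_UNIV_D[OF assms]])
      (auto intro!: derivative_eq_intros)
  then show ?thesis
    by (rule has_derivative_imp_has_field_derivative) (simp add: gradient_inner[OF assms])
qed

lemma test_partial:
  assumes "\<phi> \<in> test_functions \<Omega>" shows "partial_deriv i \<phi> \<in> test_functions \<Omega>"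
proof -
  let ?K = "closure {x. \<phi> x \<noteq> 0}"
  have "Ck k (partial_deriv i \<phi>)" for k using test_Ck[OF assms, of "Suc k"] by simp
  moreover have "partial_deriv i \<phi> x = 0" if "x \<notin> ?K" for x
  proof -
    have "((\<lambda>x. 0) has_derivative (\<lambda>h. 0)) (at x)" by simp
    then have "(\<phi> has_derivative (\<lambda>h. 0)) (at x)"
      by (rule has_derivative_transform_within_open[of _ _ _ _ "- ?K"])
        (use that closure_subset[of "{x. \<phi> x \<noteq> 0}"] in auto)
    from partial_deriv_eq[OF this] show ?thesis .
  qed
  then have sub: "closure {x. partial_deriv i \<phi> x \<noteq> 0} \<subseteq> ?K"
    by (intro closure_minimal) auto
  moreover have "bounded {x. partial_deriv i \<phi> x \<noteq> 0}"
    using assms unfolding test_functions_def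
    by (intro bounded_subset[OF _ subset_trans[OF closure_subset sub]]) (auto intro: bounded_closure)
  ultimately show ?thesis using assms unfolding test_functions_def by auto
qed

lemma test_add:
  assumes "\<phi> \<in> test_functions \<Omega>" "\<psi> \<in> test_functions \<Omega>"
  shows "(\<lambda>x. \<phi> x + \<psi> x) \<in> test_functions \<Omega>"
proof -
  have "closure {x. \<phi> x + \<psi> x \<noteq> 0} \<subseteq> closure ({x. \<phi> x \<noteq> 0} \<union> {x. \<psi> x \<noteq> 0})"
    by (rule closure_mono) auto
  moreover have "bounded {x. \<phi> x + \<psi> x \<noteq> 0}"
    by (rule bounded_subset[of "{x. \<phi> x \<noteq> 0} \<union> {x. \<psi> x \<noteq> 0}"])
      (use assms in \<open>auto simp: test_functions_def\<close>)
  ultimately show ?thesis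
    using assms by (auto simp: test_functions_def Ck_add)
qed

lemma test_mult:
  assumes "\<phi> \<in> test_functions \<Omega>" "\<And>k. Ck k \<psi>"
  shows "(\<lambda>x. \<phi> x * \<psi> x) \<in> test_functions \<Omega>"
proof -
  have "closure {x. \<phi> x * \<psi> x \<noteq> 0} \<subseteq> closure {x. \<phi> x \<noteq> 0}"
    by (rule closure_mono) auto
  moreover have "bounded {x. \<phi> x * \<psi> x \<noteq> 0}"
    by (rule bounded_subset[of "{x. \<phi> x \<noteq> 0}"])
      (use assms in \<open>auto simp: test_functions_def\<close>)
  ultimately show ?thesis
    using assms by (auto simp: test_functions_def Ck_mult)
qed

lemma test_scale: "\<phi> \<in> test_functions \<Omega> \<Longrightarrow> (\<lambda>x. c * \<phi> x) \<in> test_functions \<Omega>"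
  using test_mult[of \<phi> \<Omega> "\<lambda>x. c"] by (simp add: Ck_const mult.commute)

lemma test_bound:
  assumes "\<phi> \<in> test_functions \<Omega>" obtains B where "B > 0" "\<And>x. \<bar>\<phi> x\<bar> \<le> B"
proof -
  let ?K = "closure {x. \<phi> x \<noteq> 0}"
  have "compact (\<phi> ` ?K)"
    using assms test_continuous[OF assms]
    by (intro compact_continuous_image) (auto simp: test_functions_def intro: continuous_on_subset)
  then obtain B where B: "B > 0" "\<And>y. y \<in> \<phi> ` ?K \<Longrightarrow> norm y \<le> B"
    by (meson bounded_pos compact_imp_bounded)
  have "\<bar>\<phi> x\<bar> \<le> B" for x
    using B(1) B(2)[of "\<phi> x"] closure_subset[of "{x. \<phi> x \<noteq> 0}"] by (cases "\<phi> x = 0") auto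
  then show ?thesis using B(1) that by blast
qed

lemma test_supp_bound:
  assumes "\<phi> \<in> test_functions \<Omega>" obtains R where "R > 0" "\<And>x. norm x > R \<Longrightarrow> \<phi> x = 0"
proof -
  have "bounded {x. \<phi> x \<noteq> 0}" using assms by (auto simp: test_functions_def)
  then obtain R where "R > 0" "\<forall>x\<in>{x. \<phi> x \<noteq> 0}. norm x \<le> R" by (auto simp: bounded_pos)
  then show ?thesis using that[of R] by force
qed

lemma integrable_bounded_support:
  fixes h :: "'a::euclidean_space \<Rightarrow> real"
  assumes "h \<in> borel_measurable borel" "\<And>x. \<bar>h x\<bar> \<le> B" "\<And>x. norm x > R \<Longrightarrow> h x = 0"
  shows "integrable lborel h"
proof (rule Bochner_Integration.integrable_bound)
  show "integrable lborel (\<lambda>x. B * indicator (cball 0 R) x)"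
    by (intro integrable_mult_right integrable_real_indicator) (auto simp: emeasure_bounded_finite[OF bounded_cball, simplified])
qed (use assms in \<open>auto simp: indicator_def not_le intro!: AE_I2 order_trans[OF _ abs_ge_self]\<close>)

lemma test_integrable_lborel: "\<phi> \<in> test_functions \<Omega> \<Longrightarrow> integrable lborel \<phi>"
  by (rule test_bound, assumption, rule test_supp_bound, assumption)
    (rule integrable_bounded_support[OF test_borel])

text \<open>Difference quotients integrate to zero by translation invariance. The mean value theorem
  bounds them, and as the steps are at most 1 they all live in the ball of radius
  \<open>R + 1\<close>, so dominated convergence applies.\<close>

lemma test_partial_integral_zero:
  assumes \<phi>: "\<phi> \<in> test_functions \<Omega>"
  shows "(\<integral>x. partial_deriv i \<phi> x \<partial>lborel) = 0"
proof -
  note df = test_differentiable[OF \<phi>]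
  note [measurable] = test_borel[OF \<phi>] test_borel[OF test_partial[OF \<phi>]]
  obtain B where B: "B > 0" "\<And>x. \<bar>partial_deriv i \<phi> x\<bar> \<le> B" using test_bound[OF test_partial[OF \<phi>]] by metis
  obtain R where R: "R > 0" "\<And>x. norm x > R \<Longrightarrow> \<phi> x = 0" using test_supp_bound[OF \<phi>] by metis
  let ?e = "axis i 1 :: real^'a"
  let ?h = "\<lambda>k. inverse (real (Suc k))"
  let ?g = "\<lambda>k x. (\<phi> (x + ?h k *\<^sub>R ?e) - \<phi> x) / ?h k"
  have h: "0 < ?h k" "?h k \<le> 1" for k by (auto simp: inverse_le_1_iff)
  have D: "((\<lambda>s. \<phi> (x + s *\<^sub>R ?e)) has_real_derivative partial_deriv i \<phi> (x + s *\<^sub>R ?e)) (at s)" for x s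
    using line_derivative[OF df, of x ?e s] by (simp add: gradient_def inner_axis)
  have bd: "\<bar>?g k x\<bar> \<le> B * indicator (cball 0 (R + 1)) x" for k x
  proof (cases "norm x > R + 1")
    case True
    have "norm x \<le> norm (x + ?h k *\<^sub>R ?e) + norm (?h k *\<^sub>R ?e)" by (metis add_diff_cancel norm_triangle_ineq4)
    moreover have "norm (?h k *\<^sub>R ?e) \<le> 1" using h[of k] by (simp add: norm_axis_1)
    ultimately have "norm (x + ?h k *\<^sub>R ?e) > R" using True by linarith
    then show ?thesis using R True by (simp add: indicator_def)
  next
    case False
    obtain z where z: "\<phi> (x + ?h k *\<^sub>R ?e) - \<phi> (x + 0 *\<^sub>R ?e) = (?h k - 0) * partial_deriv i \<phi> (x + z *\<^sub>R ?e)"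
      using MVT2[OF h(1)[of k], of "\<lambda>s. \<phi> (x + s *\<^sub>R ?e)", OF D] by metis
    then have "?g k x = partial_deriv i \<phi> (x + z *\<^sub>R ?e)" using h[of k] by (simp add: field_simps)
    then show ?thesis using B(2) False by (simp add: indicator_def not_less)
  qed
  have "(\<lambda>k. \<integral>x. ?g k x \<partial>lborel) \<longlonglongrightarrow> (\<integral>x. partial_deriv i \<phi> x \<partial>lborel)"
  proof (rule integral_dominated_convergence[where w="\<lambda>x. B * indicator (cball 0 (R + 1)) x"])
    show "integrable lborel (\<lambda>x. B * indicator (cball (0::real^'a) (R + 1)) x)"
      by (intro integrable_mult_right integrable_real_indicator) (auto simp: emeasure_bounded_finite[OF bounded_cball, simplified])
    show "AE x in lborel. (\<lambda>k. ?g k x) \<longlonglongrightarrow> partial_deriv i \<phi> x"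
    proof (rule AE_I2)
      fix x
      have "((\<lambda>h. (\<phi> (x + h *\<^sub>R ?e) - \<phi> x) / h) \<longlongrightarrow> partial_deriv i \<phi> x) (at 0)"
        using D[of x 0] by (simp add: DERIV_def)
      moreover have "filterlim ?h (at 0) sequentially"
        by (rule filterlim_atI[OF LIMSEQ_inverse_real_of_nat]) (auto intro!: always_eventually)
      ultimately show "(\<lambda>k. ?g k x) \<longlonglongrightarrow> partial_deriv i \<phi> x"
        by (rule filterlim_compose)
    qed
  qed (use bd in auto)
  moreover have "(\<integral>x. ?g k x \<partial>lborel) = 0" for k
  proof -
    have "integrable lborel (\<lambda>x. \<phi> (x + ?h k *\<^sub>R ?e))"
      using test_integrable_lborel[OF \<phi>] lborel_integrable_real_affine
      by (subst (asm) lborel_distr_plus[of "?h k *\<^sub>R ?e", symmetric])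
        (simp add: integrable_distr_eq add.commute)
    then show ?thesis
      using test_integrable_lborel[OF \<phi>] integral_lborel_translation[of \<phi> "?h k *\<^sub>R ?e"]
      by (simp add: Bochner_Integration.integral_diff)
  qed
  ultimately show ?thesis by (simp add: LIMSEQ_const_iff)
qed

lemma partial_deriv_mult:
  assumes "\<phi> differentiable_on UNIV" "\<psi> differentiable_on UNIV"
  shows "partial_deriv i (\<lambda>x. \<phi> x * \<psi> x) x = \<phi> x * partial_deriv i \<psi> x + partial_deriv i \<phi> x * \<psi> x"
  by (subst partial_deriv_eq[OF has_derivative_mult[OF differentiable_on_UNIV_D[OF assms(1)] differentiable_on_UNIV_D[OF assms(2)]]])
    (simp add: partial_deriv_def)

lemma test_integration_by_parts:
  assumes \<phi>: "\<phi> \<in> test_functions \<Omega>" and \<psi>: "\<psi> \<in> test_functions \<Omega>"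
  shows "(\<integral>x. \<phi> x * partial_deriv i \<psi> x \<partial>lborel) = - (\<integral>x. partial_deriv i \<phi> x * \<psi> x \<partial>lborel)"
proof -
  have "(\<integral>x. \<phi> x * partial_deriv i \<psi> x + partial_deriv i \<phi> x * \<psi> x \<partial>lborel) = 0"
    using test_partial_integral_zero[OF test_mult[OF \<phi> test_Ck[OF \<psi>]], of i]
    by (simp add: partial_deriv_mult test_differentiable[OF \<phi>] test_differentiable[OF \<psi>])
  moreover have "integrable lborel (\<lambda>x. \<phi> x * partial_deriv i \<psi> x)"
    by (rule test_integrable_lborel[OF test_mult[OF \<phi> test_Ck[OF test_partial[OF \<psi>]]]])
  moreover have "integrable lborel (\<lambda>x. partial_deriv i \<phi> x * \<psi> x)"
    by (rule test_integrable_lborel[OF test_mult[OF test_partial[OF \<phi>] test_Ck[OF \<psi>]]])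
  ultimately show ?thesis by simp
qed

section \<open>The spaces \<open>L\<^sup>2\<close>, \<open>H\<^sup>1\<close> and \<open>H\<^sup>1\<^sub>0\<close>\<close>

text \<open>The completeness of \<open>L2\<close> and the extension of the Sobolev inequality both
  need integrability of an almost everywhere limit along with the bound, so both are drawn from
  Fatou's lemma at once.\<close>

lemma Fatou_bound:
  fixes F :: "nat \<Rightarrow> 'a \<Rightarrow> real"
  assumes F: "\<And>n. integrable M (F n)" "\<And>n x. 0 \<le> F n x" and G: "G \<in> borel_measurable M"
    and lim: "AE x in M. (\<lambda>n. F n x) \<longlonglongrightarrow> G x"
    and bd: "eventually (\<lambda>n. (\<integral>x. F n x \<partial>M) \<le> C) sequentially"
  shows "integrable M G" "(\<integral>x. G x \<partial>M) \<le> C"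
proof -
  note [measurable] = G borel_measurable_integrable[OF F(1)]
  have pos: "AE x in M. 0 \<le> G x"
    using lim by eventually_elim (rule LIMSEQ_le_const, auto intro: F(2))
  have C: "0 \<le> C"
  proof -
    obtain n where "(\<integral>x. F n x \<partial>M) \<le> C" using bd eventually_happens' sequentially_bot by blast
    moreover have "0 \<le> (\<integral>x. F n x \<partial>M)" by (rule Bochner_Integration.integral_nonneg) (rule F(2))
    ultimately show ?thesis by simp
  qed
  have "(\<integral>\<^sup>+x. ennreal (G x) \<partial>M) = (\<integral>\<^sup>+x. liminf (\<lambda>n. ennreal (F n x)) \<partial>M)"
  proof (rule nn_integral_cong_AE)
    show "AE x in M. ennreal (G x) = liminf (\<lambda>n. ennreal (F n x))"
      using lim by eventually_elim (metis lim_imp_Liminf sequentially_bot tendsto_ennrealI)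
  qed
  also have "\<dots> \<le> liminf (\<lambda>n. \<integral>\<^sup>+x. ennreal (F n x) \<partial>M)"
    by (rule nn_integral_liminf) auto
  also have "\<dots> = liminf (\<lambda>n. ennreal (\<integral>x. F n x \<partial>M))"
    using F by (simp add: nn_integral_eq_integral)
  also have "\<dots> \<le> liminf (\<lambda>n. ennreal C)"
    using bd by (intro Liminf_mono) (auto elim!: eventually_mono intro: ennreal_leI)
  also have "\<dots> = ennreal C" by (simp add: Liminf_const)
  finally have le: "(\<integral>\<^sup>+x. ennreal (G x) \<partial>M) \<le> ennreal C" .
  show int: "integrable M G"
    by (rule integrableI_nonneg[OF G pos]) (use le in \<open>simp add: le_less_trans[OF le]\<close>)
  show "(\<integral>x. G x \<partial>M) \<le> C"
    using le C pos by (simp add: nn_integral_eq_integral[OF int])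
qed

section \<open>The space \<open>L2\<close>: inner product and completeness\<close>

definition l2_inner :: "(real^'n::finite) set \<Rightarrow> (real^'n \<Rightarrow> 'b::euclidean_space) \<Rightarrow> (real^'n \<Rightarrow> 'b) \<Rightarrow> real" where
  "l2_inner S u v = (\<integral>x. u x \<bullet> v x \<partial>lebesgue_on S)"

lemma L2_measurable: "u \<in> L2 S \<Longrightarrow> u \<in> borel_measurable (lebesgue_on S)"
  by (simp add: L2_def)

lemma L2_integrable_inner:
  assumes "u \<in> L2 S" "v \<in> L2 S" shows "integrable (lebesgue_on S) (\<lambda>x. u x \<bullet> v x)"
proof (rule Bochner_Integration.integrable_bound)
  show "integrable (lebesgue_on S) (\<lambda>x. (norm (u x))\<^sup>2 + (norm (v x))\<^sup>2)"
    using assms by (auto simp: L2_def)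
  show "(\<lambda>x. u x \<bullet> v x) \<in> borel_measurable (lebesgue_on S)"
    using assms by (auto simp: L2_def)
  have "\<bar>u x \<bullet> v x\<bar> \<le> (norm (u x))\<^sup>2 + (norm (v x))\<^sup>2" for x
    using Cauchy_Schwarz_ineq2[of "u x" "v x"] sum_squares_bound[of "norm (u x)" "norm (v x)"]
      zero_le_power2[of "norm (u x)"] zero_le_power2[of "norm (v x)"] by linarith
  then show "AE x in lebesgue_on S. norm (u x \<bullet> v x) \<le> norm ((norm (u x))\<^sup>2 + (norm (v x))\<^sup>2)"
    by auto
qed

lemma L2_add:
  assumes "u \<in> L2 S" "v \<in> L2 S" shows "(\<lambda>x. u x + v x) \<in> L2 S"
proof -
  have "integrable (lebesgue_on S) (\<lambda>x. (norm (u x))\<^sup>2 + 2 * (u x \<bullet> v x) + (norm (v x))\<^sup>2)"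
    using assms L2_integrable_inner[OF assms] by (auto simp: L2_def)
  moreover have "(norm (u x + v x))\<^sup>2 = (norm (u x))\<^sup>2 + 2 * (u x \<bullet> v x) + (norm (v x))\<^sup>2" for x
    by (simp add: power2_norm_eq_inner algebra_simps inner_commute)
  ultimately show ?thesis using assms by (auto simp: L2_def)
qed

lemma L2_scale: "u \<in> L2 S \<Longrightarrow> (\<lambda>x. c *\<^sub>R u x) \<in> L2 S"
  by (auto simp: L2_def power_mult_distrib)

lemma L2_diff: "u \<in> L2 S \<Longrightarrow> v \<in> L2 S \<Longrightarrow> (\<lambda>x. u x - v x) \<in> L2 S"
  using L2_add[of u S "\<lambda>x. (-1) *\<^sub>R v x"] L2_scale[of v S "-1"] by simp

lemma L2_component:
  fixes u :: "real^'n::finite \<Rightarrow> real^'m::finite"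
  shows "u \<in> L2 S \<Longrightarrow> (\<lambda>x. u x $ i) \<in> L2 S"
proof -
  assume u: "u \<in> L2 S"
  have "(\<lambda>x. u x $ i) \<in> borel_measurable (lebesgue_on S)"
    by (rule measurable_compose[OF L2_measurable[OF u]])
      (intro borel_measurable_continuous_onI continuous_intros)
  moreover have "integrable (lebesgue_on S) (\<lambda>x. (u x $ i)\<^sup>2)"
  proof (rule Bochner_Integration.integrable_bound[of _ "\<lambda>x. (norm (u x))\<^sup>2"])
    show "integrable (lebesgue_on S) (\<lambda>x. (norm (u x))\<^sup>2)" using u by (auto simp: L2_def)
    show "(\<lambda>x. (u x $ i)\<^sup>2) \<in> borel_measurable (lebesgue_on S)" using calculation by simp
    show "AE x in lebesgue_on S. norm ((u x $ i)\<^sup>2) \<le> norm ((norm (u x))\<^sup>2)"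
      using component_le_norm_cart power_mono[of "\<bar>u x $ i\<bar>" "norm (u x)" 2 for x] by auto
  qed
  ultimately show ?thesis by (simp add: L2_def)
qed

lemma l2_inner_commute: "l2_inner S u v = l2_inner S v u"
  by (simp add: l2_inner_def inner_commute)

lemma l2_inner_add_left:
  "u \<in> L2 S \<Longrightarrow> v \<in> L2 S \<Longrightarrow> w \<in> L2 S \<Longrightarrow>
   l2_inner S (\<lambda>x. u x + v x) w = l2_inner S u w + l2_inner S v w"
  by (simp add: l2_inner_def inner_add_left L2_integrable_inner)

lemma l2_inner_diff_left:
  "u \<in> L2 S \<Longrightarrow> v \<in> L2 S \<Longrightarrow> w \<in> L2 S \<Longrightarrow>
   l2_inner S (\<lambda>x. u x - v x) w = l2_inner S u w - l2_inner S v w"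
  by (simp add: l2_inner_def inner_diff_left L2_integrable_inner)

lemma l2_inner_scale_left: "l2_inner S (\<lambda>x. c *\<^sub>R u x) v = c * l2_inner S u v"
  by (simp add: l2_inner_def)

lemma l2_inner_nonneg: "0 \<le> l2_inner S u u"
  by (simp add: l2_inner_def integral_nonneg_AE)

lemma l2_inner_self: "l2_inner S u u = (\<integral>x. (norm (u x))\<^sup>2 \<partial>lebesgue_on S)"
  by (simp add: l2_inner_def power2_norm_eq_inner)

lemma quadratic_form_Cauchy_Schwarz:
  fixes a b c :: real
  assumes "\<And>t. 0 \<le> a + 2 * t * b + t\<^sup>2 * c" "0 \<le> a" "0 \<le> c"
  shows "\<bar>b\<bar> \<le> sqrt a * sqrt c"
proof -
  have "b\<^sup>2 \<le> a * c"
  proof (cases "c = 0")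
    case True
    have "b = 0"
    proof (rule ccontr)
      assume "b \<noteq> 0"
      \<comment> \<open>At this \<open>t\<close> the affine function \<open>a + 2 * t * b\<close>
        takes the value -1.\<close>
      have "0 \<le> a + 2 * (- (a + 1) / (2 * b)) * b" using assms(1)[of "- (a + 1) / (2 * b)"] True by simp
      then show False using \<open>b \<noteq> 0\<close> by (simp add: field_simps)
    qed
    then show ?thesis using True by simp
  next
    case False
    \<comment> \<open>The quadratic is evaluated at its minimum \<open>- b / c\<close>;
      multiplication by \<open>c\<close> produces the discriminant.\<close>
    have "0 \<le> c * (a + 2 * (- b / c) * b + (- b / c)\<^sup>2 * c)"
      by (rule mult_nonneg_nonneg[OF assms(3) assms(1)])
    also have "\<dots> = a * c - b\<^sup>2" using False by (simp add: power2_eq_square field_simps)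
    finally show ?thesis by simp
  qed
  then have "sqrt (b\<^sup>2) \<le> sqrt (a * c)" by (rule real_sqrt_le_mono)
  then show ?thesis by (simp add: real_sqrt_mult)
qed

lemma l2_inner_Cauchy_Schwarz:
  assumes "u \<in> L2 S" "v \<in> L2 S"
  shows "\<bar>l2_inner S u v\<bar> \<le> sqrt (l2_inner S u u) * sqrt (l2_inner S v v)"
proof (rule quadratic_form_Cauchy_Schwarz)
  fix t :: real
  let ?w = "\<lambda>x. u x + t *\<^sub>R v x"
  have "l2_inner S ?w ?w = (\<integral>x. u x \<bullet> u x + 2 * t * (u x \<bullet> v x) + t\<^sup>2 * (v x \<bullet> v x) \<partial>lebesgue_on S)"
    unfolding l2_inner_def
    by (rule Bochner_Integration.integral_cong) (auto simp: inner_commute power2_eq_square algebra_simps)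
  also have "\<dots> = l2_inner S u u + 2 * t * l2_inner S u v + t\<^sup>2 * l2_inner S v v"
    using assms by (simp add: l2_inner_def L2_integrable_inner)
  finally have "l2_inner S ?w ?w = l2_inner S u u + 2 * t * l2_inner S u v + t\<^sup>2 * l2_inner S v v" .
  then show "0 \<le> l2_inner S u u + 2 * t * l2_inner S u v + t\<^sup>2 * l2_inner S v v"
    using l2_inner_nonneg[of S ?w] by simp
qed (simp_all add: l2_inner_nonneg)

lemma l2_inner_cong_AE:
  assumes "AE x in lebesgue_on S. u x = u' x" "AE x in lebesgue_on S. v x = v' x"
    "u \<in> L2 S" "v \<in> L2 S" "u' \<in> L2 S" "v' \<in> L2 S"
  shows "l2_inner S u v = l2_inner S u' v'"
  unfolding l2_inner_def
proof (rule integral_cong_AE)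
  show "AE x in lebesgue_on S. u x \<bullet> v x = u' x \<bullet> v' x" using assms(1,2) by eventually_elim simp
qed (use assms(3-6) in \<open>auto simp: L2_def\<close>)

lemma l2_tendsto_inner:
  assumes "\<And>n. f n \<in> L2 S" "g \<in> L2 S" "h \<in> L2 S"
    "(\<lambda>n. l2_inner S (\<lambda>x. f n x - g x) (\<lambda>x. f n x - g x)) \<longlonglongrightarrow> 0"
  shows "(\<lambda>n. l2_inner S (f n) h) \<longlonglongrightarrow> l2_inner S g h"
proof -
  have "(\<lambda>n. sqrt (l2_inner S (\<lambda>x. f n x - g x) (\<lambda>x. f n x - g x)) * sqrt (l2_inner S h h)) \<longlonglongrightarrow> sqrt 0 * sqrt (l2_inner S h h)"
    by (intro tendsto_intros assms(4))
  then have lim: "(\<lambda>n. sqrt (l2_inner S (\<lambda>x. f n x - g x) (\<lambda>x. f n x - g x)) * sqrt (l2_inner S h h)) \<longlonglongrightarrow> 0"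
    by simp
  have "norm (l2_inner S (f n) h - l2_inner S g h)
      \<le> sqrt (l2_inner S (\<lambda>x. f n x - g x) (\<lambda>x. f n x - g x)) * sqrt (l2_inner S h h)" for n
    using l2_inner_Cauchy_Schwarz[OF L2_diff[OF assms(1,2)] assms(3), of n]
    by (simp add: l2_inner_diff_left[OF assms(1-3)])
  then have "(\<lambda>n. l2_inner S (f n) h - l2_inner S g h) \<longlonglongrightarrow> 0"
    by (intro Lim_null_comparison[OF _ lim] always_eventually allI)
  then show ?thesis by (rule LIM_zero_cancel)
qed

text \<open>On a set of finite measure a Cauchy sequence in \<open>L2\<close> is one in
  \<open>L^1\<close> and therefore has an almost everywhere convergent subsequence. Fatou's lemma
  turns the Cauchy estimate between \<open>f m\<close> and \<open>f (r i)\<close> into one between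
  \<open>f m\<close> and the limit.\<close>

lemma L2_complete:
  fixes f :: "nat \<Rightarrow> real^'n::finite \<Rightarrow> 'b::euclidean_space"
  assumes S: "S \<in> lmeasurable" and f: "\<And>n. f n \<in> L2 S"
    and Cauchy: "\<And>e. e > 0 \<Longrightarrow> \<exists>N. \<forall>m\<ge>N. \<forall>n\<ge>N. l2_inner S (\<lambda>x. f m x - f n x) (\<lambda>x. f m x - f n x) < e"
  shows "\<exists>g\<in>L2 S. (\<lambda>n. l2_inner S (\<lambda>x. f n x - g x) (\<lambda>x. f n x - g x)) \<longlonglongrightarrow> 0"
proof -
  let ?M = "lebesgue_on S"
  interpret finite_measure ?M using S by (rule finite_measure_lebesgue_on)
  \<comment> \<open>Splitting at height \<open>\<eta>\<close> compares the two norms without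
    Hoelder's inequality.\<close>
  have sq: "norm y \<le> \<eta> + (norm y)\<^sup>2 / \<eta>" if "\<eta> > 0" for \<eta> and y :: 'b
  proof (cases "norm y \<le> \<eta>")
    case False
    then have "norm y * \<eta> \<le> (norm y)\<^sup>2" by (simp add: power2_eq_square mult_left_mono)
    then have "norm y \<le> (norm y)\<^sup>2 / \<eta>" using that by (simp add: field_simps)
    then show ?thesis using that by linarith
  qed (use that in \<open>simp add: add_increasing2\<close>)
  have L1: "integrable ?M u" if "u \<in> L2 S" for u :: "real^'n \<Rightarrow> 'b"
  proof (rule Bochner_Integration.integrable_bound)
    show "integrable ?M (\<lambda>x. 1 + (norm (u x))\<^sup>2)" using that by (simp add: L2_def)
  qed (use that sq[of 1] in \<open>auto simp: L2_def\<close>)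
  obtain r where r: "strict_mono r" and ae: "AE x in ?M. Cauchy (\<lambda>i. f (r i) x)"
  proof (rule cauchy_L1_AE_cauchy_subseq[of ?M f])
    show "integrable ?M (f n)" for n using L1 f by blast
    fix e :: real assume e: "e > 0"
    let ?m = "measure ?M (space ?M)"
    \<comment> \<open>The constant part contributes \<open>\<eta>\<close> times the measure, less
      than \<open>e / 2\<close>; the tolerance \<open>\<eta> * (e / 2)\<close> requested next keeps
      the quadratic part below \<open>e / 2\<close> too. The \<open>+ 1\<close> guards against
      measure zero.\<close>
    define \<eta> where "\<eta> = e / (2 * (?m + 1))"
    have \<eta>: "\<eta> > 0" "\<eta> * ?m < e / 2" using e measure_nonneg[of ?M "space ?M"] by (auto simp: \<eta>_def field_simps add_pos_nonneg)
    obtain N where N: "\<And>m n. m \<ge> N \<Longrightarrow> n \<ge> N \<Longrightarrow> l2_inner S (\<lambda>x. f m x - f n x) (\<lambda>x. f m x - f n x) < \<eta> * (e / 2)"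
      using Cauchy[of "\<eta> * (e / 2)"] \<eta>(1) e by auto
    show "\<exists>N. \<forall>i\<ge>N. \<forall>j\<ge>N. (LINT x|?M. norm (f i x - f j x)) < e"
    proof (intro exI allI impI)
      fix i j assume ij: "i \<ge> N" "j \<ge> N"
      have d: "(\<lambda>x. f i x - f j x) \<in> L2 S" using f L2_diff by blast
      then have int: "integrable ?M (\<lambda>x. (norm (f i x - f j x))\<^sup>2)" by (auto simp: L2_def)
      have "(LINT x|?M. norm (f i x - f j x)) \<le> (LINT x|?M. \<eta> + (norm (f i x - f j x))\<^sup>2 / \<eta>)"
        using L1[OF d] int sq[OF \<eta>(1)] by (intro integral_mono) auto
      also have "\<dots> = \<eta> * ?m + l2_inner S (\<lambda>x. f i x - f j x) (\<lambda>x. f i x - f j x) / \<eta>"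
        using int by (simp add: l2_inner_self)
      also have "\<dots> < e / 2 + e / 2"
        using \<eta> N[OF ij] by (intro add_strict_mono) (auto simp: field_simps)
      finally show "(LINT x|?M. norm (f i x - f j x)) < e" by simp
    qed
  qed
  define g where "g x = lim (\<lambda>i. f (r i) x)" for x
  have fm: "f n \<in> borel_measurable ?M" for n using f L2_measurable by blast
  have gm: "g \<in> borel_measurable ?M"
    unfolding g_def by (rule borel_measurable_lim_metric) (rule fm)
  have lim: "AE x in ?M. (\<lambda>i. f (r i) x) \<longlonglongrightarrow> g x"
    using ae by eventually_elim (metis g_def Cauchy_convergent convergent_LIMSEQ_iff)
  have F: "integrable ?M (\<lambda>x. (norm (f m x - g x))\<^sup>2) \<and> (\<integral>x. (norm (f m x - g x))\<^sup>2 \<partial>?M) \<le> e"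
    if that': "\<And>n. n \<ge> N \<Longrightarrow> l2_inner S (\<lambda>x. f m x - f n x) (\<lambda>x. f m x - f n x) < e" for m e N
  proof -
    let ?F = "\<lambda>i x. (norm (f m x - f (r i) x))\<^sup>2"
    have 1: "integrable ?M (?F i)" for i
      using L2_diff[OF f f] by (auto simp: L2_def)
    have 2: "AE x in ?M. (\<lambda>n. ?F n x) \<longlonglongrightarrow> (norm (f m x - g x))\<^sup>2"
      using lim by eventually_elim (intro tendsto_intros)
    have "(\<integral>x. ?F i x \<partial>?M) \<le> e" if "i \<ge> N" for i
      using that' [of "r i"] seq_suble[OF r, of i] that by (simp add: l2_inner_self)
    then have 3: "\<forall>\<^sub>F i in sequentially. (\<integral>x. ?F i x \<partial>?M) \<le> e"
      by (auto simp: eventually_sequentially)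
    have 4: "(\<lambda>x. (norm (f m x - g x))\<^sup>2) \<in> borel_measurable ?M" using fm gm by auto
    show ?thesis
      using Fatou_bound(1)[OF 1 _ 4 2 3] Fatou_bound(2)[OF 1 _ 4 2 3] by simp
  qed
  have g: "g \<in> L2 S"
  proof -
    obtain N where N: "\<And>m n. m \<ge> N \<Longrightarrow> n \<ge> N \<Longrightarrow> l2_inner S (\<lambda>x. f m x - f n x) (\<lambda>x. f m x - f n x) < 1"
      using Cauchy[of 1] by auto
    then have "(\<lambda>x. f N x - g x) \<in> L2 S" using F[of N N 1] fm gm by (auto simp: L2_def)
    from L2_diff[OF f[of N] this] show ?thesis by simp
  qed
  moreover have "(\<lambda>n. l2_inner S (\<lambda>x. f n x - g x) (\<lambda>x. f n x - g x)) \<longlonglongrightarrow> 0"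
  proof (rule LIMSEQ_I)
    fix e :: real assume e: "e > 0"
    obtain N where N: "\<And>m n. m \<ge> N \<Longrightarrow> n \<ge> N \<Longrightarrow> l2_inner S (\<lambda>x. f m x - f n x) (\<lambda>x. f m x - f n x) < e / 2"
      using Cauchy[of "e/2"] e by auto
    then have "l2_inner S (\<lambda>x. f n x - g x) (\<lambda>x. f n x - g x) < e" if "n \<ge> N" for n
      using F[of N n "e/2"] that e by (force simp: l2_inner_self)
    then show "\<exists>no. \<forall>n\<ge>no. norm (l2_inner S (\<lambda>x. f n x - g x) (\<lambda>x. f n x - g x) - 0) < e"
      by (intro exI[of _ N]) (simp add: abs_of_nonneg l2_inner_nonneg)
  qed
  ultimately show ?thesis by blast
qed

section \<open>Weak gradients and the Dirichlet form\<close>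

lemma H1_weak_gradient:
  assumes "u \<in> H1 \<Omega>"
  shows "u \<in> L2 \<Omega>" "weak_gradient \<Omega> u \<in> L2 \<Omega>" "is_weak_gradient \<Omega> u (weak_gradient \<Omega> u)"
proof -
  have "\<exists>D. D \<in> L2 \<Omega> \<and> is_weak_gradient \<Omega> u D" using assms by (auto simp: H1_def)
  from someI_ex[OF this] show "weak_gradient \<Omega> u \<in> L2 \<Omega>" "is_weak_gradient \<Omega> u (weak_gradient \<Omega> u)"
    by (auto simp: weak_gradient_def)
qed (use assms in \<open>simp add: H1_def\<close>)

definition dirichlet :: "(real^'n::finite) set \<Rightarrow> (real^'n \<Rightarrow> real) \<Rightarrow> (real^'n \<Rightarrow> real) \<Rightarrow> real" where
  "dirichlet \<Omega> u v = l2_inner \<Omega> (weak_gradient \<Omega> u) (weak_gradient \<Omega> v)"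

lemma dirichlet_commute: "dirichlet \<Omega> u v = dirichlet \<Omega> v u"
  by (simp add: dirichlet_def l2_inner_commute)

lemma dirichlet_nonneg: "0 \<le> dirichlet \<Omega> u u"
  by (simp add: dirichlet_def l2_inner_nonneg)

lemma H1_norm_square: "(H1_norm \<Omega> u)\<^sup>2 = l2_inner \<Omega> u u + dirichlet \<Omega> u u"
proof -
  have "0 \<le> l2_inner \<Omega> u u + dirichlet \<Omega> u u"
    using l2_inner_nonneg dirichlet_nonneg by (metis add_nonneg_nonneg)
  then show ?thesis
    by (simp add: H1_norm_def l2_inner_self dirichlet_def)
qed

lemma H1_norm_nonneg: "0 \<le> H1_norm \<Omega> u"
  by (simp add: H1_norm_def)

locale bounded_open =
  fixes \<Omega> :: "(real^'n::finite) set"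
  assumes open_domain: "open \<Omega>" and bounded_domain: "bounded \<Omega>"
begin

lemma domain_sets [measurable, simp]: "\<Omega> \<in> sets lebesgue"
  using open_domain by simp

lemma domain_lmeasurable: "\<Omega> \<in> lmeasurable"
  using open_domain bounded_domain by (simp add: lmeasurable_open)

lemma finite_measure_domain: "finite_measure (lebesgue_on \<Omega>)"
  using domain_lmeasurable by (rule finite_measure_lebesgue_on)

lemma borel_measurable_domain:
  "h \<in> borel_measurable borel \<Longrightarrow> h \<in> borel_measurable (lebesgue_on \<Omega>)"
  by (rule measurable_restrict_space1) (auto intro: measurable_completion)

lemma integrable_domain:
  fixes h :: "real^'n \<Rightarrow> real"
  shows "integrable lborel h \<Longrightarrow> integrable (lebesgue_on \<Omega>) h"
  using integrable_mult_indicator[of \<Omega> lebesgue h]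
  by (simp add: integrable_restrict_space integrable_completion borel_measurable_integrable)

lemma test_L2: "\<phi> \<in> test_functions \<Omega> \<Longrightarrow> \<phi> \<in> L2 \<Omega>"
  using test_integrable_lborel[OF test_mult[of \<phi> \<Omega> \<phi>]] test_Ck[of \<phi> \<Omega>]
  by (auto simp: L2_def power2_eq_square intro!: borel_measurable_domain test_borel integrable_domain)

lemma gradient_L2:
  assumes "\<phi> \<in> test_functions \<Omega>" shows "gradient \<phi> \<in> L2 \<Omega>"
proof -
  have "continuous_on UNIV (gradient \<phi>)"
    unfolding gradient_def[abs_def]
    by (intro continuous_on_vec_lambda) (rule test_continuous[OF test_partial[OF assms]])
  then have "gradient \<phi> \<in> borel_measurable (lebesgue_on \<Omega>)"
    by (intro borel_measurable_domain borel_measurable_continuous_onI)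
  moreover have "(norm (gradient \<phi> x))\<^sup>2 = (\<Sum>i\<in>UNIV. (partial_deriv i \<phi> x)\<^sup>2)" for x
    unfolding power2_norm_eq_inner by (simp add: gradient_def inner_vec_def power2_eq_square)
  moreover have "integrable (lebesgue_on \<Omega>) (\<lambda>x. \<Sum>i\<in>UNIV. (partial_deriv i \<phi> x)\<^sup>2)"
    using test_L2[OF test_partial[OF assms]] by (auto simp: L2_def)
  ultimately show ?thesis by (simp add: L2_def)
qed

lemma is_weak_gradient_test:
  assumes \<phi>: "\<phi> \<in> test_functions \<Omega>" shows "is_weak_gradient \<Omega> \<phi> (gradient \<phi>)"
  unfolding is_weak_gradient_def
proof (intro ballI allI)
  fix \<psi> i assume \<psi>: "\<psi> \<in> test_functions \<Omega>"
  have "(\<integral>x. \<phi> x * partial_deriv i \<psi> x \<partial>lebesgue_on \<Omega>) = (\<integral>x. \<phi> x * partial_deriv i \<psi> x \<partial>lborel)"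
    by (rule integral_lebesgue_on_supp)
      (use test_borel[OF \<phi>] test_borel[OF test_partial[OF \<psi>]] test_zero_outside[OF \<phi>] in auto)
  moreover have "(\<integral>x. gradient \<phi> x $ i * \<psi> x \<partial>lebesgue_on \<Omega>) = (\<integral>x. partial_deriv i \<phi> x * \<psi> x \<partial>lborel)"
    unfolding gradient_def vec_lambda_beta
    by (rule integral_lebesgue_on_supp)
      (use test_borel[OF \<psi>] test_borel[OF test_partial[OF \<phi>]] test_zero_outside[OF \<psi>] in auto)
  ultimately show "(\<integral>x. \<phi> x * partial_deriv i \<psi> x \<partial>lebesgue_on \<Omega>) = - (\<integral>x. gradient \<phi> x $ i * \<psi> x \<partial>lebesgue_on \<Omega>)"
    using test_integration_by_parts[OF \<phi> \<psi>] by simp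
qed

lemma L2_integrable:
  fixes u :: "real^'n \<Rightarrow> real"
  assumes "u \<in> L2 \<Omega>" shows "integrable (lebesgue_on \<Omega>) u"
proof -
  interpret finite_measure "lebesgue_on \<Omega>" by (rule finite_measure_domain)
  have "(\<lambda>x. 1::real) \<in> L2 \<Omega>" by (simp add: L2_def)
  from L2_integrable_inner[OF assms this] show ?thesis by simp
qed

text \<open>The fundamental lemma is applied to each coordinate of the difference. Admitting two
  representatives \<open>u\<close> and \<open>u'\<close> makes the Dirichlet form insensitive to
  changes on null sets.\<close>

lemma weak_gradient_unique:
  assumes "D \<in> L2 \<Omega>" "D' \<in> L2 \<Omega>" "is_weak_gradient \<Omega> u D" "is_weak_gradient \<Omega> u' D'"
    and uu': "AE x in lebesgue_on \<Omega>. u x = u' x" "u \<in> L2 \<Omega>" "u' \<in> L2 \<Omega>"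
  shows "AE x in lebesgue_on \<Omega>. D x = D' x"
proof -
  have "AE x in lebesgue_on \<Omega>. D x $ i - D' x $ i = 0" for i
  proof (rule AE_zero_if_orthogonal_tests[OF open_domain])
    have DD: "(\<lambda>x. D x $ i) \<in> L2 \<Omega>" "(\<lambda>x. D' x $ i) \<in> L2 \<Omega>" using assms L2_component by blast+
    then show "integrable (lebesgue_on \<Omega>) (\<lambda>x. D x $ i - D' x $ i)"
      by (intro L2_integrable L2_diff)
    fix \<phi> assume \<phi>: "\<phi> \<in> test_functions \<Omega>"
    have "l2_inner \<Omega> u (partial_deriv i \<phi>) = l2_inner \<Omega> u' (partial_deriv i \<phi>)"
      using test_L2[OF test_partial[OF \<phi>]] uu' by (intro l2_inner_cong_AE) auto
    then have "l2_inner \<Omega> (\<lambda>x. D x $ i) \<phi> = l2_inner \<Omega> (\<lambda>x. D' x $ i) \<phi>"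
      using assms(3,4) \<phi> unfolding is_weak_gradient_def l2_inner_def inner_real_def by simp
    then show "(\<integral>x. (D x $ i - D' x $ i) * \<phi> x \<partial>lebesgue_on \<Omega>) = 0"
      using l2_inner_diff_left[OF DD test_L2[OF \<phi>]] by (simp add: l2_inner_def)
  qed
  then have "AE x in lebesgue_on \<Omega>. \<forall>i. D x $ i - D' x $ i = 0" by (simp add: AE_all_countable)
  then show ?thesis by eventually_elim (simp add: vec_eq_iff)
qed

lemma H1I:
  assumes "u \<in> L2 \<Omega>" "D \<in> L2 \<Omega>" "is_weak_gradient \<Omega> u D"
  shows "u \<in> H1 \<Omega>" "AE x in lebesgue_on \<Omega>. weak_gradient \<Omega> u x = D x"
proof -
  show u: "u \<in> H1 \<Omega>" using assms by (auto simp: H1_def)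
  show "AE x in lebesgue_on \<Omega>. weak_gradient \<Omega> u x = D x"
    using weak_gradient_unique[OF H1_weak_gradient(2)[OF u] assms(2) H1_weak_gradient(3)[OF u] assms(3)] assms(1)
    by simp
qed

lemma is_weak_gradient_lincomb:
  fixes u v :: "real^'n \<Rightarrow> real"
  assumes "u \<in> L2 \<Omega>" "v \<in> L2 \<Omega>" "D \<in> L2 \<Omega>" "E \<in> L2 \<Omega>" "is_weak_gradient \<Omega> u D" "is_weak_gradient \<Omega> v E"
  shows "is_weak_gradient \<Omega> (\<lambda>x. u x + c * v x) (\<lambda>x. D x + c *\<^sub>R E x)"
  unfolding is_weak_gradient_def
proof (intro ballI allI)
  fix \<phi> i assume \<phi>: "\<phi> \<in> test_functions \<Omega>"
  note t = test_L2[OF \<phi>] test_L2[OF test_partial[OF \<phi>, of i]]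
  have i: "integrable (lebesgue_on \<Omega>) (\<lambda>x. u x * partial_deriv i \<phi> x)"
    "integrable (lebesgue_on \<Omega>) (\<lambda>x. v x * partial_deriv i \<phi> x)"
    "integrable (lebesgue_on \<Omega>) (\<lambda>x. D x $ i * \<phi> x)"
    "integrable (lebesgue_on \<Omega>) (\<lambda>x. E x $ i * \<phi> x)"
    using L2_integrable_inner[OF assms(1) t(2)] L2_integrable_inner[OF assms(2) t(2)]
      L2_integrable_inner[OF L2_component[OF assms(3)] t(1)] L2_integrable_inner[OF L2_component[OF assms(4)] t(1)]
    by simp_all
  show "(\<integral>x. (u x + c * v x) * partial_deriv i \<phi> x \<partial>lebesgue_on \<Omega>) =
      - (\<integral>x. (D x + c *\<^sub>R E x) $ i * \<phi> x \<partial>lebesgue_on \<Omega>)"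
    using i assms(5,6) \<phi> by (simp add: is_weak_gradient_def distrib_right mult.assoc)
qed

lemma H1_lincomb:
  assumes u: "u \<in> H1 \<Omega>" and v: "v \<in> H1 \<Omega>"
  shows "(\<lambda>x. u x + c * v x) \<in> H1 \<Omega>"
    "AE x in lebesgue_on \<Omega>. weak_gradient \<Omega> (\<lambda>x. u x + c * v x) x = weak_gradient \<Omega> u x + c *\<^sub>R weak_gradient \<Omega> v x"
proof -
  note wu = H1_weak_gradient[OF u] and wv = H1_weak_gradient[OF v]
  have l2: "(\<lambda>x. u x + c * v x) \<in> L2 \<Omega>" using L2_add[OF wu(1) L2_scale[OF wv(1), of c]] by simp
  note * = is_weak_gradient_lincomb[OF wu(1) wv(1) wu(2) wv(2) wu(3) wv(3), of c]
  show "(\<lambda>x. u x + c * v x) \<in> H1 \<Omega>"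
    "AE x in lebesgue_on \<Omega>. weak_gradient \<Omega> (\<lambda>x. u x + c * v x) x = weak_gradient \<Omega> u x + c *\<^sub>R weak_gradient \<Omega> v x"
    using H1I[OF l2 L2_add[OF wu(2) L2_scale[OF wv(2)]] *] by auto
qed

lemma dirichlet_lincomb_left:
  assumes u: "u \<in> H1 \<Omega>" and v: "v \<in> H1 \<Omega>" and w: "w \<in> H1 \<Omega>"
  shows "dirichlet \<Omega> (\<lambda>x. u x + c * v x) w = dirichlet \<Omega> u w + c * dirichlet \<Omega> v w"
proof -
  note wu = H1_weak_gradient[OF u] and wv = H1_weak_gradient[OF v] and ww = H1_weak_gradient[OF w]
  have "dirichlet \<Omega> (\<lambda>x. u x + c * v x) w
      = l2_inner \<Omega> (\<lambda>x. weak_gradient \<Omega> u x + c *\<^sub>R weak_gradient \<Omega> v x) (weak_gradient \<Omega> w)"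
    unfolding dirichlet_def
    by (rule l2_inner_cong_AE[OF H1_lincomb(2)[OF u v]])
      (use H1_weak_gradient(2)[OF H1_lincomb(1)[OF u v]] ww wu wv in \<open>auto intro: L2_add L2_scale\<close>)
  then show ?thesis
    using wu wv ww by (simp add: dirichlet_def l2_inner_add_left L2_scale l2_inner_scale_left)
qed

lemma dirichlet_AE_zero:
  assumes u: "u \<in> H1 \<Omega>" and z: "AE x in lebesgue_on \<Omega>. u x = 0" and w: "w \<in> H1 \<Omega>"
  shows "dirichlet \<Omega> u w = 0"
proof -
  have 0: "(\<lambda>x::real^'n. 0::real^'n) \<in> L2 \<Omega>" "(\<lambda>x::real^'n. 0::real) \<in> L2 \<Omega>" by (auto simp: L2_def)
  have "is_weak_gradient \<Omega> (\<lambda>x. 0) (\<lambda>x. 0)" by (simp add: is_weak_gradient_def)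
  then have "AE x in lebesgue_on \<Omega>. weak_gradient \<Omega> u x = 0"
    using weak_gradient_unique[OF H1_weak_gradient(2)[OF u] 0(1) H1_weak_gradient(3)[OF u] _ z] H1_weak_gradient(1)[OF u] 0 by auto
  then have "dirichlet \<Omega> u w = l2_inner \<Omega> (\<lambda>x. 0) (weak_gradient \<Omega> w)"
    unfolding dirichlet_def
    by (rule l2_inner_cong_AE) (use 0 H1_weak_gradient[OF u] H1_weak_gradient[OF w] in auto)
  then show ?thesis by (simp add: l2_inner_def)
qed

lemma test_H1: "\<phi> \<in> test_functions \<Omega> \<Longrightarrow> \<phi> \<in> H1 \<Omega>"
  using H1I(1)[OF test_L2 gradient_L2 is_weak_gradient_test] .

lemma dirichlet_test:
  assumes "\<phi> \<in> test_functions \<Omega>"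
  shows "dirichlet \<Omega> \<phi> \<phi> = (\<integral>x. (norm (gradient \<phi> x))\<^sup>2 \<partial>lborel)"
proof -
  have 1: "AE x in lebesgue_on \<Omega>. weak_gradient \<Omega> \<phi> x = gradient \<phi> x"
    using H1I(2)[OF test_L2 gradient_L2 is_weak_gradient_test] assms by blast
  have "dirichlet \<Omega> \<phi> \<phi> = l2_inner \<Omega> (gradient \<phi>) (gradient \<phi>)"
    unfolding dirichlet_def
    by (rule l2_inner_cong_AE[OF 1 1]) (use H1_weak_gradient[OF test_H1[OF assms]] gradient_L2[OF assms] in auto)
  also have "\<dots> = (\<integral>x. (norm (gradient \<phi> x))\<^sup>2 \<partial>lborel)"
    unfolding l2_inner_self
  proof (rule integral_lebesgue_on_supp)
    have "continuous_on UNIV (gradient \<phi>)"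
      unfolding gradient_def[abs_def]
      by (intro continuous_on_vec_lambda) (rule test_continuous[OF test_partial[OF assms]])
    then show "(\<lambda>x. (norm (gradient \<phi> x))\<^sup>2) \<in> borel_measurable borel"
      by (intro borel_measurable_continuous_onI continuous_intros)
    show "(norm (gradient \<phi> x))\<^sup>2 = 0" if "x \<notin> \<Omega>" for x
      using test_zero_outside[OF test_partial[OF assms] that] by (simp add: gradient_def vec_eq_iff)
  qed simp
  finally show ?thesis .
qed

lemma l2_lincomb_bound:
  assumes "u \<in> L2 \<Omega>" "v \<in> L2 \<Omega>"
  shows "l2_inner \<Omega> (\<lambda>x. u x + v x) (\<lambda>x. u x + v x) \<le> 2 * l2_inner \<Omega> u u + 2 * l2_inner \<Omega> v (v::_ \<Rightarrow> real)"
proof -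
  have i: "integrable (lebesgue_on \<Omega>) (\<lambda>x. u x * u x)" "integrable (lebesgue_on \<Omega>) (\<lambda>x. v x * v x)"
    "integrable (lebesgue_on \<Omega>) (\<lambda>x. (u x + v x) * (u x + v x))"
    using L2_integrable_inner[OF assms(1) assms(1)] L2_integrable_inner[OF assms(2) assms(2)]
      L2_integrable_inner[OF L2_add[OF assms] L2_add[OF assms]] by simp_all
  have "l2_inner \<Omega> (\<lambda>x. u x + v x) (\<lambda>x. u x + v x) \<le> (\<integral>x. 2 * (u x * u x) + 2 * (v x * v x) \<partial>lebesgue_on \<Omega>)"
    unfolding l2_inner_def inner_real_def
  proof (rule integral_mono)
    fix x
    have "0 \<le> (u x - v x)\<^sup>2" by simp
    then show "(u x + v x) * (u x + v x) \<le> 2 * (u x * u x) + 2 * (v x * v x)"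
      by (simp add: power2_eq_square algebra_simps)
  qed (use i in auto)
  then show ?thesis using i by (simp add: l2_inner_def)
qed

lemma dirichlet_lincomb_self:
  assumes "u \<in> H1 \<Omega>" "v \<in> H1 \<Omega>"
  shows "dirichlet \<Omega> (\<lambda>x. u x + c * v x) (\<lambda>x. u x + c * v x)
    = dirichlet \<Omega> u u + 2 * c * dirichlet \<Omega> u v + c\<^sup>2 * dirichlet \<Omega> v v"
proof -
  have "dirichlet \<Omega> (\<lambda>x. u x + c * v x) w = dirichlet \<Omega> u w + c * dirichlet \<Omega> v w" if "w \<in> H1 \<Omega>" for w
    using dirichlet_lincomb_left[OF assms that] .
  note * = this and ** = this[unfolded dirichlet_commute[of \<Omega> "\<lambda>x. u x + c * v x"]]
  show ?thesis
    using *[OF H1_lincomb(1)[OF assms, of c]] **[OF assms(1)] **[OF assms(2)] dirichlet_commute[of \<Omega> u v]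
    by (simp add: power2_eq_square algebra_simps)
qed

lemma dirichlet_Cauchy_Schwarz:
  assumes "u \<in> H1 \<Omega>" "v \<in> H1 \<Omega>"
  shows "\<bar>dirichlet \<Omega> u v\<bar> \<le> sqrt (dirichlet \<Omega> u u) * sqrt (dirichlet \<Omega> v v)"
  unfolding dirichlet_def
  by (rule l2_inner_Cauchy_Schwarz) (use H1_weak_gradient assms in blast)+

lemma dirichlet_add_bound:
  assumes "u \<in> H1 \<Omega>" "v \<in> H1 \<Omega>"
  shows "dirichlet \<Omega> (\<lambda>x. u x + v x) (\<lambda>x. u x + v x) \<le> 2 * dirichlet \<Omega> u u + 2 * dirichlet \<Omega> v v"
  using dirichlet_lincomb_self[OF assms, of 1] dirichlet_lincomb_self[OF assms, of "-1"]
    dirichlet_nonneg[of \<Omega> "\<lambda>x. u x + (-1) * v x"] by simp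

section \<open>Approximation by test functions and the vector space \<open>H10\<close>\<close>

lemma H10_approx:
  assumes "u \<in> H10 \<Omega>"
  shows "\<exists>\<phi>. (\<forall>k::nat. \<phi> k \<in> test_functions \<Omega>) \<and>
    (\<lambda>k. l2_inner \<Omega> (\<lambda>x. \<phi> k x - u x) (\<lambda>x. \<phi> k x - u x)) \<longlonglongrightarrow> 0 \<and>
    (\<lambda>k. dirichlet \<Omega> (\<lambda>x. \<phi> k x - u x) (\<lambda>x. \<phi> k x - u x)) \<longlonglongrightarrow> 0"
proof -
  obtain \<phi> where \<phi>: "\<And>k::nat. \<phi> k \<in> test_functions \<Omega>" "(\<lambda>k. H1_norm \<Omega> (\<lambda>x. \<phi> k x - u x)) \<longlonglongrightarrow> 0"
    using assms by (auto simp: H10_def)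
  have l: "(\<lambda>k. (H1_norm \<Omega> (\<lambda>x. \<phi> k x - u x))\<^sup>2) \<longlonglongrightarrow> 0" using tendsto_power[OF \<phi>(2), of 2] by simp
  have "(\<lambda>k. l2_inner \<Omega> (\<lambda>x. \<phi> k x - u x) (\<lambda>x. \<phi> k x - u x)) \<longlonglongrightarrow> 0"
    by (rule Lim_null_comparison[OF _ l]) (simp add: H1_norm_square l2_inner_nonneg dirichlet_nonneg)
  moreover have "(\<lambda>k. dirichlet \<Omega> (\<lambda>x. \<phi> k x - u x) (\<lambda>x. \<phi> k x - u x)) \<longlonglongrightarrow> 0"
    by (rule Lim_null_comparison[OF _ l]) (simp add: H1_norm_square l2_inner_nonneg dirichlet_nonneg)
  ultimately show ?thesis using \<phi>(1) by blast
qed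

lemma H10I:
  assumes "u \<in> H1 \<Omega>" "\<And>k::nat. \<phi> k \<in> test_functions \<Omega>"
    "(\<lambda>k. l2_inner \<Omega> (\<lambda>x. \<phi> k x - u x) (\<lambda>x. \<phi> k x - u x)) \<longlonglongrightarrow> 0"
    "(\<lambda>k. dirichlet \<Omega> (\<lambda>x. \<phi> k x - u x) (\<lambda>x. \<phi> k x - u x)) \<longlonglongrightarrow> 0"
  shows "u \<in> H10 \<Omega>"
proof -
  have "(\<lambda>k. sqrt ((H1_norm \<Omega> (\<lambda>x. \<phi> k x - u x))\<^sup>2)) \<longlonglongrightarrow> sqrt (0 + 0)"
    unfolding H1_norm_square by (intro tendsto_intros assms)
  then show ?thesis using assms(1,2) by (auto simp: H10_def H1_norm_nonneg)
qed

lemma H10_H1: "u \<in> H10 \<Omega> \<Longrightarrow> u \<in> H1 \<Omega>"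
  by (simp add: H10_def)

lemma H1_diff:
  assumes "u \<in> H1 \<Omega>" "v \<in> H1 \<Omega>" shows "(\<lambda>x. u x - v x) \<in> H1 \<Omega>"
  using H1_lincomb(1)[OF assms, of "-1"] by simp

lemma H10_lincomb:
  assumes u: "u \<in> H10 \<Omega>" and v: "v \<in> H10 \<Omega>" shows "(\<lambda>x. u x + c * v x) \<in> H10 \<Omega>"
proof -
  note u1 = H10_H1[OF u] and v1 = H10_H1[OF v]
  obtain \<phi> where \<phi>: "\<And>k::nat. \<phi> k \<in> test_functions \<Omega>"
    "(\<lambda>k. l2_inner \<Omega> (\<lambda>x. \<phi> k x - u x) (\<lambda>x. \<phi> k x - u x)) \<longlonglongrightarrow> 0"
    "(\<lambda>k. dirichlet \<Omega> (\<lambda>x. \<phi> k x - u x) (\<lambda>x. \<phi> k x - u x)) \<longlonglongrightarrow> 0" using H10_approx[OF u] by blast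
  obtain \<psi> where \<psi>: "\<And>k::nat. \<psi> k \<in> test_functions \<Omega>"
    "(\<lambda>k. l2_inner \<Omega> (\<lambda>x. \<psi> k x - v x) (\<lambda>x. \<psi> k x - v x)) \<longlonglongrightarrow> 0"
    "(\<lambda>k. dirichlet \<Omega> (\<lambda>x. \<psi> k x - v x) (\<lambda>x. \<psi> k x - v x)) \<longlonglongrightarrow> 0" using H10_approx[OF v] by blast
  have z: "(\<lambda>x. 0) \<in> H1 \<Omega>" using H1_diff[OF u1 u1] by simp
  have a: "(\<lambda>x. \<phi> k x - u x) \<in> H1 \<Omega>" for k using H1_diff[OF test_H1[OF \<phi>(1)] u1] .
  have b: "(\<lambda>x. c * (\<psi> k x - v x)) \<in> H1 \<Omega>" for k
    using H1_lincomb(1)[OF z H1_diff[OF test_H1[OF \<psi>(1)[of k]] v1], of c] by simp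
  have eq: "\<phi> k x + c * \<psi> k x - (u x + c * v x) = (\<phi> k x - u x) + c * (\<psi> k x - v x)" for k x
    by (simp add: algebra_simps)
  have sc: "l2_inner \<Omega> (\<lambda>x. c * w x) (\<lambda>x. c * w x) = c\<^sup>2 * l2_inner \<Omega> w w" for w :: "real^'n \<Rightarrow> real"
  proof -
    have "c * w x * (c * w x) = c\<^sup>2 * (w x * w x)" for x by (simp add: power2_eq_square)
    then show ?thesis unfolding l2_inner_def inner_real_def by (simp only: integral_mult_right_zero)
  qed
  have sd: "dirichlet \<Omega> (\<lambda>x. c * w x) (\<lambda>x. c * w x) = c\<^sup>2 * dirichlet \<Omega> w w" if "w \<in> H1 \<Omega>" for w
    using dirichlet_lincomb_self[OF z that, of c] dirichlet_AE_zero[OF z _ that] dirichlet_AE_zero[OF z _ z] by simp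
  show ?thesis
  proof (rule H10I[of _ "\<lambda>k x. \<phi> k x + c * \<psi> k x"])
    show "(\<lambda>x. u x + c * v x) \<in> H1 \<Omega>" by (rule H1_lincomb(1)[OF u1 v1])
    show "(\<lambda>x. \<phi> k x + c * \<psi> k x) \<in> test_functions \<Omega>" for k using \<phi> \<psi> test_add test_scale by blast
    have 1: "(\<lambda>k. 2 * l2_inner \<Omega> (\<lambda>x. \<phi> k x - u x) (\<lambda>x. \<phi> k x - u x) +
        2 * (c\<^sup>2 * l2_inner \<Omega> (\<lambda>x. \<psi> k x - v x) (\<lambda>x. \<psi> k x - v x))) \<longlonglongrightarrow> 2 * 0 + 2 * (c\<^sup>2 * 0)"
      by (intro tendsto_intros \<phi> \<psi>)
    then have 1: "(\<lambda>k. 2 * l2_inner \<Omega> (\<lambda>x. \<phi> k x - u x) (\<lambda>x. \<phi> k x - u x) +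
        2 * (c\<^sup>2 * l2_inner \<Omega> (\<lambda>x. \<psi> k x - v x) (\<lambda>x. \<psi> k x - v x))) \<longlonglongrightarrow> 0" by simp
    have 2: "(\<lambda>k. 2 * dirichlet \<Omega> (\<lambda>x. \<phi> k x - u x) (\<lambda>x. \<phi> k x - u x) +
        2 * (c\<^sup>2 * dirichlet \<Omega> (\<lambda>x. \<psi> k x - v x) (\<lambda>x. \<psi> k x - v x))) \<longlonglongrightarrow> 2 * 0 + 2 * (c\<^sup>2 * 0)"
      by (intro tendsto_intros \<phi> \<psi>)
    then have 2: "(\<lambda>k. 2 * dirichlet \<Omega> (\<lambda>x. \<phi> k x - u x) (\<lambda>x. \<phi> k x - u x) +
        2 * (c\<^sup>2 * dirichlet \<Omega> (\<lambda>x. \<psi> k x - v x) (\<lambda>x. \<psi> k x - v x))) \<longlonglongrightarrow> 0" by simp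
    show "(\<lambda>k. l2_inner \<Omega> (\<lambda>x. \<phi> k x + c * \<psi> k x - (u x + c * v x)) (\<lambda>x. \<phi> k x + c * \<psi> k x - (u x + c * v x))) \<longlonglongrightarrow> 0"
      unfolding eq
      by (rule Lim_null_comparison[OF _ 1], rule always_eventually, rule allI)
        (use l2_lincomb_bound[OF H1_weak_gradient(1)[OF a] H1_weak_gradient(1)[OF b]] in \<open>simp add: sc l2_inner_nonneg\<close>)
    show "(\<lambda>k. dirichlet \<Omega> (\<lambda>x. \<phi> k x + c * \<psi> k x - (u x + c * v x)) (\<lambda>x. \<phi> k x + c * \<psi> k x - (u x + c * v x))) \<longlonglongrightarrow> 0"
      unfolding eq
      by (rule Lim_null_comparison[OF _ 2], rule always_eventually, rule allI)
        (use dirichlet_add_bound[OF a b] in \<open>simp add: sd[OF H1_diff[OF test_H1[OF \<psi>(1)] v1]] dirichlet_nonneg\<close>)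
  qed
qed

lemma test_H10: "\<phi> \<in> test_functions \<Omega> \<Longrightarrow> \<phi> \<in> H10 \<Omega>"
proof -
  assume \<phi>: "\<phi> \<in> test_functions \<Omega>"
  have z: "(\<lambda>x. 0) \<in> H1 \<Omega>" using H1_diff[OF test_H1[OF \<phi>] test_H1[OF \<phi>]] by simp
  show ?thesis
    by (rule H10I[OF test_H1[OF \<phi>], of "\<lambda>_. \<phi>"])
      (use \<phi> dirichlet_AE_zero[OF z _ z] in \<open>auto simp: l2_inner_def\<close>)
qed

lemma zero_H10: "(\<lambda>x. 0) \<in> H10 \<Omega>"
  by (rule test_H10) (auto simp: test_functions_def Ck_const)

end

section \<open>Subcritical Sobolev embedding and Rellich compactness\<close>

text \<open>Cauchy-Schwarz against the constant 1 on \<open>A\<close>; the nonnegative quadratic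
  polynomial in \<open>t\<close> is the integral of \<open>(1 + t * f)^2\<close> over
  \<open>A\<close>.\<close>

lemma integral_square_le:
  fixes f :: "'a \<Rightarrow> real"
  assumes A: "A \<in> sets M" "emeasure M A < \<infinity>"
    and f: "integrable M (\<lambda>x. indicator A x * f x)" "integrable M (\<lambda>x. indicator A x * (f x)\<^sup>2)"
  shows "(\<integral>x. indicator A x * f x \<partial>M)\<^sup>2 \<le> measure M A * (\<integral>x. indicator A x * (f x)\<^sup>2 \<partial>M)"
proof -
  have iA: "integrable M (indicator A :: 'a \<Rightarrow> real)" using A by simp
  have "0 \<le> measure M A + 2 * t * (\<integral>x. indicator A x * f x \<partial>M) + t\<^sup>2 * (\<integral>x. indicator A x * (f x)\<^sup>2 \<partial>M)" for t
  proof -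
    have "0 \<le> (\<integral>x. indicator A x * (1 + t * f x)\<^sup>2 \<partial>M)"
      by (rule Bochner_Integration.integral_nonneg) simp
    also have "\<dots> = (\<integral>x. indicator A x + 2 * t * (indicator A x * f x) + t\<^sup>2 * (indicator A x * (f x)\<^sup>2) \<partial>M)"
      by (rule Bochner_Integration.integral_cong) (auto simp: power2_eq_square algebra_simps)
    also have "\<dots> = measure M A + 2 * t * (\<integral>x. indicator A x * f x \<partial>M) + t\<^sup>2 * (\<integral>x. indicator A x * (f x)\<^sup>2 \<partial>M)"
      using iA f A sets.Int_space_eq2[OF A(1)] by simp
    finally show ?thesis .
  qed
  then have "\<bar>\<integral>x. indicator A x * f x \<partial>M\<bar> \<le> sqrt (measure M A) * sqrt (\<integral>x. indicator A x * (f x)\<^sup>2 \<partial>M)"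
    by (rule quadratic_form_Cauchy_Schwarz) (auto intro!: Bochner_Integration.integral_nonneg)
  then have "\<bar>\<integral>x. indicator A x * f x \<partial>M\<bar>\<^sup>2 \<le> (sqrt (measure M A) * sqrt (\<integral>x. indicator A x * (f x)\<^sup>2 \<partial>M))\<^sup>2"
    by (rule power_mono) simp
  then show ?thesis by (simp add: power_mult_distrib Bochner_Integration.integral_nonneg)
qed

text \<open>For test functions this is the Dirichlet form; it is written classically and over the
  whole space so that functions may be translated freely.\<close>

definition grad_energy :: "(real^'n::finite \<Rightarrow> real) \<Rightarrow> real" where
  "grad_energy \<phi> = (\<integral>x. (norm (gradient \<phi> x))\<^sup>2 \<partial>lborel)"

lemma grad_energy_nonneg: "0 \<le> grad_energy \<phi>"
  unfolding grad_energy_def by (rule Bochner_Integration.integral_nonneg) simp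

lemma gradient_continuous: "\<phi> \<in> test_functions \<Omega> \<Longrightarrow> continuous_on UNIV (gradient \<phi>)"
  unfolding gradient_def[abs_def]
  by (intro continuous_on_vec_lambda) (rule test_continuous[OF test_partial])

lemma gradient_square_integrable:
  assumes "\<phi> \<in> test_functions \<Omega>" shows "integrable lborel (\<lambda>x. (norm (gradient \<phi> x))\<^sup>2)"
proof -
  have "(norm (gradient \<phi> x))\<^sup>2 = (\<Sum>i\<in>UNIV. partial_deriv i \<phi> x * partial_deriv i \<phi> x)" for x
    unfolding power2_norm_eq_inner by (simp add: gradient_def inner_vec_def)
  then show ?thesis
    using test_integrable_lborel[OF test_mult[OF test_partial[OF assms] test_Ck[OF test_partial[OF assms]]]] by simp
qed

lemma nn_integral_gradient:
  "\<phi> \<in> test_functions \<Omega> \<Longrightarrow> (\<integral>\<^sup>+x. ennreal ((norm (gradient \<phi> x))\<^sup>2) \<partial>lborel) = ennreal (grad_energy \<phi>)"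
  unfolding grad_energy_def by (rule nn_integral_eq_integral[OF gradient_square_integrable]) auto

text \<open>The fundamental theorem of calculus along the segment from \<open>x\<close> to
  \<open>x + z\<close>, then Cauchy-Schwarz on the unit interval. The nonnegative integral lets
  Fubini's theorem act without integrability conditions.\<close>

lemma difference_square_le:
  assumes \<phi>: "\<phi> \<in> test_functions \<Omega>"
  shows "ennreal ((\<phi> (x + z) - \<phi> x)\<^sup>2)
    \<le> (\<integral>\<^sup>+s. indicator {0..1} s * ennreal ((norm z)\<^sup>2 * (norm (gradient \<phi> (x + s *\<^sub>R z)))\<^sup>2) \<partial>lborel)"
proof -
  let ?h = "\<lambda>s. gradient \<phi> (x + s *\<^sub>R z) \<bullet> z"
  have ch: "continuous_on S ?h" for S
    by (intro continuous_intros continuous_on_compose2[OF gradient_continuous[OF \<phi>]]) auto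
  have i1: "integrable lborel (\<lambda>s. indicator {0..1} s * ?h s)"
    using borel_integrable_compact[of "{0..1::real}" ?h] ch by simp
  have i2: "integrable lborel (\<lambda>s. indicator {0..1} s * (?h s)\<^sup>2)"
    using borel_integrable_compact[of "{0..1::real}" "\<lambda>s. (?h s)\<^sup>2"] by (simp add: ch continuous_on_power)
  have "(\<integral>s. indicator {0..1} s *\<^sub>R ?h s \<partial>lborel) = \<phi> (x + 1 *\<^sub>R z) - \<phi> (x + 0 *\<^sub>R z)"
    by (rule integral_FTC_atLeastAtMost[OF _ _ ch])
      (auto intro: has_vector_derivative_at_within
         line_derivative[OF test_differentiable[OF \<phi>], unfolded has_real_derivative_iff_has_vector_derivative])
  then have "(\<phi> (x + z) - \<phi> x)\<^sup>2 \<le> (\<integral>s. indicator {0..1} s * (?h s)\<^sup>2 \<partial>lborel)"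
    using integral_square_le[OF _ _ i1 i2] by simp
  then have "ennreal ((\<phi> (x + z) - \<phi> x)\<^sup>2) \<le> ennreal (\<integral>s. indicator {0..1} s * (?h s)\<^sup>2 \<partial>lborel)"
    by (rule ennreal_leI)
  also have "\<dots> = (\<integral>\<^sup>+s. ennreal (indicator {0..1} s * (?h s)\<^sup>2) \<partial>lborel)"
    by (rule nn_integral_eq_integral[OF i2, symmetric]) auto
  also have "\<dots> \<le> (\<integral>\<^sup>+s. indicator {0..1} s * ennreal ((norm z)\<^sup>2 * (norm (gradient \<phi> (x + s *\<^sub>R z)))\<^sup>2) \<partial>lborel)"
  proof (rule nn_integral_mono)
    fix s
    have "(?h s)\<^sup>2 \<le> (norm z)\<^sup>2 * (norm (gradient \<phi> (x + s *\<^sub>R z)))\<^sup>2"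
      using Cauchy_Schwarz_ineq[of "gradient \<phi> (x + s *\<^sub>R z)" z] by (simp add: power2_norm_eq_inner mult.commute)
    then show "ennreal (indicator {0..1} s * (?h s)\<^sup>2) \<le> indicator {0..1} s * ennreal ((norm z)\<^sup>2 * (norm (gradient \<phi> (x + s *\<^sub>R z)))\<^sup>2)"
      by (auto simp: indicator_def intro: ennreal_leI)
  qed
  finally show ?thesis .
qed

text \<open>After integration in \<open>x\<close> and exchange of the integrals, translation
  invariance gives every parameter \<open>s\<close> on the segment the same gradient energy.\<close>

lemma translation_estimate:
  assumes \<phi>: "\<phi> \<in> test_functions \<Omega>"
  shows "(\<integral>\<^sup>+x. ennreal ((\<phi> (x + z) - \<phi> x)\<^sup>2) \<partial>lborel) \<le> ennreal ((norm z)\<^sup>2 * grad_energy \<phi>)"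
proof -
  have [measurable]: "gradient \<phi> \<in> borel_measurable borel"
    by (rule borel_measurable_continuous_onI[OF gradient_continuous[OF \<phi>]])
  let ?g = "\<lambda>x s. indicator {0..1} s * ennreal ((norm z)\<^sup>2 * (norm (gradient \<phi> (x + s *\<^sub>R z)))\<^sup>2)"
  have "(\<integral>\<^sup>+x. ennreal ((\<phi> (x + z) - \<phi> x)\<^sup>2) \<partial>lborel) \<le> (\<integral>\<^sup>+x. \<integral>\<^sup>+s. ?g x s \<partial>lborel \<partial>lborel)"
    by (rule nn_integral_mono) (rule difference_square_le[OF \<phi>])
  also have "\<dots> = (\<integral>\<^sup>+s. \<integral>\<^sup>+x. ?g x s \<partial>lborel \<partial>lborel)"
    by (rule lborel_pair.Fubini'[symmetric]) measurable
  also have "\<dots> = (\<integral>\<^sup>+s. indicator {0..1::real} s * ennreal ((norm z)\<^sup>2 * grad_energy \<phi>) \<partial>lborel)"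
  proof (rule nn_integral_cong)
    fix s :: real
    have "(\<integral>\<^sup>+x. ?g x s \<partial>lborel) = indicator {0..1} s * (ennreal ((norm z)\<^sup>2) * (\<integral>\<^sup>+x. ennreal ((norm (gradient \<phi> (x + s *\<^sub>R z)))\<^sup>2) \<partial>lborel))"
      by (simp add: nn_integral_cmult ennreal_mult)
    also have "\<dots> = indicator {0..1} s * ennreal ((norm z)\<^sup>2 * grad_energy \<phi>)"
      by (subst nn_integral_lborel_translation[of "\<lambda>x. ennreal ((norm (gradient \<phi> x))\<^sup>2)"])
        (auto simp: nn_integral_gradient[OF \<phi>] ennreal_mult grad_energy_nonneg)
    finally show "(\<integral>\<^sup>+x. ?g x s \<partial>lborel) = indicator {0..1} s * ennreal ((norm z)\<^sup>2 * grad_energy \<phi>)" .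
  qed
  also have "\<dots> = ennreal ((norm z)\<^sup>2 * grad_energy \<phi>)"
    by (simp add: nn_integral_multc)
  finally show ?thesis .
qed

lemma test_square_integrable:
  "\<phi> \<in> test_functions \<Omega> \<Longrightarrow> integrable lborel (\<lambda>x. (\<phi> x)\<^sup>2)"
  using test_integrable_lborel[OF test_mult[of \<phi> \<Omega> \<phi>]] test_Ck[of \<phi> \<Omega>] by (simp add: power2_eq_square)

text \<open>A shift longer than the diameter makes the supports of \<open>\<phi>\<close> and its
  translate disjoint, so the translation estimate controls \<open>\<phi>\<close> itself; the
  constant is the squared length of the shift.\<close>

lemma (in bounded_open) test_Poincare:
  obtains P where "P > 0" "\<And>\<phi>. \<phi> \<in> test_functions \<Omega> \<Longrightarrow> (\<integral>x. (\<phi> x)\<^sup>2 \<partial>lborel) \<le> P * grad_energy \<phi>"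
proof -
  obtain R where R: "R > 0" "\<And>x. x \<in> \<Omega> \<Longrightarrow> norm x \<le> R" using bounded_domain by (auto simp: bounded_pos)
  obtain i :: 'n where True by simp
  define z :: "real^'n" where "z = (2 * R + 1) *\<^sub>R axis i 1"
  have z: "norm z = 2 * R + 1" using R(1) by (simp add: z_def)
  show ?thesis
  proof (rule that)
    show "0 < (norm z)\<^sup>2" using z R(1) by simp
    fix \<phi> assume \<phi>: "\<phi> \<in> test_functions \<Omega>"
    note [measurable] = test_borel[OF \<phi>]
    have "(\<phi> (x + z))\<^sup>2 + (\<phi> x)\<^sup>2 = (\<phi> (x + z) - \<phi> x)\<^sup>2" for x
    proof -
      have "\<not> (x + z \<in> \<Omega> \<and> x \<in> \<Omega>)"
      proof
        assume "x + z \<in> \<Omega> \<and> x \<in> \<Omega>"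
        then have "norm (x + z) \<le> R" "norm x \<le> R" using R by auto
        then show False using z norm_triangle_ineq4[of "x + z" x] by simp
      qed
      then have "\<phi> (x + z) * \<phi> x = 0" using test_zero_outside[OF \<phi>] by auto
      then show ?thesis by (simp add: power2_eq_square algebra_simps)
    qed
    then have "(\<integral>\<^sup>+x. ennreal ((\<phi> x)\<^sup>2) \<partial>lborel) \<le> (\<integral>\<^sup>+x. ennreal ((\<phi> (x + z) - \<phi> x)\<^sup>2) \<partial>lborel)"
      by (intro nn_integral_mono ennreal_leI) (metis le_add_same_cancel2 zero_le_power2)
    also have "\<dots> \<le> ennreal ((norm z)\<^sup>2 * grad_energy \<phi>)" by (rule translation_estimate[OF \<phi>])
    finally show "(\<integral>x. (\<phi> x)\<^sup>2 \<partial>lborel) \<le> (norm z)\<^sup>2 * grad_energy \<phi>"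
      using grad_energy_nonneg[of \<phi>] by (simp add: nn_integral_eq_integral[OF test_square_integrable[OF \<phi>]])
  qed
qed

section \<open>Averages over a grid of cubes\<close>

definition grid :: "real \<Rightarrow> real^'n::finite \<Rightarrow> int^'n" where
  "grid h x = (\<chi> i. \<lfloor>x $ i / h\<rfloor>)"

lemma grid_measurable [measurable]: "grid h \<in> measurable borel (count_space UNIV)"
proof -
  have "grid h -` {k} = (\<Inter>i\<in>UNIV. {x. \<lfloor>x $ i / h\<rfloor> = k $ i})" for k :: "int^'a"
    by (auto simp: grid_def vec_eq_iff)
  moreover have "{x :: real^'a. \<lfloor>x $ i / h\<rfloor> = c} \<in> sets borel" for i c
  proof -
    have "(\<lambda>x::real^'a. x $ i / h) \<in> borel_measurable borel"
      by (cases "h = 0") (auto intro!: borel_measurable_continuous_onI continuous_intros)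
    from measurable_sets[OF measurable_compose[OF this measurable_real_floor], of "{c}"]
    show ?thesis by (simp add: vimage_def)
  qed
  ultimately show ?thesis
    by (subst measurable_count_space_eq2_countable) (auto intro!: sets.finite_INT)
qed

lemma grid_cell_sets [measurable]: "{y. grid h y = k} \<in> sets borel"
  using measurable_sets[OF grid_measurable, of "{k}" h] by (simp add: vimage_def)

lemma grid_cell_iff:
  assumes "h > 0"
  shows "grid h x = k \<longleftrightarrow> (\<forall>i. of_int (k $ i) * h \<le> x $ i \<and> x $ i < (of_int (k $ i) + 1) * h)"
  using assms by (auto simp: grid_def vec_eq_iff floor_eq_iff field_simps)

text \<open>Cells are half-open in order to partition the space; their volume is squeezed between
  that of an open and a closed box.\<close>

lemma grid_cell_measure:
  assumes h: "h > 0"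
  shows "emeasure lborel {y::real^'n::finite. grid h y = k} < \<infinity>"
    "measure lborel {y::real^'n. grid h y = k} = h ^ CARD('n)"
proof -
  let ?S = "{y::real^'n. grid h y = k}"
  define a :: "real^'n" where "a = (\<chi> i. of_int (k $ i) * h)"
  define b :: "real^'n" where "b = (\<chi> i. (of_int (k $ i) + 1) * h)"
  have sub: "box a b \<subseteq> ?S" "?S \<subseteq> cbox a b"
    using h by (auto simp: grid_cell_iff mem_box_cart a_def b_def less_imp_le)
  have ne: "cbox a b \<noteq> {}" using h by (auto simp: interval_ne_empty_cart a_def b_def algebra_simps)
  have "measure lborel (cbox a b) = h ^ CARD('n)"
    unfolding content_cbox_cart[OF ne] by (simp add: a_def b_def algebra_simps)
  then have c: "emeasure lborel (cbox a b) = ennreal (h ^ CARD('n))"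
    using emeasure_lborel_cbox_finite[of a b] by (simp add: emeasure_eq_ennreal_measure less_top)
  have d: "emeasure lborel (box a b) = emeasure lborel (cbox a b)"
    by (simp add: emeasure_lborel_box_eq emeasure_lborel_cbox_eq)
  have "emeasure lborel (box a b) \<le> emeasure lborel ?S" "emeasure lborel ?S \<le> emeasure lborel (cbox a b)"
    using sub by (auto intro!: emeasure_mono)
  then have e: "emeasure lborel ?S = ennreal (h ^ CARD('n))" using c d by simp
  then show "emeasure lborel ?S < \<infinity>" by simp
  show "measure lborel ?S = h ^ CARD('n)" using e h by (simp add: measure_def)
qed

text \<open>Separated from the average because it depends on the point only through the index
  \<open>k\<close>: the diagonal argument for compactness then runs over countably many
  numbers.\<close>

definition grid_integral :: "real \<Rightarrow> (real^'n::finite \<Rightarrow> real) \<Rightarrow> int^'n \<Rightarrow> real" where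
  "grid_integral h w k = (\<integral>y. indicator {y. grid h y = k} y * w y \<partial>lborel)"

definition grid_average :: "real \<Rightarrow> (real^'n::finite \<Rightarrow> real) \<Rightarrow> real^'n \<Rightarrow> real" where
  "grid_average h w x = grid_integral h w (grid h x) / h ^ CARD('n)"

lemma grid_average_borel [measurable]: "grid_average h w \<in> borel_measurable borel"
  unfolding grid_average_def[abs_def] by measurable

lemma integrable_grid_cell:
  "integrable lborel w \<Longrightarrow> integrable lborel (\<lambda>y. indicator {y. grid h y = k} y * (w y :: real))"
  using integrable_mult_indicator[of "{y. grid h y = k}" lborel w] by simp

text \<open>The average minus \<open>\<phi> x\<close> is the mean of
  \<open>\<phi> y - \<phi> x\<close> over the cell of \<open>x\<close>, and Cauchy-Schwarz moves the
  square inside the mean.\<close>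

lemma grid_average_error_pointwise:
  fixes \<phi> :: "real^'n::finite \<Rightarrow> real"
  assumes \<phi>: "\<phi> \<in> test_functions \<Omega>" and h: "h > 0"
  shows "ennreal ((\<phi> x - grid_average h \<phi> x)\<^sup>2)
    \<le> ennreal (inverse (h ^ CARD('n))) * (\<integral>\<^sup>+y. indicator {y. grid h y = grid h x} y * ennreal ((\<phi> y - \<phi> x)\<^sup>2) \<partial>lborel)"
proof -
  let ?A = "{y. grid h y = grid h x}" and ?m = "h ^ CARD('n)"
  note A = grid_cell_measure[OF h, of "grid h x"]
  have iA: "integrable lborel (indicator ?A :: real^'n \<Rightarrow> real)" using A by simp
  have i1: "integrable lborel (\<lambda>y. indicator ?A y * (\<phi> y - \<phi> x))"
    using integrable_grid_cell[OF test_integrable_lborel[OF \<phi>], of h "grid h x"] iA by (simp add: right_diff_distrib)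
  have "integrable lborel (\<lambda>y. indicator ?A y * (\<phi> y)\<^sup>2 - 2 * \<phi> x * (indicator ?A y * \<phi> y) + indicator ?A y * (\<phi> x)\<^sup>2)"
    using integrable_grid_cell[OF test_integrable_lborel[OF \<phi>], of h "grid h x"]
      integrable_grid_cell[OF test_square_integrable[OF \<phi>], of h "grid h x"] iA by simp
  moreover have "indicator ?A y * (\<phi> y)\<^sup>2 - 2 * \<phi> x * (indicator ?A y * \<phi> y) + indicator ?A y * (\<phi> x)\<^sup>2
      = indicator ?A y * (\<phi> y - \<phi> x)\<^sup>2" for y
    by (simp add: power2_eq_square algebra_simps)
  ultimately have i2: "integrable lborel (\<lambda>y. indicator ?A y * (\<phi> y - \<phi> x)\<^sup>2)" by simp
  have m: "?m > 0" using h by simp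
  have "(\<integral>y. indicator ?A y * (\<phi> y - \<phi> x) \<partial>lborel) = grid_integral h \<phi> (grid h x) - ?m * \<phi> x"
    using integrable_grid_cell[OF test_integrable_lborel[OF \<phi>], of h "grid h x"] iA A
    by (simp add: right_diff_distrib grid_integral_def)
  then have "(grid_integral h \<phi> (grid h x) - ?m * \<phi> x)\<^sup>2 \<le> ?m * (\<integral>y. indicator ?A y * (\<phi> y - \<phi> x)\<^sup>2 \<partial>lborel)"
    using integral_square_le[OF _ A(1) i1 i2] A(2) by simp
  moreover have "\<phi> x - grid_average h \<phi> x = - (grid_integral h \<phi> (grid h x) - ?m * \<phi> x) / ?m"
  proof -
    have "a - b / c = - (b - c * a) / c" if "c > 0" for a b c :: real using that by (simp add: field_simps)
    from this[OF m] show ?thesis by (simp only: grid_average_def)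
  qed
  ultimately have "(\<phi> x - grid_average h \<phi> x)\<^sup>2 \<le> ?m * (\<integral>y. indicator ?A y * (\<phi> y - \<phi> x)\<^sup>2 \<partial>lborel) / ?m\<^sup>2"
    using m by (simp only: power_divide power2_minus) (rule divide_right_mono, auto)
  also have "\<dots> = inverse ?m * (\<integral>y. indicator ?A y * (\<phi> y - \<phi> x)\<^sup>2 \<partial>lborel)"
    using m by (simp add: power2_eq_square field_simps)
  finally have "ennreal ((\<phi> x - grid_average h \<phi> x)\<^sup>2) \<le> ennreal (inverse ?m * (\<integral>y. indicator ?A y * (\<phi> y - \<phi> x)\<^sup>2 \<partial>lborel))"
    by (rule ennreal_leI)
  also have "\<dots> = ennreal (inverse ?m) * ennreal (\<integral>y. indicator ?A y * (\<phi> y - \<phi> x)\<^sup>2 \<partial>lborel)"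
    using m by (intro ennreal_mult Bochner_Integration.integral_nonneg) auto
  also have "ennreal (\<integral>y. indicator ?A y * (\<phi> y - \<phi> x)\<^sup>2 \<partial>lborel) = (\<integral>\<^sup>+y. ennreal (indicator ?A y * (\<phi> y - \<phi> x)\<^sup>2) \<partial>lborel)"
    by (rule nn_integral_eq_integral[OF i2, symmetric]) auto
  also have "\<dots> = (\<integral>\<^sup>+y. indicator ?A y * ennreal ((\<phi> y - \<phi> x)\<^sup>2) \<partial>lborel)"
    by (rule nn_integral_cong) (auto simp: indicator_def)
  finally show ?thesis .
qed

text \<open>In \<open>grid_average_error\<close> the power of 2 is the volume of
  \<open>[-h, h]^N\<close> relative to a cell, and the square comes from the bound
  \<open>N * h\<close> on the length of vectors in that cube.\<close>

definition grid_const :: "'n itself \<Rightarrow> real" where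
  "grid_const _ = 2 ^ CARD('n) * (real CARD('n))\<^sup>2"

text \<open>Two points of one cell differ by a vector of the cube \<open>Q\<close> of side
  \<open>2 * h\<close>. Enlarging the cell to \<open>x + Q\<close> makes the set of differences
  independent of \<open>x\<close>, so that the integrals can be exchanged and the translation
  estimate applied for each \<open>z\<close>.\<close>

lemma grid_average_error:
  fixes \<phi> :: "real^'n::finite \<Rightarrow> real"
  assumes \<phi>: "\<phi> \<in> test_functions \<Omega>" and h: "h > 0"
  shows "(\<integral>\<^sup>+x. ennreal ((\<phi> x - grid_average h \<phi> x)\<^sup>2) \<partial>lborel) \<le> ennreal (grid_const TYPE('n) * h\<^sup>2 * grad_energy \<phi>)"
proof -
  note [measurable] = test_borel[OF \<phi>]
  let ?m = "h ^ CARD('n)" and ?N = "real CARD('n)"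
  define Q :: "(real^'n) set" where "Q = cbox (\<chi> i. - h) (\<chi> i. h)"
  have [measurable]: "Q \<in> sets borel" by (simp add: Q_def)
  have nQ: "norm z \<le> ?N * h" if "z \<in> Q" for z
  proof -
    have "norm z \<le> (\<Sum>i\<in>UNIV. \<bar>z $ i\<bar>)" by (rule norm_le_l1_cart)
    also have "\<dots> \<le> (\<Sum>i\<in>(UNIV::'n set). h)"
      using that by (intro sum_mono) (auto simp: Q_def mem_box_cart abs_le_iff minus_le_iff)
    finally show ?thesis by simp
  qed
  have mQ: "emeasure lborel Q = ennreal ((2 * h) ^ CARD('n))"
  proof -
    have ne: "Q \<noteq> {}" using h by (auto simp: Q_def interval_ne_empty_cart)
    then have "measure lborel Q = (2 * h) ^ CARD('n)"
      unfolding Q_def by (subst content_cbox_cart) auto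
    moreover have "emeasure lborel Q \<noteq> \<infinity>" unfolding Q_def using emeasure_lborel_cbox_finite by (simp add: less_top)
    ultimately show ?thesis by (simp add: emeasure_eq_ennreal_measure)
  qed
  have cell: "(\<integral>\<^sup>+y. indicator {y. grid h y = grid h x} y * ennreal ((\<phi> y - \<phi> x)\<^sup>2) \<partial>lborel)
      \<le> (\<integral>\<^sup>+z. indicator Q z * ennreal ((\<phi> (x + z) - \<phi> x)\<^sup>2) \<partial>lborel)" for x
  proof -
    have "(\<integral>\<^sup>+y. indicator {y. grid h y = grid h x} y * ennreal ((\<phi> y - \<phi> x)\<^sup>2) \<partial>lborel)
        \<le> (\<integral>\<^sup>+y. indicator Q (y - x) * ennreal ((\<phi> (x + (y - x)) - \<phi> x)\<^sup>2) \<partial>lborel)"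
    proof (rule nn_integral_mono)
      fix y
      have "y - x \<in> Q" if "grid h y = grid h x"
      proof -
        have "\<bar>y $ i - x $ i\<bar> \<le> h" for i
        proof -
          have "of_int (grid h x $ i) * h \<le> y $ i" "y $ i < (of_int (grid h x $ i) + 1) * h"
            "of_int (grid h x $ i) * h \<le> x $ i" "x $ i < (of_int (grid h x $ i) + 1) * h"
            using grid_cell_iff[OF h, of y "grid h x"] grid_cell_iff[OF h, of x "grid h x"] that by auto
          then show ?thesis by (simp add: distrib_right abs_le_iff)
        qed
        then have "- h \<le> y $ i - x $ i \<and> y $ i - x $ i \<le> h" for i by (metis abs_le_iff minus_le_iff)
        then show ?thesis by (simp add: Q_def mem_box_cart)
      qed
      then show "indicator {y. grid h y = grid h x} y * ennreal ((\<phi> y - \<phi> x)\<^sup>2)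
          \<le> indicator Q (y - x) * ennreal ((\<phi> (x + (y - x)) - \<phi> x)\<^sup>2)"
        by (auto simp: indicator_def)
    qed
    also have "\<dots> = (\<integral>\<^sup>+z. indicator Q z * ennreal ((\<phi> (x + z) - \<phi> x)\<^sup>2) \<partial>lborel)"
      using nn_integral_lborel_translation[of "\<lambda>z. indicator Q z * ennreal ((\<phi> (x + z) - \<phi> x)\<^sup>2)" "- x"] by simp
    finally show ?thesis .
  qed
  have "(\<integral>\<^sup>+x. ennreal ((\<phi> x - grid_average h \<phi> x)\<^sup>2) \<partial>lborel)
      \<le> (\<integral>\<^sup>+x. ennreal (inverse ?m) * (\<integral>\<^sup>+z. indicator Q z * ennreal ((\<phi> (x + z) - \<phi> x)\<^sup>2) \<partial>lborel) \<partial>lborel)"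
    by (intro nn_integral_mono order_trans[OF grid_average_error_pointwise[OF \<phi> h]] mult_left_mono cell) simp
  also have "\<dots> = ennreal (inverse ?m) * (\<integral>\<^sup>+x. \<integral>\<^sup>+z. indicator Q z * ennreal ((\<phi> (x + z) - \<phi> x)\<^sup>2) \<partial>lborel \<partial>lborel)"
    by (rule nn_integral_cmult) measurable
  also have "(\<integral>\<^sup>+x. \<integral>\<^sup>+z. indicator Q z * ennreal ((\<phi> (x + z) - \<phi> x)\<^sup>2) \<partial>lborel \<partial>lborel)
      = (\<integral>\<^sup>+z. \<integral>\<^sup>+x. indicator Q z * ennreal ((\<phi> (x + z) - \<phi> x)\<^sup>2) \<partial>lborel \<partial>lborel)"
    by (rule lborel_pair.Fubini'[symmetric]) measurable
  also have "\<dots> \<le> (\<integral>\<^sup>+z. indicator Q z * ennreal ((?N * h)\<^sup>2 * grad_energy \<phi>) \<partial>lborel)"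
  proof (rule nn_integral_mono)
    fix z
    have "(\<integral>\<^sup>+x. indicator Q z * ennreal ((\<phi> (x + z) - \<phi> x)\<^sup>2) \<partial>lborel)
        = indicator Q z * (\<integral>\<^sup>+x. ennreal ((\<phi> (x + z) - \<phi> x)\<^sup>2) \<partial>lborel)"
      by (rule nn_integral_cmult) measurable
    also have "\<dots> \<le> indicator Q z * ennreal ((norm z)\<^sup>2 * grad_energy \<phi>)"
      by (rule mult_left_mono[OF translation_estimate[OF \<phi>]]) simp
    also have "\<dots> \<le> indicator Q z * ennreal ((?N * h)\<^sup>2 * grad_energy \<phi>)"
      using nQ[of z] by (auto simp: indicator_def intro!: ennreal_leI mult_right_mono power_mono grad_energy_nonneg)
    finally show "(\<integral>\<^sup>+x. indicator Q z * ennreal ((\<phi> (x + z) - \<phi> x)\<^sup>2) \<partial>lborel) \<le> indicator Q z * ennreal ((?N * h)\<^sup>2 * grad_energy \<phi>)" .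
  qed
  also have "\<dots> = ennreal ((2 * h) ^ CARD('n)) * ennreal ((?N * h)\<^sup>2 * grad_energy \<phi>)"
    by (simp add: nn_integral_multc mQ)
  also have "ennreal (inverse ?m) * (ennreal ((2 * h) ^ CARD('n)) * ennreal ((?N * h)\<^sup>2 * grad_energy \<phi>))
      = ennreal (inverse ?m * ((2 * h) ^ CARD('n) * ((?N * h)\<^sup>2 * grad_energy \<phi>)))"
    using h grad_energy_nonneg[of \<phi>] by (simp add: ennreal_mult)
  also have "inverse ?m * ((2 * h) ^ CARD('n) * ((?N * h)\<^sup>2 * grad_energy \<phi>)) = grid_const TYPE('n) * h\<^sup>2 * grad_energy \<phi>"
    using h by (simp add: grid_const_def power_mult_distrib)
  finally show ?thesis by (simp add: mult_left_mono)
qed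

lemma test_powr_integrable:
  assumes \<phi>: "\<phi> \<in> test_functions \<Omega>" and s: "s > 0"
  shows "integrable lborel (\<lambda>x. \<bar>\<phi> x\<bar> powr s)"
proof -
  note [measurable] = test_borel[OF \<phi>]
  obtain B where B: "B > 0" "\<And>x. \<bar>\<phi> x\<bar> \<le> B" using test_bound[OF \<phi>] by metis
  obtain R where R: "R > 0" "\<And>x. norm x > R \<Longrightarrow> \<phi> x = 0" using test_supp_bound[OF \<phi>] by metis
  show ?thesis
    by (rule integrable_bounded_support[where B="B powr s" and R=R])
      (use B R s in \<open>auto intro!: powr_mono2\<close>)
qed

lemma gradient_scale:
  assumes "\<phi> \<in> test_functions \<Omega>"
  shows "gradient (\<lambda>x. c * \<phi> x) x = c *\<^sub>R gradient \<phi> x"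
proof -
  have "partial_deriv i (\<lambda>x. c * \<phi> x) x = c * partial_deriv i \<phi> x" for i
    by (subst partial_deriv_eq[OF has_derivative_mult_right[OF differentiable_on_UNIV_D[OF test_differentiable[OF assms]]]])
      (simp add: partial_deriv_def)
  then show ?thesis by (simp add: gradient_def vec_eq_iff)
qed

lemma grad_energy_scale:
  "\<phi> \<in> test_functions \<Omega> \<Longrightarrow> grad_energy (\<lambda>x. c * \<phi> x) = c\<^sup>2 * grad_energy \<phi>"
  by (simp add: grad_energy_def gradient_scale power_mult_distrib)

text \<open>Split \<open>\<phi>\<close> at height \<open>l / 4\<close>. The part below contributes
  at most \<open>l / 4\<close> to the average, and the volume of a cell is chosen such that the
  bound \<open>K\<close> gives exactly \<open>l / 4\<close> for the part above.\<close>

lemma grid_average_le: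
  fixes \<phi> :: "real^'n::finite \<Rightarrow> real"
  assumes \<phi>: "\<phi> \<in> test_functions \<Omega>" and s: "s \<ge> 1" and K: "K > 0"
    and bd: "(\<integral>x. \<bar>\<phi> x\<bar> powr s \<partial>lborel) \<le> K"
    and l: "l > 0" and h: "h > 0" "h ^ CARD('n) = K * (4 / l) powr s"
  shows "\<bar>grid_average h \<phi> x\<bar> \<le> l / 2"
proof -
  let ?A = "{y. grid h y = grid h x}"
  have ps: "integrable lborel (\<lambda>x. \<bar>\<phi> x\<bar> powr s)" using test_powr_integrable[OF \<phi>] s by simp
  have iA: "integrable lborel (indicator ?A :: real^'n \<Rightarrow> real)" using grid_cell_measure[OF h(1), of "grid h x"] by simp
  have pt: "\<bar>\<phi> y\<bar> \<le> l / 4 + (l / 4) powr (1 - s) * \<bar>\<phi> y\<bar> powr s" for y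
  proof (cases "\<bar>\<phi> y\<bar> \<le> l / 4")
    case False
    then have "(l / 4) powr (s - 1) \<le> \<bar>\<phi> y\<bar> powr (s - 1)" using l s by (intro powr_mono2) auto
    then have "\<bar>\<phi> y\<bar> * ((l / 4) powr (1 - s) * (l / 4) powr (s - 1)) \<le> \<bar>\<phi> y\<bar> * ((l / 4) powr (1 - s) * \<bar>\<phi> y\<bar> powr (s - 1))"
      by (intro mult_left_mono) auto
    moreover have "(l / 4) powr (1 - s) * (l / 4) powr (s - 1) = 1" using l by (simp flip: powr_add)
    moreover have "\<bar>\<phi> y\<bar> * \<bar>\<phi> y\<bar> powr (s - 1) = \<bar>\<phi> y\<bar> powr s" using False l by (simp add: powr_diff)
    ultimately have "\<bar>\<phi> y\<bar> \<le> (l / 4) powr (1 - s) * \<bar>\<phi> y\<bar> powr s"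
      by (metis mult.left_commute mult.right_neutral)
    then show ?thesis using l by simp
  qed (simp add: add_increasing2)
  have "\<bar>grid_integral h \<phi> (grid h x)\<bar> \<le> (\<integral>y. \<bar>indicator ?A y * \<phi> y\<bar> \<partial>lborel)"
    unfolding grid_integral_def by (rule integral_abs_bound)
  also have "\<dots> \<le> (\<integral>y. l / 4 * indicator ?A y + (l / 4) powr (1 - s) * \<bar>\<phi> y\<bar> powr s \<partial>lborel)"
  proof (rule integral_mono)
    show "\<bar>indicator ?A y * \<phi> y\<bar> \<le> l / 4 * indicator ?A y + (l / 4) powr (1 - s) * \<bar>\<phi> y\<bar> powr s" for y
      using pt[of y] by (auto simp: indicator_def)
  qed (use integrable_grid_cell[OF test_integrable_lborel[OF \<phi>]] iA ps in auto)
  also have "\<dots> = l / 4 * h ^ CARD('n) + (l / 4) powr (1 - s) * (\<integral>y. \<bar>\<phi> y\<bar> powr s \<partial>lborel)"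
    using iA ps grid_cell_measure(2)[OF h(1), of "grid h x"] by simp
  also have "\<dots> \<le> l / 4 * h ^ CARD('n) + (l / 4) powr (1 - s) * K"
    using bd by (intro add_left_mono mult_left_mono) auto
  also have "(l / 4) powr (1 - s) * K = l / 4 * h ^ CARD('n)"
    using l by (simp add: h(2) powr_diff powr_divide field_simps)
  finally have "\<bar>grid_integral h \<phi> (grid h x)\<bar> \<le> l / 2 * h ^ CARD('n)" by simp
  then show ?thesis using h(1) by (simp add: grid_average_def abs_divide divide_le_eq)
qed

text \<open>Where \<open>\<phi>\<close> exceeds \<open>l\<close> although its average is at most
  \<open>l / 2\<close>, it differs from the average by at least \<open>l / 2\<close>. Chebyshev's
  inequality then yields a bound of order \<open>h^2 / l^2\<close>, and \<open>h^2\<close> is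
  proportional to \<open>l\<close> to the power \<open>- 2 * s / N\<close>.\<close>

lemma weak_type_estimate:
  fixes \<phi> :: "real^'n::finite \<Rightarrow> real"
  assumes \<phi>: "\<phi> \<in> test_functions \<Omega>" and s: "s \<ge> 1" and K: "K > 0"
    and bd: "(\<integral>x. \<bar>\<phi> x\<bar> powr s \<partial>lborel) \<le> K" and E: "grad_energy \<phi> \<le> 1" and l: "l > 0"
  shows "emeasure lborel {x. \<bar>\<phi> x\<bar> > l} \<le>
    ennreal (4 * grid_const TYPE('n) * (K * 4 powr s) powr (2 / real CARD('n)) * l powr - (2 + 2 * s / real CARD('n)))"
proof -
  note [measurable] = test_borel[OF \<phi>]
  let ?N = "real CARD('n)"
  have N: "?N > 0" by simp
  define h where "h = (K * (4 / l) powr s) powr (1 / ?N)"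
  have base: "K * (4 / l) powr s > 0" using K l by simp
  then have h: "h > 0" unfolding h_def by (simp only: powr_gt_zero)
  have hN: "h ^ CARD('n) = K * (4 / l) powr s"
    using base N K l by (simp add: h_def powr_powr flip: powr_realpow)
  note avg = grid_average_le[OF \<phi> s K bd l h hN]
  have "emeasure lborel {x. \<bar>\<phi> x\<bar> > l} = (\<integral>\<^sup>+x. indicator {x. \<bar>\<phi> x\<bar> > l} x \<partial>lborel)" by simp
  also have "\<dots> \<le> (\<integral>\<^sup>+x. ennreal ((2 / l)\<^sup>2) * ennreal ((\<phi> x - grid_average h \<phi> x)\<^sup>2) \<partial>lborel)"
  proof (rule nn_integral_mono)
    fix x
    have "1 \<le> (2 / l)\<^sup>2 * (\<phi> x - grid_average h \<phi> x)\<^sup>2" if "\<bar>\<phi> x\<bar> > l"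
    proof -
      have "l / 2 \<le> \<bar>\<phi> x - grid_average h \<phi> x\<bar>" using avg[of x] that by linarith
      then have "1 \<le> 2 / l * \<bar>\<phi> x - grid_average h \<phi> x\<bar>" using l by (simp add: field_simps)
      then have "1\<^sup>2 \<le> (2 / l * \<bar>\<phi> x - grid_average h \<phi> x\<bar>)\<^sup>2" by (intro power_mono) auto
      then show ?thesis by (simp only: power_mult_distrib power2_abs power_one)
    qed
    then show "indicator {x. \<bar>\<phi> x\<bar> > l} x \<le> ennreal ((2 / l)\<^sup>2) * ennreal ((\<phi> x - grid_average h \<phi> x)\<^sup>2)"
      by (auto simp: indicator_def simp flip: ennreal_mult ennreal_1 intro!: ennreal_leI)
  qed
  also have "\<dots> = ennreal ((2 / l)\<^sup>2) * (\<integral>\<^sup>+x. ennreal ((\<phi> x - grid_average h \<phi> x)\<^sup>2) \<partial>lborel)"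
    by (rule nn_integral_cmult) measurable
  also have "\<dots> \<le> ennreal ((2 / l)\<^sup>2) * ennreal (grid_const TYPE('n) * h\<^sup>2 * grad_energy \<phi>)"
    by (rule mult_left_mono[OF grid_average_error[OF \<phi> h]]) simp
  also have "\<dots> \<le> ennreal ((2 / l)\<^sup>2) * ennreal (grid_const TYPE('n) * h\<^sup>2 * 1)"
    by (intro mult_left_mono ennreal_leI E) (auto simp: grid_const_def)
  also have "\<dots> = ennreal ((2 / l)\<^sup>2 * (grid_const TYPE('n) * h\<^sup>2))"
    by (subst ennreal_mult[symmetric]) (auto simp: grid_const_def)
  also have "(2 / l)\<^sup>2 * (grid_const TYPE('n) * h\<^sup>2) =
      4 * grid_const TYPE('n) * (K * 4 powr s) powr (2 / ?N) * l powr - (2 + 2 * s / ?N)"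
  proof -
    have "h\<^sup>2 = (K * (4 / l) powr s) powr (2 / ?N)"
      using base K l by (simp add: h_def powr_powr flip: powr_realpow)
    also have "K * (4 / l) powr s = (K * 4 powr s) * l powr - s"
      using l by (simp add: powr_divide powr_minus_divide)
    also have "(\<dots>) powr (2 / ?N) = (K * 4 powr s) powr (2 / ?N) * l powr (- s * (2 / ?N))"
      using K by (simp add: powr_mult powr_powr)
    finally have h2: "h\<^sup>2 = (K * 4 powr s) powr (2 / ?N) * l powr (- s * (2 / ?N))" .
    have "(2 / l)\<^sup>2 = 4 * l powr - 2" using l by (simp add: powr_minus powr_numeral power_divide divide_inverse power_inverse)
    moreover have "l powr - 2 * l powr (- s * (2 / ?N)) = l powr - (2 + 2 * s / ?N)"
      by (simp add: powr_add[symmetric] algebra_simps)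
    ultimately show ?thesis unfolding h2 by (simp add: mult.assoc mult.left_commute)
  qed
  finally show ?thesis .
qed

lemma dyadic_bound:
  assumes "y > (1::real)" shows "\<exists>j. 2 ^ j < y \<and> y \<le> 2 ^ Suc j"
proof -
  obtain n where "y < 2 ^ n" using real_arch_pow[of 2 y] by auto
  then have ex: "\<exists>n. y \<le> 2 ^ n" by (auto intro: less_imp_le)
  define k where "k = (LEAST n. y \<le> (2::real) ^ n)"
  have k: "y \<le> 2 ^ k" unfolding k_def by (rule LeastI_ex[OF ex])
  then have "k \<noteq> 0" using assms by (cases k) auto
  then obtain j where j: "k = Suc j" by (cases k) auto
  have "\<not> y \<le> 2 ^ j" using not_less_Least[of j "\<lambda>n. y \<le> (2::real) ^ n"] j by (simp add: k_def)
  then show ?thesis using k j by (intro exI[of _ j]) auto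
qed

section \<open>Bootstrapping the Sobolev exponent\<close>

context bounded_open begin

text \<open>Stated on the unit ball of the gradient norm because the weak type estimate is not
  homogeneous; \<open>Sobolev_test\<close> recovers the inequality by scaling.\<close>

definition embeds :: "real \<Rightarrow> bool" where
  "embeds s \<longleftrightarrow> (\<exists>K>0. \<forall>\<phi>\<in>test_functions \<Omega>. grad_energy \<phi> \<le> 1 \<longrightarrow> (\<integral>x. \<bar>\<phi> x\<bar> powr s \<partial>lborel) \<le> K)"

lemma domain_borel [measurable]: "\<Omega> \<in> sets borel"
  using open_domain by simp

lemma domain_emeasure: "emeasure lborel \<Omega> = ennreal (measure lborel \<Omega>)" "emeasure lborel \<Omega> < \<infinity>"
  using emeasure_bounded_finite[OF bounded_domain] by (auto simp: emeasure_eq_ennreal_measure less_top)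

lemma embeds_2: "embeds 2"
proof -
  obtain P where P: "P > 0" "\<And>\<phi>. \<phi> \<in> test_functions \<Omega> \<Longrightarrow> (\<integral>x. (\<phi> x)\<^sup>2 \<partial>lborel) \<le> P * grad_energy \<phi>"
    using test_Poincare by metis
  have "(\<integral>x. \<bar>\<phi> x\<bar> powr 2 \<partial>lborel) \<le> P" if "\<phi> \<in> test_functions \<Omega>" "grad_energy \<phi> \<le> 1" for \<phi>
  proof -
    have "(\<integral>x. \<bar>\<phi> x\<bar> powr 2 \<partial>lborel) \<le> P * grad_energy \<phi>" using P(2)[OF that(1)] by (simp add: powr_numeral)
    also have "\<dots> \<le> P * 1" by (rule mult_left_mono) (use P that in auto)
    finally show ?thesis by simp
  qed
  then show ?thesis using P(1) unfolding embeds_def by blast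
qed

lemma embeds_mono:
  assumes "embeds s" "0 < r" "r \<le> s" shows "embeds r"
proof -
  obtain K where K: "K > 0" "\<And>\<phi>. \<phi> \<in> test_functions \<Omega> \<Longrightarrow> grad_energy \<phi> \<le> 1 \<Longrightarrow> (\<integral>x. \<bar>\<phi> x\<bar> powr s \<partial>lborel) \<le> K"
    using assms(1) by (auto simp: embeds_def)
  have "(\<integral>x. \<bar>\<phi> x\<bar> powr r \<partial>lborel) \<le> measure lborel \<Omega> + K" if \<phi>: "\<phi> \<in> test_functions \<Omega>" "grad_energy \<phi> \<le> 1" for \<phi>
  proof -
    have iO: "integrable lborel (indicator \<Omega> :: real^'n \<Rightarrow> real)" using domain_emeasure by simp
    have ir: "integrable lborel (\<lambda>x. \<bar>\<phi> x\<bar> powr r)" "integrable lborel (\<lambda>x. \<bar>\<phi> x\<bar> powr s)"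
      using test_powr_integrable[OF \<phi>(1)] assms by auto
    have "(\<integral>x. \<bar>\<phi> x\<bar> powr r \<partial>lborel) \<le> (\<integral>x. indicator \<Omega> x + \<bar>\<phi> x\<bar> powr s \<partial>lborel)"
    proof (rule integral_mono)
      fix x show "\<bar>\<phi> x\<bar> powr r \<le> indicator \<Omega> x + \<bar>\<phi> x\<bar> powr s"
      proof (cases "x \<in> \<Omega>")
        case True
        then show ?thesis
        proof (cases "\<bar>\<phi> x\<bar> \<le> 1")
          case t: True
          then have "\<bar>\<phi> x\<bar> powr r \<le> 1" using powr_mono2[of r "\<bar>\<phi> x\<bar>" 1] assms by simp
          then show ?thesis using True by (simp add: add_increasing2)
        next
          case False
          then have "\<bar>\<phi> x\<bar> powr r \<le> \<bar>\<phi> x\<bar> powr s" using assms by (intro powr_mono) auto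
          then show ?thesis using True by simp
        qed
      qed (use test_zero_outside[OF \<phi>(1)] in auto)
    qed (use iO ir in auto)
    also have "\<dots> = measure lborel \<Omega> + (\<integral>x. \<bar>\<phi> x\<bar> powr s \<partial>lborel)" using iO ir by simp
    finally show ?thesis using K(2)[OF \<phi>] by simp
  qed
  moreover have "0 < measure lborel \<Omega> + K" using K(1) by (simp add: add_nonneg_pos)
  ultimately show ?thesis unfolding embeds_def by blast
qed

text \<open>Values at most 1 cost no more than the volume of the domain. Larger ones are sorted into
  dyadic layers, where the weak type estimate yields a geometric series; it converges because
  \<open>r\<close> is strictly below the weak exponent.\<close>

lemma embeds_step:
  assumes "embeds s" "1 \<le> s" "0 < r" "r < 2 + 2 * s / real CARD('n)" shows "embeds r"
proof -
  let ?N = "real CARD('n)"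
  let ?\<sigma> = "2 + 2 * s / ?N"
  obtain K where K: "K > 0" "\<And>\<phi>. \<phi> \<in> test_functions \<Omega> \<Longrightarrow> grad_energy \<phi> \<le> 1 \<Longrightarrow> (\<integral>x. \<bar>\<phi> x\<bar> powr s \<partial>lborel) \<le> K"
    using assms(1) by (auto simp: embeds_def)
  define A where "A = 4 * grid_const TYPE('n) * (K * 4 powr s) powr (2 / ?N)"
  have A: "A \<ge> 0" by (simp add: A_def grid_const_def)
  \<comment> \<open>The ratio of the series: doubling the level multiplies the integrand by
    \<open>2 powr r\<close> and the bound on the measure by \<open>2 powr - \<sigma>\<close>, where
    the exponent \<open>\<sigma>\<close> is the one abbreviated above.\<close>
  define \<rho> where "\<rho> = (2::real) powr (r - ?\<sigma>)"
  have \<rho>: "0 < \<rho>" "\<rho> < 1" using assms(4) by (auto simp: \<rho>_def powr_less_one)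
  define B where "B = 2 powr r * A / (1 - \<rho>)"
  have "(\<integral>x. \<bar>\<phi> x\<bar> powr r \<partial>lborel) \<le> measure lborel \<Omega> + B" if \<phi>: "\<phi> \<in> test_functions \<Omega>" "grad_energy \<phi> \<le> 1" for \<phi>
  proof -
    note [measurable] = test_borel[OF \<phi>(1)]
    have weak: "emeasure lborel {x. \<bar>\<phi> x\<bar> > 2 ^ j} \<le> ennreal (A * (2 ^ j) powr - ?\<sigma>)" for j
      using weak_type_estimate[OF \<phi>(1) assms(2) K(1) K(2)[OF \<phi>] \<phi>(2), of "2 ^ j"] by (simp add: A_def)
    have pt: "ennreal (\<bar>\<phi> x\<bar> powr r) \<le> indicator \<Omega> x + (\<Sum>j. ennreal ((2 ^ Suc j) powr r) * indicator {x. \<bar>\<phi> x\<bar> > 2 ^ j} x)" for x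
    proof (cases "\<bar>\<phi> x\<bar> \<le> 1")
      case True
      then have "\<bar>\<phi> x\<bar> powr r \<le> 1" using powr_mono2[of r "\<bar>\<phi> x\<bar>" 1] assms by simp
      then have "ennreal (\<bar>\<phi> x\<bar> powr r) \<le> indicator \<Omega> x"
        using test_zero_outside[OF \<phi>(1), of x] by (auto simp: indicator_def)
      then show ?thesis by (simp add: add_increasing2)
    next
      case False
      then obtain j where j: "2 ^ j < \<bar>\<phi> x\<bar>" "\<bar>\<phi> x\<bar> \<le> 2 ^ Suc j" using dyadic_bound[of "\<bar>\<phi> x\<bar>"] by auto
      have "ennreal (\<bar>\<phi> x\<bar> powr r) \<le> ennreal ((2 ^ Suc j) powr r) * indicator {x. \<bar>\<phi> x\<bar> > 2 ^ j} x"
        using j assms(3) by (auto intro!: ennreal_leI powr_mono2)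
      also have "\<dots> \<le> (\<Sum>j. ennreal ((2 ^ Suc j) powr r) * indicator {x. \<bar>\<phi> x\<bar> > 2 ^ j} x)"
      proof -
        define f where "f = (\<lambda>j. ennreal ((2 ^ Suc j) powr r) * indicator {x. \<bar>\<phi> x\<bar> > 2 ^ j} x)"
        have "sum f {j} \<le> suminf f" by (rule sum_le_suminf) auto
        then have "f j \<le> suminf f" by simp
        then show ?thesis by (simp only: f_def)
      qed
      finally show ?thesis by (simp add: add_increasing)
    qed
    have dy: "(\<integral>\<^sup>+x. ennreal ((2 ^ Suc j) powr r) * indicator {x. \<bar>\<phi> x\<bar> > 2 ^ j} x \<partial>lborel) \<le> ennreal (2 powr r * A * \<rho> ^ j)" for j
    proof -
      have "(\<integral>\<^sup>+x. ennreal ((2 ^ Suc j) powr r) * indicator {x. \<bar>\<phi> x\<bar> > 2 ^ j} x \<partial>lborel)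
          = ennreal ((2 ^ Suc j) powr r) * emeasure lborel {x. \<bar>\<phi> x\<bar> > 2 ^ j}"
        by (simp add: nn_integral_cmult)
      also have "\<dots> \<le> ennreal ((2 ^ Suc j) powr r) * ennreal (A * (2 ^ j) powr - ?\<sigma>)"
        by (rule mult_left_mono[OF weak]) simp
      also have "\<dots> = ennreal ((2 ^ Suc j) powr r * (A * (2 ^ j) powr - ?\<sigma>))"
        using A by (simp add: ennreal_mult)
      also have "(2 ^ Suc j) powr r * (A * (2 ^ j) powr - ?\<sigma>) = 2 powr r * A * \<rho> ^ j"
      proof -
        have "(2 ^ j) powr r * (2 ^ j) powr - ?\<sigma> = \<rho> ^ j"
        proof -
          have "(2 ^ j) powr r * (2 ^ j) powr - ?\<sigma> = (2 ^ j :: real) powr (r + - ?\<sigma>)" by (rule powr_add[symmetric])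
          also have "\<dots> = 2 powr (real j * (r + - ?\<sigma>))" by (simp only: powr_realpow[symmetric] powr_powr zero_less_numeral)
          also have "\<dots> = (2 powr (r + - ?\<sigma>)) powr real j" by (simp only: powr_powr mult.commute)
          also have "2 powr (r + - ?\<sigma>) = \<rho>"
            unfolding \<rho>_def by (rule arg_cong[of _ _ "\<lambda>x. 2 powr x"]) simp
          also have "\<rho> powr real j = \<rho> ^ j" by (rule powr_realpow[OF \<rho>(1)])
          finally show ?thesis .
        qed
        then show ?thesis by (simp add: powr_mult mult.assoc mult.left_commute)
      qed
      finally show ?thesis .
    qed
    have "(\<integral>\<^sup>+x. ennreal (\<bar>\<phi> x\<bar> powr r) \<partial>lborel)
        \<le> (\<integral>\<^sup>+x. indicator \<Omega> x + (\<Sum>j. ennreal ((2 ^ Suc j) powr r) * indicator {x. \<bar>\<phi> x\<bar> > 2 ^ j} x) \<partial>lborel)"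
      by (rule nn_integral_mono[OF pt])
    also have "\<dots> = emeasure lborel \<Omega> + (\<Sum>j. \<integral>\<^sup>+x. ennreal ((2 ^ Suc j) powr r) * indicator {x. \<bar>\<phi> x\<bar> > 2 ^ j} x \<partial>lborel)"
      by (subst nn_integral_add) (auto simp: nn_integral_suminf)
    also have "\<dots> \<le> emeasure lborel \<Omega> + (\<Sum>j. ennreal (2 powr r * A * \<rho> ^ j))"
      by (intro add_left_mono suminf_le dy) auto
    also have "(\<Sum>j. ennreal (2 powr r * A * \<rho> ^ j)) = ennreal B"
    proof -
      have "(\<lambda>j. 2 powr r * A * \<rho> ^ j) sums (2 powr r * A * (1 / (1 - \<rho>)))"
        using \<rho> by (intro sums_mult geometric_sums) auto
      then show ?thesis using A \<rho> by (subst suminf_ennreal_eq[of _ B]) (auto simp: B_def)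
    qed
    also have "emeasure lborel \<Omega> + ennreal B = ennreal (measure lborel \<Omega> + B)"
      using A \<rho> by (simp add: domain_emeasure B_def)
    finally have "(\<integral>\<^sup>+x. ennreal (\<bar>\<phi> x\<bar> powr r) \<partial>lborel) \<le> ennreal (measure lborel \<Omega> + B)" .
    then have "ennreal (\<integral>x. \<bar>\<phi> x\<bar> powr r \<partial>lborel) \<le> ennreal (measure lborel \<Omega> + B)"
      using test_powr_integrable[OF \<phi>(1) assms(3)] by (simp only: nn_integral_eq_integral powr_ge_zero AE_I2)
    moreover have "0 \<le> measure lborel \<Omega> + B" using A \<rho> by (simp add: B_def)
    ultimately show ?thesis by (simp only: ennreal_le_iff)
  qed
  \<comment> \<open>The added 1 secures the strict positivity that \<open>embeds\<close> asks
    for.\<close>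
  moreover have "measure lborel \<Omega> + B \<le> measure lborel \<Omega> + B + 1" "0 < measure lborel \<Omega> + B + 1"
    using A \<rho> by (auto simp: B_def intro!: add_nonneg_pos add_nonneg_nonneg)
  ultimately show ?thesis unfolding embeds_def by (meson order_trans)
qed

text \<open>If \<open>r\<close> were out of reach, the reachable exponents would have a supremum at
  most \<open>r\<close>. The bootstrapping step makes this supremum at least the image of itself
  under \<open>s \<mapsto> 2 + 2 * s / N\<close>, hence at least critical, against the assumption on
  \<open>r\<close>.\<close>

lemma embeds_subcritical:
  assumes r: "r \<ge> 2" and sub: "r * (real CARD('n) - 2) < 2 * real CARD('n)"
  shows "embeds r"
proof (rule ccontr)
  assume nr: "\<not> embeds r"
  let ?N = "real CARD('n)"
  have N: "?N \<ge> 1" using zero_less_card_finite[where 'a='n] by linarith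
  define S where "S = {s. 2 \<le> s \<and> embeds s}"
  have le: "s \<le> r" if "s \<in> S" for s
    using embeds_mono[of s r] nr r that by (cases "r \<le> s") (auto simp: S_def)
  have bdd: "bdd_above S" using le by (rule bdd_aboveI)
  have S2: "2 \<in> S" using embeds_2 by (simp add: S_def)
  define \<sigma> where "\<sigma> = Sup S"
  have \<sigma>: "2 \<le> \<sigma>" "\<sigma> \<le> r" unfolding \<sigma>_def using cSup_upper[OF S2 bdd] cSup_least[of S r] le S2 by auto
  \<comment> \<open>The step reaches only exponents strictly below the image, hence the limit
    argument through \<open>dense_le\<close>.\<close>
  have step: "2 + 2 * s / ?N \<le> \<sigma>" if "s \<in> S" for s
  proof (rule dense_le)
    fix x assume x: "x < 2 + 2 * s / ?N"
    show "x \<le> \<sigma>"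
    proof (cases "x < 2")
      case False
      then have "x \<in> S" using embeds_step[of s x] that x by (auto simp: S_def)
      then show ?thesis unfolding \<sigma>_def by (rule cSup_upper[OF _ bdd])
    qed (use \<sigma> in simp)
  qed
  have "s \<le> (\<sigma> - 2) * ?N / 2" if "s \<in> S" for s
    using step[OF that] N by (simp add: field_simps)
  then have "\<sigma> \<le> (\<sigma> - 2) * ?N / 2" unfolding \<sigma>_def using S2 by (intro cSup_least) auto
  then have *: "2 * ?N \<le> \<sigma> * (?N - 2)" by (simp add: algebra_simps)
  \<comment> \<open>Below dimension two the right side of \<open>*\<close> is nonpositive while the
    left side is positive.\<close>
  have "?N \<ge> 2" 
  proof (rule ccontr)
    assume "\<not> ?N \<ge> 2"
    then have "\<sigma> * (?N - 2) \<le> 0" using \<sigma> by (intro mult_nonneg_nonpos) auto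
    then show False using * N by linarith
  qed
  then have "\<sigma> * (?N - 2) \<le> r * (?N - 2)" using \<sigma> by (intro mult_right_mono) auto
  then show False using * sub by linarith
qed

text \<open>Scaling to gradient energy 1. A function of zero energy cannot be scaled, but it
  vanishes almost everywhere by the Poincare inequality.\<close>

lemma Sobolev_test:
  assumes r: "r \<ge> 2" and sub: "r * (real CARD('n) - 2) < 2 * real CARD('n)"
  obtains K where "K > 0" "\<And>\<phi>. \<phi> \<in> test_functions \<Omega> \<Longrightarrow> (\<integral>x. \<bar>\<phi> x\<bar> powr r \<partial>lborel) \<le> K * sqrt (grad_energy \<phi>) powr r"
proof -
  obtain K where K: "K > 0" "\<And>\<phi>. \<phi> \<in> test_functions \<Omega> \<Longrightarrow> grad_energy \<phi> \<le> 1 \<Longrightarrow> (\<integral>x. \<bar>\<phi> x\<bar> powr r \<partial>lborel) \<le> K"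
    using embeds_subcritical[OF assms] by (auto simp: embeds_def)
  obtain P where P: "P > 0" "\<And>\<phi>. \<phi> \<in> test_functions \<Omega> \<Longrightarrow> (\<integral>x. (\<phi> x)\<^sup>2 \<partial>lborel) \<le> P * grad_energy \<phi>"
    using test_Poincare by metis
  have "(\<integral>x. \<bar>\<phi> x\<bar> powr r \<partial>lborel) \<le> K * sqrt (grad_energy \<phi>) powr r" if \<phi>: "\<phi> \<in> test_functions \<Omega>" for \<phi>
  proof (cases "grad_energy \<phi> = 0")
    case True
    have nn: "0 \<le> (\<integral>x. (\<phi> x)\<^sup>2 \<partial>lborel)" by (rule Bochner_Integration.integral_nonneg) simp
    have "(\<integral>x. (\<phi> x)\<^sup>2 \<partial>lborel) = 0" using P(2)[OF \<phi>] True nn by simp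
    then have "AE x in lborel. (\<phi> x)\<^sup>2 = 0"
      by (subst (asm) integral_nonneg_eq_0_iff_AE[OF test_square_integrable[OF \<phi>]]) auto
    then have "AE x in lborel. \<bar>\<phi> x\<bar> powr r = 0" by eventually_elim simp
    then have "(\<integral>x. \<bar>\<phi> x\<bar> powr r \<partial>lborel) = 0" by (rule integral_eq_zero_AE)
    then show ?thesis using True by simp
  next
    case False
    define E where "E = sqrt (grad_energy \<phi>)"
    have E: "E > 0" using False grad_energy_nonneg[of \<phi>] by (simp add: E_def)
    have "grad_energy (\<lambda>x. inverse E * \<phi> x) = 1"
      using False grad_energy_nonneg[of \<phi>] by (simp add: grad_energy_scale[OF \<phi>] E_def power_inverse)
    then have "(\<integral>x. \<bar>inverse E * \<phi> x\<bar> powr r \<partial>lborel) \<le> K"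
      using K(2)[OF test_scale[OF \<phi>, of "inverse E"]] by simp
    also have "(\<integral>x. \<bar>inverse E * \<phi> x\<bar> powr r \<partial>lborel) = inverse (E powr r) * (\<integral>x. \<bar>\<phi> x\<bar> powr r \<partial>lborel)"
      using E by (simp add: abs_mult powr_mult powr_minus[symmetric] inverse_powr)
    finally show ?thesis using E by (simp add: E_def[symmetric] field_simps)
  qed
  then show ?thesis using that K(1) by blast
qed

end

section \<open>Rellich compactness for test functions\<close>

lemma grid_average_diff:
  assumes "\<phi> \<in> test_functions \<Omega>" "\<psi> \<in> test_functions \<Omega>"
  shows "grid_average h (\<lambda>x. \<phi> x - \<psi> x) x = grid_average h \<phi> x - grid_average h \<psi> x"
  using integrable_grid_cell[OF test_integrable_lborel[OF assms(1)]] integrable_grid_cell[OF test_integrable_lborel[OF assms(2)]]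
  by (simp add: grid_average_def grid_integral_def right_diff_distrib diff_divide_distrib)

lemma tendsto_square_AE_subseq:
  fixes f :: "nat \<Rightarrow> 'a \<Rightarrow> real"
  assumes "\<And>n. integrable M (\<lambda>x. (f n x - g x)\<^sup>2)" "(\<lambda>n. \<integral>x. (f n x - g x)\<^sup>2 \<partial>M) \<longlonglongrightarrow> 0"
  obtains r where "strict_mono r" "AE x in M. (\<lambda>n. f (r n) x) \<longlonglongrightarrow> g x"
proof -
  obtain r where r: "strict_mono r" "AE x in M. (\<lambda>n. (f (r n) x - g x)\<^sup>2) \<longlonglongrightarrow> 0"
    using tendsto_L1_AE_subseq[of M "\<lambda>n x. (f n x - g x)\<^sup>2"] assms by auto
  have "AE x in M. (\<lambda>n. f (r n) x) \<longlonglongrightarrow> g x"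
    using r(2)
  proof eventually_elim
    case (elim x)
    from tendsto_real_sqrt[OF elim] have "(\<lambda>n. \<bar>f (r n) x - g x\<bar>) \<longlonglongrightarrow> 0" by simp
    then show ?case by (metis LIM_zero_cancel tendsto_rabs_zero_cancel)
  qed
  then show ?thesis using r(1) that by blast
qed

context bounded_open begin

lemma dirichlet_grad_energy: "\<phi> \<in> test_functions \<Omega> \<Longrightarrow> dirichlet \<Omega> \<phi> \<phi> = grad_energy \<phi>"
  by (simp add: dirichlet_test grad_energy_def)

lemma test_diff: "\<phi> \<in> test_functions \<Omega> \<Longrightarrow> \<psi> \<in> test_functions \<Omega> \<Longrightarrow> (\<lambda>x. \<phi> x - \<psi> x) \<in> test_functions \<Omega>"
  using test_add[of \<phi> \<Omega> "\<lambda>x. (-1) * \<psi> x"] test_scale[of \<psi> \<Omega> "-1"] by simp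

lemma grad_energy_diff_le:
  assumes "\<phi> \<in> test_functions \<Omega>" "\<psi> \<in> test_functions \<Omega>"
  shows "grad_energy (\<lambda>x. \<phi> x - \<psi> x) \<le> 2 * grad_energy \<phi> + 2 * grad_energy \<psi>"
  using dirichlet_add_bound[OF test_H1[OF assms(1)] test_H1[OF test_scale[OF assms(2), of "-1"]]]
    grad_energy_scale[OF assms(2), of "-1"]
  by (simp add: dirichlet_grad_energy assms test_diff test_scale test_scale[of _ _ "-1", simplified])

lemma grid_average_error_domain:
  assumes \<phi>: "\<phi> \<in> test_functions \<Omega>" and h: "h > 0"
  shows "integrable (lebesgue_on \<Omega>) (\<lambda>x. (\<phi> x - grid_average h \<phi> x)\<^sup>2)"
    "(\<integral>x. (\<phi> x - grid_average h \<phi> x)\<^sup>2 \<partial>lebesgue_on \<Omega>) \<le> grid_const TYPE('n) * h\<^sup>2 * grad_energy \<phi>"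
proof -
  note [measurable] = test_borel[OF \<phi>]
  let ?f = "\<lambda>x. (\<phi> x - grid_average h \<phi> x)\<^sup>2"
  have nn: "0 \<le> grid_const TYPE('n) * h\<^sup>2 * grad_energy \<phi>"
    using grad_energy_nonneg[of \<phi>] by (simp add: grid_const_def)
  have m: "?f \<in> borel_measurable (lebesgue_on \<Omega>)" by (rule borel_measurable_domain) measurable
  have "(\<integral>\<^sup>+x. ennreal (?f x) \<partial>lebesgue_on \<Omega>) \<le> (\<integral>\<^sup>+x. ennreal (?f x) \<partial>lborel)"
    by (subst nn_integral_restrict_space) (auto simp: nn_integral_completion indicator_def intro!: nn_integral_mono)
  also have "\<dots> \<le> ennreal (grid_const TYPE('n) * h\<^sup>2 * grad_energy \<phi>)" by (rule grid_average_error[OF \<phi> h])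
  finally have le: "(\<integral>\<^sup>+x. ennreal (?f x) \<partial>lebesgue_on \<Omega>) \<le> ennreal (grid_const TYPE('n) * h\<^sup>2 * grad_energy \<phi>)" .
  show int: "integrable (lebesgue_on \<Omega>) ?f"
    by (rule integrableI_nonneg[OF m]) (use le_less_trans[OF le] in auto)
  show "(\<integral>x. ?f x \<partial>lebesgue_on \<Omega>) \<le> grid_const TYPE('n) * h\<^sup>2 * grad_energy \<phi>"
    using le nn by (simp add: nn_integral_eq_integral[OF int])
qed

text \<open>Since \<open>\<bar>y\<bar>\<close> is at most \<open>1 + y^2\<close>, the bound is
  uniform in the grid and the cell, as the diagonal argument requires.\<close>

lemma grid_integral_bound:
  assumes \<phi>: "\<phi> \<in> test_functions \<Omega>"
  shows "\<bar>grid_integral h \<phi> k\<bar> \<le> measure lborel \<Omega> + (\<integral>x. (\<phi> x)\<^sup>2 \<partial>lborel)"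
proof -
  have iO: "integrable lborel (indicator \<Omega> :: real^'n \<Rightarrow> real)" using domain_emeasure by simp
  have "\<bar>grid_integral h \<phi> k\<bar> \<le> (\<integral>y. \<bar>indicator {y. grid h y = k} y * \<phi> y\<bar> \<partial>lborel)"
    unfolding grid_integral_def by (rule integral_abs_bound)
  also have "\<dots> \<le> (\<integral>y. indicator \<Omega> y + (\<phi> y)\<^sup>2 \<partial>lborel)"
  proof (rule integral_mono)
    fix y
    have "\<bar>\<phi> y\<bar> \<le> 1 + (\<phi> y)\<^sup>2"
      using zero_le_power2[of "\<bar>\<phi> y\<bar> - 1"] by (simp add: power2_eq_square algebra_simps)
    then show "\<bar>indicator {y. grid h y = k} y * \<phi> y\<bar> \<le> indicator \<Omega> y + (\<phi> y)\<^sup>2"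
      using test_zero_outside[OF \<phi>, of y] by (auto simp: indicator_def)
  qed (use iO integrable_grid_cell[OF test_integrable_lborel[OF \<phi>]] test_square_integrable[OF \<phi>] in auto)
  also have "\<dots> = measure lborel \<Omega> + (\<integral>x. (\<phi> x)\<^sup>2 \<partial>lborel)" using iO test_square_integrable[OF \<phi>] by simp
  finally show ?thesis .
qed

text \<open>A diagonal subsequence makes the integrals over all cells of all grids of side
  \<open>1 / (j + 1)\<close> converge. For fixed \<open>j\<close> the averages then converge in
  \<open>L^2\<close> by dominated convergence, and their distance to the functions is of order
  \<open>h j\<close> uniformly in \<open>n\<close>; so the functions form a Cauchy sequence.\<close>

lemma Rellich_test:
  assumes \<phi>: "\<And>n::nat. \<phi> n \<in> test_functions \<Omega>" and B: "\<And>n. grad_energy (\<phi> n) \<le> B"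
  shows "\<exists>r u. strict_mono r \<and> u \<in> L2 \<Omega> \<and> (\<lambda>n. l2_inner \<Omega> (\<lambda>x. \<phi> (r n) x - u x) (\<lambda>x. \<phi> (r n) x - u x)) \<longlonglongrightarrow> 0"
proof -
  interpret finite_measure "lebesgue_on \<Omega>" by (rule finite_measure_domain)
  have B0: "0 \<le> B" using B[of 0] grad_energy_nonneg[of "\<phi> 0"] by simp
  obtain P where P: "P > 0" "\<And>\<phi>. \<phi> \<in> test_functions \<Omega> \<Longrightarrow> (\<integral>x. (\<phi> x)\<^sup>2 \<partial>lborel) \<le> P * grad_energy \<phi>"
    using test_Poincare by metis
  define M where "M = measure lborel \<Omega> + P * B"
  have gb: "\<bar>grid_integral h (\<phi> n) k\<bar> \<le> M" for h n k
  proof -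
    have "P * grad_energy (\<phi> n) \<le> P * B" using P(1) B by (intro mult_left_mono) auto
    then show ?thesis using grid_integral_bound[OF \<phi>, of h n k] P(2)[OF \<phi>, of n] by (simp add: M_def)
  qed
  define h where "h j = inverse (real (Suc j))" for j
  have h: "h j > 0" for j by (simp add: h_def)
  \<comment> \<open>A pair consists of the number of a grid and the index of a cell.\<close>
  have "countable (UNIV :: (nat \<times> (int^'n)) set)" by simp
  then obtain r where r: "strict_mono r"
    "\<And>p. \<exists>l. (\<lambda>n. grid_integral (h (fst p)) (\<phi> (r n)) (snd p)) \<longlonglongrightarrow> l"
    using function_convergent_subsequence[of "UNIV :: (nat \<times> (int^'n)) set" "\<lambda>n p. grid_integral (h (fst p)) (\<phi> n) (snd p)" M] gb
    by (auto simp del: split_paired_All)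
  let ?a = "\<lambda>j n x. grid_average (h j) (\<phi> (r n)) x"
  define L where "L j x = lim (\<lambda>n. ?a j n x)" for j x
  have lim: "(\<lambda>n. ?a j n x) \<longlonglongrightarrow> L j x" for j x
  proof -
    obtain l where "(\<lambda>n. grid_integral (h j) (\<phi> (r n)) (grid (h j) x)) \<longlonglongrightarrow> l"
      using r(2)[of "(j, grid (h j) x)"] by auto
    then have "(\<lambda>n. ?a j n x) \<longlonglongrightarrow> l / h j ^ CARD('n)"
      unfolding grid_average_def by (intro tendsto_divide tendsto_const) (use h[of j] in auto)
    then show ?thesis unfolding L_def by (metis limI)
  qed
  have am: "?a j n \<in> borel_measurable (lebesgue_on \<Omega>)" for j n by (rule borel_measurable_domain) measurable
  have Lm: "L j \<in> borel_measurable (lebesgue_on \<Omega>)" for j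
    by (rule borel_measurable_LIMSEQ_real[OF lim am])
  have ab: "\<bar>?a j n x\<bar> \<le> M / h j ^ CARD('n)" for j n x
    using h[of j] gb[of "h j" "r n" "grid (h j) x"] by (simp add: grid_average_def abs_divide divide_right_mono)
  have Lb: "\<bar>L j x\<bar> \<le> M / h j ^ CARD('n)" for j x
    by (rule LIMSEQ_le_const2[OF tendsto_rabs[OF lim]]) (use ab in auto)
  have dom: "(?a j n x - L j x)\<^sup>2 \<le> (2 * (M / h j ^ CARD('n)))\<^sup>2" for j n x
  proof -
    have "\<bar>?a j n x - L j x\<bar> \<le> 2 * (M / h j ^ CARD('n))" using ab[of j n x] Lb[of j x] by linarith
    from power_mono[OF this, of 2] show ?thesis by simp
  qed
  have aLint: "integrable (lebesgue_on \<Omega>) (\<lambda>x. (?a j n x - L j x)\<^sup>2)" for j n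
  proof (rule integrable_const_bound)
    show "AE x in lebesgue_on \<Omega>. norm ((?a j n x - L j x)\<^sup>2) \<le> (2 * (M / h j ^ CARD('n)))\<^sup>2" using dom by simp
  qed (use am[of j n] Lm[of j] in simp)
  have aL: "(\<lambda>n. \<integral>x. (?a j n x - L j x)\<^sup>2 \<partial>lebesgue_on \<Omega>) \<longlonglongrightarrow> 0" for j
  proof -
    have "(\<lambda>n. \<integral>x. (?a j n x - L j x)\<^sup>2 \<partial>lebesgue_on \<Omega>) \<longlonglongrightarrow> (\<integral>x. 0 \<partial>lebesgue_on \<Omega>)"
    proof (rule integral_dominated_convergence[where w="\<lambda>x. (2 * (M / h j ^ CARD('n)))\<^sup>2"])
      have "(\<lambda>n. (?a j n x - L j x)\<^sup>2) \<longlonglongrightarrow> (L j x - L j x)\<^sup>2" for x by (intro tendsto_intros lim)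
      then show "AE x in lebesgue_on \<Omega>. (\<lambda>n. (?a j n x - L j x)\<^sup>2) \<longlonglongrightarrow> 0" by simp
    qed (use am[of j] Lm[of j] dom[of j] in auto)
    then show ?thesis by simp
  qed
  \<comment> \<open>The difference is compared with its own average, and the two averages with their
    common limit \<open>L j\<close>. Only the first error involves the gradient, and it is uniform
    in \<open>m\<close> and \<open>n\<close>.\<close>
  have key: "l2_inner \<Omega> (\<lambda>x. \<phi> (r m) x - \<phi> (r n) x) (\<lambda>x. \<phi> (r m) x - \<phi> (r n) x) \<le>
      8 * grid_const TYPE('n) * B * (h j)\<^sup>2 + 4 * (\<integral>x. (?a j m x - L j x)\<^sup>2 \<partial>lebesgue_on \<Omega>) +
      4 * (\<integral>x. (?a j n x - L j x)\<^sup>2 \<partial>lebesgue_on \<Omega>)" for m n j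
  proof -
    let ?w = "\<lambda>x. \<phi> (r m) x - \<phi> (r n) x"
    have w: "?w \<in> test_functions \<Omega>" using \<phi> test_diff by blast
    have i: "integrable (lebesgue_on \<Omega>) (\<lambda>x. (?w x)\<^sup>2)"
      using integrable_domain[OF test_square_integrable[OF w]] .
    note e = grid_average_error_domain[OF w h[of j]]
    have "l2_inner \<Omega> ?w ?w = (\<integral>x. (?w x)\<^sup>2 \<partial>lebesgue_on \<Omega>)" by (simp add: l2_inner_self)
    also have "\<dots> \<le> (\<integral>x. 2 * (?w x - grid_average (h j) ?w x)\<^sup>2 + 4 * (?a j m x - L j x)\<^sup>2 + 4 * (?a j n x - L j x)\<^sup>2 \<partial>lebesgue_on \<Omega>)"
    proof (rule integral_mono)
      fix x
      have aux: "w\<^sup>2 \<le> 2 * (w - (a - b))\<^sup>2 + 4 * (a - l)\<^sup>2 + 4 * (b - l)\<^sup>2" for w a b l :: real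
      proof -
        have "2 * (w - (a - b))\<^sup>2 + 4 * (a - l)\<^sup>2 + 4 * (b - l)\<^sup>2 - w\<^sup>2 = (w - 2 * (a - b))\<^sup>2 + 2 * (a + b - 2 * l)\<^sup>2"
          by (simp add: power2_eq_square algebra_simps)
        then show ?thesis by (smt (verit) zero_le_power2)
      qed
      show "(?w x)\<^sup>2 \<le> 2 * (?w x - grid_average (h j) ?w x)\<^sup>2 + 4 * (?a j m x - L j x)\<^sup>2 + 4 * (?a j n x - L j x)\<^sup>2"
        unfolding grid_average_diff[OF \<phi> \<phi>] by (rule aux)
    qed (use i e(1) aLint in auto)
    also have "\<dots> = 2 * (\<integral>x. (?w x - grid_average (h j) ?w x)\<^sup>2 \<partial>lebesgue_on \<Omega>) + 4 * (\<integral>x. (?a j m x - L j x)\<^sup>2 \<partial>lebesgue_on \<Omega>) +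
      4 * (\<integral>x. (?a j n x - L j x)\<^sup>2 \<partial>lebesgue_on \<Omega>)"
      using e(1) aLint[of j m] aLint[of j n] by simp
    also have "2 * (\<integral>x. (?w x - grid_average (h j) ?w x)\<^sup>2 \<partial>lebesgue_on \<Omega>) \<le> 8 * grid_const TYPE('n) * B * (h j)\<^sup>2"
    proof -
      have "grad_energy ?w \<le> 4 * B" using grad_energy_diff_le[OF \<phi> \<phi>, of "r m" "r n"] B[of "r m"] B[of "r n"] by linarith
      then have "grid_const TYPE('n) * (h j)\<^sup>2 * grad_energy ?w \<le> grid_const TYPE('n) * (h j)\<^sup>2 * (4 * B)"
        by (intro mult_left_mono) (auto simp: grid_const_def)
      then show ?thesis using e(2) by (simp add: algebra_simps)
    qed
    finally show ?thesis by simp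
  qed
  have "\<exists>u\<in>L2 \<Omega>. (\<lambda>n. l2_inner \<Omega> (\<lambda>x. \<phi> (r n) x - u x) (\<lambda>x. \<phi> (r n) x - u x)) \<longlonglongrightarrow> 0"
  proof (rule L2_complete[OF domain_lmeasurable])
    show "\<phi> (r n) \<in> L2 \<Omega>" for n by (rule test_L2[OF \<phi>])
    fix e :: real assume e: "e > 0"
    have "(\<lambda>j. 8 * grid_const TYPE('n) * B * (h j)\<^sup>2) \<longlonglongrightarrow> 8 * grid_const TYPE('n) * B * 0\<^sup>2"
      unfolding h_def by (intro tendsto_intros LIMSEQ_inverse_real_of_nat)
    then have "eventually (\<lambda>j. 8 * grid_const TYPE('n) * B * (h j)\<^sup>2 < e / 2) sequentially"
      by (rule order_tendstoD(2)) (use e in simp)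
    then obtain j where j: "8 * grid_const TYPE('n) * B * (h j)\<^sup>2 < e / 2"
      using eventually_happens' sequentially_bot by blast
    have "eventually (\<lambda>n. (\<integral>x. (?a j n x - L j x)\<^sup>2 \<partial>lebesgue_on \<Omega>) < e / 16) sequentially"
      by (rule order_tendstoD(2)[OF aL]) (use e in simp)
    then obtain N where N: "\<And>n. n \<ge> N \<Longrightarrow> (\<integral>x. (?a j n x - L j x)\<^sup>2 \<partial>lebesgue_on \<Omega>) < e / 16"
      by (auto simp: eventually_sequentially)
    show "\<exists>N. \<forall>m\<ge>N. \<forall>n\<ge>N. l2_inner \<Omega> (\<lambda>x. \<phi> (r m) x - \<phi> (r n) x) (\<lambda>x. \<phi> (r m) x - \<phi> (r n) x) < e"
    proof (intro exI allI impI)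
      fix m n assume mn: "N \<le> m" "N \<le> n"
      then show "l2_inner \<Omega> (\<lambda>x. \<phi> (r m) x - \<phi> (r n) x) (\<lambda>x. \<phi> (r m) x - \<phi> (r n) x) < e"
        using key[of m n j] j N[OF mn(1)] N[OF mn(2)] by linarith
    qed
  qed
  then show ?thesis using r(1) by blast
qed

end

section \<open>From test functions to \<open>H10\<close>: Sobolev inequality, closedness,
  compactness\<close>

context bounded_open begin

lemma dirichlet_tendsto:
  assumes w: "\<And>n::nat. w n \<in> H1 \<Omega>" and u: "u \<in> H1 \<Omega>"
    and lim: "(\<lambda>n. dirichlet \<Omega> (\<lambda>x. w n x - u x) (\<lambda>x. w n x - u x)) \<longlonglongrightarrow> 0"
  shows "(\<lambda>n. dirichlet \<Omega> (w n) (w n)) \<longlonglongrightarrow> dirichlet \<Omega> u u"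
proof -
  let ?d = "\<lambda>n x. w n x - u x"
  have d: "?d n \<in> H1 \<Omega>" for n by (rule H1_diff[OF w u])
  have "(\<lambda>n. sqrt (dirichlet \<Omega> u u) * sqrt (dirichlet \<Omega> (?d n) (?d n))) \<longlonglongrightarrow> sqrt (dirichlet \<Omega> u u) * sqrt 0"
    by (intro tendsto_intros lim)
  then have l: "(\<lambda>n. sqrt (dirichlet \<Omega> u u) * sqrt (dirichlet \<Omega> (?d n) (?d n))) \<longlonglongrightarrow> 0" by simp
  have c: "(\<lambda>n. dirichlet \<Omega> u (?d n)) \<longlonglongrightarrow> 0"
    by (rule Lim_null_comparison[OF _ l]) (use dirichlet_Cauchy_Schwarz[OF u d] in simp)
  have "(\<lambda>n. dirichlet \<Omega> u u + 2 * 1 * dirichlet \<Omega> u (?d n) + 1\<^sup>2 * dirichlet \<Omega> (?d n) (?d n)) \<longlonglongrightarrow> dirichlet \<Omega> u u + 2 * 1 * 0 + 1\<^sup>2 * 0"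
    by (intro tendsto_intros c lim)
  then show ?thesis
    using dirichlet_lincomb_self[OF u d, of 1] by simp
qed

text \<open>Test functions approximating \<open>u\<close> converge almost everywhere along a
  subsequence, and Fatou's lemma applies. The slack \<open>e\<close> is there because the bounds
  along the sequence only converge to the desired one.\<close>

lemma Sobolev_H10:
  assumes r: "r \<ge> 2" and sub: "r * (real CARD('n) - 2) < 2 * real CARD('n)"
  shows "\<exists>K>0. \<forall>u\<in>H10 \<Omega>. integrable (lebesgue_on \<Omega>) (\<lambda>x. \<bar>u x\<bar> powr r) \<and>
    (\<integral>x. \<bar>u x\<bar> powr r \<partial>lebesgue_on \<Omega>) \<le> K * sqrt (dirichlet \<Omega> u u) powr r"
proof -
  obtain K where K: "K > 0" "\<And>\<phi>. \<phi> \<in> test_functions \<Omega> \<Longrightarrow> (\<integral>x. \<bar>\<phi> x\<bar> powr r \<partial>lborel) \<le> K * sqrt (grad_energy \<phi>) powr r"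
    using Sobolev_test[OF assms] by metis
  have "integrable (lebesgue_on \<Omega>) (\<lambda>x. \<bar>u x\<bar> powr r) \<and>
    (\<integral>x. \<bar>u x\<bar> powr r \<partial>lebesgue_on \<Omega>) \<le> K * sqrt (dirichlet \<Omega> u u) powr r" if u: "u \<in> H10 \<Omega>" for u
  proof -
    obtain \<phi> where \<phi>: "\<And>k::nat. \<phi> k \<in> test_functions \<Omega>"
      "(\<lambda>k. l2_inner \<Omega> (\<lambda>x. \<phi> k x - u x) (\<lambda>x. \<phi> k x - u x)) \<longlonglongrightarrow> 0"
      "(\<lambda>k. dirichlet \<Omega> (\<lambda>x. \<phi> k x - u x) (\<lambda>x. \<phi> k x - u x)) \<longlonglongrightarrow> 0"
      using H10_approx[OF u] by blast
    note u1 = H10_H1[OF u]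
    note um = L2_measurable[OF H1_weak_gradient(1)[OF u1]]
    have "(\<lambda>x. \<phi> k x - u x) \<in> L2 \<Omega>" for k
      by (rule L2_diff[OF test_L2[OF \<phi>(1)] H1_weak_gradient(1)[OF u1]])
    then have "integrable (lebesgue_on \<Omega>) (\<lambda>x. (\<phi> k x - u x)\<^sup>2)" for k by (simp add: L2_def)
    then obtain s where s: "strict_mono s" "AE x in lebesgue_on \<Omega>. (\<lambda>n. \<phi> (s n) x) \<longlonglongrightarrow> u x"
      using tendsto_square_AE_subseq[of "lebesgue_on \<Omega>" \<phi> u] \<phi>(2) by (auto simp: l2_inner_self)
    have E: "(\<lambda>n. grad_energy (\<phi> (s n))) \<longlonglongrightarrow> dirichlet \<Omega> u u"
      using LIMSEQ_subseq_LIMSEQ[OF dirichlet_tendsto[OF test_H1[OF \<phi>(1)] u1 \<phi>(3)] s(1)]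
      by (simp add: o_def dirichlet_grad_energy[OF \<phi>(1)])
    have "(\<lambda>n. sqrt (grad_energy (\<phi> (s n))) powr r) \<longlonglongrightarrow> sqrt (dirichlet \<Omega> u u) powr r"
      using r by (intro tendsto_powr' tendsto_intros E) (auto simp: dirichlet_nonneg grad_energy_nonneg)
    then have L: "(\<lambda>n. K * sqrt (grad_energy (\<phi> (s n))) powr r) \<longlonglongrightarrow> K * sqrt (dirichlet \<Omega> u u) powr r"
      by (rule tendsto_mult_left)
    have *: "integrable (lebesgue_on \<Omega>) (\<lambda>x. \<bar>u x\<bar> powr r) \<and>
        (\<integral>x. \<bar>u x\<bar> powr r \<partial>lebesgue_on \<Omega>) \<le> K * sqrt (dirichlet \<Omega> u u) powr r + e" if e: "e > 0" for e
    proof -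
      have 1: "integrable (lebesgue_on \<Omega>) (\<lambda>x. \<bar>\<phi> (s n) x\<bar> powr r)" for n
        using r by (intro integrable_domain test_powr_integrable[OF \<phi>(1)]) auto
      have 2: "AE x in lebesgue_on \<Omega>. (\<lambda>n. \<bar>\<phi> (s n) x\<bar> powr r) \<longlonglongrightarrow> \<bar>u x\<bar> powr r"
        using s(2)
      proof eventually_elim
        case (elim x)
        then show ?case using r by (intro tendsto_powr' tendsto_rabs tendsto_const) auto
      qed
      have le: "(\<integral>x. \<bar>\<phi> (s n) x\<bar> powr r \<partial>lebesgue_on \<Omega>) \<le> K * sqrt (grad_energy (\<phi> (s n))) powr r" for n
      proof -
        note [measurable] = test_borel[OF \<phi>(1)]
        have "(\<integral>x. \<bar>\<phi> (s n) x\<bar> powr r \<partial>lebesgue_on \<Omega>) = (\<integral>x. \<bar>\<phi> (s n) x\<bar> powr r \<partial>lborel)"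
          using r test_zero_outside[OF \<phi>(1)] by (intro integral_lebesgue_on_supp) auto
        then show ?thesis using K(2)[OF \<phi>(1)] by simp
      qed
      have "eventually (\<lambda>n. K * sqrt (grad_energy (\<phi> (s n))) powr r < K * sqrt (dirichlet \<Omega> u u) powr r + e) sequentially"
        by (rule order_tendstoD(2)[OF L]) (use e in simp)
      then have 3: "eventually (\<lambda>n. (\<integral>x. \<bar>\<phi> (s n) x\<bar> powr r \<partial>lebesgue_on \<Omega>) \<le> K * sqrt (dirichlet \<Omega> u u) powr r + e) sequentially"
        by (rule eventually_mono) (use le less_imp_le order_trans in blast)
      have 4: "(\<lambda>x. \<bar>u x\<bar> powr r) \<in> borel_measurable (lebesgue_on \<Omega>)" using um by measurable
      show ?thesis using Fatou_bound(1)[OF 1 _ 4 2 3] Fatou_bound(2)[OF 1 _ 4 2 3] by simp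
    qed
    have "integrable (lebesgue_on \<Omega>) (\<lambda>x. \<bar>u x\<bar> powr r)" using *[of 1] by simp
    moreover have "(\<integral>x. \<bar>u x\<bar> powr r \<partial>lebesgue_on \<Omega>) \<le> K * sqrt (dirichlet \<Omega> u u) powr r"
      by (rule field_le_epsilon) (use * in blast)
    ultimately show ?thesis by blast
  qed
  then show ?thesis using K(1) by blast
qed

lemma dirichlet_diff_l2:
  assumes u: "u \<in> H1 \<Omega>" and v: "v \<in> H1 \<Omega>"
  shows "dirichlet \<Omega> (\<lambda>x. u x - v x) (\<lambda>x. u x - v x) =
    l2_inner \<Omega> (\<lambda>x. weak_gradient \<Omega> u x - weak_gradient \<Omega> v x) (\<lambda>x. weak_gradient \<Omega> u x - weak_gradient \<Omega> v x)"
proof -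
  have "AE x in lebesgue_on \<Omega>. weak_gradient \<Omega> (\<lambda>x. u x - v x) x = weak_gradient \<Omega> u x - weak_gradient \<Omega> v x"
    using H1_lincomb(2)[OF u v, of "-1"] by simp
  then show ?thesis
    unfolding dirichlet_def
    by (intro l2_inner_cong_AE) (use H1_weak_gradient[OF u] H1_weak_gradient[OF v] H1_weak_gradient[OF H1_diff[OF u v]] L2_diff in auto)
qed

lemma l2_component_le:
  fixes w :: "real^'n \<Rightarrow> real^'n"
  assumes "w \<in> L2 \<Omega>" shows "l2_inner \<Omega> (\<lambda>x. w x $ i) (\<lambda>x. w x $ i) \<le> l2_inner \<Omega> w w"
  unfolding l2_inner_def
proof (rule integral_mono)
  fix x
  have "(w x $ i)\<^sup>2 \<le> (norm (w x))\<^sup>2" using component_le_norm_cart[of "w x" i] power_mono[of "\<bar>w x $ i\<bar>" "norm (w x)" 2] by simp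
  then show "w x $ i \<bullet> w x $ i \<le> w x \<bullet> w x"
    unfolding power2_norm_eq_inner by (simp add: power2_eq_square)
qed (use L2_integrable_inner[OF assms assms] L2_integrable_inner[OF L2_component[OF assms] L2_component[OF assms]] in auto)

text \<open>The identity defining weak gradients pairs \<open>w n\<close> and its gradient with
  fixed \<open>L2\<close> functions, so it survives convergence of both in
  \<open>L2\<close>.\<close>

lemma H1_limit:
  assumes w: "\<And>n::nat. w n \<in> H1 \<Omega>" and u: "u \<in> L2 \<Omega>" and D: "D \<in> L2 \<Omega>"
    and wu: "(\<lambda>n. l2_inner \<Omega> (\<lambda>x. w n x - u x) (\<lambda>x. w n x - u x)) \<longlonglongrightarrow> 0"
    and wD: "(\<lambda>n. l2_inner \<Omega> (\<lambda>x. weak_gradient \<Omega> (w n) x - D x) (\<lambda>x. weak_gradient \<Omega> (w n) x - D x)) \<longlonglongrightarrow> 0"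
  shows "u \<in> H1 \<Omega>" "(\<lambda>n. dirichlet \<Omega> (\<lambda>x. w n x - u x) (\<lambda>x. w n x - u x)) \<longlonglongrightarrow> 0"
proof -
  note ww = H1_weak_gradient[OF w]
  have "is_weak_gradient \<Omega> u D"
    unfolding is_weak_gradient_def
  proof (intro ballI allI)
    fix \<phi> i assume \<phi>: "\<phi> \<in> test_functions \<Omega>"
    have 1: "(\<lambda>n. l2_inner \<Omega> (w n) (partial_deriv i \<phi>)) \<longlonglongrightarrow> l2_inner \<Omega> u (partial_deriv i \<phi>)"
      by (rule l2_tendsto_inner[OF ww(1) u test_L2[OF test_partial[OF \<phi>]] wu])
    have c: "(\<lambda>n. l2_inner \<Omega> (\<lambda>x. weak_gradient \<Omega> (w n) x $ i - D x $ i) (\<lambda>x. weak_gradient \<Omega> (w n) x $ i - D x $ i)) \<longlonglongrightarrow> 0"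
      by (rule Lim_null_comparison[OF _ wD])
        (use l2_component_le[OF L2_diff[OF ww(2) D], of _ i] in \<open>simp add: l2_inner_nonneg\<close>)
    have 2: "(\<lambda>n. l2_inner \<Omega> (\<lambda>x. weak_gradient \<Omega> (w n) x $ i) \<phi>) \<longlonglongrightarrow> l2_inner \<Omega> (\<lambda>x. D x $ i) \<phi>"
      by (rule l2_tendsto_inner[OF L2_component[OF ww(2)] L2_component[OF D] test_L2[OF \<phi>] c])
    have "l2_inner \<Omega> (w n) (partial_deriv i \<phi>) = - l2_inner \<Omega> (\<lambda>x. weak_gradient \<Omega> (w n) x $ i) \<phi>" for n
      using ww(3)[of n] \<phi> by (simp add: is_weak_gradient_def l2_inner_def)
    then have "(\<lambda>n. l2_inner \<Omega> (w n) (partial_deriv i \<phi>)) \<longlonglongrightarrow> - l2_inner \<Omega> (\<lambda>x. D x $ i) \<phi>"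
      using tendsto_minus[OF 2] by simp
    from LIMSEQ_unique[OF 1 this]
    show "(\<integral>x. u x * partial_deriv i \<phi> x \<partial>lebesgue_on \<Omega>) = - (\<integral>x. D x $ i * \<phi> x \<partial>lebesgue_on \<Omega>)"
      by (simp add: l2_inner_def)
  qed
  note u1 = H1I[OF u D this]
  show u1': "u \<in> H1 \<Omega>" by (rule u1(1))
  have "dirichlet \<Omega> (\<lambda>x. w n x - u x) (\<lambda>x. w n x - u x) =
      l2_inner \<Omega> (\<lambda>x. weak_gradient \<Omega> (w n) x - D x) (\<lambda>x. weak_gradient \<Omega> (w n) x - D x)" for n
  proof -
    have "AE x in lebesgue_on \<Omega>. weak_gradient \<Omega> (w n) x - weak_gradient \<Omega> u x = weak_gradient \<Omega> (w n) x - D x"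
      using u1(2) by eventually_elim simp
    then show ?thesis
      unfolding dirichlet_diff_l2[OF w u1']
      by (intro l2_inner_cong_AE) (use L2_diff[OF ww(2)[of n] D] L2_diff[OF ww(2)[of n] H1_weak_gradient(2)[OF u1']] in auto)
  qed
  then show "(\<lambda>n. dirichlet \<Omega> (\<lambda>x. w n x - u x) (\<lambda>x. w n x - u x)) \<longlonglongrightarrow> 0" using wD by simp
qed

lemma grad_energy_parallelogram:
  assumes "\<phi> \<in> test_functions \<Omega>" "\<psi> \<in> test_functions \<Omega>"
  shows "grad_energy (\<lambda>x. \<phi> x - \<psi> x) + 4 * grad_energy (\<lambda>x. (1/2) * (\<phi> x + \<psi> x)) = 2 * grad_energy \<phi> + 2 * grad_energy \<psi>"
  using dirichlet_lincomb_self[OF test_H1[OF assms(1)] test_H1[OF assms(2)], of 1]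
    dirichlet_lincomb_self[OF test_H1[OF assms(1)] test_H1[OF assms(2)], of "-1"]
    grad_energy_scale[OF test_add[OF assms], of "1/2"]
  by (simp add: dirichlet_grad_energy assms test_diff test_add power2_eq_square)

text \<open>The functions \<open>w n\<close> in the proof almost minimise the gradient norm over the convex set of test functions
  within distance \<open>1 / (n + 1)\<close> of \<open>u\<close> in the square of the \<open>L\<^sup>2\<close> norm; by the parallelogram law their gradients
  form a Cauchy sequence, which replaces a weak compactness argument.\<close>

lemma H10_closed:
  assumes \<phi>: "\<And>n::nat. \<phi> n \<in> test_functions \<Omega>" and u: "u \<in> L2 \<Omega>"
    and lim: "(\<lambda>n. l2_inner \<Omega> (\<lambda>x. \<phi> n x - u x) (\<lambda>x. \<phi> n x - u x)) \<longlonglongrightarrow> 0"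
    and E: "(\<lambda>n. grad_energy (\<phi> n)) \<longlonglongrightarrow> \<beta>"
  shows "u \<in> H10 \<Omega>" "dirichlet \<Omega> u u \<le> \<beta>"
proof -
  let ?e = "\<lambda>n. inverse (real (Suc n))"
  define K where "K n = {w \<in> test_functions \<Omega>. l2_inner \<Omega> (\<lambda>x. w x - u x) (\<lambda>x. w x - u x) \<le> ?e n}" for n
  \<comment> \<open>These infima increase with \<open>n\<close> because the sets shrink, and stay
    below \<open>\<beta>\<close> because the given sequence eventually enters every set; hence they
    converge.\<close>
  define d where "d n = Inf (grad_energy ` K n)" for n
  have bdd: "bdd_below (grad_energy ` K n)" for n by (rule bdd_belowI[of _ 0]) (auto simp: grad_energy_nonneg)
  have ev: "eventually (\<lambda>k. \<phi> k \<in> K n) sequentially" for n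
  proof -
    have "eventually (\<lambda>k. l2_inner \<Omega> (\<lambda>x. \<phi> k x - u x) (\<lambda>x. \<phi> k x - u x) < ?e n) sequentially"
      by (rule order_tendstoD(2)[OF lim]) simp
    then show ?thesis by eventually_elim (simp add: K_def \<phi> less_imp_le)
  qed
  have ne: "K n \<noteq> {}" for n using eventually_happens'[OF _ ev[of n]] by auto
  have d_le: "d n \<le> \<beta>" for n
  proof (rule LIMSEQ_le_const[OF E])
    obtain N where "\<And>k. k \<ge> N \<Longrightarrow> \<phi> k \<in> K n" using ev[of n] by (auto simp: eventually_sequentially)
    then show "\<exists>N. \<forall>k\<ge>N. d n \<le> grad_energy (\<phi> k)"
      unfolding d_def by (intro exI[of _ N] allI impI cInf_lower bdd) auto
  qed
  have Kmono: "K m \<subseteq> K n" if "n \<le> m" for n m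
  proof -
    have "?e m \<le> ?e n" using that by simp
    then show ?thesis unfolding K_def by (blast intro: order_trans)
  qed
  have dmono: "d n \<le> d m" if "n \<le> m" for n m
    unfolding d_def using Kmono[OF that] ne[of m] by (intro cInf_superset_mono bdd) auto
  have "\<exists>w\<in>K n. grad_energy w < d n + ?e n" for n
    using cInf_lessD[of "grad_energy ` K n" "d n + ?e n"] ne[of n] by (auto simp: d_def)
  then obtain w where w: "\<And>n. w n \<in> K n" "\<And>n. grad_energy (w n) < d n + ?e n" by metis
  have wt: "w n \<in> test_functions \<Omega>" for n using w(1) by (auto simp: K_def)
  note w1 = test_H1[OF wt]
  have mid: "(\<lambda>x. (1/2) * (a x + b x)) \<in> K n" if "a \<in> K n" "b \<in> K n" for a b n
  proof -
    have ab: "a \<in> test_functions \<Omega>" "b \<in> test_functions \<Omega>" using that by (auto simp: K_def)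
    let ?a = "\<lambda>x. a x - u x" and ?b = "\<lambda>x. b x - u x"
    have L: "?a \<in> L2 \<Omega>" "?b \<in> L2 \<Omega>" using ab u by (auto intro: L2_diff test_L2)
    have "l2_inner \<Omega> (\<lambda>x. (1/2) *\<^sub>R (?a x + ?b x)) (\<lambda>x. (1/2) *\<^sub>R (?a x + ?b x)) =
        (1/4) * l2_inner \<Omega> (\<lambda>x. ?a x + ?b x) (\<lambda>x. ?a x + ?b x)"
      unfolding l2_inner_scale_left l2_inner_commute[of \<Omega> "\<lambda>x. ?a x + ?b x" "\<lambda>x. (1/2) *\<^sub>R (?a x + ?b x)"] by simp
    also have "\<dots> \<le> (1/4) * (2 * l2_inner \<Omega> ?a ?a + 2 * l2_inner \<Omega> ?b ?b)"
      by (rule mult_left_mono[OF l2_lincomb_bound[OF L]]) simp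
    also have "\<dots> \<le> ?e n" using that by (auto simp: K_def)
    finally have "l2_inner \<Omega> (\<lambda>x. (1/2) *\<^sub>R (?a x + ?b x)) (\<lambda>x. (1/2) *\<^sub>R (?a x + ?b x)) \<le> ?e n" .
    moreover have "(\<lambda>x. (1/2) *\<^sub>R (?a x + ?b x)) = (\<lambda>x. (1/2) * (a x + b x) - u x)" by (auto simp: field_simps)
    ultimately show ?thesis using test_scale[OF test_add[OF ab], of "1/2"] unfolding K_def by simp
  qed
  \<comment> \<open>The midpoint of \<open>w m\<close> and \<open>w n\<close> lies in the larger set
    \<open>K n\<close>, so its energy is at least \<open>d n\<close>; the parallelogram law leaves
    the increment of \<open>d\<close> and the two tolerances.\<close>
  have diff: "grad_energy (\<lambda>x. w m x - w n x) \<le> 2 * (d m - d n) + 2 * ?e n + 2 * ?e m" if "n \<le> m" for n m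
  proof -
    have "(\<lambda>x. (1/2) * (w m x + w n x)) \<in> K n" using mid w(1) Kmono[OF that] by blast
    then have "d n \<le> grad_energy (\<lambda>x. (1/2) * (w m x + w n x))" unfolding d_def by (intro cInf_lower bdd) auto
    then show ?thesis using grad_energy_parallelogram[OF wt wt, of m n] w(2)[of n] w(2)[of m] by argo
  qed
  have "incseq d" using dmono by (simp add: incseq_def)
  then have "convergent d" by (rule incseq_convergent) (use d_le in \<open>auto simp: convergent_def\<close>)
  then have Cd: "Cauchy d" by (rule convergent_Cauchy)
  have "\<exists>D\<in>L2 \<Omega>. (\<lambda>n. l2_inner \<Omega> (\<lambda>x. weak_gradient \<Omega> (w n) x - D x) (\<lambda>x. weak_gradient \<Omega> (w n) x - D x)) \<longlonglongrightarrow> 0"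
  proof (rule L2_complete[OF domain_lmeasurable H1_weak_gradient(2)[OF w1]])
    fix e :: real assume e: "e > 0"
    obtain N1 where N1: "\<And>m n. m \<ge> N1 \<Longrightarrow> n \<ge> N1 \<Longrightarrow> norm (d m - d n) < e / 6"
      using CauchyD[OF Cd, of "e/6"] e by auto
    have "eventually (\<lambda>n. ?e n < e / 6) sequentially"
      by (rule order_tendstoD(2)[OF LIMSEQ_inverse_real_of_nat]) (use e in simp)
    then obtain N2 where N2: "\<And>n. n \<ge> N2 \<Longrightarrow> ?e n < e / 6" by (auto simp: eventually_sequentially)
    have main: "grad_energy (\<lambda>x. w m x - w n x) < e" if "n \<ge> max N1 N2" "n \<le> m" for m n
    proof -
      have "d m - d n < e / 6" using N1[of m n] that abs_ge_self[of "d m - d n"] by (simp del: abs_ge_self)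
      moreover have "?e n < e / 6" "?e m < e / 6" using N2 that by auto
      ultimately have "2 * (d m - d n) + 2 * ?e n + 2 * ?e m < 2 * (e / 6) + 2 * (e / 6) + 2 * (e / 6)"
        by (intro add_strict_mono mult_strict_left_mono) auto
      then show ?thesis using diff[OF that(2)] by simp
    qed
    have sym: "grad_energy (\<lambda>x. w m x - w n x) = grad_energy (\<lambda>x. w n x - w m x)" for m n
      using grad_energy_scale[OF test_diff[OF wt wt], of "-1" m n] by simp
    have "l2_inner \<Omega> (\<lambda>x. weak_gradient \<Omega> (w m) x - weak_gradient \<Omega> (w n) x) (\<lambda>x. weak_gradient \<Omega> (w m) x - weak_gradient \<Omega> (w n) x) < e"
      if "m \<ge> max N1 N2" "n \<ge> max N1 N2" for m n
      unfolding dirichlet_diff_l2[OF w1 w1, symmetric] dirichlet_grad_energy[OF test_diff[OF wt wt]]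
      using main[of n m] main[of m n] sym[of m n] that by (cases "n \<le> m") auto
    then show "\<exists>N. \<forall>m\<ge>N. \<forall>n\<ge>N. l2_inner \<Omega> (\<lambda>x. weak_gradient \<Omega> (w m) x - weak_gradient \<Omega> (w n) x)
        (\<lambda>x. weak_gradient \<Omega> (w m) x - weak_gradient \<Omega> (w n) x) < e" by blast
  qed
  then obtain D where D: "D \<in> L2 \<Omega>"
    "(\<lambda>n. l2_inner \<Omega> (\<lambda>x. weak_gradient \<Omega> (w n) x - D x) (\<lambda>x. weak_gradient \<Omega> (w n) x - D x)) \<longlonglongrightarrow> 0" by blast
  have wu: "(\<lambda>n. l2_inner \<Omega> (\<lambda>x. w n x - u x) (\<lambda>x. w n x - u x)) \<longlonglongrightarrow> 0"
    by (rule Lim_null_comparison[OF _ LIMSEQ_inverse_real_of_nat])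
      (use w(1) in \<open>auto simp: K_def l2_inner_nonneg\<close>)
  note lim' = H1_limit[OF w1 u D(1) wu D(2)]
  show "u \<in> H10 \<Omega>" by (rule H10I[OF lim'(1) wt wu lim'(2)])
  have "(\<lambda>n. grad_energy (w n)) \<longlonglongrightarrow> dirichlet \<Omega> u u"
    using dirichlet_tendsto[OF w1 lim'] by (simp add: dirichlet_grad_energy[OF wt])
  moreover have "(\<lambda>n. \<beta> + ?e n) \<longlonglongrightarrow> \<beta> + 0" by (intro tendsto_intros LIMSEQ_inverse_real_of_nat)
  then have "(\<lambda>n. \<beta> + ?e n) \<longlonglongrightarrow> \<beta>" by simp
  moreover have "grad_energy (w n) \<le> \<beta> + ?e n" for n
    by (rule less_imp_le[OF less_le_trans[OF w(2) add_right_mono[OF d_le]]])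
  ultimately show "dirichlet \<Omega> u u \<le> \<beta>" by (intro LIMSEQ_le) auto
qed

end

context bounded_open begin

text \<open>Each \<open>u n\<close> is replaced by a test function within \<open>1 / (n + 1)\<close>
  of it in both quadratic forms. Rellich's theorem gives a limit, and \<open>H10_closed\<close> puts
  it into \<open>H10\<close> with the energy bound; the replacement does not change the limit
  \<open>\<beta>\<close> of the energies.\<close>

lemma H10_compact:
  assumes u: "\<And>n::nat. u n \<in> H10 \<Omega>" and B: "\<And>n. dirichlet \<Omega> (u n) (u n) \<le> B"
  shows "\<exists>s v \<beta>. strict_mono s \<and> v \<in> H10 \<Omega> \<and> (\<lambda>n. dirichlet \<Omega> (u (s n)) (u (s n))) \<longlonglongrightarrow> \<beta> \<and>
    dirichlet \<Omega> v v \<le> \<beta> \<and> (\<lambda>n. l2_inner \<Omega> (\<lambda>x. u (s n) x - v x) (\<lambda>x. u (s n) x - v x)) \<longlonglongrightarrow> 0"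
proof -
  let ?e = "\<lambda>n. inverse (real (Suc n))"
  note u1 = H10_H1[OF u]
  have "\<exists>\<phi>. \<phi> \<in> test_functions \<Omega> \<and> l2_inner \<Omega> (\<lambda>x. \<phi> x - u n x) (\<lambda>x. \<phi> x - u n x) < ?e n \<and>
      dirichlet \<Omega> (\<lambda>x. \<phi> x - u n x) (\<lambda>x. \<phi> x - u n x) < ?e n" for n
  proof -
    obtain \<phi> where \<phi>: "\<And>k::nat. \<phi> k \<in> test_functions \<Omega>"
      "(\<lambda>k. l2_inner \<Omega> (\<lambda>x. \<phi> k x - u n x) (\<lambda>x. \<phi> k x - u n x)) \<longlonglongrightarrow> 0"
      "(\<lambda>k. dirichlet \<Omega> (\<lambda>x. \<phi> k x - u n x) (\<lambda>x. \<phi> k x - u n x)) \<longlonglongrightarrow> 0"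
      using H10_approx[OF u[of n]] by blast
    have "eventually (\<lambda>k. l2_inner \<Omega> (\<lambda>x. \<phi> k x - u n x) (\<lambda>x. \<phi> k x - u n x) < ?e n \<and>
      dirichlet \<Omega> (\<lambda>x. \<phi> k x - u n x) (\<lambda>x. \<phi> k x - u n x) < ?e n) sequentially"
      by (rule eventually_conj; rule order_tendstoD(2), rule \<phi>(2,3)) simp_all
    from eventually_happens'[OF sequentially_bot this] obtain k where
      "l2_inner \<Omega> (\<lambda>x. \<phi> k x - u n x) (\<lambda>x. \<phi> k x - u n x) < ?e n \<and>
      dirichlet \<Omega> (\<lambda>x. \<phi> k x - u n x) (\<lambda>x. \<phi> k x - u n x) < ?e n" ..
    with \<phi>(1)[of k] show ?thesis by (intro exI[of _ "\<phi> k"] conjI) (assumption | erule conjunct1 conjunct2)+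
  qed
  from choice[OF allI[OF this]] obtain \<phi> where "\<forall>n. \<phi> n \<in> test_functions \<Omega> \<and>
    l2_inner \<Omega> (\<lambda>x. \<phi> n x - u n x) (\<lambda>x. \<phi> n x - u n x) < ?e n \<and>
    dirichlet \<Omega> (\<lambda>x. \<phi> n x - u n x) (\<lambda>x. \<phi> n x - u n x) < ?e n" ..
  then have \<phi>: "\<And>n. \<phi> n \<in> test_functions \<Omega>"
    "\<And>n. l2_inner \<Omega> (\<lambda>x. \<phi> n x - u n x) (\<lambda>x. \<phi> n x - u n x) < ?e n"
    "\<And>n. dirichlet \<Omega> (\<lambda>x. \<phi> n x - u n x) (\<lambda>x. \<phi> n x - u n x) < ?e n" by fast+
  note \<phi>1 = test_H1[OF \<phi>(1)]
  have L2s: "\<phi> n \<in> L2 \<Omega>" "u n \<in> L2 \<Omega>" for n using \<phi>(1) test_L2 u1 H1_weak_gradient(1) by blast+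
  have lim0: "(\<lambda>n. ?e n) \<longlonglongrightarrow> 0" by (rule LIMSEQ_inverse_real_of_nat)
  have Eb: "grad_energy (\<phi> n) \<le> 2 * B + 2" for n
  proof -
    have "dirichlet \<Omega> (\<phi> n) (\<phi> n) \<le> 2 * dirichlet \<Omega> (\<lambda>x. \<phi> n x - u n x) (\<lambda>x. \<phi> n x - u n x) + 2 * dirichlet \<Omega> (u n) (u n)"
      using dirichlet_add_bound[OF H1_diff[OF \<phi>1 u1] u1, of n n n] by simp
    moreover have "?e n \<le> 1" by (simp add: inverse_le_1_iff)
    ultimately show ?thesis using \<phi>(3)[of n] B[of n] dirichlet_grad_energy[OF \<phi>(1), of n] by linarith
  qed
  have "norm (dirichlet \<Omega> (u n) (u n)) \<le> B" for n using B[of n] dirichlet_nonneg[of \<Omega> "u n"] by simp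
  then have "bounded (range (\<lambda>n. dirichlet \<Omega> (u n) (u n)))" by (intro boundedI[of _ B]) auto
  then obtain \<beta> s1 where s1: "strict_mono s1" "(\<lambda>n. dirichlet \<Omega> (u (s1 n)) (u (s1 n))) \<longlonglongrightarrow> \<beta>"
    using bounded_imp_convergent_subsequence[of "\<lambda>n. dirichlet \<Omega> (u n) (u n)"] by (auto simp: o_def)
  obtain s2 v where s2: "strict_mono s2" "v \<in> L2 \<Omega>"
    "(\<lambda>n. l2_inner \<Omega> (\<lambda>x. \<phi> (s1 (s2 n)) x - v x) (\<lambda>x. \<phi> (s1 (s2 n)) x - v x)) \<longlonglongrightarrow> 0"
    using Rellich_test[of "\<lambda>n. \<phi> (s1 n)", OF \<phi>(1) Eb] by blast
  define s where "s n = s1 (s2 n)" for n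
  have s: "strict_mono s" using s1(1) s2(1) by (auto simp: strict_mono_def s_def)
  have lims: "(\<lambda>n. ?e (s n)) \<longlonglongrightarrow> 0" using LIMSEQ_subseq_LIMSEQ[OF lim0 s] by (simp add: o_def)
  have d\<beta>: "(\<lambda>n. dirichlet \<Omega> (u (s n)) (u (s n))) \<longlonglongrightarrow> \<beta>"
    using LIMSEQ_subseq_LIMSEQ[OF s1(2) s2(1)] by (simp add: s_def o_def)
  have d0: "(\<lambda>n. dirichlet \<Omega> (\<lambda>x. \<phi> (s n) x - u (s n) x) (\<lambda>x. \<phi> (s n) x - u (s n) x)) \<longlonglongrightarrow> 0"
    by (rule Lim_null_comparison[OF _ lims]) (use \<phi>(3) in \<open>auto simp: dirichlet_nonneg less_imp_le simp del: of_nat_Suc\<close>)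
  have c0: "(\<lambda>n. dirichlet \<Omega> (u (s n)) (\<lambda>x. \<phi> (s n) x - u (s n) x)) \<longlonglongrightarrow> 0"
  proof (rule Lim_null_comparison)
    let ?g = "\<lambda>n. sqrt (dirichlet \<Omega> (u (s n)) (u (s n))) * sqrt (dirichlet \<Omega> (\<lambda>x. \<phi> (s n) x - u (s n) x) (\<lambda>x. \<phi> (s n) x - u (s n) x))"
    have "?g \<longlonglongrightarrow> sqrt \<beta> * sqrt 0" by (intro tendsto_intros d\<beta> d0)
    then show "?g \<longlonglongrightarrow> 0" by simp
    show "\<forall>\<^sub>F n in sequentially. norm (dirichlet \<Omega> (u (s n)) (\<lambda>x. \<phi> (s n) x - u (s n) x)) \<le> ?g n"
      using dirichlet_Cauchy_Schwarz[OF u1 H1_diff[OF \<phi>1 u1]] by simp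
  qed
  have E: "(\<lambda>n. grad_energy (\<phi> (s n))) \<longlonglongrightarrow> \<beta>"
  proof -
    have "grad_energy (\<phi> (s n)) = dirichlet \<Omega> (u (s n)) (u (s n)) + 2 * dirichlet \<Omega> (u (s n)) (\<lambda>x. \<phi> (s n) x - u (s n) x)
       + dirichlet \<Omega> (\<lambda>x. \<phi> (s n) x - u (s n) x) (\<lambda>x. \<phi> (s n) x - u (s n) x)" for n
      using dirichlet_lincomb_self[OF u1 H1_diff[OF \<phi>1 u1], of "s n" 1 "s n" "s n"] by (simp add: dirichlet_grad_energy[OF \<phi>(1)])
    moreover have "(\<lambda>n. dirichlet \<Omega> (u (s n)) (u (s n)) + 2 * dirichlet \<Omega> (u (s n)) (\<lambda>x. \<phi> (s n) x - u (s n) x)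
       + dirichlet \<Omega> (\<lambda>x. \<phi> (s n) x - u (s n) x) (\<lambda>x. \<phi> (s n) x - u (s n) x)) \<longlonglongrightarrow> \<beta> + 2 * 0 + 0"
      by (intro tendsto_intros d\<beta> d0 c0)
    ultimately show ?thesis by simp
  qed
  note cl = H10_closed[OF \<phi>(1) s2(2) s2(3)[folded s_def] E]
  have "(\<lambda>n. l2_inner \<Omega> (\<lambda>x. u (s n) x - v x) (\<lambda>x. u (s n) x - v x)) \<longlonglongrightarrow> 0"
  proof (rule Lim_null_comparison)
    let ?g = "\<lambda>n. 2 * l2_inner \<Omega> (\<lambda>x. \<phi> (s n) x - v x) (\<lambda>x. \<phi> (s n) x - v x) + 2 * ?e (s n)"
    have "?g \<longlonglongrightarrow> 2 * 0 + 2 * 0" by (intro tendsto_intros lims s2(3)[folded s_def])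
    then show "?g \<longlonglongrightarrow> 0" by simp
    have "l2_inner \<Omega> (\<lambda>x. u (s n) x - v x) (\<lambda>x. u (s n) x - v x) \<le> ?g n" for n
    proof -
      have "l2_inner \<Omega> (\<lambda>x. (\<phi> (s n) x - v x) + (u (s n) x - \<phi> (s n) x)) (\<lambda>x. (\<phi> (s n) x - v x) + (u (s n) x - \<phi> (s n) x))
          \<le> 2 * l2_inner \<Omega> (\<lambda>x. \<phi> (s n) x - v x) (\<lambda>x. \<phi> (s n) x - v x)
           + 2 * l2_inner \<Omega> (\<lambda>x. u (s n) x - \<phi> (s n) x) (\<lambda>x. u (s n) x - \<phi> (s n) x)"
        by (rule l2_lincomb_bound[OF L2_diff[OF L2s(1) s2(2)] L2_diff[OF L2s(2) L2s(1)]])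
      moreover have "l2_inner \<Omega> (\<lambda>x. u (s n) x - \<phi> (s n) x) (\<lambda>x. u (s n) x - \<phi> (s n) x)
          = l2_inner \<Omega> (\<lambda>x. \<phi> (s n) x - u (s n) x) (\<lambda>x. \<phi> (s n) x - u (s n) x)"
        unfolding l2_inner_self by (simp add: power2_commute)
      ultimately show ?thesis using \<phi>(2)[of "s n"] by simp
    qed
    then show "\<forall>\<^sub>F n in sequentially. norm (l2_inner \<Omega> (\<lambda>x. u (s n) x - v x) (\<lambda>x. u (s n) x - v x)) \<le> ?g n"
      by (simp add: l2_inner_nonneg del: of_nat_Suc)
  qed
  then show ?thesis using s cl d\<beta> by blast
qed

text \<open>As \<open>r\<close> is strictly subcritical, the powers \<open>r + \<delta>\<close> stay
  bounded for a small \<open>\<delta>\<close>. Values above \<open>M\<close> cost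
  \<open>M powr - \<delta>\<close> times this bound, those below cost \<open>M powr (r - 2)\<close>
  times the square integral; \<open>M\<close> is fixed first, then \<open>n\<close>.\<close>

lemma interpolation:
  assumes w: "\<And>n::nat. w n \<in> H10 \<Omega>" and B: "\<And>n. dirichlet \<Omega> (w n) (w n) \<le> B"
    and lim: "(\<lambda>n. l2_inner \<Omega> (w n) (w n)) \<longlonglongrightarrow> 0"
    and r: "r \<ge> 2" and sub: "r * (real CARD('n) - 2) < 2 * real CARD('n)"
  shows "(\<lambda>n. \<integral>x. \<bar>w n x\<bar> powr r \<partial>lebesgue_on \<Omega>) \<longlonglongrightarrow> 0"
proof -
  let ?N = "real CARD('n)"
  have N: "?N \<ge> 1" using zero_less_card_finite[where 'a='n] by linarith
  \<comment> \<open>The gap in the subcriticality condition divided by \<open>2 * N\<close>: as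
    \<open>N - 2 < 2 * N\<close>, the increase of the left side is less than the gap in every
    dimension.\<close>
  define \<delta> where "\<delta> = (2 * ?N - r * (?N - 2)) / (2 * ?N)"
  have \<delta>: "\<delta> > 0" using sub N by (simp add: \<delta>_def)
  have "\<delta> * (?N - 2) < 2 * ?N - r * (?N - 2)"
  proof -
    have "\<delta> * (?N - 2) < \<delta> * (2 * ?N)" using \<delta> N by (intro mult_strict_left_mono) auto
    then show ?thesis using N by (simp add: \<delta>_def)
  qed
  then have sub': "(r + \<delta>) * (?N - 2) < 2 * ?N" by (simp add: algebra_simps)
  obtain K where K: "K > 0" "\<And>u. u \<in> H10 \<Omega> \<Longrightarrow> integrable (lebesgue_on \<Omega>) (\<lambda>x. \<bar>u x\<bar> powr (r + \<delta>))"
    "\<And>u. u \<in> H10 \<Omega> \<Longrightarrow> (\<integral>x. \<bar>u x\<bar> powr (r + \<delta>) \<partial>lebesgue_on \<Omega>) \<le> K * sqrt (dirichlet \<Omega> u u) powr (r + \<delta>)"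
    using Sobolev_H10[OF _ sub'] r \<delta> by auto
  have ir: "integrable (lebesgue_on \<Omega>) (\<lambda>x. \<bar>w n x\<bar> powr r)" for n
    using Sobolev_H10[OF r sub] w by blast
  have i2: "integrable (lebesgue_on \<Omega>) (\<lambda>x. (w n x)\<^sup>2)" for n
    using H1_weak_gradient(1)[OF H10_H1[OF w]] by (simp add: L2_def)
  define C where "C = K * sqrt B powr (r + \<delta>)"
  have B0: "B \<ge> 0" using B[of 0] dirichlet_nonneg[of \<Omega> "w 0"] by simp
  have C: "C \<ge> 0" using K(1) by (simp add: C_def)
  have Cb: "(\<integral>x. \<bar>w n x\<bar> powr (r + \<delta>) \<partial>lebesgue_on \<Omega>) \<le> C" for n
  proof -
    have "sqrt (dirichlet \<Omega> (w n) (w n)) powr (r + \<delta>) \<le> sqrt B powr (r + \<delta>)"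
      using B r \<delta> by (intro powr_mono2) (auto simp: dirichlet_nonneg)
    then show ?thesis using K(1) K(3)[OF w, of n] unfolding C_def by (meson mult_left_mono less_imp_le order_trans)
  qed
  have est: "(\<integral>x. \<bar>w n x\<bar> powr r \<partial>lebesgue_on \<Omega>) \<le> M powr (-\<delta>) * C + M powr (r - 2) * l2_inner \<Omega> (w n) (w n)" if M: "M > 0" for M n
  proof -
    have "(\<integral>x. \<bar>w n x\<bar> powr r \<partial>lebesgue_on \<Omega>) \<le> (\<integral>x. M powr (-\<delta>) * \<bar>w n x\<bar> powr (r + \<delta>) + M powr (r - 2) * (w n x)\<^sup>2 \<partial>lebesgue_on \<Omega>)"
    proof (rule integral_mono)
      fix x
      let ?y = "\<bar>w n x\<bar>"
      show "?y powr r \<le> M powr (-\<delta>) * ?y powr (r + \<delta>) + M powr (r - 2) * (w n x)\<^sup>2"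
      proof (cases "?y < M")
        case True
        have "?y powr r = ?y powr (r - 2) * ?y\<^sup>2"
          using r by (cases "?y = 0") (auto simp: powr_diff powr_numeral)
        also have "\<dots> \<le> M powr (r - 2) * ?y\<^sup>2"
          using True r by (intro mult_right_mono powr_mono2) auto
        finally show ?thesis by (simp add: add_increasing)
      next
        case False
        have "?y powr r = ?y powr (-\<delta>) * ?y powr (r + \<delta>)" by (simp flip: powr_add)
        also have "\<dots> \<le> M powr (-\<delta>) * ?y powr (r + \<delta>)"
          using False M \<delta> by (intro mult_right_mono powr_mono2') auto
        finally show ?thesis by (simp add: add_increasing2)
      qed
    qed (use ir i2 K(2)[OF w] in auto)
    also have "\<dots> = M powr (-\<delta>) * (\<integral>x. \<bar>w n x\<bar> powr (r + \<delta>) \<partial>lebesgue_on \<Omega>) + M powr (r - 2) * l2_inner \<Omega> (w n) (w n)"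
      using i2 K(2)[OF w] by (simp add: l2_inner_self)
    also have "\<dots> \<le> M powr (-\<delta>) * C + M powr (r - 2) * l2_inner \<Omega> (w n) (w n)"
      using Cb[of n] by (simp add: mult_left_mono)
    finally show ?thesis .
  qed
  show ?thesis
  proof (rule LIMSEQ_I)
    fix e :: real assume e: "e > 0"
    have "((\<lambda>M. M powr (-\<delta>) * C) \<longlongrightarrow> 0 * C) at_top"
      by (intro tendsto_intros tendsto_neg_powr filterlim_ident) (use \<delta> in auto)
    then have "eventually (\<lambda>M. M powr (-\<delta>) * C < e / 2) at_top"
      by (rule order_tendstoD(2)) (use e in simp)
    then have "eventually (\<lambda>M. M powr (-\<delta>) * C < e / 2 \<and> M > 0) at_top"
      by (intro eventually_conj eventually_gt_at_top)
    then obtain M where M: "M > 0" "M powr (-\<delta>) * C < e / 2"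
      by (auto simp: eventually_at_top_linorder)
    have "(\<lambda>n. M powr (r - 2) * l2_inner \<Omega> (w n) (w n)) \<longlonglongrightarrow> M powr (r - 2) * 0" by (intro tendsto_intros lim)
    then have "eventually (\<lambda>n. M powr (r - 2) * l2_inner \<Omega> (w n) (w n) < e / 2) sequentially"
      by (rule order_tendstoD(2)) (use e in simp)
    then obtain n0 where n0: "\<And>n. n \<ge> n0 \<Longrightarrow> M powr (r - 2) * l2_inner \<Omega> (w n) (w n) < e / 2"
      by (auto simp: eventually_sequentially)
    have "(\<integral>x. \<bar>w n x\<bar> powr r \<partial>lebesgue_on \<Omega>) < e" if "n \<ge> n0" for n
      using est[OF M(1), of n] M(2) n0[OF that] by linarith
    then show "\<exists>no. \<forall>n\<ge>no. norm ((\<integral>x. \<bar>w n x\<bar> powr r \<partial>lebesgue_on \<Omega>) - 0) < e"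
      by (intro exI[of _ n0]) (simp add: abs_of_nonneg Bochner_Integration.integral_nonneg)
  qed
qed

end

section \<open>The nonlinearity\<close>

text \<open>The quotient \<open>g y / y\<close> is strictly increasing. With \<open>k\<close> its
  value at \<open>s\<close>, the derivative \<open>g y - k * y\<close> of
  \<open>G y - k * y^2 / 2\<close> is negative before \<open>s\<close> and positive after it, so
  \<open>s\<close> is the strict minimum on the half line.\<close>

lemma quadratic_minorant:
  fixes G g g' :: "real \<Rightarrow> real"
  assumes G: "\<And>y. (G has_real_derivative g y) (at y)" and g: "\<And>y. (g has_real_derivative g' y) (at y)"
    and super: "\<And>y. y > 0 \<Longrightarrow> g y < g' y * y" and s: "s > 0" and z: "z \<ge> 0" "z \<noteq> s"
  shows "G z - G s > g s / s * (z\<^sup>2 - s\<^sup>2) / 2"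
proof -
  have q: "g a / a < g b / b" if "0 < a" "a < b" for a b
  proof (rule DERIV_pos_imp_increasing[OF that(2), of "\<lambda>y. g y / y"])
    fix x assume "a \<le> x" "x \<le> b"
    then have x: "x > 0" using that by simp
    have "((\<lambda>y. g y / y) has_real_derivative (g' x * x - g x * 1) / (x * x)) (at x)"
      by (rule DERIV_divide[OF g DERIV_ident]) (use x in simp)
    then show "\<exists>y. ((\<lambda>y. g y / y) has_real_derivative y) (at x) \<and> 0 < y" using super[OF x] x by force
  qed
  define k where "k = g s / s"
  have H: "((\<lambda>y. G y - k * y\<^sup>2 / 2) has_real_derivative (g y - k * y)) (at y)" for y
    by (auto intro!: derivative_eq_intros G)
  have cont: "continuous_on A (\<lambda>y. G y - k * y\<^sup>2 / 2)" for A
    by (rule DERIV_continuous_on) (use H in \<open>blast intro: has_field_derivative_at_within\<close>)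
  have "G s - k * s\<^sup>2 / 2 < G z - k * z\<^sup>2 / 2"
  proof (cases "z > s")
    case True
    show ?thesis
    proof (rule DERIV_pos_imp_increasing_open[OF True _ cont])
      fix x assume x: "s < x" "x < z"
      have "g x - k * x > 0" using q[OF s x(1)] s x by (simp add: k_def field_simps)
      then show "\<exists>y. ((\<lambda>y. G y - k * y\<^sup>2 / 2) has_real_derivative y) (at x) \<and> 0 < y" using H by blast
    qed
  next
    case False
    then have zs: "z < s" using z by simp
    show ?thesis
    proof (rule DERIV_neg_imp_decreasing_open[OF zs _ cont])
      fix x assume x: "z < x" "x < s"
      then have x0: "x > 0" using z by simp
      have "g x - k * x < 0" using q[OF x0 x(2)] s x0 by (simp add: k_def field_simps)
      then show "\<exists>y. ((\<lambda>y. G y - k * y\<^sup>2 / 2) has_real_derivative y) (at x) \<and> y < 0" using H by blast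
    qed
  qed
  then show ?thesis by (simp add: k_def algebra_simps diff_divide_distrib)
qed

text \<open>The function \<open>g y * y powr - (1 + \<delta>)\<close> is nondecreasing, so beyond 1
  \<open>g\<close> grows at least like \<open>y powr (1 + \<delta>)\<close> and overtakes every
  linear function; comparison of derivatives beyond that point gives the quadratic bound.\<close>

lemma superquadratic_minorant:
  fixes G g g' :: "real \<Rightarrow> real"
  assumes G: "\<And>y. (G has_real_derivative g y) (at y)" and g: "\<And>y. (g has_real_derivative g' y) (at y)"
    and pos: "\<And>y. y > 0 \<Longrightarrow> 0 < g y" and super: "\<And>y. y > 0 \<Longrightarrow> (1 + \<delta>) * g y \<le> g' y * y" and \<delta>: "\<delta> > 0"
    and G0: "G 0 = 0" and K: "K \<ge> 0"
  shows "\<exists>C\<ge>0. \<forall>y\<ge>0. G y \<ge> K * y\<^sup>2 - C"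
proof -
  have q: "g 1 * y powr (1 + \<delta>) \<le> g y" if "y \<ge> 1" for y
  proof -
    have "g 1 * 1 powr - (1 + \<delta>) \<le> g y * y powr - (1 + \<delta>)"
    proof (rule DERIV_nonneg_imp_nondecreasing[OF that, of "\<lambda>y. g y * y powr - (1 + \<delta>)"])
      fix x :: real assume "1 \<le> x" "x \<le> y"
      then have x: "x > 0" by simp
      have "((\<lambda>y. g y * y powr - (1 + \<delta>)) has_real_derivative
          g x * (- (1 + \<delta>) * x powr (- (1 + \<delta>) - 1)) + g' x * x powr - (1 + \<delta>)) (at x)"
        by (rule DERIV_mult'[OF g has_real_derivative_powr[OF x]])
      moreover have "g x * (- (1 + \<delta>) * x powr (- (1 + \<delta>) - 1)) + g' x * x powr - (1 + \<delta>)
          = x powr (- (1 + \<delta>) - 1) * (g' x * x - (1 + \<delta>) * g x)"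
      proof -
        have "x powr - (1 + \<delta>) = x powr (- (1 + \<delta>) - 1 + 1)" by simp
        also have "\<dots> = x powr (- (1 + \<delta>) - 1) * x" using x by (subst powr_add) simp
        finally show ?thesis by (simp add: algebra_simps)
      qed
      ultimately show "\<exists>d. ((\<lambda>y. g y * y powr - (1 + \<delta>)) has_real_derivative d) (at x) \<and> 0 \<le> d"
        using super[OF x] by (intro exI conjI) (auto intro!: mult_nonneg_nonneg)
    qed
    then have "g 1 \<le> g y * inverse (y powr (1 + \<delta>))" unfolding powr_minus by simp
    then show ?thesis using that by (simp add: field_simps)
  qed
  \<comment> \<open>From here on \<open>g 1 * y powr \<delta>\<close> is at least
    \<open>2 * K\<close>; the constant in the conclusion is \<open>K * Y^2\<close>.\<close>
  define Y where "Y = max 1 ((2 * K / g 1) powr (1 / \<delta>))"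
  have Y: "Y \<ge> 1" by (simp add: Y_def)
  have big: "2 * K * y \<le> g y" if "y \<ge> Y" for y
  proof -
    have y: "y \<ge> 1" using Y that by simp
    have "2 * K / g 1 = ((2 * K / g 1) powr (1 / \<delta>)) powr \<delta>"
      using \<delta> K pos[of 1] by (simp add: powr_powr)
    also have "\<dots> \<le> y powr \<delta>" using that \<delta> by (intro powr_mono2) (auto simp: Y_def)
    finally have "2 * K \<le> g 1 * y powr \<delta>" using pos[of 1] by (simp add: field_simps)
    then have "2 * K * y \<le> g 1 * y powr \<delta> * y" using y by (intro mult_right_mono) auto
    also have "\<dots> = g 1 * y powr (1 + \<delta>)" using y by (simp add: powr_add)
    finally show ?thesis using q[OF y] by simp
  qed
  have cG: "continuous_on A G" for A
    by (rule DERIV_continuous_on) (use G in \<open>blast intro: has_field_derivative_at_within\<close>)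
  have Gnn: "0 \<le> G y" if y: "y \<ge> 0" for y
  proof (cases "y = 0")
    case False
    then have "0 < y" using that by simp
    then have "G 0 < G y"
      by (rule DERIV_pos_imp_increasing_open[OF _ _ cG]) (use G pos in blast)
    then show ?thesis using G0 by simp
  qed (use G0 in simp)
  have "G y \<ge> K * y\<^sup>2 - K * Y\<^sup>2" if y: "y \<ge> 0" for y
  proof (cases "y \<le> Y")
    case True
    then have "K * y\<^sup>2 \<le> K * Y\<^sup>2" using y K by (intro mult_left_mono power_mono) auto
    then show ?thesis using Gnn[OF y] by simp
  next
    case False
    then have "Y \<le> y" by simp
    then have "G Y - K * Y\<^sup>2 \<le> G y - K * y\<^sup>2"
    proof (rule DERIV_nonneg_imp_nondecreasing[of _ _ "\<lambda>y. G y - K * y\<^sup>2"])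
      fix x assume x: "Y \<le> x" "x \<le> y"
      have "((\<lambda>y. G y - K * y\<^sup>2) has_real_derivative g x - 2 * K * x) (at x)"
        by (auto intro!: derivative_eq_intros G)
      then show "\<exists>d. ((\<lambda>y. G y - K * y\<^sup>2) has_real_derivative d) (at x) \<and> 0 \<le> d"
        using big[OF x(1)] by force
    qed
    then show ?thesis using Gnn[of Y] Y by simp
  qed
  moreover have "0 \<le> K * Y\<^sup>2" using K by simp
  ultimately show ?thesis by blast
qed

locale nonlinearity =
  fixes f :: "real \<Rightarrow> real" and p C \<delta> :: real
  assumes f_C1: "f C1_differentiable_on UNIV" and f_small: "f \<in> o[at 0](\<lambda>s. s)"
    and p_gt_1: "p > 1" and C_pos: "C > 0"
    and f_growth: "\<And>s. \<bar>deriv f s\<bar> \<le> C * (1 + \<bar>s\<bar> powr (p - 1))"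
    and delta_pos: "\<delta> > 0"
    and f_super: "\<And>s. s \<noteq> 0 \<Longrightarrow> 0 < (1 + \<delta>) * f s * s \<and> (1 + \<delta>) * f s * s \<le> deriv f s * s\<^sup>2"
begin

abbreviation "F \<equiv> primitive f"

lemma f_deriv: "(f has_real_derivative deriv f s) (at s)"
proof -
  obtain D where "(f has_vector_derivative D) (at s)"
    using f_C1 unfolding C1_differentiable_on_def by blast
  then have "(f has_real_derivative D) (at s)" by (simp add: has_real_derivative_iff_has_vector_derivative)
  then show ?thesis by (metis DERIV_imp_deriv)
qed

lemma f_cont: "continuous_on A f"
  by (rule DERIV_continuous_on) (use f_deriv in \<open>blast intro: has_field_derivative_at_within\<close>)

text \<open>The Landau condition says nothing about the value at 0 itself; continuity supplies
  it.\<close>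

lemma f_0: "f 0 = 0"
proof -
  have "(\<lambda>s. f s / s) \<midarrow>0\<rightarrow> 0" by (rule smalloD_tendsto[OF f_small])
  then have "(\<lambda>s. f s / s * s) \<midarrow>0\<rightarrow> 0 * 0" by (intro tendsto_intros)
  then have "(\<lambda>s. f s / s * s) \<midarrow>0\<rightarrow> 0" by (simp only: mult_zero_left)
  then have "f \<midarrow>0\<rightarrow> 0"
    by (rule Lim_transform_eventually) (auto simp: eventually_at_filter)
  moreover have "f \<midarrow>0\<rightarrow> f 0" using f_cont[of UNIV] by (simp add: continuous_on_eq_continuous_at isCont_def)
  ultimately show ?thesis by (rule LIM_unique[symmetric])
qed

lemma F_deriv: "(F has_real_derivative f s) (at s)"
proof -
  define a where "a = - \<bar>s\<bar> - 1"
  define b where "b = \<bar>s\<bar> + 1"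
  have "((\<lambda>u. LBINT y=ereal 0..ereal u. f y) has_vector_derivative f s) (at s within {a..b})"
    by (rule interval_integral_FTC2) (auto simp: a_def b_def f_cont)
  moreover have "at s within {a..b} = at s" by (rule at_within_Icc_at) (auto simp: a_def b_def)
  ultimately show ?thesis
    by (simp add: has_real_derivative_iff_has_vector_derivative primitive_def[abs_def])
qed

lemma F_0: "F 0 = 0" by (simp add: primitive_def zero_ereal_def)

lemma F_cont: "continuous_on A F"
  by (rule DERIV_continuous_on) (use F_deriv in \<open>blast intro: has_field_derivative_at_within\<close>)

lemma f_sign: "s \<noteq> 0 \<Longrightarrow> 0 < f s * s"
  using f_super[of s] delta_pos by (simp add: zero_less_mult_iff mult.assoc)

context fixes \<sigma> :: real assumes \<sigma>: "\<sigma> = 1 \<or> \<sigma> = - 1" begin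

text \<open>For \<open>\<sigma> = -1\<close> the reflected function
  \<open>\<sigma> * f (\<sigma> * y)\<close> inherits the conditions on \<open>f\<close>, so that
  the minorants proved for positive arguments cover negative ones as well.\<close>

lemma reflect_derivs:
  "((\<lambda>y. F (\<sigma> * y)) has_real_derivative \<sigma> * f (\<sigma> * y)) (at y)"
  "((\<lambda>y. \<sigma> * f (\<sigma> * y)) has_real_derivative deriv f (\<sigma> * y)) (at y)"
proof -
  have "((\<lambda>y. F (\<sigma> * y)) has_real_derivative f (\<sigma> * y) * \<sigma>) (at y)"
    by (rule DERIV_chain2[OF F_deriv]) (auto intro!: derivative_eq_intros)
  then show "((\<lambda>y. F (\<sigma> * y)) has_real_derivative \<sigma> * f (\<sigma> * y)) (at y)" by (simp add: mult.commute)
  have "((\<lambda>y. f (\<sigma> * y)) has_real_derivative deriv f (\<sigma> * y) * \<sigma>) (at y)"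
    by (rule DERIV_chain2[OF f_deriv]) (auto intro!: derivative_eq_intros)
  then have "((\<lambda>y. \<sigma> * f (\<sigma> * y)) has_real_derivative \<sigma> * (deriv f (\<sigma> * y) * \<sigma>)) (at y)"
    by (rule DERIV_cmult)
  then show "((\<lambda>y. \<sigma> * f (\<sigma> * y)) has_real_derivative deriv f (\<sigma> * y)) (at y)" using \<sigma> by auto
qed

lemma reflect_super:
  assumes "y > 0"
  shows "0 < \<sigma> * f (\<sigma> * y)" "(1 + \<delta>) * (\<sigma> * f (\<sigma> * y)) \<le> deriv f (\<sigma> * y) * y"
    "\<sigma> * f (\<sigma> * y) < deriv f (\<sigma> * y) * y"
proof -
  have ne: "\<sigma> * y \<noteq> 0" and s2: "\<sigma> * \<sigma> = 1" using \<sigma> assms by auto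
  have "0 < f (\<sigma> * y) * (\<sigma> * y)" by (rule f_sign[OF ne])
  then show a: "0 < \<sigma> * f (\<sigma> * y)" using assms \<sigma> by (auto simp: zero_less_mult_iff)
  have "(1 + \<delta>) * f (\<sigma> * y) * (\<sigma> * y) \<le> deriv f (\<sigma> * y) * (\<sigma> * y)\<^sup>2" using f_super[OF ne] by simp
  then have "(1 + \<delta>) * (\<sigma> * f (\<sigma> * y)) * y \<le> (deriv f (\<sigma> * y) * y) * y"
    using \<sigma> by (auto simp: power2_eq_square algebra_simps)
  then show b: "(1 + \<delta>) * (\<sigma> * f (\<sigma> * y)) \<le> deriv f (\<sigma> * y) * y" using assms by simp
  have "0 < \<delta> * (\<sigma> * f (\<sigma> * y))" using a delta_pos by simp
  then show "\<sigma> * f (\<sigma> * y) < deriv f (\<sigma> * y) * y" using b by (simp add: distrib_right)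
qed

end

lemma F_superquadratic:
  assumes K: "K \<ge> 0" shows "\<exists>C\<ge>0. \<forall>s. F s \<ge> K * s\<^sup>2 - C"
proof -
  have "\<exists>C\<ge>0. \<forall>y\<ge>0. F (\<sigma> * y) \<ge> K * y\<^sup>2 - C" if \<sigma>: "\<sigma> = 1 \<or> \<sigma> = - 1" for \<sigma>
    by (rule superquadratic_minorant[OF reflect_derivs[OF \<sigma>] reflect_super(1)[OF \<sigma>] reflect_super(2)[OF \<sigma>] delta_pos _ K])
      (use F_0 in auto)
  from this[of 1] this[of "-1"] obtain C1 C2 where C: "C1 \<ge> 0" "C2 \<ge> 0"
    "\<And>y. y \<ge> 0 \<Longrightarrow> F y \<ge> K * y\<^sup>2 - C1" "\<And>y. y \<ge> 0 \<Longrightarrow> F (- y) \<ge> K * y\<^sup>2 - C2" by auto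
  have "F s \<ge> K * s\<^sup>2 - max C1 C2" for s
    using C(3)[of s] C(4)[of "- s"] by (cases "s \<ge> 0") (auto simp: max_def)
  then show ?thesis using C(1) by (intro exI[of _ "max C1 C2"]) auto
qed

lemma F_nonneg: "0 \<le> F s"
proof -
  have nn: "0 \<le> F (\<sigma> * y)" if \<sigma>: "\<sigma> = 1 \<or> \<sigma> = - 1" and y: "y > 0" for \<sigma> y
  proof -
    have c: "continuous_on {0..y} (\<lambda>y. F (\<sigma> * y))"
      by (rule DERIV_continuous_on) (use reflect_derivs(1)[OF \<sigma>] in \<open>blast intro: has_field_derivative_at_within\<close>)
    have "F (\<sigma> * 0) < F (\<sigma> * y)"
      by (rule DERIV_pos_imp_increasing_open[OF y _ c]) (use reflect_derivs(1)[OF \<sigma>] reflect_super(1)[OF \<sigma>] in blast)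
    then show ?thesis using F_0 by simp
  qed
  show ?thesis
    using nn[of 1 s] nn[of "-1" "- s"] F_0 by (cases s "0::real" rule: linorder_cases) auto
qed

text \<open>The inequality of Szulkin and Weth behind the maximality of critical points.\<close>

lemma F_fibre:
  assumes t: "t \<ge> 0"
  shows "f s * ((t\<^sup>2 - 1) / 2 * s + t * r) + F s - F (t * s + r) \<le> 0"
    "s \<noteq> 0 \<Longrightarrow> t \<noteq> 1 \<Longrightarrow> r = 0 \<Longrightarrow> f s * ((t\<^sup>2 - 1) / 2 * s + t * r) + F s - F (t * s + r) < 0"
proof -
  let ?E = "f s * ((t\<^sup>2 - 1) / 2 * s + t * r) + F s - F (t * s + r)"
  have main: "?E \<le> 0 \<and> (t \<noteq> 1 \<longrightarrow> r = 0 \<longrightarrow> ?E < 0)" if s: "s \<noteq> 0"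
  proof -
    define \<sigma> where "\<sigma> = sgn s"
    have \<sigma>: "\<sigma> = 1 \<or> \<sigma> = - 1" and abs: "\<sigma> * \<bar>s\<bar> = s" using s by (auto simp: \<sigma>_def sgn_if)
    have s2: "\<sigma> * (\<sigma> * x) = x" for x using \<sigma> by auto
    define z where "z = t * s + r"
    have fs: "f s * s > 0" by (rule f_sign[OF s])
    have minor: "F (\<sigma> * y) - F s > (\<sigma> * f s) / \<bar>s\<bar> * (y\<^sup>2 - s\<^sup>2) / 2" if "y \<ge> 0" "y \<noteq> \<bar>s\<bar>" for y
      using quadratic_minorant[OF reflect_derivs[OF \<sigma>] reflect_super(3)[OF \<sigma>], of "\<bar>s\<bar>" y] that s abs by simp
    have k: "(\<sigma> * f s) / \<bar>s\<bar> = f s / s" using \<sigma> abs s by (auto simp: field_simps)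
    have kpos: "f s / s > 0" using fs s by (simp add: zero_less_divide_iff zero_less_mult_iff)
    show ?thesis
    proof (cases "\<sigma> * z \<ge> 0")
      case True
      have sq: "(\<sigma> * z)\<^sup>2 = z\<^sup>2" using \<sigma> by auto
      \<comment> \<open>Bounding \<open>F\<close> below by its quadratic minorant at
        \<open>s\<close> completes the square: only \<open>- (f s / s) * r^2 / 2\<close>
        survives.\<close>
      have id: "f s * ((t\<^sup>2 - 1) / 2 * s + t * r) - f s / s * (z\<^sup>2 - s\<^sup>2) / 2 = - (f s / s * r\<^sup>2 / 2)"
        using s by (simp add: z_def power2_eq_square field_simps)
      have nn: "f s / s * r\<^sup>2 / 2 \<ge> 0"
        by (rule divide_nonneg_nonneg[OF mult_nonneg_nonneg]) (use kpos in auto)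
      show ?thesis
      proof (cases "z = s")
        case True
        have "r = 0 \<longrightarrow> t = 1" using True s by (auto simp: z_def)
        then show ?thesis using id nn True by (auto simp: z_def)
      next
        case False
        have "\<sigma> * z \<noteq> \<bar>s\<bar>" using False \<sigma> abs s2[of z] by metis
        then have "F z - F s > f s / s * (z\<^sup>2 - s\<^sup>2) / 2"
          using minor[OF True] unfolding s2 sq k by simp
        then show ?thesis using id nn unfolding z_def by linarith
      qed
    next
      case False
      \<comment> \<open>When \<open>z\<close> has the opposite sign of \<open>s\<close>, the
        expression equals \<open>t * f s * z\<close> minus \<open>t^2 * f s * s / 2\<close>, plus
        \<open>F s - f s * s / 2\<close>, minus \<open>F z\<close>; no term is positive, and the one
        with \<open>F s\<close> is negative.\<close>
      have "F s < f s * s / 2"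
      proof -
        have "F 0 - F s > f s / s * (0 - s\<^sup>2) / 2" using minor[of 0] s unfolding k by simp
        then show ?thesis using s F_0 by (simp add: power2_eq_square)
      qed
      moreover have "f s * z < 0"
      proof -
        have "f s * z * (\<sigma> * \<sigma>) * \<bar>s\<bar> = (f s * s) * (\<sigma> * z)" using abs by (metis mult.assoc mult.commute)
        also have "\<dots> < 0" using False by (intro mult_pos_neg[OF fs]) simp
        finally have "f s * z * (\<sigma> * \<sigma>) * \<bar>s\<bar> < 0" .
        moreover have "\<sigma> * \<sigma> = 1" using \<sigma> by auto
        ultimately have "f s * z * \<bar>s\<bar> < 0" by simp
        then show ?thesis using s by (simp only: mult_less_0_iff[of "f s * z" "\<bar>s\<bar>"]) simp
      qed
      then have "t * (f s * z) \<le> 0" using t by (simp add: mult_nonneg_nonpos)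
      moreover have "t\<^sup>2 * (f s * s) / 2 \<ge> 0" using fs by simp
      moreover have "f s * ((t\<^sup>2 - 1) / 2 * s + t * r) + f s * s / 2 = t * (f s * z) - t\<^sup>2 * (f s * s) / 2"
        by (simp add: z_def power2_eq_square field_simps)
      ultimately have "?E < 0" using F_nonneg[of z] unfolding z_def by linarith
      then show ?thesis using less_imp_le by blast
    qed
  qed
  show "?E \<le> 0"
    using main F_nonneg[of r] by (cases "s = 0") (auto simp: f_0 F_0)
  show "s \<noteq> 0 \<Longrightarrow> t \<noteq> 1 \<Longrightarrow> r = 0 \<Longrightarrow> ?E < 0" using main by blast
qed

text \<open>A common majorant: its integral is controlled by the embeddings with exponents 2 and
  \<open>p + 1\<close>, and all products in the Taylor estimates below are bounded by sums of
  weights.\<close>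

definition weight :: "real \<Rightarrow> real" where
  "weight s = s\<^sup>2 + \<bar>s\<bar> powr (p + 1)"

lemma weight_nonneg: "0 \<le> weight s" by (simp add: weight_def)

lemma powr_max_bound: "0 \<le> a \<Longrightarrow> 0 \<le> b \<Longrightarrow> 0 \<le> e \<Longrightarrow> (max a b) powr e \<le> a powr e + b powr e" for a b e :: real
  by (auto simp: max_def)

text \<open>Products with the higher power are estimated by replacing every factor by the largest
  one, which gives a pure power \<open>p + 1\<close>.\<close>

lemma weight_products:
  "\<bar>r\<bar> * \<bar>q\<bar> \<le> weight r + weight q"
  "\<bar>s\<bar> powr p * \<bar>r\<bar> \<le> weight s + weight r"
  "\<bar>s\<bar> powr (p - 1) * (\<bar>r\<bar> * \<bar>q\<bar>) \<le> weight s + weight r + weight q"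
proof -
  show "\<bar>r\<bar> * \<bar>q\<bar> \<le> weight r + weight q" for r q
  proof -
    have "2 * (\<bar>r\<bar> * \<bar>q\<bar>) \<le> r\<^sup>2 + q\<^sup>2" using sum_squares_bound[of "\<bar>r\<bar>" "\<bar>q\<bar>"] by simp
    moreover have "0 \<le> \<bar>r\<bar> * \<bar>q\<bar>" by simp
    moreover have "r\<^sup>2 \<le> weight r" "q\<^sup>2 \<le> weight q" by (auto simp: weight_def)
    ultimately show ?thesis by linarith
  qed
  have w: "(max a b) powr (p + 1) \<le> a powr (p + 1) + b powr (p + 1)" if "a \<ge> 0" "b \<ge> 0" for a b
    using powr_max_bound[OF that] p_gt_1 by simp
  have pw: "\<bar>s\<bar> powr (p + 1) \<le> weight s" for s by (simp add: weight_def)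
  show "\<bar>s\<bar> powr p * \<bar>r\<bar> \<le> weight s + weight r" for s r
  proof -
    let ?m = "max \<bar>s\<bar> \<bar>r\<bar>"
    have "\<bar>s\<bar> powr p * \<bar>r\<bar> \<le> ?m powr p * ?m" using p_gt_1 by (intro mult_mono powr_mono2) auto
    also have "\<dots> = ?m powr (p + 1)" by (cases "?m = 0") (auto simp: powr_add)
    finally show ?thesis using w[of "\<bar>s\<bar>" "\<bar>r\<bar>"] pw[of s] pw[of r] by simp
  qed
  show "\<bar>s\<bar> powr (p - 1) * (\<bar>r\<bar> * \<bar>q\<bar>) \<le> weight s + weight r + weight q"
  proof -
    let ?m = "max \<bar>s\<bar> (max \<bar>r\<bar> \<bar>q\<bar>)"
    have "\<bar>s\<bar> powr (p - 1) * (\<bar>r\<bar> * \<bar>q\<bar>) \<le> ?m powr (p - 1) * (?m * ?m)"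
      using p_gt_1 by (intro mult_mono powr_mono2) auto
    also have "\<dots> = ?m powr (p + 1)"
    proof (cases "?m = 0")
      case False
      then have "?m > 0" by linarith
      then have "?m powr (p - 1 + 2) = ?m powr (p - 1) * ?m\<^sup>2" by (simp only: powr_add powr_numeral)
      then show ?thesis by (simp add: power2_eq_square add.commute)
    next
      case True
      show ?thesis unfolding True by simp
    qed
    finally show ?thesis using w[of "\<bar>s\<bar>" "max \<bar>r\<bar> \<bar>q\<bar>"] w[of "\<bar>r\<bar>" "\<bar>q\<bar>"] pw[of s] pw[of r] pw[of q]
      by (simp add: le_max_iff_disj)
  qed
qed

text \<open>The mean value inequality on the segment from \<open>s\<close> to \<open>s + r\<close>,
  all of whose points are at most \<open>2 * max \<bar>s\<bar> \<bar>r\<bar>\<close> in absolute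
  value; hence the factor \<open>2 powr (p - 1)\<close>.\<close>

lemma f_lipschitz: "\<bar>f (s + r) - f s\<bar> \<le> C * \<bar>r\<bar> * (1 + 2 powr (p - 1) * (\<bar>s\<bar> powr (p - 1) + \<bar>r\<bar> powr (p - 1)))"
proof -
  let ?B = "C * (1 + 2 powr (p - 1) * (\<bar>s\<bar> powr (p - 1) + \<bar>r\<bar> powr (p - 1)))"
  have "norm (f (s + r) - f s) \<le> ?B * norm ((s + r) - s)"
  proof (rule field_differentiable_bound[where S="closed_segment s (s + r)" and f'="deriv f"])
    fix z assume z: "z \<in> closed_segment s (s + r)"
    show "(f has_field_derivative deriv f z) (at z within closed_segment s (s + r))"
      by (rule has_field_derivative_at_within[OF f_deriv])
    have "\<bar>z\<bar> \<le> 2 * max \<bar>s\<bar> \<bar>r\<bar>" using z by (auto simp: closed_segment_eq_real_ivl split: if_splits)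
    then have "\<bar>z\<bar> powr (p - 1) \<le> (2 * max \<bar>s\<bar> \<bar>r\<bar>) powr (p - 1)" using p_gt_1 by (intro powr_mono2) auto
    also have "\<dots> = 2 powr (p - 1) * (max \<bar>s\<bar> \<bar>r\<bar>) powr (p - 1)" by (simp add: powr_mult)
    also have "\<dots> \<le> 2 powr (p - 1) * (\<bar>s\<bar> powr (p - 1) + \<bar>r\<bar> powr (p - 1))"
      using p_gt_1 by (intro mult_left_mono powr_max_bound) auto
    finally have "C * (1 + \<bar>z\<bar> powr (p - 1)) \<le> ?B" using C_pos by simp
    then show "norm (deriv f z) \<le> ?B" using f_growth[of z] by simp
  qed auto
  then show ?thesis by (simp add: mult.commute mult.left_commute)
qed

text \<open>The constant of \<open>f_difference_weight\<close>. The 4 rounds up the coefficients, at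
  most 3, with which weights occur when its two triple products are added.\<close>

definition gconst :: real where "gconst = C * (1 + 4 * 2 powr (p - 1))"

lemma gconst_pos: "gconst > 0" using C_pos by (simp add: gconst_def add_pos_nonneg)

text \<open>With the factor \<open>N\<close> in front, a direction \<open>N r\<close> can be normalised before integrating, so that these pointwise
  bounds replace Hoelder's inequality.\<close>

lemma f_difference_weight:
  assumes N: "0 \<le> N" "N \<le> 1"
  shows "\<bar>f (s + N * r) - f s\<bar> * \<bar>q\<bar> \<le> N * (gconst * (weight s + weight r + weight q))"
proof -
  have "\<bar>N * r\<bar> powr (p - 1) \<le> \<bar>r\<bar> powr (p - 1)"
    using N p_gt_1 by (intro powr_mono2) (auto simp: abs_mult mult_left_le_one_le)
  then have "C * \<bar>N * r\<bar> * (1 + 2 powr (p - 1) * (\<bar>s\<bar> powr (p - 1) + \<bar>N * r\<bar> powr (p - 1)))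
     \<le> C * \<bar>N * r\<bar> * (1 + 2 powr (p - 1) * (\<bar>s\<bar> powr (p - 1) + \<bar>r\<bar> powr (p - 1)))"
    using C_pos by (intro mult_left_mono add_left_mono) auto
  then have "\<bar>f (s + N * r) - f s\<bar> \<le> C * \<bar>N * r\<bar> * (1 + 2 powr (p - 1) * (\<bar>s\<bar> powr (p - 1) + \<bar>r\<bar> powr (p - 1)))"
    using f_lipschitz[of s "N * r"] by linarith
  then have "\<bar>f (s + N * r) - f s\<bar> * \<bar>q\<bar> \<le> C * \<bar>N * r\<bar> * (1 + 2 powr (p - 1) * (\<bar>s\<bar> powr (p - 1) + \<bar>r\<bar> powr (p - 1))) * \<bar>q\<bar>"
    by (rule mult_right_mono) simp
  also have "\<dots> = N * (C * (\<bar>r\<bar> * \<bar>q\<bar> + 2 powr (p - 1) * (\<bar>s\<bar> powr (p - 1) * (\<bar>r\<bar> * \<bar>q\<bar>) + \<bar>r\<bar> powr (p - 1) * (\<bar>r\<bar> * \<bar>q\<bar>))))"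
    using N by (simp add: abs_mult algebra_simps)
  also have "\<dots> \<le> N * (C * (1 * (weight s + weight r + weight q) + 2 powr (p - 1) * (4 * (weight s + weight r + weight q))))"
  proof (intro mult_left_mono add_mono)
    show "\<bar>r\<bar> * \<bar>q\<bar> \<le> 1 * (weight s + weight r + weight q)" using weight_products(1)[of r q] weight_nonneg[of s] by simp
    show "\<bar>s\<bar> powr (p - 1) * (\<bar>r\<bar> * \<bar>q\<bar>) + \<bar>r\<bar> powr (p - 1) * (\<bar>r\<bar> * \<bar>q\<bar>) \<le> 4 * (weight s + weight r + weight q)"
    proof -
      have "a + b \<le> 4 * (x + y + z)" if "a \<le> x + y + z" "b \<le> y + y + z" "0 \<le> x" "0 \<le> y" "0 \<le> z" for a b x y z :: real
        using that by argo
      from this[OF weight_products(3) weight_products(3) weight_nonneg weight_nonneg weight_nonneg] show ?thesis .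
    qed
  qed (use N C_pos in auto)
  also have "\<dots> = N * (gconst * (weight s + weight r + weight q))" by (simp add: gconst_def algebra_simps)
  finally show ?thesis .
qed

lemma f_weight: "\<bar>f s * r\<bar> \<le> gconst * (weight s + weight r)"
  using f_difference_weight[of 1 0 s r] by (simp add: f_0 abs_mult weight_def)

text \<open>The function \<open>F (s + M * r) - f s * (M * r)\<close> of \<open>M\<close> has a
  derivative of order \<open>M\<close> by the previous estimate, so its increment over
  \<open>[0, N]\<close> is of order \<open>N^2\<close>. The direction \<open>r\<close> plays both
  roles, \<open>r\<close> and \<open>q\<close>, hence the factor 2.\<close>

lemma F_taylor_weight:
  assumes N: "0 \<le> N" "N \<le> 1"
  shows "\<bar>F (s + N * r) - F s - f s * (N * r)\<bar> \<le> N\<^sup>2 * (2 * gconst * (weight s + weight r))"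
proof -
  let ?X = "gconst * (weight s + weight r + weight r)"
  have X: "0 \<le> ?X" "?X \<le> 2 * gconst * (weight s + weight r)"
    using gconst_pos weight_nonneg[of s] weight_nonneg[of r] by (auto simp: algebra_simps)
  have "norm ((F (s + N * r) - f s * (N * r)) - (F (s + 0 * r) - f s * (0 * r))) \<le> (N * ?X) * norm (N - 0)"
  proof (rule field_differentiable_bound[where S="{0..N}" and f="\<lambda>M. F (s + M * r) - f s * (M * r)" and f'="\<lambda>M. (f (s + M * r) - f s) * r"])
    fix M assume M: "M \<in> {0..N}"
    show "((\<lambda>M. F (s + M * r) - f s * (M * r)) has_field_derivative (f (s + M * r) - f s) * r) (at M within {0..N})"
      by (rule has_field_derivative_at_within)
        (auto intro!: derivative_eq_intros DERIV_chain2[OF F_deriv] simp: algebra_simps)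
    have "norm ((f (s + M * r) - f s) * r) \<le> M * ?X"
      using f_difference_weight[of M s r r] M N by (simp add: abs_mult)
    also have "\<dots> \<le> N * ?X" using M X(1) by (intro mult_right_mono) auto
    finally show "norm ((f (s + M * r) - f s) * r) \<le> N * ?X" .
  qed (use N in auto)
  then have "\<bar>F (s + N * r) - F s - f s * (N * r)\<bar> \<le> (N * ?X) * N" using N by (simp add: algebra_simps)
  also have "\<dots> = N\<^sup>2 * ?X" by (simp add: power2_eq_square)
  also have "\<dots> \<le> N\<^sup>2 * (2 * gconst * (weight s + weight r))" by (rule mult_left_mono[OF X(2)]) simp
  finally show ?thesis .
qed

lemma F_weight: "\<bar>F s\<bar> \<le> 2 * gconst * weight s"
  using F_taylor_weight[of 1 0 s] by (simp add: F_0 f_0 weight_def)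

text \<open>Near 0 the condition \<open>f s = o(s)\<close> gives the quadratic term with a small
  constant. Away from 0 the square is itself dominated by the power \<open>p + 1\<close>, at the
  price of \<open>d powr (1 - p)\<close>.\<close>

lemma F_small:
  assumes e: "e > 0" shows "\<exists>K\<ge>0. \<forall>s. F s \<le> e * s\<^sup>2 + K * \<bar>s\<bar> powr (p + 1)"
proof -
  have "eventually (\<lambda>s. norm (f s) \<le> e * norm s) (at 0)"
    using landau_o.smallD[OF f_small e] .
  then obtain d where d: "d > 0" "\<And>s. s \<noteq> 0 \<Longrightarrow> dist s 0 < d \<Longrightarrow> norm (f s) \<le> e * norm s"
    by (auto simp: eventually_at)
  then have fe: "\<bar>f s\<bar> \<le> e * \<bar>s\<bar>" if "\<bar>s\<bar> < d" for s using that f_0 by (cases "s = 0") auto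
  have near: "F s \<le> e * s\<^sup>2" if s: "\<bar>s\<bar> < d" for s
  proof -
    have "norm (F s - F 0) \<le> (e * \<bar>s\<bar>) * norm (s - 0)"
    proof (rule field_differentiable_bound[where S="closed_segment 0 s" and f'=f])
      fix z assume z: "z \<in> closed_segment 0 s"
      show "(F has_field_derivative f z) (at z within closed_segment 0 s)" by (rule has_field_derivative_at_within[OF F_deriv])
      have "\<bar>z\<bar> \<le> \<bar>s\<bar>" using z by (auto simp: closed_segment_eq_real_ivl split: if_splits)
      then have "\<bar>f z\<bar> \<le> e * \<bar>z\<bar>" "e * \<bar>z\<bar> \<le> e * \<bar>s\<bar>" using fe[of z] s e by auto
      then show "norm (f z) \<le> e * \<bar>s\<bar>" by simp
    qed auto
    then show ?thesis using F_nonneg[of s] by (simp add: F_0 power2_eq_square)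
  qed
  define K where "K = 2 * gconst * (d powr (1 - p) + 1)"
  have K: "K \<ge> 0" using gconst_pos by (simp add: K_def)
  have "F s \<le> e * s\<^sup>2 + K * \<bar>s\<bar> powr (p + 1)" for s
  proof (cases "\<bar>s\<bar> < d")
    case True
    then show ?thesis using near[of s] K by (simp add: add_increasing2)
  next
    case False
    then have s: "\<bar>s\<bar> > 0" using d(1) by linarith
    have "s\<^sup>2 = \<bar>s\<bar> powr (1 - p) * \<bar>s\<bar> powr (p + 1)" using s by (simp flip: powr_add)
    also have "\<dots> \<le> d powr (1 - p) * \<bar>s\<bar> powr (p + 1)"
      using False d(1) p_gt_1 by (intro mult_right_mono powr_mono2') auto
    finally have "weight s \<le> (d powr (1 - p) + 1) * \<bar>s\<bar> powr (p + 1)" by (simp add: weight_def distrib_right)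
    then have "2 * gconst * weight s \<le> 2 * gconst * ((d powr (1 - p) + 1) * \<bar>s\<bar> powr (p + 1))"
      using gconst_pos by (intro mult_left_mono) auto
    then have "F s \<le> K * \<bar>s\<bar> powr (p + 1)" using F_weight[of s] by (simp add: K_def mult.assoc)
    then show ?thesis using e by (simp add: add_increasing)
  qed
  then show ?thesis using K by blast
qed

end

section \<open>The variational problem\<close>

text \<open>An abstract \<open>H10\<close> with its Dirichlet form \<open>D\<close>, where
  \<open>R\<close> is the set of exponents with compact embedding. The clause
  \<open>compactness\<close> stands for weak compactness: subsequence, lower semicontinuity of
  \<open>D\<close>, and strong convergence for every exponent in \<open>R\<close>. The clause
  \<open>D_null\<close> makes \<open>D\<close> respect equality almost everywhere.\<close>

locale compact_embedding =
  fixes M :: "'a measure" and H :: "('a \<Rightarrow> real) set" and D :: "('a \<Rightarrow> real) \<Rightarrow> ('a \<Rightarrow> real) \<Rightarrow> real"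
    and R :: "real set"
  assumes finite_M: "finite_measure M"
    and H_meas: "\<And>u. u \<in> H \<Longrightarrow> u \<in> borel_measurable M"
    and H_zero: "(\<lambda>x. 0) \<in> H"
    and H_lincomb: "\<And>u v c. u \<in> H \<Longrightarrow> v \<in> H \<Longrightarrow> (\<lambda>x. u x + c * v x) \<in> H"
    and D_lincomb: "\<And>u v w c. u \<in> H \<Longrightarrow> v \<in> H \<Longrightarrow> w \<in> H \<Longrightarrow> D (\<lambda>x. u x + c * v x) w = D u w + c * D v w"
    and D_commute: "\<And>u v. D u v = D v u"
    and D_nonneg: "\<And>u. 0 \<le> D u u"
    and D_null: "\<And>u w. u \<in> H \<Longrightarrow> w \<in> H \<Longrightarrow> AE x in M. u x = 0 \<Longrightarrow> D u w = 0"
    and two_R: "2 \<in> R" and R_pos: "\<And>r. r \<in> R \<Longrightarrow> 0 < r"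
    and embedding: "\<And>r. r \<in> R \<Longrightarrow> \<exists>K>0. \<forall>u\<in>H. integrable M (\<lambda>x. \<bar>u x\<bar> powr r) \<and>
        (\<integral>x. \<bar>u x\<bar> powr r \<partial>M) \<le> K * sqrt (D u u) powr r"
    and compactness: "\<And>u B. (\<And>n::nat. u n \<in> H) \<Longrightarrow> (\<And>n. D (u n) (u n) \<le> B) \<Longrightarrow>
        \<exists>s v \<beta>. strict_mono s \<and> v \<in> H \<and> (\<lambda>n. D (u (s n)) (u (s n))) \<longlonglongrightarrow> \<beta> \<and> D v v \<le> \<beta> \<and>
          (\<forall>r\<in>R. (\<lambda>n. \<integral>x. \<bar>u (s n) x - v x\<bar> powr r \<partial>M) \<longlonglongrightarrow> 0)"
begin

lemma H_add: "u \<in> H \<Longrightarrow> v \<in> H \<Longrightarrow> (\<lambda>x. u x + v x) \<in> H"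
  using H_lincomb[of u v 1] by simp

lemma H_diff: "u \<in> H \<Longrightarrow> v \<in> H \<Longrightarrow> (\<lambda>x. u x - v x) \<in> H"
  using H_lincomb[of u v "-1"] by simp

lemma H_scale: "u \<in> H \<Longrightarrow> (\<lambda>x. c * u x) \<in> H"
  using H_lincomb[OF H_zero, of u c] by simp

lemma H_minus: "u \<in> H \<Longrightarrow> (\<lambda>x. - u x) \<in> H"
  using H_scale[of u "-1"] by simp

lemma D_zero: "w \<in> H \<Longrightarrow> D (\<lambda>x. 0) w = 0"
  by (rule D_null[OF H_zero]) auto

lemma D_add: "u \<in> H \<Longrightarrow> v \<in> H \<Longrightarrow> w \<in> H \<Longrightarrow> D (\<lambda>x. u x + v x) w = D u w + D v w"
  using D_lincomb[of u v w 1] by simp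

lemma D_diff: "u \<in> H \<Longrightarrow> v \<in> H \<Longrightarrow> w \<in> H \<Longrightarrow> D (\<lambda>x. u x - v x) w = D u w - D v w"
  using D_lincomb[of u v w "-1"] by simp

lemma D_scale: "u \<in> H \<Longrightarrow> w \<in> H \<Longrightarrow> D (\<lambda>x. c * u x) w = c * D u w"
  using D_lincomb[OF H_zero, of u w c] D_zero by simp

lemma D_add_right: "u \<in> H \<Longrightarrow> v \<in> H \<Longrightarrow> w \<in> H \<Longrightarrow> D w (\<lambda>x. u x + v x) = D w u + D w v"
  using D_add[of u v w] by (simp add: D_commute[of w])

lemma D_diff_right: "u \<in> H \<Longrightarrow> v \<in> H \<Longrightarrow> w \<in> H \<Longrightarrow> D w (\<lambda>x. u x - v x) = D w u - D w v"
  using D_diff[of u v w] by (simp add: D_commute[of w])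

lemma D_scale_right: "u \<in> H \<Longrightarrow> w \<in> H \<Longrightarrow> D w (\<lambda>x. c * u x) = c * D w u"
  using D_scale[of u w c] by (simp add: D_commute[of w])

lemmas D_bilinear = D_add D_diff D_scale D_add_right D_diff_right D_scale_right
lemmas H_closed = H_add H_diff H_scale H_minus H_zero

lemma powr_integrable: "r \<in> R \<Longrightarrow> u \<in> H \<Longrightarrow> integrable M (\<lambda>x. \<bar>u x\<bar> powr r)"
  using embedding by blast

lemma square_integrable: "u \<in> H \<Longrightarrow> integrable M (\<lambda>x. (u x)\<^sup>2)"
  using embedding[OF two_R] by (auto simp: powr_numeral)

lemma square_bound: "\<exists>K>0. \<forall>u\<in>H. (\<integral>x. (u x)\<^sup>2 \<partial>M) \<le> K * D u u"
  using embedding[OF two_R] by (simp add: powr_numeral D_nonneg) blast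

lemma AE_zero_if_D_zero: "u \<in> H \<Longrightarrow> D u u = 0 \<Longrightarrow> AE x in M. u x = 0"
proof -
  assume u: "u \<in> H" "D u u = 0"
  then have "(\<integral>x. (u x)\<^sup>2 \<partial>M) \<le> 0" using square_bound by auto
  moreover have "0 \<le> (\<integral>x. (u x)\<^sup>2 \<partial>M)" by (rule Bochner_Integration.integral_nonneg) simp
  ultimately have "(\<integral>x. (u x)\<^sup>2 \<partial>M) = 0" by simp
  then have "AE x in M. (u x)\<^sup>2 = 0"
    by (subst (asm) integral_nonneg_eq_0_iff_AE[OF square_integrable[OF u(1)]]) auto
  then show ?thesis by eventually_elim simp
qed

text \<open>Division by the norm. The equation is claimed only almost everywhere because an element
  of zero norm need not be the zero function.\<close>

lemma normalize:
  assumes "\<phi> \<in> H"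
  shows "\<exists>r\<in>H. D r r \<le> 1 \<and> (AE x in M. \<phi> x = sqrt (D \<phi> \<phi>) * r x)"
proof (cases "D \<phi> \<phi> = 0")
  case True
  then show ?thesis using AE_zero_if_D_zero[OF assms True] H_zero D_zero[OF H_zero] by (intro bexI[of _ "\<lambda>x. 0"]) auto
next
  case False
  then have N: "D \<phi> \<phi> > 0" using D_nonneg[of \<phi>] by simp
  let ?r = "\<lambda>x. (1 / sqrt (D \<phi> \<phi>)) * \<phi> x"
  have "D ?r ?r = 1 / sqrt (D \<phi> \<phi>) * (1 / sqrt (D \<phi> \<phi>) * D \<phi> \<phi>)"
    using assms by (simp add: D_scale D_scale_right H_scale del: times_divide_eq_left)
  also have "\<dots> = 1" using N by (simp add: field_simps)
  finally have "D ?r ?r = 1" .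
  moreover have "\<phi> x = sqrt (D \<phi> \<phi>) * ?r x" for x using N by simp
  moreover have "?r \<in> H" by (rule H_scale[OF assms])
  ultimately show ?thesis by (intro bexI[of _ ?r] conjI AE_I2) auto
qed

end

section \<open>Estimates for a single nonlinear term\<close>

locale nonlinear_functional = compact_embedding M H D R + nonlinearity f p C \<delta>
  for M :: "'a measure" and H D R f p C \<delta> +
  assumes p_R: "p + 1 \<in> R"
begin

definition Wt :: "('a \<Rightarrow> real) \<Rightarrow> real" where "Wt u = (\<integral>x. weight (u x) \<partial>M)"
definition \<Psi> :: "('a \<Rightarrow> real) \<Rightarrow> real" where "\<Psi> u = (\<integral>x. F (u x) \<partial>M)"
text \<open>The derivative of \<open>\<Psi>\<close> at \<open>u\<close>;
  \<open>\<Psi>_taylor\<close> gives the expansion with a quadratic remainder in the norm of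
  \<open>D\<close>.\<close>

definition df :: "('a \<Rightarrow> real) \<Rightarrow> ('a \<Rightarrow> real) \<Rightarrow> real" where "df u \<phi> = (\<integral>x. f (u x) * \<phi> x \<partial>M)"

lemma weight_integrable: "u \<in> H \<Longrightarrow> integrable M (\<lambda>x. weight (u x))"
  unfolding weight_def using square_integrable embedding[OF p_R] by auto

lemma Wt_nonneg: "0 \<le> Wt u"
  unfolding Wt_def by (rule Bochner_Integration.integral_nonneg) (rule weight_nonneg)

lemma Wt_bound: "\<exists>K>0. \<forall>u\<in>H. D u u \<le> \<rho> \<longrightarrow> Wt u \<le> K"
proof -
  obtain K1 where K1: "K1 > 0" "\<And>u. u \<in> H \<Longrightarrow> (\<integral>x. (u x)\<^sup>2 \<partial>M) \<le> K1 * D u u" using square_bound by blast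
  obtain K2 where K2: "K2 > 0" "\<And>u. u \<in> H \<Longrightarrow> integrable M (\<lambda>x. \<bar>u x\<bar> powr (p + 1))"
    "\<And>u. u \<in> H \<Longrightarrow> (\<integral>x. \<bar>u x\<bar> powr (p + 1) \<partial>M) \<le> K2 * sqrt (D u u) powr (p + 1)" using embedding[OF p_R] by blast
  let ?\<rho> = "max \<rho> 0"
  let ?K = "K1 * ?\<rho> + K2 * sqrt ?\<rho> powr (p + 1) + 1"
  have "Wt u \<le> ?K" if u: "u \<in> H" "D u u \<le> \<rho>" for u
  proof -
    have "Wt u = (\<integral>x. (u x)\<^sup>2 \<partial>M) + (\<integral>x. \<bar>u x\<bar> powr (p + 1) \<partial>M)"
      unfolding Wt_def weight_def using square_integrable[OF u(1)] K2(2)[OF u(1)] by simp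
    also have "\<dots> \<le> K1 * D u u + K2 * sqrt (D u u) powr (p + 1)" using K1(2) K2(3) u(1) by (intro add_mono) auto
    also have "\<dots> \<le> K1 * ?\<rho> + K2 * sqrt ?\<rho> powr (p + 1)"
      using K1(1) K2(1) u(2) p_gt_1 D_nonneg[of u] by (intro add_mono mult_left_mono powr_mono2) auto
    finally show ?thesis by simp
  qed
  moreover have "?K > 0" using K1(1) K2(1) by (intro add_nonneg_pos) auto
  ultimately show ?thesis by blast
qed

lemma F_measurable: "u \<in> H \<Longrightarrow> (\<lambda>x. F (u x)) \<in> borel_measurable M"
  using measurable_compose[OF H_meas borel_measurable_continuous_onI[OF F_cont[of UNIV]]] .

lemma f_measurable: "u \<in> H \<Longrightarrow> (\<lambda>x. f (u x)) \<in> borel_measurable M"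
  using measurable_compose[OF H_meas borel_measurable_continuous_onI[OF f_cont[of UNIV]]] .

lemma F_integrable: "u \<in> H \<Longrightarrow> integrable M (\<lambda>x. F (u x))"
  by (rule Bochner_Integration.integrable_bound[of _ "\<lambda>x. 2 * gconst * weight (u x)"])
    (use F_measurable weight_integrable F_weight gconst_pos weight_nonneg in \<open>auto simp: abs_mult\<close>)

lemma df_integrable:
  assumes "u \<in> H" "\<phi> \<in> H" shows "integrable M (\<lambda>x. f (u x) * \<phi> x)"
proof (rule Bochner_Integration.integrable_bound[of _ "\<lambda>x. gconst * (weight (u x) + weight (\<phi> x))"])
  show "AE x in M. norm (f (u x) * \<phi> x) \<le> norm (gconst * (weight (u x) + weight (\<phi> x)))"
    using f_weight gconst_pos weight_nonneg by (auto simp: abs_mult intro!: AE_I2)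
qed (use assms f_measurable H_meas weight_integrable in auto)

lemma df_lincomb: "u \<in> H \<Longrightarrow> \<phi> \<in> H \<Longrightarrow> \<psi> \<in> H \<Longrightarrow> df u (\<lambda>x. a * \<phi> x + b * \<psi> x) = a * df u \<phi> + b * df u \<psi>"
proof -
  assume a: "u \<in> H" "\<phi> \<in> H" "\<psi> \<in> H"
  have "df u (\<lambda>x. a * \<phi> x + b * \<psi> x) = (\<integral>x. a * (f (u x) * \<phi> x) + b * (f (u x) * \<psi> x) \<partial>M)"
    unfolding df_def by (rule Bochner_Integration.integral_cong) (auto simp: algebra_simps)
  then show ?thesis using a by (simp add: df_def df_integrable)
qed

lemma df_scale: "df u (\<lambda>x. a * \<phi> x) = a * df u \<phi>"
  unfolding df_def by (simp add: mult.left_commute)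

lemma df_bound: "\<exists>K\<ge>0. \<forall>u\<in>H. \<forall>\<phi>\<in>H. D u u \<le> \<rho> \<longrightarrow> \<bar>df u \<phi>\<bar> \<le> K * sqrt (D \<phi> \<phi>)"
proof -
  obtain K1 where K1: "K1 > 0" "\<And>u. u \<in> H \<Longrightarrow> D u u \<le> \<rho> \<Longrightarrow> Wt u \<le> K1" using Wt_bound by blast
  obtain K2 where K2: "K2 > 0" "\<And>u. u \<in> H \<Longrightarrow> D u u \<le> 1 \<Longrightarrow> Wt u \<le> K2" using Wt_bound by blast
  have "\<bar>df u \<phi>\<bar> \<le> (gconst * (K1 + K2)) * sqrt (D \<phi> \<phi>)" if u: "u \<in> H" "D u u \<le> \<rho>" and \<phi>: "\<phi> \<in> H" for u \<phi>
  proof -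
    let ?N = "sqrt (D \<phi> \<phi>)"
    obtain r where r: "r \<in> H" "D r r \<le> 1" "AE x in M. \<phi> x = ?N * r x" using normalize[OF \<phi>] by blast
    have "df u \<phi> = df u (\<lambda>x. ?N * r x)"
      unfolding df_def
    proof (rule integral_cong_AE)
      show "AE x in M. f (u x) * \<phi> x = f (u x) * (?N * r x)" using r(3) by eventually_elim simp
    qed (use f_measurable[OF u(1)] H_meas[OF \<phi>] H_meas[OF r(1)] in auto)
    then have eq: "df u \<phi> = ?N * df u r" by (simp add: df_scale)
    have "\<bar>df u r\<bar> \<le> (\<integral>x. \<bar>f (u x) * r x\<bar> \<partial>M)" unfolding df_def by (rule integral_abs_bound)
    also have "\<dots> \<le> (\<integral>x. gconst * (weight (u x) + weight (r x)) \<partial>M)"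
      using df_integrable[OF u(1) r(1)] weight_integrable[OF u(1)] weight_integrable[OF r(1)] f_weight
      by (intro integral_mono) auto
    also have "\<dots> = gconst * (Wt u + Wt r)"
      using weight_integrable[OF u(1)] weight_integrable[OF r(1)] by (simp add: Wt_def)
    also have "\<dots> \<le> gconst * (K1 + K2)"
      using K1(2)[OF u] K2(2)[OF r(1,2)] gconst_pos by (intro mult_left_mono add_mono) auto
    finally have "?N * \<bar>df u r\<bar> \<le> ?N * (gconst * (K1 + K2))" by (rule mult_left_mono) (simp add: D_nonneg)
    then show ?thesis unfolding eq by (simp add: abs_mult D_nonneg mult.commute)
  qed
  moreover have "gconst * (K1 + K2) \<ge> 0" using gconst_pos K1(1) K2(1) by simp
  ultimately show ?thesis by blast
qed

text \<open>Write \<open>\<phi>\<close> as its norm times an element of the unit ball and integrate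
  \<open>F_taylor_weight\<close>; the weights of both arguments are bounded on bounded sets, and the
  factor \<open>N^2\<close> is \<open>D \<phi> \<phi>\<close>.\<close>

lemma \<Psi>_taylor: "\<exists>K\<ge>0. \<forall>u\<in>H. \<forall>\<phi>\<in>H. D u u \<le> \<rho> \<longrightarrow> D \<phi> \<phi> \<le> 1 \<longrightarrow>
    \<bar>\<Psi> (\<lambda>x. u x + \<phi> x) - \<Psi> u - df u \<phi>\<bar> \<le> K * D \<phi> \<phi>"
proof -
  obtain K1 where K1: "K1 > 0" "\<And>u. u \<in> H \<Longrightarrow> D u u \<le> \<rho> \<Longrightarrow> Wt u \<le> K1" using Wt_bound by blast
  obtain K2 where K2: "K2 > 0" "\<And>u. u \<in> H \<Longrightarrow> D u u \<le> 1 \<Longrightarrow> Wt u \<le> K2" using Wt_bound by blast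
  have "\<bar>\<Psi> (\<lambda>x. u x + \<phi> x) - \<Psi> u - df u \<phi>\<bar> \<le> (2 * gconst * (K1 + K2)) * D \<phi> \<phi>"
    if u: "u \<in> H" "D u u \<le> \<rho>" and \<phi>: "\<phi> \<in> H" "D \<phi> \<phi> \<le> 1" for u \<phi>
  proof -
    let ?N = "sqrt (D \<phi> \<phi>)"
    have N: "0 \<le> ?N" "?N \<le> 1" using \<phi>(2) by (auto simp: D_nonneg)
    obtain r where r: "r \<in> H" "D r r \<le> 1" "AE x in M. \<phi> x = ?N * r x" using normalize[OF \<phi>(1)] by blast
    note i = F_integrable[OF H_add[OF u(1) \<phi>(1)]] F_integrable[OF u(1)] df_integrable[OF u(1) \<phi>(1)]
      weight_integrable[OF u(1)] weight_integrable[OF r(1)]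
    have "\<Psi> (\<lambda>x. u x + \<phi> x) - \<Psi> u - df u \<phi> = (\<integral>x. F (u x + \<phi> x) - F (u x) - f (u x) * \<phi> x \<partial>M)"
      using i by (simp add: \<Psi>_def df_def)
    also have "\<bar>\<dots>\<bar> \<le> (\<integral>x. \<bar>F (u x + \<phi> x) - F (u x) - f (u x) * \<phi> x\<bar> \<partial>M)" by (rule integral_abs_bound)
    also have "\<dots> \<le> (\<integral>x. ?N\<^sup>2 * (2 * gconst * (weight (u x) + weight (r x))) \<partial>M)"
    proof (rule integral_mono_AE)
      show "AE x in M. \<bar>F (u x + \<phi> x) - F (u x) - f (u x) * \<phi> x\<bar> \<le> ?N\<^sup>2 * (2 * gconst * (weight (u x) + weight (r x)))"
        using r(3) by eventually_elim (use F_taylor_weight[OF N] in metis)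
    qed (use i in auto)
    also have "\<dots> = D \<phi> \<phi> * (2 * gconst * (Wt u + Wt r))" using i D_nonneg[of \<phi>] by (simp add: Wt_def)
    also have "\<dots> \<le> D \<phi> \<phi> * (2 * gconst * (K1 + K2))"
      using K1(2)[OF u] K2(2)[OF r(1,2)] gconst_pos D_nonneg[of \<phi>] by (intro mult_left_mono add_mono) auto
    finally show ?thesis by (simp add: mult.commute)
  qed
  moreover have "2 * gconst * (K1 + K2) \<ge> 0" using gconst_pos K1(1) K2(1) by simp
  ultimately show ?thesis by blast
qed

lemma df_cont: "\<exists>K\<ge>0. \<forall>u\<in>H. \<forall>\<phi>\<in>H. \<forall>\<psi>\<in>H. D u u \<le> \<rho> \<longrightarrow> D \<psi> \<psi> \<le> \<rho> \<longrightarrow> D \<phi> \<phi> \<le> 1 \<longrightarrow>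
    \<bar>df (\<lambda>x. u x + \<phi> x) \<psi> - df u \<psi>\<bar> \<le> K * sqrt (D \<phi> \<phi>)"
proof -
  obtain K1 where K1: "K1 > 0" "\<And>u. u \<in> H \<Longrightarrow> D u u \<le> \<rho> \<Longrightarrow> Wt u \<le> K1" using Wt_bound by blast
  obtain K2 where K2: "K2 > 0" "\<And>u. u \<in> H \<Longrightarrow> D u u \<le> 1 \<Longrightarrow> Wt u \<le> K2" using Wt_bound by blast
  have "\<bar>df (\<lambda>x. u x + \<phi> x) \<psi> - df u \<psi>\<bar> \<le> (gconst * (K1 + K2 + K1)) * sqrt (D \<phi> \<phi>)"
    if u: "u \<in> H" "D u u \<le> \<rho>" and \<psi>: "\<psi> \<in> H" "D \<psi> \<psi> \<le> \<rho>" and \<phi>: "\<phi> \<in> H" "D \<phi> \<phi> \<le> 1" for u \<phi> \<psi>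
  proof -
    let ?N = "sqrt (D \<phi> \<phi>)"
    have N: "0 \<le> ?N" "?N \<le> 1" using \<phi>(2) by (auto simp: D_nonneg)
    obtain r where r: "r \<in> H" "D r r \<le> 1" "AE x in M. \<phi> x = ?N * r x" using normalize[OF \<phi>(1)] by blast
    note i = df_integrable[OF H_add[OF u(1) \<phi>(1)] \<psi>(1)] df_integrable[OF u(1) \<psi>(1)]
      weight_integrable[OF u(1)] weight_integrable[OF r(1)] weight_integrable[OF \<psi>(1)]
    have "df (\<lambda>x. u x + \<phi> x) \<psi> - df u \<psi> = (\<integral>x. f (u x + \<phi> x) * \<psi> x - f (u x) * \<psi> x \<partial>M)"
      using i by (simp add: df_def)
    also have "\<bar>\<dots>\<bar> \<le> (\<integral>x. \<bar>f (u x + \<phi> x) * \<psi> x - f (u x) * \<psi> x\<bar> \<partial>M)" by (rule integral_abs_bound)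
    also have "\<dots> \<le> (\<integral>x. ?N * (gconst * (weight (u x) + weight (r x) + weight (\<psi> x))) \<partial>M)"
    proof (rule integral_mono_AE)
      show "AE x in M. \<bar>f (u x + \<phi> x) * \<psi> x - f (u x) * \<psi> x\<bar> \<le> ?N * (gconst * (weight (u x) + weight (r x) + weight (\<psi> x)))"
        using r(3)
      proof eventually_elim
        case (elim x)
        show ?case
          using f_difference_weight[OF N, of "u x" "r x" "\<psi> x"] unfolding elim[symmetric]
          by (simp only: left_diff_distrib[symmetric] abs_mult)
      qed
    qed (use i in auto)
    also have "\<dots> = ?N * (gconst * (Wt u + Wt r + Wt \<psi>))" using i by (simp add: Wt_def)
    also have "\<dots> \<le> ?N * (gconst * (K1 + K2 + K1))"
      using K1(2)[OF u] K2(2)[OF r(1,2)] K1(2)[OF \<psi>] gconst_pos D_nonneg[of \<phi>] by (intro mult_left_mono add_mono) auto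
    finally show ?thesis by (simp add: mult.commute)
  qed
  moreover have "gconst * (K1 + K2 + K1) \<ge> 0" using gconst_pos K1(1) K2(1) by simp
  ultimately show ?thesis by blast
qed

text \<open>Write \<open>u n\<close> as \<open>v + e * r\<close> with \<open>r\<close> the
  difference divided by \<open>e\<close>. For fixed \<open>e\<close> the integrated weight of
  \<open>r\<close> tends to 0, so the distance of the functionals is eventually at most
  \<open>e\<close> times a constant; then \<open>e\<close> is made small.\<close>

lemma \<Psi>_compact:
  assumes u: "\<And>n::nat. u n \<in> H" "v \<in> H"
    and lim: "\<And>r. r \<in> R \<Longrightarrow> (\<lambda>n. \<integral>x. \<bar>u n x - v x\<bar> powr r \<partial>M) \<longlonglongrightarrow> 0"
  shows "(\<lambda>n. \<Psi> (u n)) \<longlonglongrightarrow> \<Psi> v"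
proof -
  let ?d = "\<lambda>n x. u n x - v x"
  have d: "?d n \<in> H" for n using H_diff u by blast
  have est: "\<bar>\<Psi> (u n) - \<Psi> v\<bar> \<le> e * (3 * gconst * (Wt v + ((\<integral>x. \<bar>?d n x\<bar> powr 2 \<partial>M) / e\<^sup>2 + (\<integral>x. \<bar>?d n x\<bar> powr (p + 1) \<partial>M) / e powr (p + 1))))"
    if e: "e > 0" "e \<le> 1" for e n
  proof -
    let ?r = "\<lambda>x. (1 / e) * ?d n x"
    have r: "?r \<in> H" by (rule H_scale[OF d])
    have eq: "u n x = v x + e * ?r x" for x using e by simp
    have Wr: "Wt ?r = (\<integral>x. \<bar>?d n x\<bar> powr 2 \<partial>M) / e\<^sup>2 + (\<integral>x. \<bar>?d n x\<bar> powr (p + 1) \<partial>M) / e powr (p + 1)"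
    proof -
      have i: "integrable M (\<lambda>x. \<bar>?d n x\<bar> powr 2)" "integrable M (\<lambda>x. \<bar>?d n x\<bar> powr (p + 1))"
        by (rule powr_integrable[OF two_R d], rule powr_integrable[OF p_R d])
      have "weight (?r x) = \<bar>?d n x\<bar> powr 2 / e\<^sup>2 + \<bar>?d n x\<bar> powr (p + 1) / e powr (p + 1)" for x
        using e by (simp add: weight_def power_divide abs_divide powr_divide powr_numeral)
      then show ?thesis unfolding Wt_def using i by simp
    qed
    note i = F_integrable[OF u(1)] F_integrable[OF u(2)] weight_integrable[OF u(2)] weight_integrable[OF r]
    have pt: "\<bar>F (u n x) - F (v x)\<bar> \<le> e * (3 * gconst * (weight (v x) + weight (?r x)))" for x
    proof -
      let ?W = "gconst * (weight (v x) + weight (?r x))"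
      have W: "0 \<le> ?W" using gconst_pos weight_nonneg by simp
      have 1: "\<bar>F (v x + e * ?r x) - F (v x) - f (v x) * (e * ?r x)\<bar> \<le> e\<^sup>2 * (2 * ?W)"
        using F_taylor_weight[of e "v x" "?r x"] e by (simp add: mult.assoc)
      have 2: "\<bar>f (v x) * (e * ?r x)\<bar> \<le> e * ?W"
        using mult_left_mono[OF f_weight[of "v x" "?r x"], of e] e by (simp add: abs_mult mult.left_commute)
      have "e\<^sup>2 * (2 * ?W) \<le> e * (2 * ?W)" using e W by (intro mult_right_mono) (auto simp: power2_eq_square mult_left_le)
      moreover have "\<bar>A - B\<bar> \<le> P' + Q" if "\<bar>A - B - X\<bar> \<le> P" "\<bar>X\<bar> \<le> Q" "P \<le> P'" for A B X P P' Q :: real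
        using that by linarith
      ultimately have "\<bar>F (u n x) - F (v x)\<bar> \<le> e * (2 * ?W) + e * ?W" using 1 2 unfolding eq[symmetric] by blast
      then show ?thesis by (simp add: algebra_simps)
    qed
    have "\<Psi> (u n) - \<Psi> v = (\<integral>x. F (u n x) - F (v x) \<partial>M)" using i by (simp add: \<Psi>_def)
    also have "\<bar>\<dots>\<bar> \<le> (\<integral>x. \<bar>F (u n x) - F (v x)\<bar> \<partial>M)" by (rule integral_abs_bound)
    also have "\<dots> \<le> (\<integral>x. e * (3 * gconst * (weight (v x) + weight (?r x))) \<partial>M)"
      by (rule integral_mono[OF _ _ pt]) (use i in auto)
    also have "\<dots> = e * (3 * gconst * (Wt v + Wt ?r))" unfolding Wt_def using i by simp
    finally show ?thesis unfolding Wr .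
  qed
  show ?thesis
  proof (rule LIMSEQ_I)
    fix \<epsilon> :: real assume \<epsilon>: "\<epsilon> > 0"
    \<comment> \<open>The constant that remains once the integrated weight of the rescaled
      difference is below 1.\<close>
    define c where "c = 3 * gconst * (Wt v + 1)"
    have c: "c > 0" using gconst_pos Wt_nonneg[of v] by (simp add: c_def)
    define e where "e = min 1 (\<epsilon> / (2 * c))"
    have e: "e > 0" "e \<le> 1" "e * c < \<epsilon>" using \<epsilon> c by (auto simp: e_def min_def field_simps)
    have "(\<lambda>n. (\<integral>x. \<bar>?d n x\<bar> powr 2 \<partial>M) / e\<^sup>2 + (\<integral>x. \<bar>?d n x\<bar> powr (p + 1) \<partial>M) / e powr (p + 1)) \<longlonglongrightarrow> 0 / e\<^sup>2 + 0 / e powr (p + 1)"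
      using e by (intro tendsto_intros lim two_R p_R) auto
    then have "eventually (\<lambda>n. (\<integral>x. \<bar>?d n x\<bar> powr 2 \<partial>M) / e\<^sup>2 + (\<integral>x. \<bar>?d n x\<bar> powr (p + 1) \<partial>M) / e powr (p + 1) < 1) sequentially"
      by (rule order_tendstoD(2)) simp
    then obtain n0 where n0: "\<And>n. n \<ge> n0 \<Longrightarrow> (\<integral>x. \<bar>?d n x\<bar> powr 2 \<partial>M) / e\<^sup>2 + (\<integral>x. \<bar>?d n x\<bar> powr (p + 1) \<partial>M) / e powr (p + 1) < 1"
      by (auto simp: eventually_sequentially)
    have "norm (\<Psi> (u n) - \<Psi> v) < \<epsilon>" if "n \<ge> n0" for n
    proof -
      have "\<bar>\<Psi> (u n) - \<Psi> v\<bar> \<le> e * c"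
        unfolding c_def
        by (rule order_trans[OF est[OF e(1,2)]]) (use n0[OF that] e gconst_pos in \<open>intro mult_left_mono add_left_mono, auto\<close>)
      then show ?thesis using e(3) by simp
    qed
    then show "\<exists>no. \<forall>n\<ge>no. norm (\<Psi> (u n) - \<Psi> v) < \<epsilon>" by blast
  qed
qed

lemma \<Psi>_nonneg: "0 \<le> \<Psi> u"
  unfolding \<Psi>_def by (rule Bochner_Integration.integral_nonneg) (rule F_nonneg)

lemma \<Psi>_superquadratic: "K \<ge> 0 \<Longrightarrow> \<exists>C\<ge>0. \<forall>u\<in>H. \<Psi> u \<ge> K * (\<integral>x. (u x)\<^sup>2 \<partial>M) - C"
proof -
  interpret finite_measure M by (rule finite_M)
  assume "K \<ge> 0"
  then obtain C0 where C0: "C0 \<ge> 0" "\<And>s. F s \<ge> K * s\<^sup>2 - C0" using F_superquadratic by blast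
  have "\<Psi> u \<ge> K * (\<integral>x. (u x)\<^sup>2 \<partial>M) - C0 * measure M (space M)" if u: "u \<in> H" for u
  proof -
    have "(\<integral>x. K * (u x)\<^sup>2 - C0 \<partial>M) \<le> \<Psi> u"
      unfolding \<Psi>_def using C0 square_integrable[OF u] F_integrable[OF u] by (intro integral_mono) auto
    then show ?thesis using square_integrable[OF u] by (simp add: mult.commute)
  qed
  then show ?thesis using C0(1) by (intro exI[of _ "C0 * measure M (space M)"]) auto
qed

lemma \<Psi>_small: "e > 0 \<Longrightarrow> \<exists>K\<ge>0. \<forall>u\<in>H. \<Psi> u \<le> e * (\<integral>x. (u x)\<^sup>2 \<partial>M) + K * (\<integral>x. \<bar>u x\<bar> powr (p + 1) \<partial>M)"
proof -
  assume "e > 0"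
  then obtain K where K: "K \<ge> 0" "\<And>s. F s \<le> e * s\<^sup>2 + K * \<bar>s\<bar> powr (p + 1)" using F_small by blast
  have "\<Psi> u \<le> e * (\<integral>x. (u x)\<^sup>2 \<partial>M) + K * (\<integral>x. \<bar>u x\<bar> powr (p + 1) \<partial>M)" if u: "u \<in> H" for u
  proof -
    have i: "integrable M (\<lambda>x. \<bar>u x\<bar> powr (p + 1))" by (rule powr_integrable[OF p_R u])
    have "\<Psi> u \<le> (\<integral>x. e * (u x)\<^sup>2 + K * \<bar>u x\<bar> powr (p + 1) \<partial>M)"
      unfolding \<Psi>_def using K i square_integrable[OF u] F_integrable[OF u] by (intro integral_mono) auto
    then show ?thesis using i square_integrable[OF u] by simp
  qed
  then show ?thesis using K(1) by blast
qed

lemma \<Psi>_fibre: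
  assumes t: "t \<ge> 0" and u: "u \<in> H" and \<phi>: "\<phi> \<in> H"
  shows "df u (\<lambda>x. (t\<^sup>2 - 1) / 2 * u x + t * \<phi> x) + \<Psi> u - \<Psi> (\<lambda>x. t * u x + \<phi> x) \<le> 0"
proof -
  note i = df_integrable[OF u H_add[OF H_scale[OF u] H_scale[OF \<phi>]]] F_integrable[OF u] F_integrable[OF H_add[OF H_scale[OF u] \<phi>]]
  have "df u (\<lambda>x. (t\<^sup>2 - 1) / 2 * u x + t * \<phi> x) + \<Psi> u - \<Psi> (\<lambda>x. t * u x + \<phi> x) =
      (\<integral>x. f (u x) * ((t\<^sup>2 - 1) / 2 * u x + t * \<phi> x) + F (u x) - F (t * u x + \<phi> x) \<partial>M)"
    unfolding df_def \<Psi>_def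
    by (subst Bochner_Integration.integral_diff Bochner_Integration.integral_add; (intro Bochner_Integration.integrable_add)?; (rule i)?)+
      (rule refl)
  also have "\<dots> \<le> (\<integral>x. 0 \<partial>M)"
    by (rule integral_mono[OF _ _ F_fibre(1)[OF t]])
      (intro Bochner_Integration.integrable_diff Bochner_Integration.integrable_add i, simp)
  finally show ?thesis by simp
qed

text \<open>A nonpositive integrand with vanishing integral is 0 almost everywhere, and the strict
  form of the fibre inequality excludes this wherever \<open>u\<close> is nonzero.\<close>

lemma \<Psi>_fibre_strict:
  assumes t: "t \<ge> 0" "t \<noteq> 1" and u: "u \<in> H"
    and z: "(t\<^sup>2 - 1) / 2 * df u u + \<Psi> u - \<Psi> (\<lambda>x. t * u x) = 0"
  shows "AE x in M. u x = 0"
proof -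
  let ?E = "\<lambda>x. f (u x) * ((t\<^sup>2 - 1) / 2 * u x) + F (u x) - F (t * u x)"
  have i: "integrable M (\<lambda>x. f (u x) * ((t\<^sup>2 - 1) / 2 * u x))" "integrable M (\<lambda>x. F (u x))" "integrable M (\<lambda>x. F (t * u x))"
    using df_integrable[OF u H_scale[OF u]] F_integrable[OF u] F_integrable[OF H_scale[OF u]] by auto
  have iE: "integrable M ?E" by (intro Bochner_Integration.integrable_diff Bochner_Integration.integrable_add i)
  have "(\<integral>x. ?E x \<partial>M) = (\<integral>x. f (u x) * ((t\<^sup>2 - 1) / 2 * u x) \<partial>M) + \<Psi> u - \<Psi> (\<lambda>x. t * u x)"
    unfolding \<Psi>_def using i by (simp only: Bochner_Integration.integral_diff Bochner_Integration.integral_add Bochner_Integration.integrable_add)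
  also have "(\<integral>x. f (u x) * ((t\<^sup>2 - 1) / 2 * u x) \<partial>M) = (t\<^sup>2 - 1) / 2 * df u u"
    using df_scale[of u "(t\<^sup>2 - 1) / 2" u] by (simp only: df_def)
  finally have "(\<integral>x. ?E x \<partial>M) = 0" using z by (simp only:)
  then have "(\<integral>x. - ?E x \<partial>M) = 0" by (simp only: Bochner_Integration.integral_minus minus_zero)
  moreover have le: "?E x \<le> 0" for x using F_fibre(1)[OF t(1), of "u x" 0] by simp
  ultimately have "AE x in M. - ?E x = 0"
    by (subst (asm) integral_nonneg_eq_0_iff_AE[OF Bochner_Integration.integrable_minus[OF iE]])
      (simp_all only: neg_0_le_iff_le le AE_I2)
  then show ?thesis
  proof eventually_elim
    case (elim x)
    then show ?case using F_fibre(2)[OF t(1) _ t(2), of "u x" 0] by force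
  qed
qed

end

context compact_embedding begin

lemma D_sum_bound:
  assumes "u \<in> H" "v \<in> H"
  shows "D (\<lambda>x. u x + v x) (\<lambda>x. u x + v x) \<le> 2 * D u u + 2 * D v v"
proof -
  have "0 \<le> D (\<lambda>x. u x - v x) (\<lambda>x. u x - v x)" by (rule D_nonneg)
  then show ?thesis using assms by (simp add: D_bilinear H_closed D_commute[of v u])
qed

lemma D_scale_self: "u \<in> H \<Longrightarrow> D (\<lambda>x. c * u x) (\<lambda>x. c * u x) = c\<^sup>2 * D u u"
  by (simp add: D_scale D_scale_right H_scale power2_eq_square)

lemma D_diff_bound:
  assumes "u \<in> H" "v \<in> H"
  shows "D (\<lambda>x. u x - v x) (\<lambda>x. u x - v x) \<le> 2 * D u u + 2 * D v v"
  using D_sum_bound[OF assms(1) H_scale[OF assms(2), of "-1"]] D_scale_self[OF assms(2), of "-1"] by simp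

lemma D_pos: "u \<in> H \<Longrightarrow> \<not> (AE x in M. u x = 0) \<Longrightarrow> 0 < D u u"
  using AE_zero_if_D_zero D_nonneg by (metis less_eq_real_def)

lemma Lr_add:
  assumes r: "r \<in> R" and H: "\<And>n::nat. x n \<in> H" "\<And>n. y n \<in> H"
    and x: "(\<lambda>n. \<integral>w. \<bar>x n w\<bar> powr r \<partial>M) \<longlonglongrightarrow> 0" and y: "(\<lambda>n. \<integral>w. \<bar>y n w\<bar> powr r \<partial>M) \<longlonglongrightarrow> 0"
  shows "(\<lambda>n. \<integral>w. \<bar>x n w + y n w\<bar> powr r \<partial>M) \<longlonglongrightarrow> 0"
proof (rule Lim_null_comparison)
  let ?g = "\<lambda>n. 2 powr r * ((\<integral>w. \<bar>x n w\<bar> powr r \<partial>M) + (\<integral>w. \<bar>y n w\<bar> powr r \<partial>M))"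
  have "?g \<longlonglongrightarrow> 2 powr r * (0 + 0)" by (intro tendsto_intros x y)
  then show "?g \<longlonglongrightarrow> 0" by simp
  have ix: "integrable M (\<lambda>w. \<bar>x n w\<bar> powr r)" "integrable M (\<lambda>w. \<bar>y n w\<bar> powr r)"
    "integrable M (\<lambda>w. \<bar>x n w + y n w\<bar> powr r)" for n
    by (rule powr_integrable[OF r H(1)], rule powr_integrable[OF r H(2)], rule powr_integrable[OF r H_add[OF H]])
  have "(\<integral>w. \<bar>x n w + y n w\<bar> powr r \<partial>M) \<le> (\<integral>w. 2 powr r * (\<bar>x n w\<bar> powr r + \<bar>y n w\<bar> powr r) \<partial>M)" for n
  proof (rule integral_mono)
    fix w
    have "\<bar>x n w + y n w\<bar> powr r \<le> (2 * max \<bar>x n w\<bar> \<bar>y n w\<bar>) powr r"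
      using R_pos[OF r] by (intro powr_mono2) auto
    also have "\<dots> = 2 powr r * (max \<bar>x n w\<bar> \<bar>y n w\<bar>) powr r" by (simp add: powr_mult)
    also have "\<dots> \<le> 2 powr r * (\<bar>x n w\<bar> powr r + \<bar>y n w\<bar> powr r)"
      by (intro mult_left_mono) (auto simp: max_def)
    finally show "\<bar>x n w + y n w\<bar> powr r \<le> 2 powr r * (\<bar>x n w\<bar> powr r + \<bar>y n w\<bar> powr r)" .
  qed (use ix in auto)
  then show "\<forall>\<^sub>F n in sequentially. norm (\<integral>w. \<bar>x n w + y n w\<bar> powr r \<partial>M) \<le> ?g n"
    using ix by (simp add: abs_of_nonneg Bochner_Integration.integral_nonneg)
qed

lemma Lr_scale:
  assumes r: "r \<in> R" and u: "u \<in> H" and t: "t \<longlonglongrightarrow> t0"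
  shows "(\<lambda>n. \<integral>w. \<bar>(t n - t0) * u w\<bar> powr r \<partial>M) \<longlonglongrightarrow> 0"
proof -
  have "(\<lambda>n. \<bar>t n - t0\<bar> powr r * (\<integral>w. \<bar>u w\<bar> powr r \<partial>M)) \<longlonglongrightarrow> \<bar>t0 - t0\<bar> powr r * (\<integral>w. \<bar>u w\<bar> powr r \<partial>M)"
    using R_pos[OF r] by (intro tendsto_mult tendsto_const tendsto_powr' tendsto_rabs tendsto_diff t) auto
  then show ?thesis by (simp add: abs_mult powr_mult)
qed

lemma Lr_scale_const:
  fixes x :: "nat \<Rightarrow> 'a \<Rightarrow> real"
  assumes "(\<lambda>n. \<integral>w. \<bar>x n w\<bar> powr r \<partial>M) \<longlonglongrightarrow> 0"
  shows "(\<lambda>n. \<integral>w. \<bar>c * x n w\<bar> powr r \<partial>M) \<longlonglongrightarrow> 0"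
proof -
  have "(\<integral>w. \<bar>c * x n w\<bar> powr r \<partial>M) = \<bar>c\<bar> powr r * (\<integral>w. \<bar>x n w\<bar> powr r \<partial>M)" for n
    by (simp add: abs_mult powr_mult)
  then show ?thesis using tendsto_mult_right_zero[OF assms] by presburger
qed

lemma Lr_zero:
  assumes r: "r \<in> R" and H: "\<And>n::nat. x n \<in> H" and x: "(\<lambda>n. D (x n) (x n)) \<longlonglongrightarrow> 0"
  shows "(\<lambda>n. \<integral>w. \<bar>x n w\<bar> powr r \<partial>M) \<longlonglongrightarrow> 0"
proof -
  obtain K where K: "K > 0" "\<And>u. u \<in> H \<Longrightarrow> (\<integral>x. \<bar>u x\<bar> powr r \<partial>M) \<le> K * sqrt (D u u) powr r"
    using embedding[OF r] by blast
  have "(\<lambda>n. K * sqrt (D (x n) (x n)) powr r) \<longlonglongrightarrow> K * sqrt 0 powr r"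
    using R_pos[OF r] by (intro tendsto_mult tendsto_const tendsto_powr' tendsto_real_sqrt x) (auto simp: D_nonneg)
  then have l: "(\<lambda>n. K * sqrt (D (x n) (x n)) powr r) \<longlonglongrightarrow> 0" by simp
  show ?thesis
    by (rule Lim_null_comparison[OF _ l]) (use K(2)[OF H] in \<open>simp add: abs_of_nonneg Bochner_Integration.integral_nonneg\<close>)
qed

end

lemma (in nonlinear_functional) \<Psi>_AE_zero:
  assumes "u \<in> H" "AE x in M. u x = 0" shows "\<Psi> u = 0"
  unfolding \<Psi>_def by (rule integral_eq_zero_AE) (use assms(2) in \<open>eventually_elim, simp add: F_0\<close>)

section \<open>The coupled functional and its fibres\<close>

locale coupled = compact_embedding M H D R + f: nonlinear_functional M H D R f p C \<delta> + g: nonlinear_functional M H D R g q C \<delta>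
  for M :: "'a measure" and H D R f g p q C \<delta>
begin

definition I :: "('a \<Rightarrow> real) \<Rightarrow> ('a \<Rightarrow> real) \<Rightarrow> real" where
  "I u v = D u v - f.\<Psi> u - g.\<Psi> v"

definition dI :: "('a \<Rightarrow> real) \<Rightarrow> ('a \<Rightarrow> real) \<Rightarrow> ('a \<Rightarrow> real) \<Rightarrow> ('a \<Rightarrow> real) \<Rightarrow> real" where
  "dI u v \<phi> \<psi> = D u \<psi> + D v \<phi> - f.df u \<phi> - g.df v \<psi>"

text \<open>\<open>J a b\<close> is \<open>I\<close> in the coordinates in which the quadratic part is diagonal.\<close>

definition J :: "('a \<Rightarrow> real) \<Rightarrow> ('a \<Rightarrow> real) \<Rightarrow> real" where
  "J a b = D a a - D b b - f.\<Psi> (\<lambda>x. a x + b x) - g.\<Psi> (\<lambda>x. a x - b x)"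

lemma J_eq_I: "a \<in> H \<Longrightarrow> b \<in> H \<Longrightarrow> J a b = I (\<lambda>x. a x + b x) (\<lambda>x. a x - b x)"
  by (simp add: J_def I_def D_bilinear H_closed D_commute[of b a])

lemma dI_lincomb:
  assumes "u \<in> H" "v \<in> H" "\<phi>1 \<in> H" "\<psi>1 \<in> H" "\<phi>2 \<in> H" "\<psi>2 \<in> H"
  shows "dI u v (\<lambda>x. a * \<phi>1 x + b * \<phi>2 x) (\<lambda>x. a * \<psi>1 x + b * \<psi>2 x) = a * dI u v \<phi>1 \<psi>1 + b * dI u v \<phi>2 \<psi>2"
  using assms by (simp add: dI_def D_bilinear H_closed f.df_lincomb g.df_lincomb algebra_simps)

text \<open>The quadratic part is expanded exactly, leaving the explicit term
  \<open>D \<phi> \<psi>\<close>; the estimated remainder comes from the two nonlinear functionals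
  alone.\<close>

lemma I_taylor:
  shows "\<exists>K\<ge>0. \<forall>u\<in>H. \<forall>v\<in>H. \<forall>\<phi>\<in>H. \<forall>\<psi>\<in>H. D u u \<le> \<rho> \<longrightarrow> D v v \<le> \<rho> \<longrightarrow> D \<phi> \<phi> \<le> 1 \<longrightarrow> D \<psi> \<psi> \<le> 1 \<longrightarrow>
    \<bar>I (\<lambda>x. u x + \<phi> x) (\<lambda>x. v x + \<psi> x) - I u v - dI u v \<phi> \<psi> - D \<phi> \<psi>\<bar> \<le> K * (D \<phi> \<phi> + D \<psi> \<psi>)"
proof -
  obtain K1 where K1: "K1 \<ge> 0" "\<And>u \<phi>. u \<in> H \<Longrightarrow> \<phi> \<in> H \<Longrightarrow> D u u \<le> \<rho> \<Longrightarrow> D \<phi> \<phi> \<le> 1 \<Longrightarrow>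
      \<bar>f.\<Psi> (\<lambda>x. u x + \<phi> x) - f.\<Psi> u - f.df u \<phi>\<bar> \<le> K1 * D \<phi> \<phi>" using f.\<Psi>_taylor[of \<rho>] by blast
  obtain K2 where K2: "K2 \<ge> 0" "\<And>u \<phi>. u \<in> H \<Longrightarrow> \<phi> \<in> H \<Longrightarrow> D u u \<le> \<rho> \<Longrightarrow> D \<phi> \<phi> \<le> 1 \<Longrightarrow>
      \<bar>g.\<Psi> (\<lambda>x. u x + \<phi> x) - g.\<Psi> u - g.df u \<phi>\<bar> \<le> K2 * D \<phi> \<phi>" using g.\<Psi>_taylor[of \<rho>] by blast
  have "\<bar>I (\<lambda>x. u x + \<phi> x) (\<lambda>x. v x + \<psi> x) - I u v - dI u v \<phi> \<psi> - D \<phi> \<psi>\<bar> \<le> (K1 + K2) * (D \<phi> \<phi> + D \<psi> \<psi>)"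
    if "u \<in> H" "v \<in> H" "\<phi> \<in> H" "\<psi> \<in> H" "D u u \<le> \<rho>" "D v v \<le> \<rho>" "D \<phi> \<phi> \<le> 1" "D \<psi> \<psi> \<le> 1" for u v \<phi> \<psi>
  proof -
    have "I (\<lambda>x. u x + \<phi> x) (\<lambda>x. v x + \<psi> x) - I u v - dI u v \<phi> \<psi> - D \<phi> \<psi> =
      - (f.\<Psi> (\<lambda>x. u x + \<phi> x) - f.\<Psi> u - f.df u \<phi>) - (g.\<Psi> (\<lambda>x. v x + \<psi> x) - g.\<Psi> v - g.df v \<psi>)"
      using that by (simp add: I_def dI_def D_bilinear H_closed D_commute[of \<phi> v])
    then have "\<bar>I (\<lambda>x. u x + \<phi> x) (\<lambda>x. v x + \<psi> x) - I u v - dI u v \<phi> \<psi> - D \<phi> \<psi>\<bar> \<le> K1 * D \<phi> \<phi> + K2 * D \<psi> \<psi>"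
      using K1(2)[OF that(1,3,5,7)] K2(2)[OF that(2,4,6,8)] by linarith
    also have "\<dots> \<le> (K1 + K2) * (D \<phi> \<phi> + D \<psi> \<psi>)"
      using K1(1) K2(1) D_nonneg[of \<phi>] D_nonneg[of \<psi>] by (simp add: distrib_left distrib_right)
    finally show ?thesis .
  qed
  then show ?thesis using K1(1) K2(1) by (intro exI[of _ "K1 + K2"]) auto
qed

text \<open>Selects a step for first order arguments: directions scaled by \<open>\<tau>\<close>
  stay in the unit ball where the Taylor estimate holds, and the error \<open>\<tau>^2 * B\<close>
  is beaten by the linear gain \<open>\<tau> * L\<close>.\<close>

lemma small_parameter:
  assumes "S \<ge> 0" "B > 0" "L > 0"
  shows "\<exists>\<tau>>0. \<tau> < 1 \<and> \<tau> * (1 + S) \<le> 1 \<and> \<tau> * B < (L::real)"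
proof -
  define \<tau> where "\<tau> = min (1 / (2 * (1 + S))) (L / (2 * B))"
  have pos: "\<tau> > 0" using assms by (simp add: \<tau>_def)
  have "\<tau> * (1 + S) \<le> 1 / (2 * (1 + S)) * (1 + S)" using assms by (intro mult_right_mono) (auto simp: \<tau>_def)
  also have "1 / (2 * (1 + S)) * (1 + S) = 1 / 2" using assms(1) by (simp add: field_simps)
  finally have a: "\<tau> * (1 + S) \<le> 1 / 2" .
  have "\<tau> * 1 \<le> \<tau> * (1 + S)" using assms pos by (intro mult_left_mono) auto
  then have b: "\<tau> < 1" using a by simp
  have "\<tau> * B \<le> L / (2 * B) * B" using assms by (intro mult_right_mono) (auto simp: \<tau>_def)
  then have "\<tau> * B < L" using assms by simp
  then show ?thesis using pos a b by (intro exI[of _ \<tau>]) simp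
qed

text \<open>A positive derivative would give an increase for a small step. Only positive steps are
  tested; equality results from applying it to the opposite direction too.\<close>

lemma dI_nonpos_at_max:
  assumes H: "u \<in> H" "v \<in> H" "\<phi> \<in> H" "\<psi> \<in> H"
    and max: "\<And>\<tau>. 0 < \<tau> \<Longrightarrow> \<tau> < 1 \<Longrightarrow> I (\<lambda>x. u x + \<tau> * \<phi> x) (\<lambda>x. v x + \<tau> * \<psi> x) \<le> I u v"
  shows "dI u v \<phi> \<psi> \<le> 0"
proof (rule ccontr)
  assume neg: "\<not> dI u v \<phi> \<psi> \<le> 0"
  let ?L = "dI u v \<phi> \<psi>" and ?S = "D \<phi> \<phi> + D \<psi> \<psi>"
  have S: "?S \<ge> 0" using D_nonneg[of \<phi>] D_nonneg[of \<psi>] by simp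
  let ?\<rho> = "max (D u u) (D v v)"
  from I_taylor[of ?\<rho>] obtain K where K0: "K \<ge> 0" and K1: "\<forall>u\<in>H. \<forall>v\<in>H. \<forall>\<phi>\<in>H. \<forall>\<psi>\<in>H. D u u \<le> ?\<rho> \<longrightarrow>
    D v v \<le> ?\<rho> \<longrightarrow> D \<phi> \<phi> \<le> 1 \<longrightarrow> D \<psi> \<psi> \<le> 1 \<longrightarrow>
    \<bar>I (\<lambda>x. u x + \<phi> x) (\<lambda>x. v x + \<psi> x) - I u v - dI u v \<phi> \<psi> - D \<phi> \<psi>\<bar> \<le> K * (D \<phi> \<phi> + D \<psi> \<psi>)"
    by (elim exE conjE)
  note K = K0 K1[rule_format, OF H(1) H(2) _ _ max.cobounded1 max.cobounded2]
  define B where "B = K * ?S + \<bar>D \<phi> \<psi>\<bar> + 1"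
  have B: "B > 0" using K(1) S by (simp add: B_def add_nonneg_pos)
  obtain \<tau> where \<tau>: "0 < \<tau>" "\<tau> < 1" "\<tau> * (1 + ?S) \<le> 1" "\<tau> * B < ?L"
    using small_parameter[OF S B, of ?L] neg by auto
  have small: "\<tau>\<^sup>2 * ?S \<le> 1"
  proof -
    have "\<tau>\<^sup>2 * ?S \<le> \<tau> * ?S" using \<tau> S by (intro mult_right_mono) (auto simp: power2_eq_square mult_left_le)
    also have "\<dots> \<le> 1" using \<tau> S by (simp add: distrib_left)
    finally show ?thesis .
  qed
  have le1: "\<tau>\<^sup>2 * D \<phi> \<phi> \<le> 1" "\<tau>\<^sup>2 * D \<psi> \<psi> \<le> 1"
    using small mult_nonneg_nonneg[OF zero_le_power2[of \<tau>] D_nonneg[of \<phi>]]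
      mult_nonneg_nonneg[OF zero_le_power2[of \<tau>] D_nonneg[of \<psi>]] by (auto simp: distrib_left)
  have dl: "dI u v (\<lambda>x. \<tau> * \<phi> x) (\<lambda>x. \<tau> * \<psi> x) = \<tau> * ?L"
    using dI_lincomb[OF H(1,2,3,4,3,4), of \<tau> 0] by simp
  have "\<bar>I (\<lambda>x. u x + \<tau> * \<phi> x) (\<lambda>x. v x + \<tau> * \<psi> x) - I u v - \<tau> * ?L - \<tau>\<^sup>2 * D \<phi> \<psi>\<bar> \<le> K * (\<tau>\<^sup>2 * ?S)"
    using K(2)[OF H_scale[OF H(3)] H_scale[OF H(4)], of \<tau> \<tau>] le1 H(3,4)
    by (simp add: D_scale_self dl D_scale D_scale_right H_scale distrib_left power2_eq_square mult.assoc)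
  then have "\<tau> * ?L \<le> K * (\<tau>\<^sup>2 * ?S) + \<tau>\<^sup>2 * \<bar>D \<phi> \<psi>\<bar>"
    using max[OF \<tau>(1,2)] mult_left_mono[OF abs_ge_self[of "- D \<phi> \<psi>"] zero_le_power2[of \<tau>]] by simp
  also have "\<dots> \<le> \<tau>\<^sup>2 * B" by (simp add: B_def algebra_simps)
  finally have "\<tau> * ?L \<le> \<tau> * (\<tau> * B)" by (simp add: power2_eq_square mult.assoc)
  then show False using \<tau>(1,4) by simp
qed

text \<open>Criticality of \<open>I\<close> along its fibre, spanned by \<open>(u, v)\<close> and
  all \<open>(\<phi>, -\<phi>)\<close>: the generalised Nehari set.\<close>

definition nehari :: "('a \<Rightarrow> real) \<Rightarrow> ('a \<Rightarrow> real) \<Rightarrow> bool" where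
  "nehari u v \<longleftrightarrow> dI u v u v = 0 \<and> (\<forall>\<phi>\<in>H. dI u v \<phi> (\<lambda>x. - \<phi> x) = 0)"

text \<open>The contribution of \<open>f\<close> to the change of \<open>I\<close> from
  \<open>(u, v)\<close> to the point of the fibre with coordinates \<open>t\<close> and
  \<open>\<phi>\<close>, after the Nehari conditions have removed the quadratic terms; see
  \<open>nehari_fibre\<close>.\<close>

definition defect_f :: "('a \<Rightarrow> real) \<Rightarrow> real \<Rightarrow> ('a \<Rightarrow> real) \<Rightarrow> real" where
  "defect_f u t \<phi> = (t\<^sup>2 - 1) / 2 * f.df u u + t * f.df u \<phi> + f.\<Psi> u - f.\<Psi> (\<lambda>x. t * u x + \<phi> x)"

definition defect_g :: "('a \<Rightarrow> real) \<Rightarrow> real \<Rightarrow> ('a \<Rightarrow> real) \<Rightarrow> real" where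
  "defect_g v t \<phi> = (t\<^sup>2 - 1) / 2 * g.df v v - t * g.df v \<phi> + g.\<Psi> v - g.\<Psi> (\<lambda>x. t * v x - \<phi> x)"

lemma defect_f_nonpos: "t \<ge> 0 \<Longrightarrow> u \<in> H \<Longrightarrow> \<phi> \<in> H \<Longrightarrow> defect_f u t \<phi> \<le> 0"
  using f.\<Psi>_fibre[of t u \<phi>] by (simp only: defect_f_def f.df_lincomb)

lemma defect_g_nonpos: "t \<ge> 0 \<Longrightarrow> v \<in> H \<Longrightarrow> \<phi> \<in> H \<Longrightarrow> defect_g v t \<phi> \<le> 0"
  using g.\<Psi>_fibre[of t v "\<lambda>x. - \<phi> x"] g.df_lincomb[of v v "\<lambda>x. - \<phi> x" "(t\<^sup>2 - 1) / 2" t] g.df_scale[of v "-1" \<phi>]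
  by (simp add: defect_g_def H_minus)

text \<open>The two Nehari conditions express \<open>D u v\<close> and the mixed quadratic terms
  through \<open>f\<close> and \<open>g\<close>. What remains is an exact loss of three terms of one
  sign, which gives maximality and later also convergence of maximising sequences.\<close>

lemma nehari_fibre:
  assumes n: "nehari u v" and H: "u \<in> H" "v \<in> H" "\<phi> \<in> H"
  shows "I (\<lambda>x. t * u x + \<phi> x) (\<lambda>x. t * v x - \<phi> x) = I u v - D \<phi> \<phi> + defect_f u t \<phi> + defect_g v t \<phi>"
proof -
  have 1: "2 * D u v = f.df u u + g.df v v"
    using n by (simp add: nehari_def dI_def D_commute[of v u])
  have "D u (\<lambda>x. - \<phi> x) = - D u \<phi>" using D_scale_right[OF H(3) H(1), of "-1"] by simp
  then have 2: "D v \<phi> - D u \<phi> = f.df u \<phi> - g.df v \<phi>"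
  proof -
    have "dI u v \<phi> (\<lambda>x. - \<phi> x) = 0" using n H(3) by (simp add: nehari_def)
    then show ?thesis using \<open>D u (\<lambda>x. - \<phi> x) = - D u \<phi>\<close> g.df_scale[of v "-1" \<phi>] by (simp add: dI_def)
  qed
  have "D (\<lambda>x. t * u x + \<phi> x) (\<lambda>x. t * v x - \<phi> x) = t\<^sup>2 * D u v + t * (D v \<phi> - D u \<phi>) - D \<phi> \<phi>"
    using H by (simp add: D_bilinear H_closed D_commute[of \<phi> v] power2_eq_square algebra_simps)
  then show ?thesis unfolding I_def defect_f_def defect_g_def 2
    using arg_cong[OF 1, of "\<lambda>x. (t\<^sup>2 - 1) / 2 * x"] by (simp add: algebra_simps diff_divide_distrib add_divide_distrib)
qed

lemma nehari_max:
  assumes "nehari u v" "u \<in> H" "v \<in> H" "\<phi> \<in> H" "t \<ge> 0"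
  shows "I (\<lambda>x. t * u x + \<phi> x) (\<lambda>x. t * v x - \<phi> x) \<le> I u v"
  using nehari_fibre[OF assms(1-4), of t] defect_f_nonpos[OF assms(5,2,4)] defect_g_nonpos[OF assms(5,3,4)] D_nonneg[of \<phi>]
  by simp

text \<open>Both functionals are bounded below with the same \<open>K\<close>, and the squares of
  \<open>t * a + b\<close> and \<open>t * a - b\<close> add up to
  \<open>2 * t^2 * a^2 + 2 * b^2\<close>. The constant \<open>c\<close> does not depend on
  \<open>a\<close>, so the estimate is uniform under perturbation of \<open>a\<close>.\<close>

lemma J_coercive:
  assumes K: "K \<ge> 0"
  shows "\<exists>c\<ge>0. \<forall>a\<in>H. \<forall>b\<in>H. \<forall>t. J (\<lambda>x. t * a x) b \<le> t\<^sup>2 * (D a a - 2 * K * (\<integral>x. (a x)\<^sup>2 \<partial>M)) - D b b + c"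
proof -
  obtain c1 where c1: "c1 \<ge> 0" "\<And>u. u \<in> H \<Longrightarrow> f.\<Psi> u \<ge> K * (\<integral>x. (u x)\<^sup>2 \<partial>M) - c1" using f.\<Psi>_superquadratic[OF K] by blast
  obtain c2 where c2: "c2 \<ge> 0" "\<And>u. u \<in> H \<Longrightarrow> g.\<Psi> u \<ge> K * (\<integral>x. (u x)\<^sup>2 \<partial>M) - c2" using g.\<Psi>_superquadratic[OF K] by blast
  have "J (\<lambda>x. t * a x) b \<le> t\<^sup>2 * (D a a - 2 * K * (\<integral>x. (a x)\<^sup>2 \<partial>M)) - D b b + (c1 + c2)" if H: "a \<in> H" "b \<in> H" for a b t
  proof -
    note Hs = H_add[OF H_scale[OF H(1), of t] H(2)] H_diff[OF H_scale[OF H(1), of t] H(2)]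
    note i = square_integrable[OF Hs(1)] square_integrable[OF Hs(2)] square_integrable[OF H(1)] square_integrable[OF H(2)]
    have "2 * t\<^sup>2 * (\<integral>x. (a x)\<^sup>2 \<partial>M) \<le> (\<integral>x. 2 * t\<^sup>2 * (a x)\<^sup>2 + 2 * (b x)\<^sup>2 \<partial>M)"
    proof -
      have "0 \<le> (\<integral>x. (b x)\<^sup>2 \<partial>M)" by (rule Bochner_Integration.integral_nonneg) simp
      then show ?thesis using i by simp
    qed
    also have "\<dots> = (\<integral>x. (t * a x + b x)\<^sup>2 + (t * a x - b x)\<^sup>2 \<partial>M)"
      by (rule Bochner_Integration.integral_cong) (auto simp: power2_eq_square algebra_simps)
    also have "\<dots> = (\<integral>x. (t * a x + b x)\<^sup>2 \<partial>M) + (\<integral>x. (t * a x - b x)\<^sup>2 \<partial>M)" using i by simp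
    finally have "K * (2 * t\<^sup>2 * (\<integral>x. (a x)\<^sup>2 \<partial>M)) \<le> K * ((\<integral>x. (t * a x + b x)\<^sup>2 \<partial>M) + (\<integral>x. (t * a x - b x)\<^sup>2 \<partial>M))"
      using K by (rule mult_left_mono)
    then show ?thesis
      using c1(2)[OF Hs(1)] c2(2)[OF Hs(2)] D_scale_self[OF H(1), of t] by (simp add: J_def algebra_simps)
  qed
  then show ?thesis using c1(1) c2(1) by (intro exI[of _ "c1 + c2"]) auto
qed

text \<open>Upper bounds of the supremum over the fibre of \<open>a\<close>, as a predicate, so that
  possibly infinite suprema need no values.\<close>

definition fibre_bound :: "('a \<Rightarrow> real) \<Rightarrow> real \<Rightarrow> bool" where
  "fibre_bound a c \<longleftrightarrow> (\<forall>t\<ge>0. \<forall>b\<in>H. J (\<lambda>x. t * a x) b \<le> c)"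

lemma square_integral_pos:
  assumes "u \<in> H" "\<not> (AE x in M. u x = 0)" shows "0 < (\<integral>x. (u x)\<^sup>2 \<partial>M)"
proof (rule ccontr)
  assume n: "\<not> 0 < (\<integral>x. (u x)\<^sup>2 \<partial>M)"
  moreover have "0 \<le> (\<integral>x. (u x)\<^sup>2 \<partial>M)" by (rule Bochner_Integration.integral_nonneg) simp
  ultimately have "(\<integral>x. (u x)\<^sup>2 \<partial>M) = 0" by simp
  then have "AE x in M. (u x)\<^sup>2 = 0"
    by (subst (asm) integral_nonneg_eq_0_iff_AE[OF square_integrable[OF assms(1)]]) auto
  then have "AE x in M. u x = 0" by eventually_elim simp
  then show False using assms(2) by blast
qed

lemma fibre_bound_exists:
  assumes a: "a \<in> H" "\<not> (AE x in M. a x = 0)"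
  shows "\<exists>c. \<forall>t\<ge>0. \<forall>b\<in>H. J (\<lambda>x. t * a x) b \<le> c - t\<^sup>2 - D b b"
proof -
  note s = square_integral_pos[OF a]
  \<comment> \<open>Makes the coefficient of \<open>t^2\<close> in the coercivity estimate equal to
    -1.\<close>
  define K where "K = (D a a + 1) / (2 * (\<integral>x. (a x)\<^sup>2 \<partial>M))"
  have K: "K \<ge> 0" using s D_nonneg[of a] by (simp add: K_def)
  have k: "D a a - 2 * K * (\<integral>x. (a x)\<^sup>2 \<partial>M) = - 1" using s by (simp add: K_def field_simps)
  obtain c where c: "\<And>a b t. a \<in> H \<Longrightarrow> b \<in> H \<Longrightarrow>
      J (\<lambda>x. t * a x) b \<le> t\<^sup>2 * (D a a - 2 * K * (\<integral>x. (a x)\<^sup>2 \<partial>M)) - D b b + c"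
    using J_coercive[OF K] by blast
  have "J (\<lambda>x. t * a x) b \<le> c - t\<^sup>2 - D b b" if "b \<in> H" for t b
    using c[OF a(1) that, of t] unfolding k by simp
  then show ?thesis by blast
qed

lemma J_zero: "J (\<lambda>x. 0) (\<lambda>x. 0) = 0"
  using f.\<Psi>_AE_zero[OF H_zero] g.\<Psi>_AE_zero[OF H_zero] by (simp add: J_def D_zero H_zero)

text \<open>Near 0 the terms with \<open>F\<close> and \<open>G\<close> are of smaller order than
  the quadratic form. This makes the minimax level positive, which keeps the maximising parameter
  \<open>t\<close> away from 0.\<close>

lemma J_positive:
  assumes a: "a \<in> H" "\<not> (AE x in M. a x = 0)"
  shows "\<exists>t>0. J (\<lambda>x. t * a x) (\<lambda>x. 0) > 0"
proof -
  note Da = D_pos[OF a] and s = square_integral_pos[OF a]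
  let ?S = "\<integral>x. (a x)\<^sup>2 \<partial>M"
  \<comment> \<open>The two small quadratic terms together take a quarter of \<open>D a a\<close>;
    the higher powers are given less than half.\<close>
  define e where "e = D a a / (8 * ?S)"
  have e: "e > 0" using Da s by (simp add: e_def)
  obtain K1 where K1: "K1 \<ge> 0" "\<And>u. u \<in> H \<Longrightarrow> f.\<Psi> u \<le> e * (\<integral>x. (u x)\<^sup>2 \<partial>M) + K1 * (\<integral>x. \<bar>u x\<bar> powr (p + 1) \<partial>M)" using f.\<Psi>_small[OF e] by blast
  obtain K2 where K2: "K2 \<ge> 0" "\<And>u. u \<in> H \<Longrightarrow> g.\<Psi> u \<le> e * (\<integral>x. (u x)\<^sup>2 \<partial>M) + K2 * (\<integral>x. \<bar>u x\<bar> powr (q + 1) \<partial>M)" using g.\<Psi>_small[OF e] by blast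
  let ?A = "K1 * (\<integral>x. \<bar>a x\<bar> powr (p + 1) \<partial>M)" and ?B = "K2 * (\<integral>x. \<bar>a x\<bar> powr (q + 1) \<partial>M)"
  have "((\<lambda>t. t powr (p - 1) * ?A + t powr (q - 1) * ?B) \<longlongrightarrow> 0 powr (p - 1) * ?A + 0 powr (q - 1) * ?B) (at_right 0)"
    using f.p_gt_1 g.p_gt_1
    by (intro tendsto_add tendsto_mult tendsto_const tendsto_powr' tendsto_ident_at)
      (auto simp: eventually_at_filter intro!: always_eventually)
  then have "eventually (\<lambda>t. t powr (p - 1) * ?A + t powr (q - 1) * ?B < D a a / 2) (at_right 0)"
    by (rule order_tendstoD(2)) (use Da in simp)
  then have "eventually (\<lambda>t. t powr (p - 1) * ?A + t powr (q - 1) * ?B < D a a / 2 \<and> 0 < t) (at_right 0)"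
    by (intro eventually_conj eventually_at_right_less)
  then obtain t where t: "t > 0" "t powr (p - 1) * ?A + t powr (q - 1) * ?B < D a a / 2"
    using eventually_happens' trivial_limit_at_right_real by blast
  have sc: "(\<integral>x. (t * a x)\<^sup>2 \<partial>M) = t\<^sup>2 * ?S" by (simp add: power_mult_distrib)
  have pw: "K * (\<integral>x. \<bar>t * a x\<bar> powr (r + 1) \<partial>M) = t\<^sup>2 * (t powr (r - 1) * (K * (\<integral>x. \<bar>a x\<bar> powr (r + 1) \<partial>M)))" for r K
  proof -
    have "t powr (r + 1) = t powr (2 + (r - 1))" by (rule arg_cong[of _ _ "\<lambda>x. t powr x"]) simp
    also have "\<dots> = t\<^sup>2 * t powr (r - 1)" using t(1) by (simp only: powr_add powr_numeral)
    finally have "t powr (r + 1) = t\<^sup>2 * t powr (r - 1)" .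
    then show ?thesis using t(1) by (simp add: abs_mult powr_mult)
  qed
  have "f.\<Psi> (\<lambda>x. t * a x) + g.\<Psi> (\<lambda>x. t * a x) \<le> t\<^sup>2 * (2 * e * ?S + (t powr (p - 1) * ?A + t powr (q - 1) * ?B))"
    using K1(2)[OF H_scale[OF a(1), of t]] K2(2)[OF H_scale[OF a(1), of t]] unfolding sc pw by (simp add: algebra_simps)
  also have "\<dots> < t\<^sup>2 * D a a"
  proof (rule mult_strict_left_mono)
    have "2 * e * ?S = D a a / 4" using s by (simp add: e_def)
    then show "2 * e * ?S + (t powr (p - 1) * ?A + t powr (q - 1) * ?B) < D a a" using t(2) Da by linarith
  qed (use t in simp)
  finally have "J (\<lambda>x. t * a x) (\<lambda>x. 0) > 0"
    using a(1) by (simp add: J_def D_zero H_zero D_scale_self)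
  then show ?thesis using t(1) by blast
qed

end

section \<open>Existence of a minimising fibre and of a maximiser on it\<close>

context compact_embedding begin

definition Lconv :: "(nat \<Rightarrow> 'a \<Rightarrow> real) \<Rightarrow> ('a \<Rightarrow> real) \<Rightarrow> bool" where
  "Lconv x v \<longleftrightarrow> (\<forall>r\<in>R. (\<lambda>n. \<integral>w. \<bar>x n w - v w\<bar> powr r \<partial>M) \<longlonglongrightarrow> 0)"

lemma Lconv_add:
  assumes "\<And>n. x n \<in> H" "\<And>n. y n \<in> H" "u \<in> H" "v \<in> H" "Lconv x u" "Lconv y v"
  shows "Lconv (\<lambda>n w. x n w + y n w) (\<lambda>w. u w + v w)"
proof -
  have eq: "x n w + y n w - (u w + v w) = (x n w - u w) + (y n w - v w)" for n w by simp
  show ?thesis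
    unfolding Lconv_def eq
    using assms(5,6) by (intro ballI Lr_add H_diff assms(1-4)) (auto simp: Lconv_def)
qed

lemma Lconv_scale_const:
  assumes "Lconv x v" shows "Lconv (\<lambda>n w. c * x n w) (\<lambda>w. c * v w)"
proof -
  have eq: "c * x n w - c * v w = c * (x n w - v w)" for n w by (simp add: right_diff_distrib)
  show ?thesis
    unfolding Lconv_def eq
    using assms by (intro ballI Lr_scale_const) (simp add: Lconv_def)
qed

lemma Lconv_diff:
  assumes "\<And>n. x n \<in> H" "\<And>n. y n \<in> H" "u \<in> H" "v \<in> H" "Lconv x u" "Lconv y v"
  shows "Lconv (\<lambda>n w. x n w - y n w) (\<lambda>w. u w - v w)"
  using Lconv_add[OF assms(1) H_scale[OF assms(2), of "-1"] assms(3) H_scale[OF assms(4), of "-1"] assms(5)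
      Lconv_scale_const[OF assms(6), of "-1"]] by simp

lemma Lconv_scale:
  assumes "u \<in> H" "t \<longlonglongrightarrow> t0" shows "Lconv (\<lambda>n w. t n * u w) (\<lambda>w. t0 * u w)"
proof -
  have eq: "t n * u w - t0 * u w = (t n - t0) * u w" for n w by (simp add: left_diff_distrib)
  show ?thesis unfolding Lconv_def eq using Lr_scale[OF _ assms] by blast
qed

lemma Lconv_const: "u \<in> H \<Longrightarrow> Lconv (\<lambda>n. u) u"
  using Lconv_scale[of u "\<lambda>n. 1" 1] by simp

lemma Lconv_zero: "(\<And>n. x n \<in> H) \<Longrightarrow> (\<lambda>n. D (x n) (x n)) \<longlonglongrightarrow> 0 \<Longrightarrow> Lconv x (\<lambda>w. 0)"
  unfolding Lconv_def using Lr_zero[of _ x] by simp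

lemma Lconv_subseq: "Lconv x v \<Longrightarrow> strict_mono s \<Longrightarrow> Lconv (\<lambda>n. x (s n)) v"
  unfolding Lconv_def using LIMSEQ_subseq_LIMSEQ by (fastforce simp: o_def)

lemma compactness_Lconv:
  assumes "\<And>n::nat. u n \<in> H" "\<And>n. D (u n) (u n) \<le> B"
  shows "\<exists>s v \<beta>. strict_mono s \<and> v \<in> H \<and> (\<lambda>n. D (u (s n)) (u (s n))) \<longlonglongrightarrow> \<beta> \<and> D v v \<le> \<beta> \<and> Lconv (\<lambda>n. u (s n)) v"
  using compactness[OF assms] unfolding Lconv_def .

end

lemma (in nonlinear_functional) \<Psi>_Lconv:
  "(\<And>n. u n \<in> H) \<Longrightarrow> v \<in> H \<Longrightarrow> Lconv u v \<Longrightarrow> (\<lambda>n. \<Psi> (u n)) \<longlonglongrightarrow> \<Psi> v"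
  by (rule \<Psi>_compact) (auto simp: Lconv_def)

context coupled begin

lemma \<Psi>_limits:
  assumes "\<And>n. x n \<in> H" "\<And>n. y n \<in> H" "u \<in> H" "v \<in> H" "Lconv x u" "Lconv y v"
  shows "(\<lambda>n. f.\<Psi> (\<lambda>w. x n w + y n w)) \<longlonglongrightarrow> f.\<Psi> (\<lambda>w. u w + v w)"
    "(\<lambda>n. g.\<Psi> (\<lambda>w. x n w - y n w)) \<longlonglongrightarrow> g.\<Psi> (\<lambda>w. u w - v w)"
  by (rule f.\<Psi>_Lconv[OF H_add[OF assms(1,2)] H_add[OF assms(3,4)] Lconv_add[OF assms]],
      rule g.\<Psi>_Lconv[OF H_diff[OF assms(1,2)] H_diff[OF assms(3,4)] Lconv_diff[OF assms]])

text \<open>The fibre contains all nonnegative multiples of \<open>a\<close>, so candidates can be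
  normalised.\<close>

lemma fibre_bound_scale: "fibre_bound a c \<Longrightarrow> s \<ge> 0 \<Longrightarrow> fibre_bound (\<lambda>x. s * a x) c"
  unfolding fibre_bound_def
proof (intro allI impI ballI)
  fix t :: real and b assume *: "\<forall>t\<ge>0. \<forall>b\<in>H. J (\<lambda>x. t * a x) b \<le> c" "0 \<le> s" "0 \<le> t" "b \<in> H"
  then have "J (\<lambda>x. (t * s) * a x) b \<le> c" by simp
  then show "J (\<lambda>x. t * (s * a x)) b \<le> c" by (simp add: mult.assoc)
qed

lemma fibre_bound_mono: "fibre_bound a c \<Longrightarrow> c \<le> c' \<Longrightarrow> fibre_bound a c'"
  unfolding fibre_bound_def by (blast intro: order_trans)

lemma fibre_bound_nonneg: "fibre_bound a c \<Longrightarrow> 0 \<le> c"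
proof -
  assume "fibre_bound a c"
  then have "\<forall>t\<ge>0. \<forall>b\<in>H. J (\<lambda>x. t * a x) b \<le> c" by (simp add: fibre_bound_def)
  from this[rule_format, OF order_refl H_zero] show "0 \<le> c" by (simp add: J_zero)
qed

text \<open>Candidates are normalised to \<open>D a a = 1\<close>. In the limit the estimate is kept
  with \<open>t^2\<close> instead of \<open>t^2 * D v v\<close>: this excludes \<open>v = 0\<close>,
  and as \<open>D v v\<close> is at most 1 it is stronger than the bound on the fibre of
  \<open>v\<close>.\<close>

lemma minimizer_exists:
  assumes a1: "a1 \<in> H" "\<not> (AE x in M. a1 x = 0)"
  shows "\<exists>a m. a \<in> H \<and> \<not> (AE x in M. a x = 0) \<and> fibre_bound a m \<and>
    (\<forall>a' c. a' \<in> H \<longrightarrow> \<not> (AE x in M. a' x = 0) \<longrightarrow> fibre_bound a' c \<longrightarrow> m \<le> c)"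
proof -
  let ?e = "\<lambda>n. inverse (real (Suc n))"
  define S where "S = {c. \<exists>a\<in>H. \<not> (AE x in M. a x = 0) \<and> fibre_bound a c}"
  obtain c1 where c1: "\<forall>t\<ge>0. \<forall>b\<in>H. J (\<lambda>x. t * a1 x) b \<le> c1 - t\<^sup>2 - D b b" using fibre_bound_exists[OF a1] by blast
  have "fibre_bound a1 c1"
    unfolding fibre_bound_def
  proof (intro allI impI ballI)
    fix t :: real and b assume "0 \<le> t" "b \<in> H"
    then have "J (\<lambda>x. t * a1 x) b \<le> c1 - t\<^sup>2 - D b b" using c1 by blast
    then show "J (\<lambda>x. t * a1 x) b \<le> c1" using D_nonneg[of b] zero_le_power2[of t] by linarith
  qed
  then have c1S: "c1 \<in> S" using a1 by (auto simp: S_def)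
  have bdd: "bdd_below S" by (rule bdd_belowI[of _ 0]) (auto simp: S_def fibre_bound_nonneg)
  define m where "m = Inf S"
  have m0: "0 \<le> m" unfolding m_def by (rule cInf_greatest) (use c1S fibre_bound_nonneg in \<open>auto simp: S_def\<close>)
  have min: "m \<le> c" if "a' \<in> H" "\<not> (AE x in M. a' x = 0)" "fibre_bound a' c" for a' c
    unfolding m_def by (rule cInf_lower[OF _ bdd]) (use that in \<open>auto simp: S_def\<close>)
  have "\<exists>a. a \<in> H \<and> D a a = 1 \<and> fibre_bound a (m + ?e n)" for n
  proof -
    have "Inf S < m + ?e n" by (simp add: m_def)
    then obtain c where c: "c \<in> S" "c < m + ?e n" using cInf_lessD[of S] c1S by blast
    then obtain a where a: "a \<in> H" "\<not> (AE x in M. a x = 0)" "fibre_bound a c" by (auto simp: S_def)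
    note Da = D_pos[OF a(1,2)]
    let ?s = "1 / sqrt (D a a)"
    have "D (\<lambda>x. ?s * a x) (\<lambda>x. ?s * a x) = ?s\<^sup>2 * D a a" by (rule D_scale_self[OF a(1)])
    also have "\<dots> = 1" using Da by (simp add: power_divide)
    finally have "D (\<lambda>x. ?s * a x) (\<lambda>x. ?s * a x) = 1" .
    moreover have "fibre_bound (\<lambda>x. ?s * a x) (m + ?e n)"
      by (rule fibre_bound_mono[OF fibre_bound_scale[OF a(3)] less_imp_le[OF c(2)]]) (simp add: D_nonneg)
    ultimately show ?thesis using H_scale[OF a(1), of ?s] by blast
  qed
  from choice[OF allI[OF this]] obtain a where "\<forall>n. a n \<in> H \<and> D (a n) (a n) = 1 \<and> fibre_bound (a n) (m + ?e n)" ..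
  then have a: "\<And>n. a n \<in> H" "\<And>n. D (a n) (a n) = 1" "\<And>n. fibre_bound (a n) (m + ?e n)" by blast+
  obtain s v \<beta> where s: "strict_mono s" "v \<in> H" "(\<lambda>n. D (a (s n)) (a (s n))) \<longlonglongrightarrow> \<beta>" "D v v \<le> \<beta>" "Lconv (\<lambda>n. a (s n)) v"
    using compactness_Lconv[of a 1] a by auto
  have "\<beta> = 1" using s(3) a(2) by (simp add: LIMSEQ_const_iff)
  then have Dv: "D v v \<le> 1" using s(4) by simp
  have key: "t\<^sup>2 - D b b - f.\<Psi> (\<lambda>w. t * v w + b w) - g.\<Psi> (\<lambda>w. t * v w - b w) \<le> m" if t: "t \<ge> 0" and b: "b \<in> H" for t b
  proof (rule LIMSEQ_le)
    note L = \<Psi>_limits[of "\<lambda>n w. t * a (s n) w" "\<lambda>n. b" "\<lambda>w. t * v w" b, OF H_scale[OF a(1)] b H_scale[OF s(2)] b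
        Lconv_scale_const[OF s(5)] Lconv_const[OF b]]
    show "(\<lambda>n. t\<^sup>2 - D b b - f.\<Psi> (\<lambda>w. t * a (s n) w + b w) - g.\<Psi> (\<lambda>w. t * a (s n) w - b w))
        \<longlonglongrightarrow> t\<^sup>2 - D b b - f.\<Psi> (\<lambda>w. t * v w + b w) - g.\<Psi> (\<lambda>w. t * v w - b w)"
      by (intro tendsto_diff tendsto_const L)
    have "(\<lambda>n. m + ?e (s n)) \<longlonglongrightarrow> m + 0"
      by (intro tendsto_add tendsto_const LIMSEQ_subseq_LIMSEQ[OF LIMSEQ_inverse_real_of_nat s(1), unfolded o_def])
    then show "(\<lambda>n. m + ?e (s n)) \<longlonglongrightarrow> m" by simp
    have "t\<^sup>2 - D b b - f.\<Psi> (\<lambda>w. t * a (s n) w + b w) - g.\<Psi> (\<lambda>w. t * a (s n) w - b w) = J (\<lambda>x. t * a (s n) x) b" for n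
      by (simp add: J_def D_scale_self[OF a(1)] a(2))
    then show "\<exists>N. \<forall>n\<ge>N. t\<^sup>2 - D b b - f.\<Psi> (\<lambda>w. t * a (s n) w + b w) - g.\<Psi> (\<lambda>w. t * a (s n) w - b w) \<le> m + ?e (s n)"
      using a(3) t b unfolding fibre_bound_def by presburger
  qed
  have "\<not> (AE x in M. v x = 0)"
  proof
    assume z: "AE x in M. v x = 0"
    \<comment> \<open>If \<open>v\<close> vanished, the limit estimate with \<open>b = 0\<close>
      would read \<open>t^2 \<le> m\<close>; this \<open>t\<close> contradicts it.\<close>
    let ?t = "m + 1"
    have z': "AE x in M. ?t * v x = 0" using z by eventually_elim simp
    have "?t\<^sup>2 \<le> m"
      using key[OF _ H_zero, of ?t] m0 f.\<Psi>_AE_zero[OF H_scale[OF s(2)] z'] g.\<Psi>_AE_zero[OF H_scale[OF s(2)] z']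
      by (simp add: D_zero H_zero)
    moreover have "m < ?t\<^sup>2"
    proof -
      have "?t\<^sup>2 = m + (m * m + m + 1)" by (simp add: power2_eq_square algebra_simps)
      moreover have "m * m \<ge> 0" by simp
      ultimately show ?thesis using m0 by linarith
    qed
    ultimately show False by simp
  qed
  moreover have "fibre_bound v m"
    unfolding fibre_bound_def
  proof (intro allI impI ballI)
    fix t :: real and b assume t: "0 \<le> t" and b: "b \<in> H"
    have "t\<^sup>2 * D v v \<le> t\<^sup>2" using Dv by (simp add: mult_left_le)
    then show "J (\<lambda>x. t * v x) b \<le> m" using key[OF t b] by (simp add: J_def D_scale_self[OF s(2)])
  qed
  ultimately show ?thesis using s(2) min by blast
qed

text \<open>By \<open>fibre_bound_exists\<close> maximising sequences are bounded. The term
  \<open>D b b\<close> enters with a minus sign, so its possible drop in the limit can only raise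
  the value.\<close>

lemma maximizer_exists:
  assumes a: "a \<in> H" "\<not> (AE x in M. a x = 0)" and m: "fibre_bound a m"
    and min: "\<And>c. fibre_bound a c \<Longrightarrow> m \<le> c"
  shows "\<exists>t>0. \<exists>b\<in>H. J (\<lambda>x. t * a x) b = m"
proof -
  let ?e = "\<lambda>n. inverse (real (Suc n))"
  have mpos: "m > 0"
  proof -
    obtain t where t: "t > 0" "J (\<lambda>x. t * a x) (\<lambda>x. 0) > 0" using J_positive[OF a] by blast
    then show ?thesis using m H_zero unfolding fibre_bound_def by (meson less_imp_le less_le_trans)
  qed
  have "\<exists>t b. t \<ge> 0 \<and> b \<in> H \<and> J (\<lambda>x. t * a x) b > m - ?e n" for n
  proof (rule ccontr)
    assume "\<not> ?thesis"
    then have "fibre_bound a (m - ?e n)" unfolding fibre_bound_def by (meson not_less)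
    from min[OF this] show False by simp
  qed
  then have "\<exists>tb. fst tb \<ge> 0 \<and> snd tb \<in> H \<and> J (\<lambda>x. fst tb * a x) (snd tb) > m - ?e n" for n by (simp only: split_paired_Ex fst_conv snd_conv)
  from choice[OF allI[OF this]] obtain tb where tb: "\<forall>n. fst (tb n) \<ge> 0 \<and> snd (tb n) \<in> H \<and> J (\<lambda>x. fst (tb n) * a x) (snd (tb n)) > m - ?e n" ..
  define t where "t n = fst (tb n)" for n
  define b where "b n = snd (tb n)" for n
  have t: "\<And>n. t n \<ge> 0" and b: "\<And>n. b n \<in> H" and J: "\<And>n. J (\<lambda>x. t n * a x) (b n) > m - ?e n"
    using tb by (auto simp: t_def b_def simp del: of_nat_Suc)
  obtain c where c: "\<And>t b. t \<ge> 0 \<Longrightarrow> b \<in> H \<Longrightarrow> J (\<lambda>x. t * a x) b \<le> c - t\<^sup>2 - D b b" using fibre_bound_exists[OF a] by blast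
  have bd: "(t n)\<^sup>2 + D (b n) (b n) \<le> c - m + 1" for n
  proof -
    have "?e n \<le> 1" by (simp add: inverse_le_1_iff)
    then show ?thesis using c[OF t b, of n n] J[of n] by linarith
  qed
  have "D (b n) (b n) \<le> c - m + 1" for n using bd[of n] zero_le_power2[of "t n"] by linarith
  from compactness_Lconv[of b, OF b this] obtain s v \<beta> where s: "strict_mono s" "v \<in> H"
    "(\<lambda>n. D (b (s n)) (b (s n))) \<longlonglongrightarrow> \<beta>" "D v v \<le> \<beta>" "Lconv (\<lambda>n. b (s n)) v" by (elim exE conjE)
  have tb1: "norm (t n) \<le> c - m + 2" for n
  proof -
    have "0 \<le> (t n - 1)\<^sup>2" by simp
    then have "2 * t n \<le> (t n)\<^sup>2 + 1" by (simp add: power2_eq_square algebra_simps)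
    then have "2 * t n \<le> c - m + 2" using bd[of n] D_nonneg[of "b n"] by linarith
    then show ?thesis using t[of n] by simp
  qed
  then have "bounded (range (\<lambda>n. t (s n)))" by (intro boundedI[of _ "c - m + 2"]) auto
  then obtain t0 r where r: "strict_mono r" "(\<lambda>n. t (s (r n))) \<longlonglongrightarrow> t0"
    using bounded_imp_convergent_subsequence[of "\<lambda>n. t (s n)"] by (auto simp: o_def)
  have t0: "t0 \<ge> 0" by (rule LIMSEQ_le_const[OF r(2)]) (use t in auto)
  note L = \<Psi>_limits[of "\<lambda>n w. t (s (r n)) * a w" "\<lambda>n. b (s (r n))" "\<lambda>w. t0 * a w" v, OF H_scale[OF a(1)] b H_scale[OF a(1)] s(2)
      Lconv_scale[OF a(1) r(2)] Lconv_subseq[OF s(5) r(1)]]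
  have db: "(\<lambda>n. D (b (s (r n))) (b (s (r n)))) \<longlonglongrightarrow> \<beta>" using LIMSEQ_subseq_LIMSEQ[OF s(3) r(1)] by (simp add: o_def)
  have "(\<lambda>n. J (\<lambda>x. t (s (r n)) * a x) (b (s (r n)))) \<longlonglongrightarrow> t0\<^sup>2 * D a a - \<beta> - f.\<Psi> (\<lambda>w. t0 * a w + v w) - g.\<Psi> (\<lambda>w. t0 * a w - v w)"
    unfolding J_def D_scale_self[OF a(1)]
    by (intro tendsto_diff tendsto_mult tendsto_power tendsto_const r(2) L db)
  moreover have "(\<lambda>n. m - ?e (s (r n))) \<longlonglongrightarrow> m - 0"
    by (intro tendsto_diff tendsto_const LIMSEQ_subseq_LIMSEQ[OF LIMSEQ_subseq_LIMSEQ[OF LIMSEQ_inverse_real_of_nat s(1)] r(1), unfolded o_def])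
  ultimately have "m - 0 \<le> t0\<^sup>2 * D a a - \<beta> - f.\<Psi> (\<lambda>w. t0 * a w + v w) - g.\<Psi> (\<lambda>w. t0 * a w - v w)"
    by (intro LIMSEQ_le) (use J less_imp_le in \<open>auto simp del: of_nat_Suc\<close>)
  also have "\<dots> \<le> J (\<lambda>x. t0 * a x) v" unfolding J_def D_scale_self[OF a(1)] using s(4) by simp
  finally have ge: "m \<le> J (\<lambda>x. t0 * a x) v" by simp
  have le: "J (\<lambda>x. t0 * a x) v \<le> m" using m t0 s(2) by (simp add: fibre_bound_def)
  \<comment> \<open>At \<open>t = 0\<close> only nonpositive terms are left, whereas
    \<open>m\<close> is positive.\<close>
  have "t0 \<noteq> 0"
  proof
    assume "t0 = 0"
    then have "J (\<lambda>x. t0 * a x) v \<le> 0"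
      using f.\<Psi>_nonneg[of v] g.\<Psi>_nonneg[of "\<lambda>x. - v x"] D_nonneg[of v] by (simp add: J_def D_zero H_zero)
    then show False using ge mpos by simp
  qed
  then show ?thesis using t0 ge le s(2) by (intro exI[of _ t0]) auto
qed

text \<open>Since \<open>t = 1\<close> is interior to the half line, \<open>a\<close> may be
  increased as well as decreased, and the directions \<open>(\<phi>, -\<phi>)\<close> form a linear
  space; so all these derivatives vanish. The pair itself is \<open>(a, a)\<close> plus
  \<open>(b, -b)\<close>.\<close>

lemma nehari_at_max:
  assumes H: "a \<in> H" "b \<in> H" and max: "\<And>t b'. t \<ge> 0 \<Longrightarrow> b' \<in> H \<Longrightarrow> J (\<lambda>x. t * a x) b' \<le> J a b"
  shows "nehari (\<lambda>x. a x + b x) (\<lambda>x. a x - b x)"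
proof -
  let ?u = "\<lambda>x. a x + b x" and ?v = "\<lambda>x. a x - b x"
  have uv: "?u \<in> H" "?v \<in> H" using H by (auto intro: H_closed)
  have aa: "dI ?u ?v (\<lambda>x. s * a x) (\<lambda>x. s * a x) \<le> 0" if s: "\<bar>s\<bar> = 1" for s
  proof (rule dI_nonpos_at_max[OF uv H_scale[OF H(1)] H_scale[OF H(1)]])
    fix \<tau> :: real assume \<tau>: "0 < \<tau>" "\<tau> < 1"
    have "\<bar>\<tau> * s\<bar> < 1" using \<tau> s by (simp add: abs_mult)
    then have t: "1 + \<tau> * s \<ge> 0" by linarith
    have "I (\<lambda>x. ?u x + \<tau> * (s * a x)) (\<lambda>x. ?v x + \<tau> * (s * a x)) = J (\<lambda>x. (1 + \<tau> * s) * a x) b"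
      unfolding J_eq_I[OF H_scale[OF H(1)] H(2)] by (simp add: algebra_simps)
    also have "\<dots> \<le> J a b" by (rule max[OF t H(2)])
    finally show "I (\<lambda>x. ?u x + \<tau> * (s * a x)) (\<lambda>x. ?v x + \<tau> * (s * a x)) \<le> I ?u ?v"
      by (simp add: J_eq_I[OF H])
  qed
  have bb: "dI ?u ?v \<phi> (\<lambda>x. - \<phi> x) \<le> 0" if \<phi>: "\<phi> \<in> H" for \<phi>
  proof (rule dI_nonpos_at_max[OF uv \<phi> H_minus[OF \<phi>]])
    fix \<tau> :: real assume \<tau>: "0 < \<tau>" "\<tau> < 1"
    have b': "(\<lambda>x. b x + \<tau> * \<phi> x) \<in> H" using H \<phi> by (auto intro: H_closed)
    have "I (\<lambda>x. ?u x + \<tau> * \<phi> x) (\<lambda>x. ?v x + \<tau> * - \<phi> x) = J (\<lambda>x. 1 * a x) (\<lambda>x. b x + \<tau> * \<phi> x)"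
      using J_eq_I[OF H(1) b'] by (simp add: algebra_simps)
    also have "\<dots> \<le> J a b" by (rule max[OF _ b']) simp
    finally show "I (\<lambda>x. ?u x + \<tau> * \<phi> x) (\<lambda>x. ?v x + \<tau> * - \<phi> x) \<le> I ?u ?v"
      by (simp add: J_eq_I[OF H])
  qed
  have sc: "dI ?u ?v (\<lambda>x. c * \<phi> x) (\<lambda>x. c * \<psi> x) = c * dI ?u ?v \<phi> \<psi>" if "\<phi> \<in> H" "\<psi> \<in> H" for \<phi> \<psi> c
    using dI_lincomb[OF uv that that, of c 0] by simp
  have aa0: "dI ?u ?v a a = 0" using aa[of 1] aa[of "-1"] sc[OF H(1,1), of "-1"] by simp
  have bb0: "dI ?u ?v \<phi> (\<lambda>x. - \<phi> x) = 0" if \<phi>: "\<phi> \<in> H" for \<phi>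
    using bb[OF \<phi>] bb[OF H_minus[OF \<phi>]] sc[OF \<phi> H_minus[OF \<phi>], of "-1"] by simp
  have "dI ?u ?v ?u ?v = dI ?u ?v a a + dI ?u ?v b (\<lambda>x. - b x)"
    using dI_lincomb[OF uv H(1) H(1) H(2) H_minus[OF H(2)], of 1 1] by simp
  then show ?thesis using aa0 bb0 H(2) by (simp add: nehari_def)
qed

end

lemma (in nonlinear_functional) df_tendsto:
  assumes H: "u \<in> H" "\<psi> \<in> H" "\<And>n. w n \<in> H" and w: "(\<lambda>n. D (w n) (w n)) \<longlonglongrightarrow> 0"
  shows "(\<lambda>n. df (\<lambda>x. u x + w n x) \<psi>) \<longlonglongrightarrow> df u \<psi>"
proof -
  let ?\<rho> = "max (D u u) (D \<psi> \<psi>)"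
  obtain K where K: "\<forall>u\<in>H. \<forall>\<phi>\<in>H. \<forall>\<psi>\<in>H. D u u \<le> ?\<rho> \<longrightarrow> D \<psi> \<psi> \<le> ?\<rho> \<longrightarrow> D \<phi> \<phi> \<le> 1 \<longrightarrow>
    \<bar>df (\<lambda>x. u x + \<phi> x) \<psi> - df u \<psi>\<bar> \<le> K * sqrt (D \<phi> \<phi>)" using df_cont[of ?\<rho>] by (elim exE conjE)
  note K' = K[rule_format, OF H(1) H(3) H(2) max.cobounded1 max.cobounded2]
  have "(\<lambda>n. K * sqrt (D (w n) (w n))) \<longlonglongrightarrow> K * sqrt 0" by (intro tendsto_intros w)
  then have l: "(\<lambda>n. K * sqrt (D (w n) (w n))) \<longlonglongrightarrow> 0" by simp
  have "eventually (\<lambda>n. D (w n) (w n) < 1) sequentially" by (rule order_tendstoD(2)[OF w]) simp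
  then have "eventually (\<lambda>n. norm (df (\<lambda>x. u x + w n x) \<psi> - df u \<psi>) \<le> K * sqrt (D (w n) (w n))) sequentially"
    by eventually_elim (use K' less_imp_le in auto)
  then have "(\<lambda>n. df (\<lambda>x. u x + w n x) \<psi> - df u \<psi>) \<longlonglongrightarrow> 0" by (rule Lim_null_comparison[OF _ l])
  then show ?thesis by (rule LIM_zero_cancel)
qed

lemma (in nonlinear_functional) df_null:
  assumes H: "u \<in> H" "\<And>n. w n \<in> H" and w: "(\<lambda>n. D (w n) (w n)) \<longlonglongrightarrow> 0"
  shows "(\<lambda>n. df u (w n)) \<longlonglongrightarrow> 0"
proof -
  obtain K where K: "\<forall>u'\<in>H. \<forall>\<phi>\<in>H. D u' u' \<le> D u u \<longrightarrow> \<bar>df u' \<phi>\<bar> \<le> K * sqrt (D \<phi> \<phi>)"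
    using df_bound[of "D u u"] by (elim exE conjE)
  have "(\<lambda>n. K * sqrt (D (w n) (w n))) \<longlonglongrightarrow> K * sqrt 0" by (intro tendsto_intros w)
  then have l: "(\<lambda>n. K * sqrt (D (w n) (w n))) \<longlonglongrightarrow> 0" by simp
  show ?thesis
    by (rule Lim_null_comparison[OF _ l]) (use K[rule_format, OF H order_refl] in simp)
qed

section \<open>Perturbing the minimiser\<close>

context coupled begin

text \<open>By \<open>nehari_fibre\<close> the gap to the maximum is a sum of three nonnegative
  terms, so each tends to 0. The first gives convergence of \<open>\<phi> n\<close> in norm; the two
  defects pass to a limit \<open>t0\<close>, and strictness of the fibre inequality leaves only
  \<open>t0 = 1\<close>.\<close>

lemma nehari_maximizing_sequence:
  assumes n: "nehari u v" and H: "u \<in> H" "v \<in> H" "\<And>n::nat. \<phi> n \<in> H"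
    and ne: "\<not> (AE x in M. u x = 0 \<and> v x = 0)"
    and t: "\<And>n. 0 \<le> t n" "\<And>n. t n \<le> T"
    and lim: "(\<lambda>n. I (\<lambda>x. t n * u x + \<phi> n x) (\<lambda>x. t n * v x - \<phi> n x)) \<longlonglongrightarrow> I u v"
  shows "(\<lambda>n. D (\<phi> n) (\<phi> n)) \<longlonglongrightarrow> 0" "\<exists>r. strict_mono r \<and> (\<lambda>n. t (r n)) \<longlonglongrightarrow> 1"
proof -
  let ?d = "\<lambda>n. I u v - I (\<lambda>x. t n * u x + \<phi> n x) (\<lambda>x. t n * v x - \<phi> n x)"
  have d: "?d \<longlonglongrightarrow> 0" using tendsto_diff[OF tendsto_const lim, of "I u v"] by simp
  have df: "defect_f u (t n) (\<phi> n) \<le> 0" and dg: "defect_g v (t n) (\<phi> n) \<le> 0" for n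
    using defect_f_nonpos[OF t(1) H(1,3)] defect_g_nonpos[OF t(1) H(2,3)] by auto
  have id: "?d n = D (\<phi> n) (\<phi> n) - defect_f u (t n) (\<phi> n) - defect_g v (t n) (\<phi> n)" for n
    using nehari_fibre[OF n H(1,2) H(3), of "t n" n] by simp
  show D0: "(\<lambda>n. D (\<phi> n) (\<phi> n)) \<longlonglongrightarrow> 0"
  proof (rule Lim_null_comparison[OF _ d], rule always_eventually, rule allI)
    show "norm (D (\<phi> n) (\<phi> n)) \<le> ?d n" for n unfolding id using df[of n] dg[of n] D_nonneg[of "\<phi> n"] by simp
  qed
  have f0: "(\<lambda>n. defect_f u (t n) (\<phi> n)) \<longlonglongrightarrow> 0"
  proof (rule Lim_null_comparison[OF _ d], rule always_eventually, rule allI)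
    show "norm (defect_f u (t n) (\<phi> n)) \<le> ?d n" for n unfolding id using df[of n] dg[of n] D_nonneg[of "\<phi> n"] by simp
  qed
  have g0: "(\<lambda>n. defect_g v (t n) (\<phi> n)) \<longlonglongrightarrow> 0"
  proof (rule Lim_null_comparison[OF _ d], rule always_eventually, rule allI)
    show "norm (defect_g v (t n) (\<phi> n)) \<le> ?d n" for n unfolding id using df[of n] dg[of n] D_nonneg[of "\<phi> n"] by simp
  qed
  have "bounded (range t)" by (rule boundedI[of _ T]) (use t in auto)
  then obtain t0 r where r: "strict_mono r" "(\<lambda>n. t (r n)) \<longlonglongrightarrow> t0"
    using bounded_imp_convergent_subsequence[of t] by (auto simp: o_def)
  have t0: "t0 \<ge> 0" by (rule LIMSEQ_le_const[OF r(2)]) (use t in auto)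
  have Dr: "(\<lambda>n. D (\<phi> (r n)) (\<phi> (r n))) \<longlonglongrightarrow> 0" using LIMSEQ_subseq_LIMSEQ[OF D0 r(1)] by (simp add: o_def)
  have Lr: "Lconv (\<lambda>n. \<phi> (r n)) (\<lambda>w. 0)" by (rule Lconv_zero[OF H(3) Dr])
  have "(\<lambda>n. defect_f u (t (r n)) (\<phi> (r n))) \<longlonglongrightarrow>
      (t0\<^sup>2 - 1) / 2 * f.df u u + t0 * 0 + f.\<Psi> u - f.\<Psi> (\<lambda>w. t0 * u w + 0)"
    unfolding defect_f_def
    by (intro tendsto_diff tendsto_add tendsto_mult tendsto_divide tendsto_power tendsto_const r(2)
        f.df_null[OF H(1,3) Dr] \<Psi>_limits(1)[OF H_scale[OF H(1)] H(3) H_scale[OF H(1)] H_zero Lconv_scale[OF H(1) r(2)] Lr]) auto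
  moreover have "(\<lambda>n. defect_f u (t (r n)) (\<phi> (r n))) \<longlonglongrightarrow> 0" using LIMSEQ_subseq_LIMSEQ[OF f0 r(1)] by (simp add: o_def)
  ultimately have "(t0\<^sup>2 - 1) / 2 * f.df u u + t0 * 0 + f.\<Psi> u - f.\<Psi> (\<lambda>w. t0 * u w + 0) = 0"
    by (rule LIMSEQ_unique)
  then have ef: "(t0\<^sup>2 - 1) / 2 * f.df u u + f.\<Psi> u - f.\<Psi> (\<lambda>w. t0 * u w) = 0" by simp
  have "(\<lambda>n. defect_g v (t (r n)) (\<phi> (r n))) \<longlonglongrightarrow>
      (t0\<^sup>2 - 1) / 2 * g.df v v - t0 * 0 + g.\<Psi> v - g.\<Psi> (\<lambda>w. t0 * v w - 0)"
    unfolding defect_g_def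
    by (intro tendsto_diff tendsto_add tendsto_mult tendsto_divide tendsto_power tendsto_const r(2)
        g.df_null[OF H(2,3) Dr] \<Psi>_limits(2)[OF H_scale[OF H(2)] H(3) H_scale[OF H(2)] H_zero Lconv_scale[OF H(2) r(2)] Lr]) auto
  moreover have "(\<lambda>n. defect_g v (t (r n)) (\<phi> (r n))) \<longlonglongrightarrow> 0" using LIMSEQ_subseq_LIMSEQ[OF g0 r(1)] by (simp add: o_def)
  ultimately have "(t0\<^sup>2 - 1) / 2 * g.df v v - t0 * 0 + g.\<Psi> v - g.\<Psi> (\<lambda>w. t0 * v w - 0) = 0"
    by (rule LIMSEQ_unique)
  then have eg: "(t0\<^sup>2 - 1) / 2 * g.df v v + g.\<Psi> v - g.\<Psi> (\<lambda>w. t0 * v w) = 0" by simp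
  have "t0 = 1"
  proof (rule ccontr)
    assume "t0 \<noteq> 1"
    from f.\<Psi>_fibre_strict[OF t0 this H(1) ef] g.\<Psi>_fibre_strict[OF t0 this H(2) eg]
    have "AE x in M. u x = 0 \<and> v x = 0" by eventually_elim simp
    then show False using ne by simp
  qed
  then show "\<exists>r. strict_mono r \<and> (\<lambda>n. t (r n)) \<longlonglongrightarrow> 1" using r by blast
qed

text \<open>By minimality the fibre of \<open>a + \<epsilon> * \<psi>\<close> has a point
  \<open>(t, b')\<close> with value above \<open>m - \<epsilon>^2\<close>, while the point with the
  same coordinates on the fibre of \<open>a\<close> has value at most \<open>m\<close>. The Taylor
  estimate bounds the difference by \<open>\<epsilon> * t * L\<close> plus a multiple of
  \<open>\<epsilon>^2\<close>; division by \<open>\<epsilon>\<close> leaves the derivative in the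
  limit.\<close>

lemma minimizer_variation:
  assumes H: "a \<in> H" "b \<in> H" "\<psi> \<in> H" and ne: "\<not> (AE x in M. a x = 0)"
    and max: "\<And>t b'. t \<ge> 0 \<Longrightarrow> b' \<in> H \<Longrightarrow> J (\<lambda>x. t * a x) b' \<le> J a b"
    and min: "\<And>a' c. a' \<in> H \<Longrightarrow> \<not> (AE x in M. a' x = 0) \<Longrightarrow> fibre_bound a' c \<Longrightarrow> J a b \<le> c"
  shows "0 \<le> dI (\<lambda>x. a x + b x) (\<lambda>x. a x - b x) \<psi> \<psi>"
proof -
  let ?u = "\<lambda>x. a x + b x" and ?v = "\<lambda>x. a x - b x"
  define m where "m = J a b"
  have uv: "?u \<in> H" "?v \<in> H" using H by (auto intro: H_closed)
  have neh: "nehari ?u ?v" by (rule nehari_at_max[OF H(1,2) max])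
  have Iuv: "I ?u ?v = m" by (simp add: m_def J_eq_I[OF H(1,2)])
  have uvne: "\<not> (AE x in M. ?u x = 0 \<and> ?v x = 0)"
  proof
    assume "AE x in M. ?u x = 0 \<and> ?v x = 0"
    then have "AE x in M. a x = 0" by eventually_elim auto
    then show False using ne by simp
  qed
  let ?A = "\<integral>x. (a x)\<^sup>2 \<partial>M" and ?P = "\<integral>x. (\<psi> x)\<^sup>2 \<partial>M"
  have A: "?A > 0" by (rule square_integral_pos[OF H(1) ne])
  \<comment> \<open>Half of the square integral of \<open>a\<close> survives perturbation. With this
    \<open>K\<close> the coercivity coefficient is bounded by a quantity tending to -2, hence at
    most -1 for small perturbations.\<close>
  define K where "K = (D a a + 2) / ?A"
  have K: "K \<ge> 0" using A D_nonneg[of a] by (simp add: K_def)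
  have KA: "K * ?A = D a a + 2" using A by (simp add: K_def)
  obtain c where c: "c \<ge> 0" "\<And>a b t. a \<in> H \<Longrightarrow> b \<in> H \<Longrightarrow>
      J (\<lambda>x. t * a x) b \<le> t\<^sup>2 * (D a a - 2 * K * (\<integral>x. (a x)\<^sup>2 \<partial>M)) - D b b + c"
    using J_coercive[OF K] by blast
  define B where "B = max 0 (c - m + 1)"
  have B: "B \<ge> 0" by (simp add: B_def)
  define ap where "ap \<epsilon> = (\<lambda>x. a x + \<epsilon> * \<psi> x)" for \<epsilon>
  have ap: "ap \<epsilon> \<in> H" for \<epsilon> unfolding ap_def by (rule H_lincomb[OF H(1,3)])
  have Dap: "D (ap \<epsilon>) (ap \<epsilon>) = D a a + 2 * \<epsilon> * D a \<psi> + \<epsilon>\<^sup>2 * D \<psi> \<psi>" for \<epsilon>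
    unfolding ap_def using H by (simp add: D_bilinear H_closed D_commute[of \<psi> a] power2_eq_square algebra_simps)
  have Sap: "?A / 2 - \<epsilon>\<^sup>2 * ?P \<le> (\<integral>x. (ap \<epsilon> x)\<^sup>2 \<partial>M)" for \<epsilon>
  proof -
    note i = square_integrable[OF H(1)] square_integrable[OF H(3)] square_integrable[OF ap[of \<epsilon>]]
    have "?A / 2 - \<epsilon>\<^sup>2 * ?P = (\<integral>x. (a x)\<^sup>2 / 2 - \<epsilon>\<^sup>2 * (\<psi> x)\<^sup>2 \<partial>M)" using i by simp
    also have "\<dots> \<le> (\<integral>x. (ap \<epsilon> x)\<^sup>2 \<partial>M)"
    proof (rule integral_mono)
      fix x
      \<comment> \<open>Half of this square is exactly the difference of the two sides
        below.\<close>
      have "0 \<le> (a x + 2 * \<epsilon> * \<psi> x)\<^sup>2" by simp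
      then show "(a x)\<^sup>2 / 2 - \<epsilon>\<^sup>2 * (\<psi> x)\<^sup>2 \<le> (ap \<epsilon> x)\<^sup>2" by (simp add: ap_def power2_eq_square algebra_simps)
    qed (use i in auto)
    finally show ?thesis .
  qed
  let ?i = "\<lambda>n. inverse (real (Suc n))"
  have i0: "?i \<longlonglongrightarrow> 0" by (rule LIMSEQ_inverse_real_of_nat)
  have l1: "(\<lambda>n. D a a + 2 * ?i n * D a \<psi> + (?i n)\<^sup>2 * D \<psi> \<psi>) \<longlonglongrightarrow> D a a + 2 * 0 * D a \<psi> + 0\<^sup>2 * D \<psi> \<psi>"
    by (intro tendsto_intros i0)
  have l2: "(\<lambda>n. D a a + 2 * ?i n * D a \<psi> + (?i n)\<^sup>2 * D \<psi> \<psi> - K * ?A + 2 * K * ((?i n)\<^sup>2 * ?P))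
      \<longlonglongrightarrow> D a a + 2 * 0 * D a \<psi> + 0\<^sup>2 * D \<psi> \<psi> - K * ?A + 2 * K * (0\<^sup>2 * ?P)"
    by (intro tendsto_intros i0)
  have l3: "(\<lambda>n. B * ((?i n)\<^sup>2 * D \<psi> \<psi>)) \<longlonglongrightarrow> B * (0\<^sup>2 * D \<psi> \<psi>)" by (intro tendsto_intros i0)
  have "eventually (\<lambda>n. D (ap (?i n)) (ap (?i n)) > 0 \<and>
      D (ap (?i n)) (ap (?i n)) - K * ?A + 2 * K * ((?i n)\<^sup>2 * ?P) < - 1 \<and> B * ((?i n)\<^sup>2 * D \<psi> \<psi>) < 1) sequentially"
    unfolding Dap
    by (intro eventually_conj order_tendstoD(1)[OF l1] order_tendstoD(2)[OF l2] order_tendstoD(2)[OF l3])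
      (use D_pos[OF H(1) ne] KA in auto)
  then obtain N where N: "\<And>n. n \<ge> N \<Longrightarrow> D (ap (?i n)) (ap (?i n)) > 0 \<and>
      D (ap (?i n)) (ap (?i n)) - K * ?A + 2 * K * ((?i n)\<^sup>2 * ?P) < - 1 \<and> B * ((?i n)\<^sup>2 * D \<psi> \<psi>) < 1"
    unfolding eventually_sequentially by blast
  \<comment> \<open>The shift by \<open>N\<close> makes the smallness conditions hold for every
    index.\<close>
  define e where "e n = ?i (n + N)" for n
  have e0: "e \<longlonglongrightarrow> 0" unfolding e_def by (rule LIMSEQ_ignore_initial_segment[OF i0])
  have epos: "e n > 0" and e1: "e n \<le> 1" for n by (auto simp: e_def inverse_le_1_iff)
  have e: "D (ap (e n)) (ap (e n)) > 0" "D (ap (e n)) (ap (e n)) - K * ?A + 2 * K * ((e n)\<^sup>2 * ?P) < - 1"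
    "B * ((e n)\<^sup>2 * D \<psi> \<psi>) < 1" for n
    using N[of "n + N"] by (simp_all only: e_def le_add2 simp_thms)
  have ne': "\<not> (AE x in M. ap (e n) x = 0)" for n
    using e(1)[of n] D_null[OF ap ap, of "e n" "e n"] by auto
  have kap: "D (ap (e n)) (ap (e n)) - 2 * K * (\<integral>x. (ap (e n) x)\<^sup>2 \<partial>M) \<le> - 1" for n
  proof -
    have "2 * K * (?A / 2 - (e n)\<^sup>2 * ?P) \<le> 2 * K * (\<integral>x. (ap (e n) x)\<^sup>2 \<partial>M)" using K by (intro mult_left_mono Sap) auto
    then show ?thesis using e(2)[of n] by (simp add: right_diff_distrib)
  qed
  \<comment> \<open>If no such point existed, the perturbed fibre would be bounded by less than the
    minimal level.\<close>
  have "\<exists>tb. fst tb \<ge> 0 \<and> snd tb \<in> H \<and> J (\<lambda>x. fst tb * ap (e n) x) (snd tb) > m - (e n)\<^sup>2" for n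
  proof (rule ccontr)
    assume no: "\<not> ?thesis"
    have "fibre_bound (ap (e n)) (m - (e n)\<^sup>2)"
      unfolding fibre_bound_def
    proof (intro allI impI ballI, rule ccontr)
      fix t :: real and b assume *: "0 \<le> t" "b \<in> H" "\<not> J (\<lambda>x. t * ap (e n) x) b \<le> m - (e n)\<^sup>2"
      show False by (rule notE[OF no], rule exI[of _ "(t, b)"]) (use * in auto)
    qed
    from min[OF ap ne' this] have "(e n)\<^sup>2 \<le> 0" by (simp add: m_def)
    then show False using epos[of n] by simp
  qed
  from choice[OF allI[OF this]] obtain tb where tb: "\<forall>n. fst (tb n) \<ge> 0 \<and> snd (tb n) \<in> H \<and> J (\<lambda>x. fst (tb n) * ap (e n) x) (snd (tb n)) > m - (e n)\<^sup>2" ..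
  define t where "t n = fst (tb n)" for n
  define b' where "b' n = snd (tb n)" for n
  have t: "\<And>n. t n \<ge> 0" and b': "\<And>n. b' n \<in> H" and Jn: "\<And>n. J (\<lambda>x. t n * ap (e n) x) (b' n) > m - (e n)\<^sup>2"
    using tb by (auto simp: t_def b'_def)
  have bd: "(t n)\<^sup>2 + D (b' n) (b' n) \<le> B" for n
  proof -
    have "(t n)\<^sup>2 * (D (ap (e n)) (ap (e n)) - 2 * K * (\<integral>x. (ap (e n) x)\<^sup>2 \<partial>M)) \<le> (t n)\<^sup>2 * - 1"
      by (rule mult_left_mono[OF kap]) simp
    moreover have "(e n)\<^sup>2 \<le> 1" using e1[of n] epos[of n] by (simp add: power_le_one)
    ultimately show ?thesis using c(2)[OF ap b', of "t n" "e n" n] Jn[of n] by (simp add: B_def)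
  qed
  have t2: "(t n)\<^sup>2 \<le> B" and Db: "D (b' n) (b' n) \<le> B" for n
    using bd[of n] D_nonneg[of "b' n"] zero_le_power2[of "t n"] by linarith+
  have tT: "t n \<le> B + 1" for n
  proof -
    have "0 \<le> (t n - 1)\<^sup>2" by simp
    then have "2 * t n \<le> (t n)\<^sup>2 + 1" by (simp add: power2_eq_square algebra_simps)
    then show ?thesis using t2[of n] t[of n] by linarith
  qed
  define un where "un n = (\<lambda>x. t n * a x + b' n x)" for n
  define vn where "vn n = (\<lambda>x. t n * a x - b' n x)" for n
  have unH: "un n \<in> H" "vn n \<in> H" for n unfolding un_def vn_def using H b' by (auto intro: H_closed)
  define \<rho> where "\<rho> = 2 * (B * D a a) + 2 * B"
  have Dun: "D (un n) (un n) \<le> \<rho>" "D (vn n) (vn n) \<le> \<rho>" for n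
  proof -
    have "(t n)\<^sup>2 * D a a \<le> B * D a a" using t2 D_nonneg by (rule mult_right_mono)
    then show "D (un n) (un n) \<le> \<rho>" "D (vn n) (vn n) \<le> \<rho>"
      using D_sum_bound[OF H_scale[OF H(1), of "t n"] b'[of n]] D_diff_bound[OF H_scale[OF H(1), of "t n"] b'[of n]] Db[of n]
      by (auto simp: un_def vn_def \<rho>_def D_scale_self[OF H(1)])
  qed
  obtain K' where K': "K' \<ge> 0" and tay: "\<forall>u\<in>H. \<forall>v\<in>H. \<forall>\<phi>\<in>H. \<forall>\<psi>\<in>H. D u u \<le> \<rho> \<longrightarrow> D v v \<le> \<rho> \<longrightarrow> D \<phi> \<phi> \<le> 1 \<longrightarrow> D \<psi> \<psi> \<le> 1 \<longrightarrow>
    \<bar>I (\<lambda>x. u x + \<phi> x) (\<lambda>x. v x + \<psi> x) - I u v - dI u v \<phi> \<psi> - D \<phi> \<psi>\<bar> \<le> K' * (D \<phi> \<phi> + D \<psi> \<psi>)"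
    using I_taylor[of \<rho>] by (elim exE conjE)
  \<comment> \<open>In direction \<open>(\<psi>, \<psi>)\<close> the exact quadratic term
    contributes 1 and the two Taylor remainders \<open>2 * K'\<close>; the factor \<open>B\<close>
    bounds \<open>t^2\<close>.\<close>
  define Q where "Q = (1 + 2 * K') * (B * D \<psi> \<psi>)"
  have Q: "Q \<ge> 0" using K' B D_nonneg[of \<psi>] by (simp add: Q_def)
  define L where "L n = dI (un n) (vn n) \<psi> \<psi>" for n
  have stepA: "J (\<lambda>x. t n * ap (e n) x) (b' n) - J (\<lambda>x. t n * a x) (b' n) \<le> e n * (t n * L n) + Q * (e n)\<^sup>2" for n
  proof -
    define s where "s = t n * e n"
    have s\<psi>: "(\<lambda>x. s * \<psi> x) \<in> H" by (rule H_scale[OF H(3)])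
    have Ds: "D (\<lambda>x. s * \<psi> x) (\<lambda>x. s * \<psi> x) \<le> B * ((e n)\<^sup>2 * D \<psi> \<psi>)"
    proof -
      have "D (\<lambda>x. s * \<psi> x) (\<lambda>x. s * \<psi> x) = (t n)\<^sup>2 * ((e n)\<^sup>2 * D \<psi> \<psi>)"
        by (simp add: D_scale_self[OF H(3)] s_def power_mult_distrib)
      also have "\<dots> \<le> B * ((e n)\<^sup>2 * D \<psi> \<psi>)" by (rule mult_right_mono[OF t2]) (simp add: D_nonneg)
      finally show ?thesis .
    qed
    then have Ds1: "D (\<lambda>x. s * \<psi> x) (\<lambda>x. s * \<psi> x) \<le> 1" using e(3)[of n] by linarith
    have J1: "J (\<lambda>x. t n * ap (e n) x) (b' n) = I (\<lambda>x. un n x + s * \<psi> x) (\<lambda>x. vn n x + s * \<psi> x)"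
      unfolding J_eq_I[OF H_scale[OF ap] b'] by (simp add: ap_def un_def vn_def s_def algebra_simps)
    have J2: "J (\<lambda>x. t n * a x) (b' n) = I (un n) (vn n)"
      unfolding J_eq_I[OF H_scale[OF H(1)] b'] by (simp add: un_def vn_def)
    have dL: "dI (un n) (vn n) (\<lambda>x. s * \<psi> x) (\<lambda>x. s * \<psi> x) = s * L n"
      using dI_lincomb[OF unH(1,2) H(3,3) H(3,3), of n n s 0] by (simp add: L_def)
    have "J (\<lambda>x. t n * ap (e n) x) (b' n) - J (\<lambda>x. t n * a x) (b' n) \<le>
        s * L n + (1 + 2 * K') * D (\<lambda>x. s * \<psi> x) (\<lambda>x. s * \<psi> x)"
      using tay[rule_format, OF unH(1) unH(2) s\<psi> s\<psi> Dun(1) Dun(2) Ds1 Ds1, of n n]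
      unfolding J1 J2 dL by (simp add: distrib_right abs_le_iff)
    also have "\<dots> \<le> s * L n + (1 + 2 * K') * (B * ((e n)\<^sup>2 * D \<psi> \<psi>))"
      using K' by (intro add_left_mono mult_left_mono Ds) auto
    finally show ?thesis by (simp add: s_def Q_def algebra_simps)
  qed
  \<comment> \<open>A crude bound has to come before convergence: it shows that the points are
    almost maximal on the original fibre too, and that is what makes them converge.\<close>
  have Lbound: "\<exists>C. \<forall>n. \<bar>L n\<bar> \<le> C"
  proof -
    obtain K1 where K1: "\<forall>u\<in>H. \<forall>\<phi>\<in>H. D u u \<le> \<rho> \<longrightarrow> \<bar>f.df u \<phi>\<bar> \<le> K1 * sqrt (D \<phi> \<phi>)" using f.df_bound[of \<rho>] by (elim exE conjE)
    obtain K2 where K2: "\<forall>u\<in>H. \<forall>\<phi>\<in>H. D u u \<le> \<rho> \<longrightarrow> \<bar>g.df u \<phi>\<bar> \<le> K2 * sqrt (D \<phi> \<phi>)" using g.df_bound[of \<rho>] by (elim exE conjE)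
    have "\<bar>L n\<bar> \<le> 2 * ((B + 1) * \<bar>D a \<psi>\<bar>) + K1 * sqrt (D \<psi> \<psi>) + K2 * sqrt (D \<psi> \<psi>)" for n
    proof -
      have "L n = 2 * (t n * D a \<psi>) - f.df (un n) \<psi> - g.df (vn n) \<psi>"
        unfolding L_def dI_def un_def vn_def using H b' by (simp add: D_bilinear H_closed)
      moreover have "\<bar>t n * D a \<psi>\<bar> \<le> (B + 1) * \<bar>D a \<psi>\<bar>" using t[of n] tT[of n] by (simp add: abs_mult mult_right_mono)
      ultimately show ?thesis
        using K1[rule_format, OF unH(1) H(3) Dun(1), of n] K2[rule_format, OF unH(2) H(3) Dun(2), of n] by linarith
    qed
    then show ?thesis by blast
  qed
  then obtain C where C: "\<And>n. \<bar>L n\<bar> \<le> C" by blast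
  have C0: "C \<ge> 0" using C[of 0] by linarith
  \<comment> \<open>The coordinate relative to the maximiser: \<open>t * (a + b) + \<phi>\<close>
    has to equal \<open>t * a + b'\<close>.\<close>
  define \<phi> where "\<phi> n = (\<lambda>x. b' n x - t n * b x)" for n
  have \<phi>H: "\<phi> n \<in> H" for n unfolding \<phi>_def using H b' by (auto intro: H_closed)
  have Jfib: "I (\<lambda>x. t n * ?u x + \<phi> n x) (\<lambda>x. t n * ?v x - \<phi> n x) = J (\<lambda>x. t n * a x) (b' n)" for n
    unfolding J_eq_I[OF H_scale[OF H(1)] b'] by (simp add: \<phi>_def algebra_simps)
  have lim: "(\<lambda>n. I (\<lambda>x. t n * ?u x + \<phi> n x) (\<lambda>x. t n * ?v x - \<phi> n x)) \<longlonglongrightarrow> I ?u ?v"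
    unfolding Jfib Iuv
  proof (rule tendsto_sandwich)
    have "(\<lambda>n. m - (e n)\<^sup>2 - e n * ((B + 1) * C) - Q * (e n)\<^sup>2) \<longlonglongrightarrow> m - 0\<^sup>2 - 0 * ((B + 1) * C) - Q * 0\<^sup>2"
      by (intro tendsto_intros e0)
    then show "(\<lambda>n. m - (e n)\<^sup>2 - e n * ((B + 1) * C) - Q * (e n)\<^sup>2) \<longlonglongrightarrow> m" by simp
    have "m - (e n)\<^sup>2 - e n * ((B + 1) * C) - Q * (e n)\<^sup>2 \<le> J (\<lambda>x. t n * a x) (b' n)" for n
    proof -
      have "t n * L n \<le> (B + 1) * C"
      proof -
        have "t n * L n \<le> t n * C" using C[of n] t[of n] by (intro mult_left_mono) auto
        also have "\<dots> \<le> (B + 1) * C" using tT C0 by (intro mult_right_mono) auto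
        finally show ?thesis .
      qed
      then have "e n * (t n * L n) \<le> e n * ((B + 1) * C)" using epos[of n] by (intro mult_left_mono) auto
      then show ?thesis using stepA[of n] Jn[of n] by linarith
    qed
    then show "\<forall>\<^sub>F n in sequentially. m - (e n)\<^sup>2 - e n * ((B + 1) * C) - Q * (e n)\<^sup>2 \<le> J (\<lambda>x. t n * a x) (b' n)" by simp
    show "\<forall>\<^sub>F n in sequentially. J (\<lambda>x. t n * a x) (b' n) \<le> m" using max[OF t b'] by (simp add: m_def)
  qed simp
  note seq = nehari_maximizing_sequence[OF neh uv(1) uv(2) \<phi>H uvne t tT lim]
  obtain r where r: "strict_mono r" "(\<lambda>n. t (r n)) \<longlonglongrightarrow> 1" using seq(2) by blast
  have D\<phi>: "(\<lambda>n. D (\<phi> (r n)) (\<phi> (r n))) \<longlonglongrightarrow> 0" using LIMSEQ_subseq_LIMSEQ[OF seq(1) r(1)] by (simp add: o_def)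
  have er: "(\<lambda>n. e (r n)) \<longlonglongrightarrow> 0" using LIMSEQ_subseq_LIMSEQ[OF e0 r(1)] by (simp add: o_def)
  \<comment> \<open>The deviations of \<open>un\<close> and \<open>vn\<close> from the maximiser;
    they tend to 0 in norm, so the derivatives converge.\<close>
  define wu where "wu n = (\<lambda>x. (t (r n) - 1) * ?u x + \<phi> (r n) x)" for n
  define wv where "wv n = (\<lambda>x. (t (r n) - 1) * ?v x - \<phi> (r n) x)" for n
  have wH: "wu n \<in> H" "wv n \<in> H" for n
    unfolding wu_def wv_def by (rule H_add[OF H_scale[OF uv(1)] \<phi>H], rule H_diff[OF H_scale[OF uv(2)] \<phi>H])
  have wu0: "(\<lambda>n. D (wu n) (wu n)) \<longlonglongrightarrow> 0"
  proof (rule Lim_null_comparison)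
    have "(\<lambda>n. 2 * ((t (r n) - 1)\<^sup>2 * D ?u ?u) + 2 * D (\<phi> (r n)) (\<phi> (r n))) \<longlonglongrightarrow> 2 * ((1 - 1)\<^sup>2 * D ?u ?u) + 2 * 0"
      by (intro tendsto_add tendsto_mult tendsto_power tendsto_diff tendsto_const r(2) D\<phi>)
    then show "(\<lambda>n. 2 * ((t (r n) - 1)\<^sup>2 * D ?u ?u) + 2 * D (\<phi> (r n)) (\<phi> (r n))) \<longlonglongrightarrow> 0" by simp
    show "\<forall>\<^sub>F n in sequentially. norm (D (wu n) (wu n)) \<le> 2 * ((t (r n) - 1)\<^sup>2 * D ?u ?u) + 2 * D (\<phi> (r n)) (\<phi> (r n))"
      using D_sum_bound[OF H_scale[OF uv(1)] \<phi>H] by (simp add: wu_def D_nonneg D_scale_self[OF uv(1)])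
  qed
  have wv0: "(\<lambda>n. D (wv n) (wv n)) \<longlonglongrightarrow> 0"
  proof (rule Lim_null_comparison)
    have "(\<lambda>n. 2 * ((t (r n) - 1)\<^sup>2 * D ?v ?v) + 2 * D (\<phi> (r n)) (\<phi> (r n))) \<longlonglongrightarrow> 2 * ((1 - 1)\<^sup>2 * D ?v ?v) + 2 * 0"
      by (intro tendsto_add tendsto_mult tendsto_power tendsto_diff tendsto_const r(2) D\<phi>)
    then show "(\<lambda>n. 2 * ((t (r n) - 1)\<^sup>2 * D ?v ?v) + 2 * D (\<phi> (r n)) (\<phi> (r n))) \<longlonglongrightarrow> 0" by simp
    show "\<forall>\<^sub>F n in sequentially. norm (D (wv n) (wv n)) \<le> 2 * ((t (r n) - 1)\<^sup>2 * D ?v ?v) + 2 * D (\<phi> (r n)) (\<phi> (r n))"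
      using D_diff_bound[OF H_scale[OF uv(2)] \<phi>H] by (simp add: wv_def D_nonneg D_scale_self[OF uv(2)])
  qed
  have unw: "un (r n) = (\<lambda>x. ?u x + wu n x)" "vn (r n) = (\<lambda>x. ?v x + wv n x)" for n
    by (auto simp: un_def vn_def wu_def wv_def \<phi>_def algebra_simps)
  have Ln: "L (r n) = 2 * (t (r n) * D a \<psi>) - f.df (\<lambda>x. ?u x + wu n x) \<psi> - g.df (\<lambda>x. ?v x + wv n x) \<psi>" for n
  proof -
    have "D (un (r n)) \<psi> + D (vn (r n)) \<psi> = 2 * (t (r n) * D a \<psi>)"
      unfolding un_def vn_def using H b' by (simp add: D_bilinear H_closed)
    then show ?thesis unfolding L_def dI_def by (simp only: unw)
  qed
  have "(\<lambda>n. L (r n)) \<longlonglongrightarrow> 2 * (1 * D a \<psi>) - f.df ?u \<psi> - g.df ?v \<psi>"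
    unfolding Ln by (intro tendsto_diff tendsto_mult tendsto_const r(2) f.df_tendsto[OF uv(1) H(3) wH(1) wu0] g.df_tendsto[OF uv(2) H(3) wH(2) wv0])
  moreover have "2 * (1 * D a \<psi>) - f.df ?u \<psi> - g.df ?v \<psi> = dI ?u ?v \<psi> \<psi>"
    using H by (simp add: dI_def D_bilinear H_closed)
  ultimately have Llim: "(\<lambda>n. t (r n) * L (r n)) \<longlonglongrightarrow> 1 * dI ?u ?v \<psi> \<psi>" by (intro tendsto_mult r(2)) simp
  \<comment> \<open>One factor \<open>e n\<close> is divided out; the other makes the lower bound
    tend to 0.\<close>
  have "- ((1 + Q) * e n) \<le> t n * L n" for n
  proof -
    have "- (e n)\<^sup>2 \<le> e n * (t n * L n) + Q * (e n)\<^sup>2" using stepA[of n] Jn[of n] max[OF t b', of n n] by (simp add: m_def)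
    then have "e n * (- ((1 + Q) * e n)) \<le> e n * (t n * L n)" by (simp add: power2_eq_square algebra_simps)
    then show ?thesis by (rule mult_left_le_imp_le[OF _ epos])
  qed
  then have "- ((1 + Q) * e (r n)) \<le> t (r n) * L (r n)" for n .
  moreover have "(\<lambda>n. - ((1 + Q) * e (r n))) \<longlonglongrightarrow> - ((1 + Q) * 0)" by (intro tendsto_intros er)
  ultimately have "- ((1 + Q) * 0) \<le> 1 * dI ?u ?v \<psi> \<psi>" using Llim by (intro LIMSEQ_le) auto
  then show ?thesis by simp
qed

text \<open>The two optimality properties complement each other: minimality over \<open>a\<close>
  kills the derivative in the directions \<open>(\<psi>, \<psi>)\<close>, maximality over the fibre
  kills it in the directions \<open>(\<phi>, -\<phi>)\<close>, and together these span all
  pairs.\<close>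

theorem critical_minimizer_exists:
  assumes "a1 \<in> H" "\<not> (AE x in M. a1 x = 0)"
  shows "\<exists>u\<in>H. \<exists>v\<in>H. \<not> (AE x in M. u x = 0 \<and> v x = 0) \<and> (\<forall>\<phi>\<in>H. \<forall>\<psi>\<in>H. dI u v \<phi> \<psi> = 0) \<and>
    (\<forall>a c. a \<in> H \<longrightarrow> \<not> (AE x in M. a x = 0) \<longrightarrow> fibre_bound a c \<longrightarrow> I u v \<le> c)"
proof -
  obtain a m where am: "a \<in> H" "\<not> (AE x in M. a x = 0)" "fibre_bound a m"
    "\<And>a' c. a' \<in> H \<Longrightarrow> \<not> (AE x in M. a' x = 0) \<Longrightarrow> fibre_bound a' c \<Longrightarrow> m \<le> c"
    using minimizer_exists[OF assms] by blast
  obtain t b where t: "t > 0" and b: "b \<in> H" and Jm: "J (\<lambda>x. t * a x) b = m"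
    using maximizer_exists[OF am(1-3) am(4)[OF am(1,2)]] by blast
  let ?a = "\<lambda>x. t * a x"
  let ?u = "\<lambda>x. ?a x + b x" and ?v = "\<lambda>x. ?a x - b x"
  have aH: "?a \<in> H" by (rule H_scale[OF am(1)])
  have uv: "?u \<in> H" "?v \<in> H" using H_add[OF aH b] H_diff[OF aH b] by auto
  have ane: "\<not> (AE x in M. ?a x = 0)" using am(2) t by simp
  have max: "J (\<lambda>x. s * ?a x) b' \<le> J ?a b" if "s \<ge> 0" "b' \<in> H" for s b'
    using fibre_bound_scale[OF am(3), of t] t that unfolding Jm fibre_bound_def by simp
  have min: "J ?a b \<le> c" if "a' \<in> H" "\<not> (AE x in M. a' x = 0)" "fibre_bound a' c" for a' c
    unfolding Jm by (rule am(4)[OF that])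
  have pos: "0 \<le> dI ?u ?v \<psi> \<psi>" if "\<psi> \<in> H" for \<psi> by (rule minimizer_variation[OF aH b that ane max min])
  have diag: "dI ?u ?v \<psi> \<psi> = 0" if \<psi>: "\<psi> \<in> H" for \<psi>
    using pos[OF \<psi>] pos[OF H_minus[OF \<psi>]] dI_lincomb[OF uv \<psi> \<psi> \<psi> \<psi>, of "-1" 0] by simp
  have neh: "nehari ?u ?v" by (rule nehari_at_max[OF aH b max])
  have cp: "dI ?u ?v \<phi> \<psi> = 0" if H: "\<phi> \<in> H" "\<psi> \<in> H" for \<phi> \<psi>
  proof -
    let ?s = "\<lambda>x. \<phi> x + \<psi> x" and ?d = "\<lambda>x. \<phi> x - \<psi> x"
    have sd: "?s \<in> H" "?d \<in> H" "(\<lambda>x. - ?d x) \<in> H" using H_add[OF H] H_diff[OF H] H_minus[OF H_diff[OF H]] by auto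
    have "dI ?u ?v ?d (\<lambda>x. - ?d x) = 0" using neh sd(2) unfolding nehari_def by blast
    \<comment> \<open>The pair \<open>(\<phi>, \<psi>)\<close> is half of \<open>(s, s)\<close> plus
      half of \<open>(d, -d)\<close>, where \<open>s\<close> is the sum and \<open>d\<close> the
      difference.\<close>
    then have "dI ?u ?v (\<lambda>x. 1/2 * ?s x + 1/2 * ?d x) (\<lambda>x. 1/2 * ?s x + 1/2 * - ?d x) = 0"
      using dI_lincomb[OF uv sd(1) sd(1) sd(2) sd(3), of "1/2" "1/2"] diag[OF sd(1)] by simp
    moreover have "(\<lambda>x. 1/2 * ?s x + 1/2 * ?d x) = \<phi>" "(\<lambda>x. 1/2 * ?s x + 1/2 * - ?d x) = \<psi>" by (auto simp: field_simps)
    ultimately show ?thesis by simp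
  qed
  have nz: "\<not> (AE x in M. ?u x = 0 \<and> ?v x = 0)"
  proof
    assume "AE x in M. ?u x = 0 \<and> ?v x = 0"
    then have "AE x in M. ?a x = 0" by eventually_elim auto
    then show False using ane by simp
  qed
  have le: "I ?u ?v \<le> c" if "a' \<in> H" "\<not> (AE x in M. a' x = 0)" "fibre_bound a' c" for a' c
    using min[OF that] J_eq_I[OF aH b] by simp
  show ?thesis
    by (rule bexI[OF _ uv(1)], rule bexI[OF _ uv(2)], intro conjI ballI allI impI)
      (rule nz, erule (1) cp, erule (2) le)
qed

end

section \<open>The elliptic system\<close>

context bounded_open begin

text \<open>In multiplied form the condition also covers dimensions one and two, where every
  exponent from 2 on is subcritical.\<close>

definition subcritical :: "real set" where
  "subcritical = {r. 2 \<le> r \<and> r * (real CARD('n) - 2) < 2 * real CARD('n)}"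

text \<open>Convergence in \<open>L^2\<close> from \<open>H10_compact\<close> is raised to every
  subcritical exponent by \<open>interpolation\<close>, as the differences stay bounded in gradient
  norm.\<close>

lemma H10_compact_embedding: "compact_embedding (lebesgue_on \<Omega>) (H10 \<Omega>) (dirichlet \<Omega>) subcritical"
proof (rule compact_embedding.intro)
  show "finite_measure (lebesgue_on \<Omega>)" by (rule finite_measure_domain)
  show "u \<in> borel_measurable (lebesgue_on \<Omega>)" if "u \<in> H10 \<Omega>" for u
    using L2_measurable H1_weak_gradient(1)[OF H10_H1[OF that]] by blast
  show "(\<lambda>x. 0) \<in> H10 \<Omega>" by (rule zero_H10)
  show "(\<lambda>x. u x + c * v x) \<in> H10 \<Omega>" if "u \<in> H10 \<Omega>" "v \<in> H10 \<Omega>" for u v c by (rule H10_lincomb[OF that])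
  show "dirichlet \<Omega> (\<lambda>x. u x + c * v x) w = dirichlet \<Omega> u w + c * dirichlet \<Omega> v w"
    if "u \<in> H10 \<Omega>" "v \<in> H10 \<Omega>" "w \<in> H10 \<Omega>" for u v w c
    by (rule dirichlet_lincomb_left) (rule H10_H1[OF that(1)] H10_H1[OF that(2)] H10_H1[OF that(3)])+
  show "dirichlet \<Omega> u v = dirichlet \<Omega> v u" for u v by (rule dirichlet_commute)
  show "0 \<le> dirichlet \<Omega> u u" for u by (rule dirichlet_nonneg)
  show "dirichlet \<Omega> u w = 0" if "u \<in> H10 \<Omega>" "w \<in> H10 \<Omega>" "AE x in lebesgue_on \<Omega>. u x = 0" for u w
    by (rule dirichlet_AE_zero[OF H10_H1[OF that(1)] that(3) H10_H1[OF that(2)]])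
  show "2 \<in> subcritical" by (simp add: subcritical_def)
  show "0 < r" if "r \<in> subcritical" for r using that by (simp add: subcritical_def)
  show "\<exists>K>0. \<forall>u\<in>H10 \<Omega>. integrable (lebesgue_on \<Omega>) (\<lambda>x. \<bar>u x\<bar> powr r) \<and>
      (\<integral>x. \<bar>u x\<bar> powr r \<partial>lebesgue_on \<Omega>) \<le> K * sqrt (dirichlet \<Omega> u u) powr r" if "r \<in> subcritical" for r
    by (rule Sobolev_H10) (use that in \<open>auto simp: subcritical_def\<close>)
  show "\<exists>s v \<beta>. strict_mono s \<and> v \<in> H10 \<Omega> \<and> (\<lambda>n. dirichlet \<Omega> (u (s n)) (u (s n))) \<longlonglongrightarrow> \<beta> \<and> dirichlet \<Omega> v v \<le> \<beta> \<and>
      (\<forall>r\<in>subcritical. (\<lambda>n. \<integral>x. \<bar>u (s n) x - v x\<bar> powr r \<partial>lebesgue_on \<Omega>) \<longlonglongrightarrow> 0)"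
    if u: "\<And>n::nat. u n \<in> H10 \<Omega>" and B: "\<And>n. dirichlet \<Omega> (u n) (u n) \<le> B" for u B
  proof -
    from H10_compact[of u B, OF u B] obtain s v \<beta> where s: "strict_mono s" "v \<in> H10 \<Omega>"
      "(\<lambda>n. dirichlet \<Omega> (u (s n)) (u (s n))) \<longlonglongrightarrow> \<beta>" "dirichlet \<Omega> v v \<le> \<beta>"
      "(\<lambda>n. l2_inner \<Omega> (\<lambda>x. u (s n) x - v x) (\<lambda>x. u (s n) x - v x)) \<longlonglongrightarrow> 0" by (elim exE conjE)
    have w: "(\<lambda>x. u (s n) x - v x) \<in> H10 \<Omega>" for n using H10_lincomb[OF u s(2), of "s n" "-1"] by simp
    have bd: "dirichlet \<Omega> (\<lambda>x. u (s n) x - v x) (\<lambda>x. u (s n) x - v x) \<le> 2 * B + 2 * dirichlet \<Omega> v v" for n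
    proof -
      note 1 = H10_H1[OF u[of "s n"]] and 2 = H10_H1[OF s(2)]
      have "0 \<le> dirichlet \<Omega> (\<lambda>x. u (s n) x + 1 * v x) (\<lambda>x. u (s n) x + 1 * v x)" by (rule dirichlet_nonneg)
      then show ?thesis
        using dirichlet_lincomb_self[OF 1 2, of 1] dirichlet_lincomb_self[OF 1 2, of "-1"] B[of "s n"] by simp
    qed
    have "(\<lambda>n. \<integral>x. \<bar>u (s n) x - v x\<bar> powr r \<partial>lebesgue_on \<Omega>) \<longlonglongrightarrow> 0" if "r \<in> subcritical" for r
      by (rule interpolation[OF w bd s(5)]) (use that in \<open>auto simp: subcritical_def\<close>)
    then show ?thesis using s by blast
  qed
qed

end

locale elliptic_system = bounded_open \<Omega> + nf: nonlinearity f p C \<delta> + ng: nonlinearity g q C \<delta>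
  for \<Omega> :: "(real^'n::finite) set" and f g :: "real \<Rightarrow> real" and p q C \<delta> :: real +
  assumes p_subcritical: "(p + 1) * (real CARD('n) - 2) < 2 * real CARD('n)"
    and q_subcritical: "(q + 1) * (real CARD('n) - 2) < 2 * real CARD('n)"

sublocale elliptic_system \<subseteq> coupled "lebesgue_on \<Omega>" "H10 \<Omega>" "dirichlet \<Omega>" subcritical f g p q C \<delta>
proof (intro coupled.intro nonlinear_functional.intro nonlinear_functional_axioms.intro H10_compact_embedding nf.nonlinearity_axioms ng.nonlinearity_axioms)
  show "p + 1 \<in> subcritical" using nf.p_gt_1 p_subcritical by (simp add: subcritical_def)
  show "q + 1 \<in> subcritical" using ng.p_gt_1 q_subcritical by (simp add: subcritical_def)
qed

context elliptic_system begin

lemma energy_eq_I: "energy \<Omega> f g u v = I u v"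
  by (simp add: energy_def I_def dirichlet_def l2_inner_def f.\<Psi>_def g.\<Psi>_def)

lemma H1_pair_norm_square: "(H1_pair_norm \<Omega> u v)\<^sup>2 = (H1_norm \<Omega> u)\<^sup>2 + (H1_norm \<Omega> v)\<^sup>2"
  by (simp add: H1_pair_norm_def)

lemma H1_pair_norm_nonneg: "0 \<le> H1_pair_norm \<Omega> u v"
  by (simp add: H1_pair_norm_def)

lemma H1_pair_norm_scale:
  assumes "\<phi> \<in> H10 \<Omega>" "\<psi> \<in> H10 \<Omega>" "\<tau> \<ge> 0"
  shows "H1_pair_norm \<Omega> (\<lambda>x. \<tau> * \<phi> x) (\<lambda>x. \<tau> * \<psi> x) = \<tau> * H1_pair_norm \<Omega> \<phi> \<psi>"
proof -
  have sc: "l2_inner \<Omega> (\<lambda>x. \<tau> * w x) (\<lambda>x. \<tau> * w x) = \<tau>\<^sup>2 * l2_inner \<Omega> w w" for w :: "real^'n \<Rightarrow> real"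
    unfolding l2_inner_self by (simp add: power_mult_distrib)
  have "(H1_pair_norm \<Omega> (\<lambda>x. \<tau> * \<phi> x) (\<lambda>x. \<tau> * \<psi> x))\<^sup>2 = (\<tau> * H1_pair_norm \<Omega> \<phi> \<psi>)\<^sup>2"
    unfolding power_mult_distrib H1_pair_norm_square H1_norm_square sc D_scale_self[OF assms(1)] D_scale_self[OF assms(2)]
    by (simp only: distrib_left)
  then show ?thesis
    by (rule power2_eq_imp_eq[OF _ H1_pair_norm_nonneg mult_nonneg_nonneg[OF assms(3) H1_pair_norm_nonneg]])
qed

lemma D_le_H1_pair_norm: "dirichlet \<Omega> \<phi> \<phi> + dirichlet \<Omega> \<psi> \<psi> \<le> (H1_pair_norm \<Omega> \<phi> \<psi>)\<^sup>2"
  using l2_inner_nonneg[of \<Omega> \<phi>] l2_inner_nonneg[of \<Omega> \<psi>] by (simp add: H1_pair_norm_square H1_norm_square)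

lemma D_mixed_bound:
  assumes "\<phi> \<in> H10 \<Omega>" "\<psi> \<in> H10 \<Omega>"
  shows "\<bar>dirichlet \<Omega> \<phi> \<psi>\<bar> \<le> dirichlet \<Omega> \<phi> \<phi> + dirichlet \<Omega> \<psi> \<psi>"
proof -
  have "0 \<le> dirichlet \<Omega> (\<lambda>x. \<phi> x + \<psi> x) (\<lambda>x. \<phi> x + \<psi> x)" "0 \<le> dirichlet \<Omega> (\<lambda>x. \<phi> x - \<psi> x) (\<lambda>x. \<phi> x - \<psi> x)"
    by (rule D_nonneg)+
  then show ?thesis using assms D_nonneg[of \<phi>] D_nonneg[of \<psi>]
    by (simp add: D_bilinear H_closed D_commute[of \<psi> \<phi>] abs_le_iff)
qed

text \<open>When the linear term vanishes, the Taylor estimate leaves a multiple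
  \<open>1 + K\<close> of the squared norm, which is below \<open>e\<close> times the norm as soon
  as the norm is at most \<open>e / (1 + K)\<close>.\<close>

lemma critical_point_if_weak:
  assumes H: "u \<in> H10 \<Omega>" "v \<in> H10 \<Omega>" and w: "\<And>\<phi> \<psi>. \<phi> \<in> H10 \<Omega> \<Longrightarrow> \<psi> \<in> H10 \<Omega> \<Longrightarrow> dI u v \<phi> \<psi> = 0"
  shows "critical_point \<Omega> (energy \<Omega> f g) u v"
proof -
  let ?\<rho> = "max (dirichlet \<Omega> u u) (dirichlet \<Omega> v v)"
  obtain K where K: "K \<ge> 0" and tay: "\<forall>u\<in>H10 \<Omega>. \<forall>v\<in>H10 \<Omega>. \<forall>\<phi>\<in>H10 \<Omega>. \<forall>\<psi>\<in>H10 \<Omega>. dirichlet \<Omega> u u \<le> ?\<rho> \<longrightarrow>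
      dirichlet \<Omega> v v \<le> ?\<rho> \<longrightarrow> dirichlet \<Omega> \<phi> \<phi> \<le> 1 \<longrightarrow> dirichlet \<Omega> \<psi> \<psi> \<le> 1 \<longrightarrow>
    \<bar>I (\<lambda>x. u x + \<phi> x) (\<lambda>x. v x + \<psi> x) - I u v - dI u v \<phi> \<psi> - dirichlet \<Omega> \<phi> \<psi>\<bar> \<le> K * (dirichlet \<Omega> \<phi> \<phi> + dirichlet \<Omega> \<psi> \<psi>)"
    using I_taylor[of ?\<rho>] by (elim exE conjE)
  have "\<exists>d>0. \<forall>\<phi>\<in>H10 \<Omega>. \<forall>\<psi>\<in>H10 \<Omega>. H1_pair_norm \<Omega> \<phi> \<psi> < d \<longrightarrow>
      \<bar>energy \<Omega> f g (\<lambda>x. u x + \<phi> x) (\<lambda>x. v x + \<psi> x) - energy \<Omega> f g u v - 0\<bar> \<le> e * H1_pair_norm \<Omega> \<phi> \<psi>" if e: "e > 0" for e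
  proof (intro exI conjI ballI impI)
    show "0 < min 1 (e / (1 + K))" using e K by simp
    fix \<phi> \<psi> assume \<phi>: "\<phi> \<in> H10 \<Omega>" and \<psi>: "\<psi> \<in> H10 \<Omega>" and small: "H1_pair_norm \<Omega> \<phi> \<psi> < min 1 (e / (1 + K))"
    let ?P = "H1_pair_norm \<Omega> \<phi> \<psi>" and ?S = "dirichlet \<Omega> \<phi> \<phi> + dirichlet \<Omega> \<psi> \<psi>"
    have P0: "?P \<ge> 0" by (rule H1_pair_norm_nonneg)
    have "?P\<^sup>2 \<le> 1" using small P0 by (intro power_le_one) auto
    then have S1: "?S \<le> 1" using D_le_H1_pair_norm[of \<phi> \<psi>] by linarith
    have le1: "dirichlet \<Omega> \<phi> \<phi> \<le> 1" "dirichlet \<Omega> \<psi> \<psi> \<le> 1" using S1 D_nonneg[of \<phi>] D_nonneg[of \<psi>] by linarith+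
    have "\<bar>I (\<lambda>x. u x + \<phi> x) (\<lambda>x. v x + \<psi> x) - I u v - 0 - dirichlet \<Omega> \<phi> \<psi>\<bar> \<le> K * ?S"
      using tay[rule_format, OF H(1) H(2) \<phi> \<psi> max.cobounded1 max.cobounded2 le1] unfolding w[OF \<phi> \<psi>] .
    then have "\<bar>I (\<lambda>x. u x + \<phi> x) (\<lambda>x. v x + \<psi> x) - I u v - 0\<bar> \<le> (1 + K) * ?S"
      using D_mixed_bound[OF \<phi> \<psi>] by (simp add: distrib_right)
    also have "\<dots> \<le> (1 + K) * (?P * ?P)"
      using D_le_H1_pair_norm[of \<phi> \<psi>] K by (intro mult_left_mono) (auto simp: power2_eq_square)
    also have "\<dots> = ((1 + K) * ?P) * ?P" by simp
    also have "\<dots> \<le> e * ?P"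
    proof (rule mult_right_mono[OF _ P0])
      have "?P \<le> e / (1 + K)" using small by simp
      then show "(1 + K) * ?P \<le> e" using K by (simp add: field_simps)
    qed
    finally show "\<bar>energy \<Omega> f g (\<lambda>x. u x + \<phi> x) (\<lambda>x. v x + \<psi> x) - energy \<Omega> f g u v - 0\<bar> \<le> e * ?P"
      by (simp add: energy_eq_I)
  qed
  moreover have "bounded_linear_H10 \<Omega> (\<lambda>_ _. 0)"
    unfolding bounded_linear_H10_def by (auto intro!: exI[of _ 0])
  ultimately show ?thesis unfolding critical_point_def has_derivative_H10_def by blast
qed

text \<open>Two expansions along a ray are compared: the vanishing Frechet derivative allows only a
  small multiple of \<open>\<tau>\<close>, whereas the Taylor estimate shows
  \<open>\<tau> * dI\<close> up to order \<open>\<tau>^2\<close>.\<close>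

lemma weak_if_critical_point:
  assumes H: "u \<in> H10 \<Omega>" "v \<in> H10 \<Omega>" and c: "critical_point \<Omega> (energy \<Omega> f g) u v"
    and \<phi>: "\<phi> \<in> H10 \<Omega>" and \<psi>: "\<psi> \<in> H10 \<Omega>"
  shows "dI u v \<phi> \<psi> = 0"
proof -
  have le: "dI u v \<phi> \<psi> \<le> 0" if \<phi>: "\<phi> \<in> H10 \<Omega>" and \<psi>: "\<psi> \<in> H10 \<Omega>" for \<phi> \<psi>
  proof (rule ccontr)
    assume neg: "\<not> dI u v \<phi> \<psi> \<le> 0"
    let ?L = "dI u v \<phi> \<psi>" and ?P = "H1_pair_norm \<Omega> \<phi> \<psi>" and ?S = "dirichlet \<Omega> \<phi> \<phi> + dirichlet \<Omega> \<psi> \<psi>"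
    have S: "?S \<ge> 0" using D_nonneg[of \<phi>] D_nonneg[of \<psi>] by simp
    have P0: "?P \<ge> 0" by (rule H1_pair_norm_nonneg)
    let ?\<rho> = "max (dirichlet \<Omega> u u) (dirichlet \<Omega> v v)"
    obtain K where K: "K \<ge> 0" and tay: "\<forall>u\<in>H10 \<Omega>. \<forall>v\<in>H10 \<Omega>. \<forall>\<phi>\<in>H10 \<Omega>. \<forall>\<psi>\<in>H10 \<Omega>. dirichlet \<Omega> u u \<le> ?\<rho> \<longrightarrow>
        dirichlet \<Omega> v v \<le> ?\<rho> \<longrightarrow> dirichlet \<Omega> \<phi> \<phi> \<le> 1 \<longrightarrow> dirichlet \<Omega> \<psi> \<psi> \<le> 1 \<longrightarrow>
      \<bar>I (\<lambda>x. u x + \<phi> x) (\<lambda>x. v x + \<psi> x) - I u v - dI u v \<phi> \<psi> - dirichlet \<Omega> \<phi> \<psi>\<bar> \<le> K * (dirichlet \<Omega> \<phi> \<phi> + dirichlet \<Omega> \<psi> \<psi>)"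
      using I_taylor[of ?\<rho>] by (elim exE conjE)
    \<comment> \<open>The Frechet error then uses up at most half of the supposed derivative; the
      \<open>+ 1\<close> covers a direction of zero norm.\<close>
    define e where "e = ?L / (2 * (?P + 1))"
    have e: "e > 0" using neg P0 by (simp add: e_def)
    have eP: "e * ?P \<le> ?L / 2"
    proof -
      have "e * ?P \<le> e * (?P + 1)" using e by simp
      also have "\<dots> = ?L / 2" using P0 by (simp add: e_def field_simps)
      finally show ?thesis .
    qed
    obtain d where d: "d > 0" and dd: "\<forall>\<phi>\<in>H10 \<Omega>. \<forall>\<psi>\<in>H10 \<Omega>. H1_pair_norm \<Omega> \<phi> \<psi> < d \<longrightarrow>
        \<bar>energy \<Omega> f g (\<lambda>x. u x + \<phi> x) (\<lambda>x. v x + \<psi> x) - energy \<Omega> f g u v - 0\<bar> \<le> e * H1_pair_norm \<Omega> \<phi> \<psi>"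
      using c e unfolding critical_point_def has_derivative_H10_def by meson
    define B where "B = (K + 1) * ?S + 1"
    have B: "B > 0" using K S by (simp add: B_def add_nonneg_pos)
    have min0: "min (?L / 2) d > 0" using neg d by simp
    \<comment> \<open>One inequality serves two purposes: the quadratic error stays below the other
      half of the derivative, and the scaled direction within the radius \<open>d\<close>.\<close>
    obtain \<tau> where \<tau>: "0 < \<tau>" "\<tau> < 1" "\<tau> * (1 + ?S) \<le> 1" "\<tau> * (B + ?P) < min (?L / 2) d"
      using small_parameter[OF S _ min0, of "B + ?P"] B P0 by auto
    have \<tau>B: "\<tau> * B < ?L / 2" "\<tau> * ?P < d"
    proof -
      have "0 \<le> \<tau> * ?P" "0 < \<tau> * B" using \<tau>(1) B P0 by auto
      moreover have "\<tau> * B + \<tau> * ?P < ?L / 2" "\<tau> * B + \<tau> * ?P < d" using \<tau>(4) by (auto simp: distrib_left)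
      ultimately show "\<tau> * B < ?L / 2" "\<tau> * ?P < d" by linarith+
    qed
    have sH: "(\<lambda>x. \<tau> * \<phi> x) \<in> H10 \<Omega>" "(\<lambda>x. \<tau> * \<psi> x) \<in> H10 \<Omega>" by (rule H_scale[OF \<phi>], rule H_scale[OF \<psi>])
    have pn: "H1_pair_norm \<Omega> (\<lambda>x. \<tau> * \<phi> x) (\<lambda>x. \<tau> * \<psi> x) = \<tau> * ?P" using H1_pair_norm_scale[OF \<phi> \<psi>] \<tau>(1) by simp
    have "\<tau>\<^sup>2 * ?S \<le> 1"
    proof -
      have "\<tau>\<^sup>2 * ?S \<le> \<tau> * ?S" using \<tau> S by (intro mult_right_mono) (auto simp: power2_eq_square mult_left_le)
      also have "\<dots> \<le> 1" using \<tau> S by (simp add: distrib_left)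
      finally show ?thesis .
    qed
    then have le1: "dirichlet \<Omega> (\<lambda>x. \<tau> * \<phi> x) (\<lambda>x. \<tau> * \<phi> x) \<le> 1" "dirichlet \<Omega> (\<lambda>x. \<tau> * \<psi> x) (\<lambda>x. \<tau> * \<psi> x) \<le> 1"
      using mult_nonneg_nonneg[OF zero_le_power2[of \<tau>] D_nonneg[of \<phi>]]
        mult_nonneg_nonneg[OF zero_le_power2[of \<tau>] D_nonneg[of \<psi>]]
      by (auto simp: distrib_left D_scale_self[OF \<phi>] D_scale_self[OF \<psi>])
    have dl: "dI u v (\<lambda>x. \<tau> * \<phi> x) (\<lambda>x. \<tau> * \<psi> x) = \<tau> * ?L"
      using dI_lincomb[OF H \<phi> \<psi> \<phi> \<psi>, of \<tau> 0] by simp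
    have "\<bar>I (\<lambda>x. u x + \<tau> * \<phi> x) (\<lambda>x. v x + \<tau> * \<psi> x) - I u v - \<tau> * ?L - \<tau>\<^sup>2 * dirichlet \<Omega> \<phi> \<psi>\<bar> \<le> K * (\<tau>\<^sup>2 * ?S)"
      using tay[rule_format, OF H(1) H(2) sH(1) sH(2) max.cobounded1 max.cobounded2 le1] \<phi> \<psi>
      by (simp add: dl D_scale_self D_scale D_scale_right H_scale distrib_left power2_eq_square mult.assoc)
    moreover have "\<bar>I (\<lambda>x. u x + \<tau> * \<phi> x) (\<lambda>x. v x + \<tau> * \<psi> x) - I u v - 0\<bar> \<le> e * (\<tau> * ?P)"
      using dd[rule_format, OF sH] \<tau>B(2) unfolding pn energy_eq_I by simp
    moreover have "\<bar>\<tau>\<^sup>2 * dirichlet \<Omega> \<phi> \<psi>\<bar> \<le> \<tau>\<^sup>2 * ?S"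
      using D_mixed_bound[OF \<phi> \<psi>] by (simp add: abs_mult mult_left_mono)
    ultimately have "\<tau> * ?L \<le> e * (\<tau> * ?P) + K * (\<tau>\<^sup>2 * ?S) + \<tau>\<^sup>2 * ?S" by linarith
    also have "\<dots> = \<tau> * (e * ?P + \<tau> * ((K + 1) * ?S))" by (simp add: power2_eq_square algebra_simps)
    finally have "?L \<le> e * ?P + \<tau> * ((K + 1) * ?S)" using \<tau>(1) by simp
    also have "\<tau> * ((K + 1) * ?S) \<le> \<tau> * B" using \<tau>(1) by (simp add: B_def)
    finally show False using eP \<tau>B(1) by linarith
  qed
  have "dI u v (\<lambda>x. - \<phi> x) (\<lambda>x. - \<psi> x) = - dI u v \<phi> \<psi>"
    using dI_lincomb[OF H \<phi> \<psi> \<phi> \<psi>, of "-1" 0] by simp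
  then show ?thesis using le[OF \<phi> \<psi>] le[OF H_minus[OF \<phi>] H_minus[OF \<psi>]] by simp
qed

lemma df_self_nonneg: "0 \<le> f.df u u" "0 \<le> g.df v v"
proof -
  have "0 \<le> f s * s" "0 \<le> g s * s" for s using nf.f_sign[of s] ng.f_sign[of s] by (cases "s = 0"; simp)+
  then show "0 \<le> f.df u u" "0 \<le> g.df v v"
    unfolding f.df_def g.df_def by (auto intro!: Bochner_Integration.integral_nonneg)
qed

text \<open>If \<open>v = - u\<close>, testing the equation with \<open>(u, v)\<close> itself writes
  0 as a sum of nonpositive terms, one of them \<open>- 2\<close> times the gradient energy of
  \<open>u\<close>. So nontrivial critical points compete in the minimax infimum.\<close>

lemma weak_not_antidiagonal:
  assumes H: "u \<in> H10 \<Omega>" "v \<in> H10 \<Omega>" and w: "dI u v u v = 0" and ne: "\<not> (AE x in lebesgue_on \<Omega>. u x = 0 \<and> v x = 0)"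
  shows "\<not> (AE x in lebesgue_on \<Omega>. v x = - u x)"
proof
  assume a: "AE x in lebesgue_on \<Omega>. v x = - u x"
  then have "AE x in lebesgue_on \<Omega>. v x + u x = 0" by eventually_elim simp
  from D_null[OF H_add[OF H(2,1)] H(1) this] have "dirichlet \<Omega> v u = - dirichlet \<Omega> u u"
    using H by (simp add: D_bilinear)
  then have "- 2 * dirichlet \<Omega> u u - f.df u u - g.df v v = 0"
    using w by (simp add: dI_def D_commute[of u v])
  then have "dirichlet \<Omega> u u = 0" using df_self_nonneg(1)[of u] df_self_nonneg(2)[of v] D_nonneg[of u] by linarith
  from AE_zero_if_D_zero[OF H(1) this] a have "AE x in lebesgue_on \<Omega>. u x = 0 \<and> v x = 0" by eventually_elim simp
  then show False using ne by simp
qed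

text \<open>The fibre through \<open>(u, v)\<close> is the one through \<open>(a, a)\<close> with
  \<open>a = (u + v) / 2\<close>, because \<open>\<phi>\<close> absorbs the half difference, and
  \<open>v \<noteq> - u\<close> means \<open>a \<noteq> 0\<close>. One inequality then follows from
  the critical minimiser, the other from maximality of a critical point on its own fibre.\<close>

theorem ground_level_minimax:
  "ground_level \<Omega> f g =
    (INF (u, v) \<in> {(u, v). u \<in> H10 \<Omega> \<and> v \<in> H10 \<Omega> \<and> \<not> (AE x in lebesgue_on \<Omega>. v x = - u x)}.
       SUP (t, \<phi>) \<in> {0..} \<times> H10 \<Omega>.
         ereal (energy \<Omega> f g (\<lambda>x. t * u x + \<phi> x) (\<lambda>x. t * v x - \<phi> x)))" (is "_ = (INF (u, v) \<in> ?A. ?S u v)")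
proof (rule antisym)
  show "ground_level \<Omega> f g \<le> (INF (u, v) \<in> ?A. ?S u v)"
  proof (rule INF_greatest, clarify)
    fix u v assume u: "u \<in> H10 \<Omega>" and v: "v \<in> H10 \<Omega>" and ne: "\<not> (AE x in lebesgue_on \<Omega>. v x = - u x)"
    let ?a = "\<lambda>x. 1/2 * (u x + v x)"
    have a: "?a \<in> H10 \<Omega>" by (rule H_scale[OF H_add[OF u v]])
    have ane: "\<not> (AE x in lebesgue_on \<Omega>. ?a x = 0)"
    proof
      assume "AE x in lebesgue_on \<Omega>. ?a x = 0"
      then have "AE x in lebesgue_on \<Omega>. v x = - u x" by eventually_elim simp
      then show False using ne by simp
    qed
    from critical_minimizer_exists[OF a ane] obtain u0 v0 where uv0: "u0 \<in> H10 \<Omega>" "v0 \<in> H10 \<Omega>"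
      and ne0: "\<not> (AE x in lebesgue_on \<Omega>. u0 x = 0 \<and> v0 x = 0)"
      and cp: "\<forall>\<phi>\<in>H10 \<Omega>. \<forall>\<psi>\<in>H10 \<Omega>. dI u0 v0 \<phi> \<psi> = 0"
      and min: "\<forall>a c. a \<in> H10 \<Omega> \<longrightarrow> \<not> (AE x in lebesgue_on \<Omega>. a x = 0) \<longrightarrow> fibre_bound a c \<longrightarrow> I u0 v0 \<le> c"
      by (elim bexE conjE)
    have crit: "critical_point \<Omega> (energy \<Omega> f g) u0 v0"
      using critical_point_if_weak[OF uv0] cp by blast
    have "ground_level \<Omega> f g \<le> ereal (energy \<Omega> f g u0 v0)"
      unfolding ground_level_def by (rule INF_lower2[of "(u0, v0)"]) (use uv0 ne0 crit in auto)
    also have "\<dots> \<le> ?S u v"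
    proof (cases "?S u v")
      case (real c)
      have "fibre_bound ?a c"
        unfolding fibre_bound_def
      proof (intro allI impI ballI)
        fix t :: real and b assume t: "0 \<le> t" and b: "b \<in> H10 \<Omega>"
        \<comment> \<open>Shifting by \<open>t\<close> times the half difference moves the point
          \<open>(t, b)\<close> of the fibre of \<open>a\<close> onto the fibre of
          \<open>(u, v)\<close>.\<close>
        let ?\<phi> = "\<lambda>x. b x - t * (1/2 * (u x - v x))"
        have \<phi>: "?\<phi> \<in> H10 \<Omega>" by (rule H_diff[OF b H_scale[OF H_scale[OF H_diff[OF u v]]]])
        have eqs: "(\<lambda>x. t * u x + ?\<phi> x) = (\<lambda>x. t * ?a x + b x)" "(\<lambda>x. t * v x - ?\<phi> x) = (\<lambda>x. t * ?a x - b x)"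
          by (auto simp: fun_eq_iff field_simps)
        have "ereal (energy \<Omega> f g (\<lambda>x. t * u x + ?\<phi> x) (\<lambda>x. t * v x - ?\<phi> x)) \<le> ?S u v"
          by (rule SUP_upper2[of "(t, ?\<phi>)"]) (use t \<phi> in auto)
        then have "ereal (energy \<Omega> f g (\<lambda>x. t * ?a x + b x) (\<lambda>x. t * ?a x - b x)) \<le> ereal c"
          unfolding eqs real .
        then show "J (\<lambda>x. t * ?a x) b \<le> c"
          by (simp only: J_eq_I[OF H_scale[OF a] b] energy_eq_I ereal_less_eq)
      qed
      then show ?thesis using min a ane real by (simp only: energy_eq_I ereal_less_eq) blast
    next
      \<comment> \<open>Impossible: the supremum is at least the real value attained at
        \<open>t = 0\<close>, \<open>\<phi> = 0\<close>.\<close>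
      case MInf
      have "ereal (energy \<Omega> f g (\<lambda>x. 0 * u x + 0) (\<lambda>x. 0 * v x - 0)) \<le> ?S u v"
        by (rule SUP_upper2[of "(0, \<lambda>x. 0)"]) (use H_zero in auto)
      then show ?thesis using MInf by simp
    qed simp
    finally show "ground_level \<Omega> f g \<le> ?S u v" .
  qed
  show "(INF (u, v) \<in> ?A. ?S u v) \<le> ground_level \<Omega> f g"
    unfolding ground_level_def
  proof (rule INF_greatest, clarify)
    fix u v assume uv: "u \<in> H10 \<Omega>" "v \<in> H10 \<Omega>" and ne: "\<not> (AE x in lebesgue_on \<Omega>. u x = 0 \<and> v x = 0)"
      and c: "critical_point \<Omega> (energy \<Omega> f g) u v"
    note w = weak_if_critical_point[OF uv c]
    have "nehari u v" unfolding nehari_def using w uv H_minus by blast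
    then have "?S u v \<le> ereal (energy \<Omega> f g u v)"
      using uv by (auto intro!: SUP_least simp: energy_eq_I nehari_max)
    then show "(INF (u, v) \<in> ?A. ?S u v) \<le> ereal (energy \<Omega> f g u v)"
      by (intro INF_lower2[of "(u, v)"]) (use uv weak_not_antidiagonal[OF uv w[OF uv] ne] in auto)
  qed
qed

end

theorem proposition5p6:
  fixes \<Omega> :: "(real^'n::finite) set"
    and f g :: "real \<Rightarrow> real"
    and p q C \<delta> :: real
  assumes "open \<Omega>" and "connected \<Omega>" and "\<Omega> \<noteq> {}" and "bounded \<Omega>"
    and "f C1_differentiable_on UNIV" and "g C1_differentiable_on UNIV"
    and "f \<in> o[at 0](\<lambda>s. s)" and "g \<in> o[at 0](\<lambda>s. s)"
    and "p > 1" and "q > 1"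
    and "(p + 1) * (real CARD('n) - 2) < 2 * real CARD('n)"
    and "(q + 1) * (real CARD('n) - 2) < 2 * real CARD('n)"
    and "C > 0"
    and "\<And>s. \<bar>deriv f s\<bar> \<le> C * (1 + \<bar>s\<bar> powr (p - 1))"
    and "\<And>s. \<bar>deriv g s\<bar> \<le> C * (1 + \<bar>s\<bar> powr (q - 1))"
    and "\<delta> > 0"
    and "\<And>s. s \<noteq> 0 \<Longrightarrow> 0 < (1 + \<delta>) * f s * s \<and> (1 + \<delta>) * f s * s \<le> deriv f s * s\<^sup>2"
    and "\<And>s. s \<noteq> 0 \<Longrightarrow> 0 < (1 + \<delta>) * g s * s \<and> (1 + \<delta>) * g s * s \<le> deriv g s * s\<^sup>2"
  shows "ground_level \<Omega> f g =
    (INF (u, v) \<in> {(u, v). u \<in> H10 \<Omega> \<and> v \<in> H10 \<Omega> \<and>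
                          \<not> (AE x in lebesgue_on \<Omega>. v x = - u x)}.
       SUP (t, \<phi>) \<in> {0..} \<times> H10 \<Omega>.
         ereal (energy \<Omega> f g (\<lambda>x. t * u x + \<phi> x) (\<lambda>x. t * v x - \<phi> x)))"
proof -
  interpret elliptic_system \<Omega> f g p q C \<delta>
    by unfold_locales (use assms in auto)
  show ?thesis by (rule ground_level_minimax)
qed

end
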